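(* Let $0<q<1$, $w\in\mathbb{C}\setminus\{0\}$, let $\mathcal{D}$ be the Dirac operator on the standard Podleś sphere, and let $u=\frac{|w|q}{1-q^2}$. Let $f=\mathcal{L}(d\phi)\in\mathcal{C}$. Then for every $\Lambda>0$ $$\operatorname{Tr}f(|\mathcal{D}|/\Lambda)=\sum_{\alpha\in\mathrm{Sd}_1}\sum_{p=0}^2a_{\alpha,p}\sum_{k=0}^p(-1)^{p-k}\binom pk f_{\alpha,k}\,(\log\Lambda)^{p-k}\,\Lambda^\alpha,$$ where $\mathrm{Sd}_1=-2\mathbb{N}+i\frac{2\pi}{\log q}\mathbb{Z}$, $f_{\alpha,k}:=\int_0^\infty s^{-\alpha}\log^k(s)\,d\phi(s)$, and the coefficients $$a_{\alpha,p}:=\frac{(-1)^p}{p!}\operatorname*{Res}_{s=\alpha}\big((s-\alpha)^p\,\Gamma(s)\,\zeta_{\mathcal{D}}(s)\big)$$ are given as follows. For $\alpha=-2m$, $m\in\mathbb{N}$: $a_{\alpha,2}=\frac{u^{-\alpha}}{\log^2q}g_m$, $a_{\alpha,1}=\frac{u^{-\alpha}}{\log^2q}h_{m,0}$, $a_{\alpha,0}=\frac{u^{-\alpha}}{\log^2q}c_{m,0}+d_m$. For $\alpha=-2m+\frac{2\pi i}{\log q}n$, $m\in\mathbb{N}$, $n\in\mathbb{Z}\setminus\{0\}$: $a_{\alpha,2}=0$, $a_{\alpha,1}=\frac{u^{-\alpha}}{\log^2q}h_{m,-n}$, $a_{\alpha,0}=\frac{u^{-\alpha}}{\log^2q}c_{m,-n}$.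 Here $$g_m=\frac{2(-1)^m}{(m!)^2},\qquad h_{m,0}=\frac{4(-1)^m}{(m!)^2}\big(\log u-\psi^{(0)}(m+1)\big),$$ $$c_{m,0}=\frac{(-1)^m}{3(m!)^2}\big[6\log^2u-\log^2q+2\pi^2-12\log u\,\psi^{(0)}(m+1)+6\psi^{(0)}(m+1)^2-6\psi^{(1)}(m+1)\big],$$ $$d_m=4\Big(\frac uq\Big)^{2m}\sum_{k=0,\,k\neq m}^{2m}\frac{(-1)^k}{k!(2m-k)!}\,q^{2k}\big(1-q^{2(k-m)}\big)^{-2}$$ and, for $a\in\mathbb{Z}\setminus\{0\}$, $$h_{m,a}=-\frac4{m!}\Gamma\big(-m-i\tfrac{2\pi}{\log q}a\big),\qquad c_{m,a}=-\frac4{m!}\Gamma\big(-m-i\tfrac{2\pi}{\log q}a\big)\Big(\log u-\psi^{(0)}\big(-m-i\tfrac{2\pi}{\log q}a\big)\Big).$$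
   Context: $\mathbb{N}=\{0,1,2,\dots\}$, $\mathbb{R}^+=(0,\infty)$, and $[n]:=\frac{q^{-n}-q^n}{q^{-1}-q}$; $\psi^{(n)}$ is the polygamma function of order $n$ ($\psi^{(0)}=\Gamma'/\Gamma$). Let $\mathcal{H}_{1/2}$ be the Hilbert space with orthonormal basis $|l,m\rangle$, $l\in\frac12+\mathbb{N}$, $m\in\{-l,\dots,l\}$, $\mathcal{H}=\mathcal{H}_{1/2}\oplus\mathcal{H}_{1/2}$, $D|l,m\rangle=[l+\frac12]|l,m\rangle$, $\mathcal{D}=\begin{pmatrix}0&\bar wD\\ wD&0\end{pmatrix}$, so $|\mathcal{D}|=|w|(D\oplus D)$. $\zeta_{\mathcal{D}}$ is the meromorphic continuation to $\mathbb{C}$ of $s\mapsto\operatorname{Tr}|\mathcal{D}|^{-s}$, $\Re(s)>0$. The Laplace transform of a measure $d\phi$ is $\mathcal{L}(d\phi)(x)=\int_0^\infty e^{-sx}\,d\phi(s)$, $x\in\mathbb{R}^+$. $\mathcal{C}$ is the set of functions $f=\mathcal{L}(d\phi)$ where $d\phi$ is a non-negative (not necessarily finite) Borel measure on $\mathbb{R}^+$ such that $\int_0^\infty e^{st}\,d\phi(s)<\infty$ for every $t\ge0$.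
   Formalization: The trace formula is stated when f(|D|/Λ) is trace class, shown equivalent to absolute convergence of all f_{α,k}, k≤2; membership in C does not ensure this: for dφ = ds/(s log² s) on (0,1/2), both Tr f(|D|/Λ) and f_{0,2} are infinite. *)

theory Defs
  imports "HOL-Complex_Analysis.Complex_Analysis"
begin

text \<open>
  Square-summable families over an index set \<open>S\<close>, i.e. the Hilbert space with an orthonormal
  basis indexed by \<open>S\<close>.  The inner product is linear in the second argument.
\<close>

definition ell2 :: "'i set \<Rightarrow> ('i \<Rightarrow> complex) set" where
  "ell2 S = {x. (\<forall>i. i \<notin> S \<longrightarrow> x i = 0) \<and> (\<lambda>i. (cmod (x i))\<^sup>2) summable_on S}"

definition ell2_inner :: "'i set \<Rightarrow> ('i \<Rightarrow> complex) \<Rightarrow> ('i \<Rightarrow> complex) \<Rightarrow> complex" where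
  "ell2_inner S x y = (\<Sum>\<^sub>\<infinity>i\<in>S. cnj (x i) * y i)"

definition ell2_norm :: "'i set \<Rightarrow> ('i \<Rightarrow> complex) \<Rightarrow> real" where
  "ell2_norm S x = sqrt (\<Sum>\<^sub>\<infinity>i\<in>S. (cmod (x i))\<^sup>2)"

definition ket :: "'i \<Rightarrow> 'i \<Rightarrow> complex" where
  "ket i = (\<lambda>j. if j = i then 1 else 0)"

text \<open>
  An operator, possibly unbounded, is represented by its graph.  The composition of \<open>T\<close> followed
  by \<open>R\<close> is then the relation composition \<open>T O R\<close>, with its natural domain.
\<close>

type_synonym 'i operator = "(('i \<Rightarrow> complex) \<times> ('i \<Rightarrow> complex)) set"

definition op_apply :: "'i operator \<Rightarrow> ('i \<Rightarrow> complex) \<Rightarrow> 'i \<Rightarrow> complex" where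
  "op_apply T x = (THE y. (x, y) \<in> T)"

definition op_scale :: "complex \<Rightarrow> 'i operator \<Rightarrow> 'i operator" where
  "op_scale c T = {(x, \<lambda>i. c * y i) | x y. (x, y) \<in> T}"

definition op_adjoint :: "'i set \<Rightarrow> 'i operator \<Rightarrow> 'i operator" where
  "op_adjoint S T = {(y, z). y \<in> ell2 S \<and> z \<in> ell2 S \<and>
     (\<forall>(x, x') \<in> T. ell2_inner S y x' = ell2_inner S z x)}"

definition op_bounded :: "'i set \<Rightarrow> 'i operator \<Rightarrow> bool" where
  "op_bounded S T \<longleftrightarrow> Domain T = ell2 S \<and> single_valued T \<and>
     (\<exists>C. \<forall>(x, y) \<in> T. ell2_norm S y \<le> C * ell2_norm S x)"

text \<open>
  Functional calculus for a self-adjoint operator \<open>A\<close> whose eigenvectors span a dense subspace.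
  If \<open>P\<^sub>\<lambda>\<close> are the orthogonal projections on the eigenspaces, then \<open>f(A) x = (\<Sum>\<lambda>. f \<lambda> P\<^sub>\<lambda> x)\<close>, the
  domain being the set of all \<open>x\<close> for which this series converges.  Equivalently, \<open>y = f(A) x\<close> iff
  \<open>P\<^sub>\<lambda> y = f \<lambda> P\<^sub>\<lambda> x\<close> for every eigenvalue \<open>\<lambda>\<close>, which is what is written here, tested on
  eigenvectors.  (For operators with continuous spectrum this is not the right notion.)
\<close>

definition op_fun :: "'i set \<Rightarrow> (real \<Rightarrow> complex) \<Rightarrow> 'i operator \<Rightarrow> 'i operator" where
  "op_fun S f A = {(x, y). x \<in> ell2 S \<and> y \<in> ell2 S \<and>
     (\<forall>v l. (v, \<lambda>i. complex_of_real l * v i) \<in> A \<longrightarrow> ell2_inner S v y = f l * ell2_inner S v x)}"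

text \<open>\<open>|T| = (T\<^sup>* T)\<^sup>1\<^sup>/\<^sup>2\<close>, for \<open>T\<close> such that \<open>T\<^sup>* T\<close> has an orthonormal basis of eigenvectors.\<close>

definition op_abs :: "'i set \<Rightarrow> 'i operator \<Rightarrow> 'i operator" where
  "op_abs S T = op_fun S (\<lambda>x. complex_of_real (sqrt x)) (T O op_adjoint S T)"

definition op_trace_class :: "'i set \<Rightarrow> 'i operator \<Rightarrow> bool" where
  "op_trace_class S T \<longleftrightarrow> op_bounded S T \<and>
     (\<lambda>i. ell2_inner S (ket i) (op_apply (op_abs S T) (ket i))) summable_on S"

definition op_trace :: "'i set \<Rightarrow> 'i operator \<Rightarrow> complex" where
  "op_trace S T = (\<Sum>\<^sub>\<infinity>i\<in>S. ell2_inner S (ket i) (op_apply T (ket i)))"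

text \<open>The labels \<open>(l, m)\<close> with \<open>l \<in> 1/2 + \<nat>\<close> and \<open>m \<in> {-l, -l + 1, \<dots>, l}\<close>.\<close>

definition podles_labels :: "(real \<times> real) set" where
  "podles_labels = {(l, m). (\<exists>n::nat. l = 1 / 2 + real n) \<and> (\<exists>j::nat. m = - l + real j \<and> m \<le> l)}"

type_synonym spinor_label = "(real \<times> real) + (real \<times> real)"

text \<open>\<open>ell2 spinor_labels\<close> is \<open>\<H>\<^sub>1\<^sub>/\<^sub>2 \<oplus> \<H>\<^sub>1\<^sub>/\<^sub>2\<close>; the summands of \<open>x\<close> are \<open>x \<circ> Inl\<close> and \<open>x \<circ> Inr\<close>.\<close>

definition spinor_labels :: "spinor_label set" where
  "spinor_labels = podles_labels <+> podles_labels"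

definition q_number :: "real \<Rightarrow> real \<Rightarrow> real" where
  "q_number q x = (q powr (- x) - q powr x) / (q powr (- 1) - q)"

definition podles_D :: "real \<Rightarrow> (real \<times> real) operator" where
  "podles_D q = {(x, y). x \<in> ell2 podles_labels \<and> y \<in> ell2 podles_labels \<and>
     (\<forall>(l, m) \<in> podles_labels. y (l, m) = complex_of_real (q_number q (l + 1 / 2)) * x (l, m))}"

definition podles_dirac :: "real \<Rightarrow> complex \<Rightarrow> spinor_label operator" where
  "podles_dirac q w = {(x, y). x \<in> ell2 spinor_labels \<and> y \<in> ell2 spinor_labels \<and>
     (\<exists>a b. (x \<circ> Inl, a) \<in> podles_D q \<and> (x \<circ> Inr, b) \<in> podles_D q \<and>
       y \<circ> Inl = (\<lambda>i. cnj w * b i) \<and> y \<circ> Inr = (\<lambda>i. w * a i))}"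

abbreviation abs_dirac :: "real \<Rightarrow> complex \<Rightarrow> spinor_label operator" where
  "abs_dirac q w \<equiv> op_abs spinor_labels (podles_dirac q w)"

text \<open>
  The predicate \<open>nicely_meromorphic_on\<close> fixes the value \<open>0\<close> at poles and removes removable
  singularities, so that the meromorphic continuation is unique as a total function.
\<close>

definition podles_zeta :: "real \<Rightarrow> complex \<Rightarrow> complex \<Rightarrow> complex" where
  "podles_zeta q w = (THE Z. Z nicely_meromorphic_on UNIV \<and>
     (\<forall>s. Re s > 0 \<longrightarrow>
        Z s = op_trace spinor_labels
                (op_fun spinor_labels (\<lambda>x. complex_of_real x powr (- s)) (abs_dirac q w))))"

definition heat_coeff :: "real \<Rightarrow> complex \<Rightarrow> complex \<Rightarrow> nat \<Rightarrow> complex" where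
  "heat_coeff q w \<alpha> p =
     (- 1) ^ p / fact p * residue (\<lambda>s. (s - \<alpha>) ^ p * (Gamma s * podles_zeta q w s)) \<alpha>"

definition Sd_pole :: "real \<Rightarrow> nat \<Rightarrow> int \<Rightarrow> complex" where
  "Sd_pole q m n = - 2 * of_nat m + \<i> * complex_of_real (2 * pi / ln q) * of_int n"

definition Sd1 :: "real \<Rightarrow> complex set" where
  "Sd1 q = {Sd_pole q m n | m n. True}"

definition laplace :: "real measure \<Rightarrow> real \<Rightarrow> real" where
  "laplace \<phi> x = (\<integral>s. exp (- (s * x)) \<partial>\<phi>)"

text \<open>The Borel measures on \<open>\<real>\<^sup>+ = (0, \<infinity>)\<close> whose Laplace transforms form the class \<open>\<C>\<close>.\<close>

definition class_C_measure :: "real measure \<Rightarrow> bool" where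
  "class_C_measure \<phi> \<longleftrightarrow> sets \<phi> = sets (restrict_space borel {0<..}) \<and>
     (\<forall>t\<ge>0. (\<integral>\<^sup>+s. ennreal (exp (s * t)) \<partial>\<phi>) < \<infinity>)"

definition moment_integrand :: "complex \<Rightarrow> nat \<Rightarrow> real \<Rightarrow> complex" where
  "moment_integrand \<alpha> k s = complex_of_real s powr (- \<alpha>) * complex_of_real (ln s ^ k)"

definition moment :: "real measure \<Rightarrow> complex \<Rightarrow> nat \<Rightarrow> complex" where
  "moment \<phi> \<alpha> k = (\<integral>s. moment_integrand \<alpha> k s \<partial>\<phi>)"

definition coeff_g :: "nat \<Rightarrow> complex" where
  "coeff_g m = 2 * (- 1) ^ m / (fact m)\<^sup>2"

definition coeff_h :: "real \<Rightarrow> real \<Rightarrow> nat \<Rightarrow> int \<Rightarrow> complex" where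
  "coeff_h q u m a =
     (if a = 0
      then 4 * (- 1) ^ m / (fact m)\<^sup>2 * (complex_of_real (ln u) - Polygamma 0 (of_nat m + 1))
      else - 4 / fact m * Gamma (- of_nat m - \<i> * complex_of_real (2 * pi / ln q) * of_int a))"

definition coeff_c :: "real \<Rightarrow> real \<Rightarrow> nat \<Rightarrow> int \<Rightarrow> complex" where
  "coeff_c q u m a =
     (if a = 0
      then (- 1) ^ m / (3 * (fact m)\<^sup>2) *
           (6 * (complex_of_real (ln u))\<^sup>2 - (complex_of_real (ln q))\<^sup>2 + 2 * (complex_of_real pi)\<^sup>2
            - 12 * complex_of_real (ln u) * Polygamma 0 (of_nat m + 1)
            + 6 * (Polygamma 0 (of_nat m + 1))\<^sup>2 - 6 * Polygamma 1 (of_nat m + 1))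
      else - 4 / fact m * Gamma (- of_nat m - \<i> * complex_of_real (2 * pi / ln q) * of_int a) *
           (complex_of_real (ln u)
            - Polygamma 0 (- of_nat m - \<i> * complex_of_real (2 * pi / ln q) * of_int a)))"

definition coeff_d :: "real \<Rightarrow> real \<Rightarrow> nat \<Rightarrow> complex" where
  "coeff_d q u m = complex_of_real (4 * (u / q) ^ (2 * m) *
     (\<Sum>k\<in>{0..2 * m} - {m}. (- 1) ^ k / (fact k * fact (2 * m - k)) * q ^ (2 * k) *
        (1 - q powi (2 * (int k - int m))) powi (- 2)))"

end

theory Submission
  imports Defs "HOL-Complex_Analysis.Complex_Analysis" "HOL-Real_Asymp.Real_Asymp"
begin

text \<open>
  Put \<open>L = - log q\<close>.  The eigenvalues of \<open>|\<D>|\<close> are \<open>u (e\<^bsup>L n\<^esup> - e\<^bsup>-L n\<^esup>)\<close>, \<open>n \<ge> 1\<close>, with multiplicity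
  \<open>4 n\<close>, so everything follows from an exact expansion of the heat trace \<open>Tr e\<^bsup>-t|\<D>|\<^esup>\<close>.  Expanding
  \<open>exp (t u e\<^bsup>-L n\<^esup>)\<close> in powers of \<open>x = t u\<close> reduces it to the sums \<open>\<Sum>n\<ge>1. n e\<^bsup>-m L n\<^esup> exp (-x e\<^bsup>L n\<^esup>)\<close>,
  which are derivatives at \<open>z = -m\<close> of \<open>\<Sum>n\<ge>1. e\<^bsup>z L n\<^esup> exp (-x e\<^bsup>L n\<^esup>)\<close>.  For \<open>Re z > 0\<close> the latter,
  completed to a sum over all integers, is turned by Poisson summation into
  \<open>L\<^sup>-\<^sup>1 \<Sum>k. \<Gamma>(z + 2 \<pi> i k / L) x\<^bsup>-z - 2 \<pi> i k / L\<^esup>\<close>, while the terms with \<open>n \<le> 0\<close> are summed as geometric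
  series after expanding the second exponential; the resulting identity continues analytically to the
  poles \<open>z = -m\<close>.

  On the other hand \<open>\<zeta>\<close> continues by the binomial series, and the residues of \<open>\<Gamma> \<zeta>\<close> are read off
  Taylor expansions of order two.  Comparing the two shows that the heat trace is the sum of the
  terms prescribed by these residues.  The explicit coefficients are so small that this sum is
  dominated by a multiple of \<open>(1 + |log t| + log\<^sup>2 t) e\<^bsup>4 u t\<^esup>\<close>, which permits integration term by term
  against \<open>\<phi>\<close> at \<open>t = s / \<Lambda>\<close>.  Since the heat trace also grows at least like \<open>log\<^sup>2 t\<close> as \<open>t \<rightarrow> 0\<close>, the
  trace class property is equivalent to the integrability of \<open>log\<^sup>2 s\<close>, hence to the existence of the
  moments.
\<close>

section \<open>Locally dominated series of holomorphic functions\<close>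

text \<open>The expansion is exact, not asymptotic, and is not obtained by Mellin inversion: no
  growth estimate for \<zeta> on vertical lines enters, only the quadratic decay of Gamma. The
  obstacle is that z = -m is a pole of two series, of the k = 0 term on the Gamma side and of the i
  = m term of the geometric series. The residues agree, and the derivative of the holomorphic
  difference contains the log^2, \<psi> and \<pi>^2/6 of the coefficients.

  The differentiated geometric series is a double series in (m, i) with kernel 1/(4 sinh^2 (L (i -
  m)/2)). The heat trace supplies it by rows, the numbers d_m by antidiagonals; only the totals
  agree, by absolute convergence.

  Poles of order three occur because the kernel has a double pole at 0 and Gamma a simple one; off
  the real axis Gamma is regular and the log^2 term disappears.

  A measure of class C has all exponential moments, so s^(-\<alpha>) is harmless and only log^2 s
  near 0 can fail to be integrable. This is why the trace class property enters the statement, as a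
  condition equivalent to the existence of the moments.\<close>

lemma uniform_limit_infsum_cofinite:
  fixes f :: "'i \<Rightarrow> complex \<Rightarrow> complex"
  assumes "finite F"
    and "\<And>i s. i \<in> A - F \<Longrightarrow> s \<in> B \<Longrightarrow> norm (f i s) \<le> M i"
    and "M summable_on (A - F)"
    and "\<And>i. i \<in> A \<Longrightarrow> continuous_on B (f i)" and "compact B"
  shows "uniform_limit B (\<lambda>X s. \<Sum>i\<in>X. f i s) (\<lambda>s. \<Sum>\<^sub>\<infinity>i\<in>A. f i s) (finite_subsets_at_top A)"
    and "\<And>s. s \<in> B \<Longrightarrow> (\<lambda>i. norm (f i s)) summable_on A"
proof -
  \<comment> \<open>The finitely many exceptional terms are not covered by \<open>M\<close>;
    continuity on the compact set bounds each of them, and \<open>M'\<close> glues these bounds to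
    \<open>M\<close> for the Weierstrass test.\<close>
  have "\<exists>m. \<forall>s\<in>B. norm (f i s) \<le> m" if "i \<in> A" for i
  proof -
    have "bounded (f i ` B)"
      using assms(4)[OF that] assms(5) compact_continuous_image compact_imp_bounded by blast
    then show ?thesis by (auto simp: bounded_iff)
  qed
  then obtain m where m: "\<And>i s. i \<in> A \<Longrightarrow> s \<in> B \<Longrightarrow> norm (f i s) \<le> m i" by metis
  define M' where "M' i = (if i \<in> F then m i else M i)" for i
  have "M' summable_on (A - F)"
    using assms(3) by (rule summable_on_cong[THEN iffD1, rotated]) (auto simp: M'_def)
  moreover have "M' summable_on (A \<inter> F)" using assms(1) by simp
  ultimately have "M' summable_on ((A - F) \<union> (A \<inter> F))" by (rule summable_on_union)
  moreover have "(A - F) \<union> (A \<inter> F) = A" by auto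
  ultimately have M': "M' summable_on A" by simp
  have le: "norm (f i s) \<le> M' i" if "i \<in> A" "s \<in> B" for i s
    using that m assms(2) by (auto simp: M'_def)
  show "uniform_limit B (\<lambda>X s. \<Sum>i\<in>X. f i s) (\<lambda>s. \<Sum>\<^sub>\<infinity>i\<in>A. f i s) (finite_subsets_at_top A)"
    by (rule Weierstrass_m_test_general[OF le M'])
  show "(\<lambda>i. norm (f i s)) summable_on A" if "s \<in> B" for s
    by (rule summable_on_comparison_test[OF M']) (use le that in auto)
qed

text \<open>The closed ball need not stay inside \<open>S\<close>, and the finite set
  \<open>F\<close> absorbs the terms that have a pole near \<open>s\<close>. The property can
  therefore be proved once on the whole plane and restricted afterwards; boundedness of the terms in
  \<open>F\<close> is recovered from holomorphy once \<open>S\<close> avoids the poles.\<close>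

definition loc_dominated :: "'i set \<Rightarrow> ('i \<Rightarrow> complex \<Rightarrow> complex) \<Rightarrow> complex set \<Rightarrow> bool" where
  "loc_dominated A f S \<longleftrightarrow> (\<forall>s\<in>S. \<exists>r>0. \<exists>F M. finite F \<and> M summable_on (A - F) \<and>
      (\<forall>i\<in>A - F. \<forall>z\<in>cball s r. norm (f i z) \<le> M i))"

lemma loc_dominatedI:
  assumes "\<And>s. s \<in> S \<Longrightarrow> \<exists>r>0. \<exists>F M. finite F \<and> M summable_on (A - F) \<and>
      (\<forall>i\<in>A - F. \<forall>z\<in>cball s r. norm (f i z) \<le> M i)"
  shows "loc_dominated A f S"
  using assms unfolding loc_dominated_def by blast

text \<open>Locally uniform convergence of the net of finite partial sums gives holomorphy and
  termwise differentiation. The latter is what later brings down the factor \<open>n\<close> in the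
  exponential sums.\<close>

lemma
  fixes f :: "'i \<Rightarrow> complex \<Rightarrow> complex"
  assumes S: "open S" and holo: "\<And>i. i \<in> A \<Longrightarrow> f i holomorphic_on S"
    and dom: "loc_dominated A f S"
  shows holomorphic_on_infsum: "(\<lambda>s. \<Sum>\<^sub>\<infinity>i\<in>A. f i s) holomorphic_on S"
    and has_sum_deriv: "\<And>s. s \<in> S \<Longrightarrow> ((\<lambda>i. deriv (f i) s) has_sum deriv (\<lambda>s. \<Sum>\<^sub>\<infinity>i\<in>A. f i s) s) A"
    and abs_summable_loc_dominated: "\<And>s. s \<in> S \<Longrightarrow> (\<lambda>i. norm (f i s)) summable_on A"
proof -
  have key: "\<exists>r>0. cball s r \<subseteq> S \<and>
      uniform_limit (cball s r) (\<lambda>X s. \<Sum>i\<in>X. f i s) (\<lambda>s. \<Sum>\<^sub>\<infinity>i\<in>A. f i s) (finite_subsets_at_top A) \<and>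
      (\<lambda>i. norm (f i s)) summable_on A"
    if s: "s \<in> S" for s
  proof -
    obtain r F M where r: "r > 0" "finite F" "M summable_on (A - F)"
      "\<And>i z. i \<in> A - F \<Longrightarrow> z \<in> cball s r \<Longrightarrow> norm (f i z) \<le> M i"
      using dom s unfolding loc_dominated_def by meson
    obtain r' where r': "r' > 0" "cball s r' \<subseteq> S" using S s open_contains_cball by blast
    define d where "d = min r r'"
    have d: "d > 0" "cball s d \<subseteq> S" "cball s d \<subseteq> cball s r"
      using r r' by (auto simp: d_def)
    have c: "continuous_on (cball s d) (f i)" if "i \<in> A" for i
      using holo[OF that] d(2) by (meson continuous_on_subset holomorphic_on_imp_continuous_on)
    have b: "norm (f i z) \<le> M i" if "i \<in> A - F" "z \<in> cball s d" for i z
      using r(4) that d(3) by blast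
    show ?thesis
      using uniform_limit_infsum_cofinite[OF r(2) b r(3) c compact_cball] d by fastforce
  qed
  have holo_sum: "(\<lambda>s. \<Sum>i\<in>X. f i s) holomorphic_on S" if "X \<subseteq> A" for X
    using that holo by (intro holomorphic_on_sum) auto
  have ev: "eventually (\<lambda>X. X \<subseteq> A) (finite_subsets_at_top A)"
    by (rule eventually_finite_subsets_at_top_weakI)
  show "(\<lambda>s. \<Sum>\<^sub>\<infinity>i\<in>A. f i s) holomorphic_on S"
  proof (rule holomorphic_onI)
    fix s assume s: "s \<in> S"
    obtain r where r: "r > 0" "cball s r \<subseteq> S"
      "uniform_limit (cball s r) (\<lambda>X s. \<Sum>i\<in>X. f i s) (\<lambda>s. \<Sum>\<^sub>\<infinity>i\<in>A. f i s) (finite_subsets_at_top A)"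
      using key[OF s] by blast
    have "eventually (\<lambda>X. continuous_on (cball s r) (\<lambda>s. \<Sum>i\<in>X. f i s) \<and>
             (\<lambda>s. \<Sum>i\<in>X. f i s) holomorphic_on ball s r) (finite_subsets_at_top A)"
      using ev
    proof eventually_elim
      case (elim X)
      have "ball s r \<subseteq> S" using r(2) by force
      then show ?case using holo_sum[OF elim] r(2)
        by (meson continuous_on_subset holomorphic_on_imp_continuous_on holomorphic_on_subset)
    qed
    then have "(\<lambda>s. \<Sum>\<^sub>\<infinity>i\<in>A. f i s) holomorphic_on ball s r"
      by (rule holomorphic_uniform_limit[OF _ r(3)]) auto
    then show "(\<lambda>s. \<Sum>\<^sub>\<infinity>i\<in>A. f i s) field_differentiable at s within S"
      using r(1) by (meson centre_in_ball field_differentiable_at_within holomorphic_on_imp_differentiable_at open_ball)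
  qed
  show "((\<lambda>i. deriv (f i) s) has_sum deriv (\<lambda>s. \<Sum>\<^sub>\<infinity>i\<in>A. f i s) s) A" if s: "s \<in> S" for s
  proof -
    obtain r where r: "r > 0" "cball s r \<subseteq> S"
      "uniform_limit (cball s r) (\<lambda>X s. \<Sum>i\<in>X. f i s) (\<lambda>s. \<Sum>\<^sub>\<infinity>i\<in>A. f i s) (finite_subsets_at_top A)"
      using key[OF s] by blast
    have sub: "ball s r \<subseteq> S" using r(2) by force
    have "((\<lambda>X. deriv (\<lambda>s. \<Sum>i\<in>X. f i s) s) \<longlongrightarrow> deriv (\<lambda>s. \<Sum>\<^sub>\<infinity>i\<in>A. f i s) s) (finite_subsets_at_top A)"
    proof (rule deriv_complex_uniform_limit)
      show "uniform_limit (ball s r) (\<lambda>X s. \<Sum>i\<in>X. f i s) (\<lambda>s. \<Sum>\<^sub>\<infinity>i\<in>A. f i s) (finite_subsets_at_top A)"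
        by (rule uniform_limit_on_subset[OF r(3)]) auto
      show "eventually (\<lambda>X. (\<lambda>s. \<Sum>i\<in>X. f i s) holomorphic_on ball s r) (finite_subsets_at_top A)"
        using ev by eventually_elim (use holo_sum sub holomorphic_on_subset in blast)
    qed (use r in auto)
    moreover have "eventually (\<lambda>X. deriv (\<lambda>s. \<Sum>i\<in>X. f i s) s = (\<Sum>i\<in>X. deriv (f i) s)) (finite_subsets_at_top A)"
      using ev
    proof eventually_elim
      case (elim X)
      have "(f i has_field_derivative deriv (f i) s) (at s)" if "i \<in> X" for i
        using that elim s S holo by (intro holomorphic_derivI) auto
      then show ?case by (intro DERIV_imp_deriv DERIV_sum) auto
    qed
    ultimately show ?thesis unfolding has_sum_def
      by (rule Lim_transform_eventually)
  qed
  show "(\<lambda>i. norm (f i s)) summable_on A" if "s \<in> S" for s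
    using key[OF that] by blast
qed

section \<open>Fourier series and Poisson summation\<close>

lemma has_integral_cis_int:
  "((\<lambda>t. cis (2 * pi * of_int k * t)) has_integral (if k = 0 then 1 else 0)) {0..1}"
proof (cases "k = 0")
  case True
  then show ?thesis using has_integral_const_real[of "1::complex" 0 1] by simp
next
  case False
  define F where "F t = cis (2 * pi * of_int k * t) / (2 * pi * of_int k * \<i>)" for t
  have "(F has_vector_derivative cis (2 * pi * of_int k * t)) (at t within {0..1})" for t
  proof -
    have "((\<lambda>z. exp (\<i> * (2 * of_real pi * of_int k * z)) / (2 * pi * of_int k * \<i>)) has_field_derivative cis (2 * pi * of_int k * t)) (at (of_real t))"
      using False by (auto intro!: derivative_eq_intros simp: cis_conv_exp)
    from has_vector_derivative_real_field[OF this] show ?thesis by (simp add: F_def[abs_def] cis_conv_exp)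
  qed
  then have "((\<lambda>t. cis (2 * pi * of_int k * t)) has_integral (F 1 - F 0)) {0..1}"
    by (intro fundamental_theorem_of_calculus) auto
  moreover have "F 1 = F 0"
    using cis_multiple_2pi[of "of_int k"] by (simp add: F_def mult_ac)
  ultimately show ?thesis using False by simp
qed

text \<open>The integral of |h - S|^2 is nonnegative for the trigonometric polynomial
  \<open>S\<close> whose coefficients are those of \<open>h\<close> over \<open>B\<close>; expanding
  the square, orthonormality leaves the integral of |h|^2 minus \<open>N\<close>.\<close>

lemma Bessel_inequality_cis:
  fixes h :: "real \<Rightarrow> complex"
  assumes h: "continuous_on {0..1} h" and "finite B"
  defines "c \<equiv> \<lambda>k::int. integral {0..1} (\<lambda>t. h t * cis (- (2 * pi * of_int k * t)))"
  shows "(\<Sum>k\<in>B. (norm (c k))\<^sup>2) \<le> integral {0..1} (\<lambda>t. (norm (h t))\<^sup>2)"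
proof -
  define e where "e k t = cis (2 * pi * of_int k * t)" for k :: int and t :: real
  have e_cnj: "cnj (e k t) = cis (- (2 * pi * of_int k * t))" for k t
    by (simp add: e_def cis_cnj)
  have c: "((\<lambda>t. h t * cnj (e k t)) has_integral c k) {0..1}" for k
    unfolding c_def e_cnj
    by (intro integrable_integral integrable_continuous_real continuous_intros h)
  define S where "S t = (\<Sum>k\<in>B. c k * e k t)" for t
  define N where "N = (\<Sum>k\<in>B. complex_of_real ((norm (c k))\<^sup>2))"
  have 1: "((\<lambda>t. \<Sum>k\<in>B. cnj (c k) * (h t * cnj (e k t))) has_integral (\<Sum>k\<in>B. cnj (c k) * c k)) {0..1}"
    using c by (intro has_integral_sum has_integral_mult_right \<open>finite B\<close>)
  have c': "((\<lambda>t. cnj (h t * cnj (e k t))) has_integral cnj (c k)) {0..1}" for k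
    using has_integral_linear[OF c[of k] bounded_linear_cnj] by (simp add: o_def)
  have 2: "((\<lambda>t. \<Sum>k\<in>B. c k * cnj (h t * cnj (e k t))) has_integral (\<Sum>k\<in>B. c k * cnj (c k))) {0..1}"
    using c' by (intro has_integral_sum has_integral_mult_right \<open>finite B\<close>)
  have ee: "((\<lambda>t. e k t * cnj (e l t)) has_integral (if k = l then 1 else 0)) {0..1}" for k l
  proof -
    have "e k t * cnj (e l t) = cis (2 * pi * of_int (k - l) * t)" for t
      by (simp add: e_def cis_cnj cis_mult algebra_simps)
    then show ?thesis using has_integral_cis_int[of "k - l"] by simp
  qed
  have 3: "((\<lambda>t. \<Sum>k\<in>B. \<Sum>l\<in>B. c k * cnj (c l) * (e k t * cnj (e l t))) has_integral
        (\<Sum>k\<in>B. \<Sum>l\<in>B. c k * cnj (c l) * (if k = l then 1 else 0))) {0..1}"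
    using ee by (intro has_integral_sum has_integral_mult_right \<open>finite B\<close>)
  have "((\<lambda>t. (norm (h t))\<^sup>2) has_integral integral {0..1} (\<lambda>t. (norm (h t))\<^sup>2)) {0..1}"
    by (intro integrable_integral integrable_continuous_real continuous_intros h)
  then have 4: "((\<lambda>t. complex_of_real ((norm (h t))\<^sup>2)) has_integral of_real (integral {0..1} (\<lambda>t. (norm (h t))\<^sup>2))) {0..1}"
    by (rule has_integral_of_real)
  have s1: "(\<Sum>k\<in>B. cnj (c k) * (h t * cnj (e k t))) = h t * cnj (S t)" for t
    by (simp add: S_def sum_distrib_left mult_ac)
  have s2: "(\<Sum>k\<in>B. c k * cnj (h t * cnj (e k t))) = S t * cnj (h t)" for t
    by (simp add: S_def sum_distrib_left sum_distrib_right mult_ac)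
  have s3: "(\<Sum>k\<in>B. \<Sum>l\<in>B. c k * cnj (c l) * (e k t * cnj (e l t))) = S t * cnj (S t)" for t
    by (simp add: S_def sum_product mult_ac)
  have n1: "(\<Sum>k\<in>B. cnj (c k) * c k) = N" "(\<Sum>k\<in>B. c k * cnj (c k)) = N"
    unfolding N_def complex_norm_square by (simp_all add: mult.commute)
  have n3: "(\<Sum>k\<in>B. \<Sum>l\<in>B. c k * cnj (c l) * (if k = l then 1 else 0)) = N"
    unfolding n1(2)[symmetric] using \<open>finite B\<close> by (simp add: if_distrib cong: if_cong)
  \<comment> \<open>The two mixed terms and the square of \<open>S\<close> all integrate to
    \<open>N\<close>, hence \<open>- N - N + N\<close>.\<close>
  have "((\<lambda>t. of_real ((norm (h t))\<^sup>2) - h t * cnj (S t) - S t * cnj (h t) + S t * cnj (S t))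
       has_integral (of_real (integral {0..1} (\<lambda>t. (norm (h t))\<^sup>2)) - N - N + N)) {0..1}"
    using 1 2 3 4 unfolding s1 s2 s3 n1 n3 by (intro has_integral_add has_integral_diff)
  moreover have "of_real ((norm (h t))\<^sup>2) - h t * cnj (S t) - S t * cnj (h t) + S t * cnj (S t)
      = of_real ((norm (h t - S t))\<^sup>2)" for t
    unfolding complex_norm_square by (simp add: algebra_simps)
  ultimately have "((\<lambda>t. complex_of_real ((norm (h t - S t))\<^sup>2)) has_integral
      (of_real (integral {0..1} (\<lambda>t. (norm (h t))\<^sup>2)) - N)) {0..1}" by simp
  then have "((\<lambda>t. Re (complex_of_real ((norm (h t - S t))\<^sup>2))) has_integral
      Re (of_real (integral {0..1} (\<lambda>t. (norm (h t))\<^sup>2)) - N)) {0..1}"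
    by (rule has_integral_Re)
  then have "0 \<le> Re (of_real (integral {0..1} (\<lambda>t. (norm (h t))\<^sup>2)) - N)"
    by (rule has_integral_nonneg) simp
  then show ?thesis by (simp add: N_def)
qed

text \<open>Bessel's inequality makes the squares of the coefficients summable along any injective
  sequence of frequencies. The freedom in \<open>K\<close> serves both ends of a telescoping sum
  over {-N..N}.\<close>

lemma Riemann_Lebesgue_cis:
  fixes h :: "real \<Rightarrow> complex"
  assumes h: "continuous_on {0..1} h" and K: "inj K"
  shows "(\<lambda>n::nat. integral {0..1} (\<lambda>t. h t * cis (- (2 * pi * of_int (K n) * t)))) \<longlonglongrightarrow> 0"
proof -
  define c where "c k = integral {0..1} (\<lambda>t. h t * cis (- (2 * pi * of_int k * t)))" for k :: int
  have "(\<Sum>n<N. (norm (c (K n)))\<^sup>2) \<le> integral {0..1} (\<lambda>t. (norm (h t))\<^sup>2)" for N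
  proof -
    have "(\<Sum>n<N. (norm (c (K n)))\<^sup>2) = (\<Sum>k\<in>K ` {..<N}. (norm (c k))\<^sup>2)"
      using K by (subst sum.reindex) (auto intro: inj_on_subset)
    also have "\<dots> \<le> integral {0..1} (\<lambda>t. (norm (h t))\<^sup>2)"
      unfolding c_def by (intro Bessel_inequality_cis h) auto
    finally show ?thesis .
  qed
  then have "summable (\<lambda>n. (norm (c (K n)))\<^sup>2)" by (intro summableI_nonneg_bounded) auto
  then have "(\<lambda>n. (norm (c (K n)))\<^sup>2) \<longlonglongrightarrow> 0" by (rule summable_LIMSEQ_zero)
  then have "(\<lambda>n. sqrt ((norm (c (K n)))\<^sup>2)) \<longlonglongrightarrow> sqrt 0" by (rule tendsto_real_sqrt)
  then have "(\<lambda>n. norm (c (K n))) \<longlonglongrightarrow> 0" by simp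
  then have "(\<lambda>n. c (K n)) \<longlonglongrightarrow> 0" by (rule tendsto_norm_zero_cancel)
  then show ?thesis by (simp add: c_def)
qed

lemma sum_int_telescope:
  fixes f :: "int \<Rightarrow> 'a::ab_group_add"
  shows "(\<Sum>k\<in>{- int N..int N}. f (k - 1) - f k) = f (- int N - 1) - f (int N)"
proof (induction N)
  case (Suc N)
  have "{- int (Suc N)..int (Suc N)} = insert (- int (Suc N)) (insert (int (Suc N)) {- int N..int N})"
    by auto
  moreover have "- int (Suc N) \<notin> insert (int (Suc N)) {- int N..int N}" "int (Suc N) \<notin> {- int N..int N}"
    by auto
  ultimately have *: "(\<Sum>k\<in>{- int (Suc N)..int (Suc N)}. f (k - 1) - f k) =
     (f (- int (Suc N) - 1) - f (- int (Suc N))) + ((f (int (Suc N) - 1) - f (int (Suc N)))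
       + (f (- int N - 1) - f (int N)))"
    using Suc by (simp only: sum.insert finite_insert finite_atLeastAtMost_int not_False_eq_True)
  have e: "int (Suc N) - 1 = int N" "- int N - 1 = - int (Suc N)" by simp_all
  have "a - b + ((d - c) + (b - d)) = a - c" for a b c d :: 'a by (simp add: algebra_simps)
  then show ?case unfolding * e by this
qed simp

lemma cis_minus_one: "cis (2 * x) - 1 = 2 * \<i> * of_real (sin x) * cis x"
  by (simp add: complex_eq_iff cos_double_sin sin_double power2_eq_square)

lemma has_vector_derivative_quotient_tendsto:
  assumes "(f has_vector_derivative d) (at a within S)"
  shows "((\<lambda>t. (f t - f a) /\<^sub>R (t - a)) \<longlongrightarrow> d) (at a within S)"
proof -
  have "((\<lambda>t. norm (f t - f a - (t - a) *\<^sub>R d) / norm (t - a)) \<longlongrightarrow> 0) (at a within S)"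
    using assms unfolding has_vector_derivative_def has_derivative_iff_norm by blast
  moreover have "\<forall>\<^sub>F t in at a within S. norm (f t - f a - (t - a) *\<^sub>R d) / norm (t - a)
      = norm ((f t - f a) /\<^sub>R (t - a) - d)"
  proof -
    have "norm (f t - f a - (t - a) *\<^sub>R d) / norm (t - a) = norm ((f t - f a) /\<^sub>R (t - a) - d)" if "t \<noteq> a" for t
    proof -
      have "(f t - f a) /\<^sub>R (t - a) - d = (f t - f a - (t - a) *\<^sub>R d) /\<^sub>R (t - a)"
        using that by (simp add: scaleR_diff_right)
      then show ?thesis by (simp add: divide_inverse mult.commute)
    qed
    then show ?thesis by (auto simp: eventually_at_filter)
  qed
  ultimately have "((\<lambda>t. norm ((f t - f a) /\<^sub>R (t - a) - d)) \<longlongrightarrow> 0) (at a within S)"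
    by (rule Lim_transform_eventually)
  then show ?thesis using LIM_zero_iff tendsto_norm_zero_iff by blast
qed

text \<open>
  Dividing \<open>g - g 0\<close> by \<open>cis (2 \<pi> t) - 1\<close> makes the Fourier coefficients telescope, so that the
  convergence of the Fourier series at \<open>0\<close> is reduced to the Riemann--Lebesgue lemma.
\<close>

lemma Fourier_series_at_0:
  fixes g :: "real \<Rightarrow> complex"
  assumes g: "continuous_on {0..1} g" "g 1 = g 0"
    and d0: "(g has_vector_derivative d0) (at 0 within {0..1})"
    and d1: "(g has_vector_derivative d1) (at 1 within {0..1})"
  shows "(\<lambda>N. \<Sum>k\<in>{- int N..int N}. integral {0..1} (\<lambda>t. g t * cis (- (2 * pi * of_int k * t)))) \<longlonglongrightarrow> g 0"
proof -
  define D where "D t = cis (2 * (pi * t)) - 1" for t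
  have D_nz: "D t \<noteq> 0" if "0 < t" "t < 1" for t
  proof -
    have "sin (pi * t) > 0" using that by (intro sin_gt_zero) auto
    then show ?thesis unfolding D_def cis_minus_one by simp
  qed
  have D0: "D 0 = 0" "D 1 = 0" by (simp_all add: D_def)
  have D': "(D has_vector_derivative 2 * pi * \<i> * cis (2 * (pi * t))) (at t within {0..1})" for t
  proof -
    have "((\<lambda>z. exp (\<i> * (2 * (of_real pi * z))) - 1) has_field_derivative 2 * pi * \<i> * cis (2 * (pi * t))) (at (of_real t))"
      by (rule derivative_eq_intros refl | simp add: cis_conv_exp)+
    from has_vector_derivative_real_field[OF this] show ?thesis by (simp add: D_def[abs_def] cis_conv_exp)
  qed
  \<comment> \<open>The values at 0 and 1 are the limits of the quotient: \<open>D\<close> has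
    derivative 2 \<pi> \<i> at both endpoints, so the one-sided derivatives of \<open>g\<close>
    determine them.\<close>
  define h where "h t = (if t = 0 then d0 / (2 * pi * \<i>) else if t = 1 then d1 / (2 * pi * \<i>)
      else (g t - g 0) / D t)" for t
  have hD: "h t * D t = g t - g 0" if "t \<in> {0..1}" for t
    using that D_nz[of t] D0 g(2) by (auto simp: h_def)
  have lim: "((\<lambda>t. (g t - g 0) / D t) \<longlongrightarrow> d / (2 * pi * \<i>)) (at a within {0..1})"
    if "(g has_vector_derivative d) (at a within {0..1})" "a \<in> {0, 1}" for a d
  proof -
    have ga: "g a = g 0" "D a = 0" "cis (2 * (pi * a)) = 1" using that(2) g(2) D0 by auto
    have "((\<lambda>t. (g t - g a) /\<^sub>R (t - a)) \<longlongrightarrow> d) (at a within {0..1})"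
      using that(1) by (rule has_vector_derivative_quotient_tendsto) 
    moreover have "((\<lambda>t. (D t - D a) /\<^sub>R (t - a)) \<longlongrightarrow> 2 * pi * \<i>) (at a within {0..1})"
      using has_vector_derivative_quotient_tendsto[OF D'[of a]] ga by simp
    ultimately have "((\<lambda>t. ((g t - g a) /\<^sub>R (t - a)) / ((D t - D a) /\<^sub>R (t - a))) \<longlongrightarrow> d / (2 * pi * \<i>)) (at a within {0..1})"
      by (intro tendsto_divide) auto
    then show ?thesis
    proof (rule Lim_transform_eventually)
      show "\<forall>\<^sub>F t in at a within {0..1}. (g t - g a) /\<^sub>R (t - a) / ((D t - D a) /\<^sub>R (t - a)) = (g t - g 0) / D t"
        using ga by (auto simp: eventually_at_filter scaleR_conv_of_real)
    qed
  qed
  have hc: "continuous_on {0..1} h"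
    unfolding continuous_on_def
  proof
    fix a :: real assume a: "a \<in> {0..1}"
    have ev: "((\<lambda>t. (g t - g 0) / D t) \<longlongrightarrow> h a) (at a within {0..1})"
    proof (cases "a \<in> {0, 1}")
      case True
      then show ?thesis using lim[of d0 0] lim[of d1 1] d0 d1 by (auto simp: h_def)
    next
      case False
      then have "D a \<noteq> 0" using D_nz[of a] a by auto
      moreover have "(g \<longlongrightarrow> g a) (at a within {0..1})" using g(1) a by (simp add: continuous_on_def)
      moreover have "(D \<longlongrightarrow> D a) (at a within {0..1})"
        using has_vector_derivative_continuous[OF D'] by (simp add: continuous_within)
      ultimately show ?thesis using False by (auto simp: h_def intro!: tendsto_intros)
    qed
    moreover have "eventually (\<lambda>t. t \<noteq> 0 \<and> t \<noteq> 1) (at a within {0..1})"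
    proof -
      have "eventually (\<lambda>t. t \<noteq> b) (at a within {0..1})" for b :: real
      proof (cases "a = b")
        case False
        then have "eventually (\<lambda>t. t \<in> - {b}) (at a)" by (intro eventually_at_in_open') auto
        then show ?thesis by (auto simp: eventually_at_filter elim: eventually_mono)
      qed (auto simp: eventually_at_filter)
      then show ?thesis by (intro eventually_conj)
    qed
    ultimately show "(h \<longlongrightarrow> h a) (at a within {0..1})"
      by (rule Lim_transform_eventually[OF _ eventually_mono]) (auto simp: h_def)
  qed
  define H where "H k = integral {0..1} (\<lambda>t. h t * cis (- (2 * pi * of_int k * t)))" for k :: int
  have H: "((\<lambda>t. h t * cis (- (2 * pi * of_int k * t))) has_integral H k) {0..1}" for k
    unfolding H_def by (intro integrable_integral integrable_continuous_real continuous_intros hc)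
  have coeff: "integral {0..1} (\<lambda>t. g t * cis (- (2 * pi * of_int k * t))) =
      g 0 * (if k = 0 then 1 else 0) + (H (k - 1) - H k)" for k
  proof (rule integral_unique, rule has_integral_eq)
    show "((\<lambda>t. g 0 * cis (2 * pi * of_int (- k) * t) + (h t * cis (- (2 * pi * of_int (k - 1) * t))
        - h t * cis (- (2 * pi * of_int k * t)))) has_integral
        g 0 * (if k = 0 then 1 else 0) + (H (k - 1) - H k)) {0..1}"
      using has_integral_cis_int[of "- k"] H[of "k - 1"] H[of k]
      by (intro has_integral_add has_integral_diff has_integral_mult_right) auto
    fix t :: real assume t: "t \<in> {0..1}"
    \<comment> \<open>Multiplication by e^(2 \<pi> \<i> t) lowers the frequency by one, so
      \<open>h * D\<close> has the coefficients \<open>H (k - 1) - H k\<close>.\<close>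
    have "cis (- (2 * pi * of_int (k - 1) * t)) = cis (- (2 * pi * of_int k * t)) * cis (2 * (pi * t))"
      by (simp add: cis_mult algebra_simps)
    then have "h t * cis (- (2 * pi * of_int (k - 1) * t)) - h t * cis (- (2 * pi * of_int k * t))
       = cis (- (2 * pi * of_int k * t)) * (h t * D t)"
      by (simp add: D_def algebra_simps)
    then show "g 0 * cis (2 * pi * of_int (- k) * t) + (h t * cis (- (2 * pi * of_int (k - 1) * t))
        - h t * cis (- (2 * pi * of_int k * t))) = g t * cis (- (2 * pi * of_int k * t))"
      unfolding hD[OF t] by (simp add: algebra_simps)
  qed
  have "(\<Sum>k\<in>{- int N..int N}. integral {0..1} (\<lambda>t. g t * cis (- (2 * pi * of_int k * t))))
      = g 0 + (H (- int N - 1) - H (int N))" for N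
    unfolding coeff sum.distrib sum_int_telescope by (simp add: sum_distrib_left[symmetric])
  moreover have "(\<lambda>N. g 0 + (H (- int N - 1) - H (int N))) \<longlonglongrightarrow> g 0 + (0 - 0)"
    unfolding H_def by (intro tendsto_add tendsto_diff tendsto_const Riemann_Lebesgue_cis hc) (auto simp: inj_def)
  ultimately show ?thesis by simp
qed

text \<open>Unconditional convergence allows any exhaustion of the integers: the closed ranges match
  the symmetric partial sums of a Fourier series, the half-open ones the unit intervals [n, n + 1]
  that tile [-N, N].\<close>

lemma has_sum_int_sequence:
  fixes f :: "int \<Rightarrow> 'a::{topological_comm_monoid_add,t2_space}"
  assumes "(f has_sum s) UNIV"
  shows "(\<lambda>N. \<Sum>k\<in>{- int N..int N}. f k) \<longlonglongrightarrow> s" "(\<lambda>N. \<Sum>k\<in>{- int N..<int N}. f k) \<longlonglongrightarrow> s"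
proof -
  have fl: "filterlim X (finite_subsets_at_top UNIV) sequentially"
    if X: "\<And>N. finite (X N)" "\<And>N k. \<bar>k\<bar> < int N \<Longrightarrow> k \<in> X N" for X :: "nat \<Rightarrow> int set"
    unfolding filterlim_finite_subsets_at_top
  proof safe
    fix Y :: "int set" assume "finite Y"
    then have "\<bar>k\<bar> \<le> Max (abs ` Y)" if "k \<in> Y" for k
      using that by simp
    then obtain b where b: "\<And>k. k \<in> Y \<Longrightarrow> \<bar>k\<bar> \<le> b" by blast
    show "\<forall>\<^sub>F N in sequentially. finite (X N) \<and> Y \<subseteq> X N \<and> X N \<subseteq> UNIV"
      using eventually_gt_at_top[of "nat b"]
    proof eventually_elim
      case (elim N)
      then show ?case using X b by (fastforce simp: nat_less_iff)
    qed
  qed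
  show "(\<lambda>N. \<Sum>k\<in>{- int N..int N}. f k) \<longlonglongrightarrow> s"
    by (rule filterlim_compose[OF assms[unfolded has_sum_def] fl]) auto
  show "(\<lambda>N. \<Sum>k\<in>{- int N..<int N}. f k) \<longlonglongrightarrow> s"
    by (rule filterlim_compose[OF assms[unfolded has_sum_def] fl]) auto
qed

lemma integral_int_decompose:
  fixes f :: "real \<Rightarrow> complex"
  assumes "continuous_on UNIV f"
  shows "(\<Sum>n\<in>{- int N..<int N}. integral {0..1} (\<lambda>t. f (t + of_int n))) = integral {- real N..real N} f"
proof (induction N)
  case (Suc N)
  have c: "continuous_on A f" for A using assms continuous_on_subset by blast
  have sh: "integral {0..1} (\<lambda>t. f (t + of_int n)) = integral {of_int n..of_int n + 1} f" for n :: int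
    using integral_shift[of 0 "of_int n" 1 f] c by (simp add: o_def add.commute)
  have i: "f integrable_on {a..b}" for a b by (intro integrable_continuous_real c)
  have "{- int (Suc N)..<int (Suc N)} = insert (- int (Suc N)) (insert (int N) {- int N..<int N})"
    by auto
  then have "(\<Sum>n\<in>{- int (Suc N)..<int (Suc N)}. integral {0..1} (\<lambda>t. f (t + of_int n)))
     = integral {- real (Suc N)..- real N} f + (integral {real N..real (Suc N)} f + integral {- real N..real N} f)"
    using Suc sh[of "- int (Suc N)"] sh[of "int N"] by (simp add: add.commute)
  also have "\<dots> = integral {- real (Suc N)..real (Suc N)} f"
    using Henstock_Kurzweil_Integration.integral_combine[of "- real (Suc N)" "- real N" "real N" f] Henstock_Kurzweil_Integration.integral_combine[of "- real (Suc N)" "real N" "real (Suc N)" f] i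
    by (simp add: add_ac) (metis add.assoc add.commute)
  finally show ?case .
qed simp

text \<open>The periodisation \<open>g\<close> of \<open>F\<close> is holomorphic near [0, 1], so
  its Fourier series converges to it at 0, and its k-th coefficient is the integral of
  \<open>F\<close> against the k-th exponential over the line. Holomorphy in a complex neighbourhood
  takes the place of decay conditions on derivatives of \<open>F\<close>, and \<open>c\<close> is
  only asked to be a limit of integrals over [-N, N].\<close>

lemma Poisson_summation_holomorphic:
  fixes F :: "complex \<Rightarrow> complex" and c :: "int \<Rightarrow> complex"
  assumes S: "open S" "complex_of_real ` {0..1} \<subseteq> S"
    and holo: "F holomorphic_on UNIV"
    and M: "M summable_on UNIV" "\<And>n v. v \<in> S \<Longrightarrow> norm (F (v + of_int n)) \<le> M n"
    and c: "\<And>k. (\<lambda>N. integral {- real N..real N} (\<lambda>t. F (of_real t) * cis (- (2 * pi * of_int k * t)))) \<longlonglongrightarrow> c k"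
      "c summable_on UNIV"
  shows "(\<Sum>\<^sub>\<infinity>n. F (of_int n)) = (\<Sum>\<^sub>\<infinity>k. c k)"
proof -
  define g where "g v = (\<Sum>\<^sub>\<infinity>n. F (v + of_int n))" for v
  have hF: "(\<lambda>v. F (v + of_int n)) holomorphic_on S" for n
    using holomorphic_on_compose[of "\<lambda>v. v + of_int n" S F] holomorphic_on_subset[OF holo]
    by (simp add: o_def holomorphic_on_add holomorphic_on_ident holomorphic_on_const)
  have dom: "loc_dominated UNIV (\<lambda>n v. F (v + of_int n)) S"
  proof (rule loc_dominatedI)
    fix s assume "s \<in> S"
    then obtain r where "r > 0" "cball s r \<subseteq> S" using S open_contains_cball by blast
    then show "\<exists>r>0. \<exists>F' M'. finite F' \<and> M' summable_on (UNIV - F') \<and>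
      (\<forall>i\<in>UNIV - F'. \<forall>z\<in>cball s r. norm (F (z + of_int i)) \<le> M' i)"
      using M by (intro exI[of _ r] conjI exI[of _ "{}"] exI[of _ M]) auto
  qed
  have g_holo: "g holomorphic_on S"
    unfolding g_def by (intro holomorphic_on_infsum S(1) hF dom)
  have g': "((\<lambda>t. g (of_real t)) has_vector_derivative deriv g (of_real t)) (at t within {0..1})" if "t \<in> {0..1}" for t
    by (rule has_vector_derivative_real_field, rule holomorphic_derivI[OF g_holo S(1)]) (use S(2) that in auto)
  have gc: "continuous_on {0..1} (\<lambda>t. g (of_real t))"
    using g' has_vector_derivative_continuous continuous_on_eq_continuous_within by blast
  have per: "g 1 = g 0"
    unfolding g_def
    by (rule infsum_reindex_bij_witness[of _ "\<lambda>n. n - 1" "\<lambda>n. n + 1"]) (auto simp: add_ac)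
  have "(\<lambda>N. \<Sum>k\<in>{- int N..int N}. integral {0..1} (\<lambda>t. g (of_real t) * cis (- (2 * pi * of_int k * t)))) \<longlonglongrightarrow> g (of_real 0)"
    by (rule Fourier_series_at_0[OF gc _ g' g']) (use per in auto)
  moreover have "integral {0..1} (\<lambda>t. g (of_real t) * cis (- (2 * pi * of_int k * t))) = c k" for k
  proof -
    define f where "f t = F (of_real t) * cis (- (2 * pi * of_int k * t))" for t
    have Fc: "continuous_on A (\<lambda>t. F (complex_of_real t + of_int n))" for A n
      using holomorphic_on_imp_continuous_on[OF holo]
      by (rule continuous_on_compose2) (auto intro!: continuous_intros)
    have fc: "continuous_on UNIV f"
      unfolding f_def using Fc[of UNIV 0] by (intro continuous_intros) auto
    have fn: "f (t + of_int n) = F (of_real t + of_int n) * cis (- (2 * pi * of_int k * t))" for t n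
    proof -
      \<comment> \<open>As \<open>k * n\<close> is an integer, all translates carry the same
        exponential, so the integrals over unit intervals can be joined into one over
        [-N, N].\<close>
      have "cis (- (2 * pi * of_int k * (t + of_int n))) = cis (- (2 * pi * of_int k * t)) * cis (2 * pi * of_int (- k * n))"
        by (simp add: cis_mult algebra_simps)
      also have "cis (2 * pi * of_int (- k * n)) = 1" by (rule cis_multiple_2pi) auto
      finally show ?thesis by (simp add: f_def)
    qed
    have "uniform_limit {0..1} (\<lambda>X t. \<Sum>n\<in>X. f (t + of_int n)) (\<lambda>t. \<Sum>\<^sub>\<infinity>n. f (t + of_int n)) (finite_subsets_at_top UNIV)"
      using M(2)[OF subsetD[OF S(2)]] by (intro Weierstrass_m_test_general[OF _ M(1)]) (auto simp: fn norm_mult)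
    moreover have "(\<Sum>\<^sub>\<infinity>n. f (t + of_int n)) = g (of_real t) * cis (- (2 * pi * of_int k * t))" for t
      unfolding fn g_def by (rule infsum_cmult_left') 
    ultimately have ul: "uniform_limit {0..1} (\<lambda>X t. \<Sum>n\<in>X. f (t + of_int n)) (\<lambda>t. g (of_real t) * cis (- (2 * pi * of_int k * t))) (finite_subsets_at_top UNIV)"
      by simp
    have fi: "(\<lambda>t. f (t + of_int n)) integrable_on {0..1}" for n
      unfolding fn by (intro integrable_continuous_real continuous_intros Fc)
    have "\<exists>I J. (\<forall>X. ((\<lambda>t. \<Sum>n\<in>X. f (t + of_int n)) has_integral I X) {0..1}) \<and>
        ((\<lambda>t. g (of_real t) * cis (- (2 * pi * of_int k * t))) has_integral J) {0..1} \<and>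
         (I \<longlongrightarrow> J) (finite_subsets_at_top UNIV)"
    proof (rule uniform_limit_integral[OF ul])
      show "continuous_on {0..1} (\<lambda>t. \<Sum>n\<in>X. f (t + of_int n))" for X
        unfolding fn by (intro continuous_intros Fc)
    qed auto
    then obtain I J where IJ: "\<And>X. ((\<lambda>t. \<Sum>n\<in>X. f (t + of_int n)) has_integral I X) {0..1}"
       "((\<lambda>t. g (of_real t) * cis (- (2 * pi * of_int k * t))) has_integral J) {0..1}"
       "(I \<longlongrightarrow> J) (finite_subsets_at_top UNIV)" by blast
    have "I X = (\<Sum>n\<in>X. integral {0..1} (\<lambda>t. f (t + of_int n)))" if "finite X" for X
      using integral_unique[OF IJ(1)[of X]] integral_sum[OF that fi] by simp
    then have "((\<lambda>X. \<Sum>n\<in>X. integral {0..1} (\<lambda>t. f (t + of_int n))) \<longlongrightarrow> J) (finite_subsets_at_top UNIV)"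
      by (intro Lim_transform_eventually[OF IJ(3)] eventually_finite_subsets_at_top_weakI) auto
    then have "((\<lambda>n. integral {0..1} (\<lambda>t. f (t + of_int n))) has_sum J) UNIV"
      by (simp add: has_sum_def)
    \<comment> \<open>The half-open ranges of translates tile [-N, N], which identifies the
      unconditional sum \<open>J\<close> with the limit \<open>c k\<close>.\<close>
    from has_sum_int_sequence(2)[OF this] have "(\<lambda>N. integral {- real N..real N} f) \<longlonglongrightarrow> J"
      by (simp add: integral_int_decompose[OF fc])
    with c(1)[of k] have "J = c k" unfolding f_def by (rule LIMSEQ_unique[symmetric])
    then show ?thesis using IJ(2) by auto
  qed
  ultimately have "(\<lambda>N. \<Sum>k\<in>{- int N..int N}. c k) \<longlonglongrightarrow> g 0" by simp
  moreover have "(\<lambda>N. \<Sum>k\<in>{- int N..int N}. c k) \<longlonglongrightarrow> (\<Sum>\<^sub>\<infinity>k. c k)"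
    using c(2) by (intro has_sum_int_sequence has_sum_infsum)
  ultimately have "g 0 = (\<Sum>\<^sub>\<infinity>k. c k)" by (rule LIMSEQ_unique)
  then show ?thesis by (simp add: g_def)
qed

section \<open>Estimates for the Gamma function\<close>

lemma norm_Gamma_le_Gamma_Re:
  assumes "Re s > 0"
  shows "norm (Gamma s) \<le> Gamma (Re s)"
proof -
  have 1: "((\<lambda>t. complex_of_real t powr (s - 1) / of_real (exp t)) has_integral Gamma s) {0..}"
    by (rule Gamma_integral_complex[OF assms])
  have 2: "((\<lambda>t. t powr (Re s - 1) / exp t) has_integral Gamma (Re s)) {0..}"
    by (rule Gamma_integral_real[OF assms])
  have "norm (integral {0..} (\<lambda>t. complex_of_real t powr (s - 1) / of_real (exp t)))
      \<le> integral {0..} (\<lambda>t. t powr (Re s - 1) / exp t)"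
    by (rule integral_norm_bound_integral)
       (use 1 2 in \<open>auto simp: has_integral_iff norm_divide norm_powr_real_powr\<close>)
  then show ?thesis using 1 2 by (simp add: has_integral_iff)
qed

lemma Gamma_real_bounded:
  fixes a b :: real
  assumes "a > 0"
  obtains C where "C > 0" "\<And>x. x \<in> {a..b} \<Longrightarrow> Gamma x \<le> C"
proof -
  have "continuous_on {a..b} (Gamma :: real \<Rightarrow> real)"
    using assms by (intro continuous_on_Gamma) (auto elim!: nonpos_Ints_cases)
  then have "bounded (Gamma ` {a..b})"
    using compact_continuous_image compact_imp_bounded by blast
  then obtain C where "\<And>x. x \<in> {a..b} \<Longrightarrow> norm (Gamma x) \<le> C" unfolding bounded_iff by blast
  then show ?thesis by (intro that[of "max C 1"]) force+
qed

lemma nonpos_Ints_Im: "Im z \<noteq> 0 \<Longrightarrow> z \<notin> \<int>\<^sub>\<le>\<^sub>0"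
  by (auto elim!: nonpos_Ints_cases)

text \<open>Shifting \<open>N\<close> times by the functional equation moves \<open>s\<close> to the
  right half-plane, where |Gamma s| is at most Gamma (Re s), and each factor of the Pochhammer
  symbol has modulus at least |Im s| \<ge> 1. Quadratic decay is enough for summability over the
  frequencies.\<close>

lemma norm_Gamma_strip_le:
  obtains C where "C > 0" "\<And>s. \<bar>Re s\<bar> \<le> R \<Longrightarrow> \<bar>Im s\<bar> \<ge> 1 \<Longrightarrow> norm (Gamma s) \<le> C / (Im s)\<^sup>2"
proof -
  \<comment> \<open>Chosen so that Re s + N lies in [1, 2 N] whenever |Re s| \<le> R, and so that
    there are at least the two factors that give (Im s)^2.\<close>
  define N where "N = nat \<lceil>\<bar>R\<bar>\<rceil> + 2"
  obtain C where C: "C > 0" "\<And>x. x \<in> {1..2 * real N} \<Longrightarrow> Gamma x \<le> C"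
    using Gamma_real_bounded[of 1] by (metis zero_less_one)
  have N: "real N \<ge> \<bar>R\<bar> + 2" "N \<ge> 2" unfolding N_def by linarith+
  show ?thesis
  proof (rule that[OF C(1)])
    fix s assume s: "\<bar>Re s\<bar> \<le> R" "\<bar>Im s\<bar> \<ge> 1"
    have "(\<Prod>i = 0..<N. \<bar>Im s\<bar>) \<le> (\<Prod>i = 0..<N. norm (s + of_nat i))"
    proof (rule prod_mono)
      fix i :: nat
      have "\<bar>Im (s + of_nat i)\<bar> \<le> norm (s + of_nat i)" by (rule abs_Im_le_cmod)
      then show "0 \<le> \<bar>Im s\<bar> \<and> \<bar>Im s\<bar> \<le> norm (s + of_nat i)" by simp
    qed
    then have "\<bar>Im s\<bar> ^ N \<le> norm (pochhammer s N)"
      by (simp add: pochhammer_prod prod_norm)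
    moreover have "\<bar>Im s\<bar> ^ 2 \<le> \<bar>Im s\<bar> ^ N" using s(2) N(2) by (rule power_increasing[rotated])
    ultimately have p: "(Im s)\<^sup>2 \<le> norm (pochhammer s N)" by simp
    have I: "Im s \<noteq> 0" using s by auto
    have "pochhammer s N = Gamma (s + of_nat N) / Gamma s"
      using I by (intro pochhammer_Gamma nonpos_Ints_Im)
    moreover have "Gamma s \<noteq> 0" using I by (simp add: Gamma_eq_zero_iff nonpos_Ints_Im)
    ultimately have "norm (Gamma s) * norm (pochhammer s N) = norm (Gamma (s + of_nat N))"
      by (simp add: norm_divide)
    also have "\<dots> \<le> Gamma (Re (s + of_nat N))"
      using s N by (intro norm_Gamma_le_Gamma_Re) auto
    also have "\<dots> \<le> C" using s N by (intro C(2)) auto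
    finally have "norm (Gamma s) * (Im s)\<^sup>2 \<le> C"
      using p by (meson mult_left_mono norm_ge_zero order_trans)
    then show "norm (Gamma s) \<le> C / (Im s)\<^sup>2"
      using I by (simp add: field_simps)
  qed
qed

text \<open>Each downward step divides by a factor |s - j| \<ge> j/2, which yields 2^m/m!; two
  upward steps, to a real part in [3/2, 5/2], yield (Im s)^(-2). Together with the factor 1/m! of
  the residues this keeps the heat expansion of exponential type in t.\<close>

lemma norm_Gamma_shift_le:
  obtains C where "C > 0"
    "\<And>s m. \<bar>Re s\<bar> \<le> 1/2 \<Longrightarrow> Im s \<noteq> 0 \<Longrightarrow> norm (Gamma (s - of_nat m)) \<le> C * 2 ^ m / (fact m * (Im s)\<^sup>2)"
proof -
  obtain C :: real where C: "C > 0" "\<And>x. x \<in> {1..3} \<Longrightarrow> Gamma x \<le> C"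
    using Gamma_real_bounded[of 1] by (metis zero_less_one)
  show ?thesis
  proof (rule that[OF C(1)])
    fix s :: complex and m :: nat assume s: "\<bar>Re s\<bar> \<le> 1/2" "Im s \<noteq> 0"
    have "fact m / 2 ^ m * (Im s)\<^sup>2 * norm (Gamma (s - of_nat m)) \<le> C"
    proof -
      have g: "Gamma (s - of_nat m + 1) = (s - of_nat m) * Gamma (s - of_nat m)" for m
        using s(2) by (intro Gamma_plus1 nonpos_Ints_Im) simp
      have 0: "fact m / 2 ^ m * norm (Gamma (s - of_nat m)) \<le> norm (Gamma s)"
      proof (induction m)
        case (Suc m)
        have "\<bar>Re (s - of_nat (Suc m))\<bar> \<le> norm (s - of_nat (Suc m))" by (rule abs_Re_le_cmod)
        moreover have "\<bar>Re (s - of_nat (Suc m))\<bar> \<ge> real (Suc m) / 2" using s(1) by simp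
        ultimately have n: "real (Suc m) / 2 \<le> norm (s - of_nat (Suc m))" by linarith
        have "fact (Suc m) / 2 ^ Suc m * norm (Gamma (s - of_nat (Suc m)))
           = fact m / 2 ^ m * (real (Suc m) / 2 * norm (Gamma (s - of_nat (Suc m))))"
          by (simp add: field_simps)
        also have "\<dots> \<le> fact m / 2 ^ m * (norm (s - of_nat (Suc m)) * norm (Gamma (s - of_nat (Suc m))))"
          by (intro mult_left_mono mult_right_mono n) auto
        also have "norm (s - of_nat (Suc m)) * norm (Gamma (s - of_nat (Suc m))) = norm (Gamma (s - of_nat m))"
          using g[of "Suc m"] by (simp add: norm_mult[symmetric])
        finally show ?case using Suc by linarith
      qed simp
      have "norm (Gamma s) * (norm s * norm (s + 1)) = norm (Gamma (s + 1 + 1))"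
        using Gamma_plus1[OF nonpos_Ints_Im[of s]] Gamma_plus1[OF nonpos_Ints_Im[of "s + 1"]] s(2)
        by (simp add: norm_mult mult_ac del: one_add_one)
      also have "\<dots> \<le> Gamma (Re (s + 1 + 1))" using s(1) by (intro norm_Gamma_le_Gamma_Re) auto
      also have "\<dots> \<le> C" using s(1) by (intro C(2)) auto
      finally have 1: "norm (Gamma s) * (norm s * norm (s + 1)) \<le> C" .
      have "\<bar>Im s\<bar> * \<bar>Im s\<bar> \<le> norm s * norm (s + 1)"
        using abs_Im_le_cmod[of s] abs_Im_le_cmod[of "s + 1"] by (intro mult_mono) auto
      then have "norm (Gamma s) * (Im s)\<^sup>2 \<le> norm (Gamma s) * (norm s * norm (s + 1))"
        by (intro mult_left_mono) (auto simp: power2_eq_square abs_mult)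
      with 1 have "norm (Gamma s) * (Im s)\<^sup>2 \<le> C" by linarith
      moreover have "fact m / 2 ^ m * norm (Gamma (s - of_nat m)) * (Im s)\<^sup>2 \<le> norm (Gamma s) * (Im s)\<^sup>2"
        using 0 by (intro mult_right_mono) auto
      ultimately show ?thesis by (simp add: mult_ac)
    qed
    then show "norm (Gamma (s - of_nat m)) \<le> C * 2 ^ m / (fact m * (Im s)\<^sup>2)"
      using s(2) by (simp add: field_simps)
  qed
qed

text \<open>Cauchy's inequality on a circle of radius \<open>r\<close>. The bounds r \<le> 1/2 and r
  \<le> \<delta>/2 keep the circle in the strip of the preceding estimate and at height at least
  |y|/2; halving the height costs the factor 4, Cauchy's inequality the factor 1/r.\<close>

lemma norm_deriv_Gamma_shift_le:
  assumes "\<delta> > 0"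
  obtains C where "C > 0"
    "\<And>y m. \<bar>y\<bar> \<ge> \<delta> \<Longrightarrow> norm (Gamma (\<i> * of_real y - of_nat m)) \<le> C * 2 ^ m / (fact m * y\<^sup>2)"
    "\<And>y m. \<bar>y\<bar> \<ge> \<delta> \<Longrightarrow> norm (deriv Gamma (\<i> * of_real y - of_nat m)) \<le> C * 2 ^ m / (fact m * y\<^sup>2)"
proof -
  obtain C where C: "C > 0"
    "\<And>s m. \<bar>Re s\<bar> \<le> 1/2 \<Longrightarrow> Im s \<noteq> 0 \<Longrightarrow> norm (Gamma (s - of_nat m)) \<le> C * 2 ^ m / (fact m * (Im s)\<^sup>2)"
    using norm_Gamma_shift_le by metis
  define r where "r = min (1/2) (\<delta> / 2)"
  have r: "r > 0" "r \<le> 1/2" "r \<le> \<delta> / 2" using assms by (auto simp: r_def)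
  define C' where "C' = C + 4 * C / r"
  have C': "C' > 0" "C' \<ge> C" "C' \<ge> 4 * C / r" using C(1) r by (auto simp: C'_def add_pos_pos)
  show ?thesis
  proof (rule that[OF C'(1)])
    fix y :: real and m :: nat assume y: "\<bar>y\<bar> \<ge> \<delta>"
    then have y0: "y \<noteq> 0" using assms by auto
    have "norm (Gamma (\<i> * of_real y - of_nat m)) \<le> C * 2 ^ m / (fact m * y\<^sup>2)"
      using C(2)[of "\<i> * of_real y" m] y0 by simp
    also have "\<dots> \<le> C' * 2 ^ m / (fact m * y\<^sup>2)"
      using C'(2) by (intro divide_right_mono mult_right_mono) auto
    finally show "norm (Gamma (\<i> * of_real y - of_nat m)) \<le> C' * 2 ^ m / (fact m * y\<^sup>2)" .
    define w where "w = \<i> * of_real y - of_nat m"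
    have im: "\<bar>Im z\<bar> \<ge> \<bar>y\<bar> / 2" "\<bar>Re (z + of_nat m)\<bar> \<le> 1/2" if "norm (w - z) \<le> r" for z
    proof -
      have "\<bar>Im (w - z)\<bar> \<le> r" "\<bar>Re (w - z)\<bar> \<le> r" using that abs_Im_le_cmod abs_Re_le_cmod order_trans by blast+
      then have "\<bar>y - Im z\<bar> \<le> r" "\<bar>Re z + real m\<bar> \<le> r" by (auto simp: w_def)
      then show "\<bar>Im z\<bar> \<ge> \<bar>y\<bar> / 2" "\<bar>Re (z + of_nat m)\<bar> \<le> 1/2" using r y by auto
    qed
    have nz: "Im z \<noteq> 0" if "norm (w - z) \<le> r" for z
      using im(1)[OF that] y0 by auto
    have "norm ((deriv ^^ 1) Gamma w) \<le> fact 1 * (4 * C * 2 ^ m / (fact m * y\<^sup>2)) / r ^ 1"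
    proof (rule Cauchy_inequality)
      show "Gamma holomorphic_on ball w r"
        using nz by (intro holomorphic_Gamma) (force simp: dist_norm dest: nonpos_Ints_Im)
      show "continuous_on (cball w r) Gamma"
        using nz by (intro continuous_on_Gamma) (force simp: dist_norm dest: nonpos_Ints_Im)
      fix z assume "norm (w - z) = r"
      then have z: "norm (w - z) \<le> r" by simp
      have "norm (Gamma ((z + of_nat m) - of_nat m)) \<le> C * 2 ^ m / (fact m * (Im (z + of_nat m))\<^sup>2)"
        using im[OF z] nz[OF z] by (intro C(2)) auto
      also have "\<dots> \<le> C * 2 ^ m / (fact m * (y / 2)\<^sup>2)"
      proof (intro divide_left_mono mult_left_mono mult_pos_pos)
        have "\<bar>y / 2\<bar> \<le> \<bar>Im (z + of_nat m)\<bar>" using im(1)[OF z] by simp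
        then show "(y / 2)\<^sup>2 \<le> (Im (z + of_nat m))\<^sup>2" using abs_le_square_iff by blast
      qed (use C y0 nz[OF z] in auto)
      finally show "norm (Gamma z) \<le> 4 * C * 2 ^ m / (fact m * y\<^sup>2)" by (simp add: power_divide mult_ac)
    qed (use r in auto)
    also have "\<dots> = 4 * C / r * 2 ^ m / (fact m * y\<^sup>2)" by simp
    also have "\<dots> \<le> C' * 2 ^ m / (fact m * y\<^sup>2)"
      using C'(3) by (intro divide_right_mono mult_right_mono) auto
    finally show "norm (deriv Gamma (\<i> * of_real y - of_nat m)) \<le> C' * 2 ^ m / (fact m * y\<^sup>2)"
      by (simp add: w_def)
  qed
qed

section \<open>Summable majorants over the integers and truncated Gamma integrals\<close>

lemma summable_on_int_abs:
  fixes f :: "nat \<Rightarrow> real"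
  assumes "summable f" "\<And>n. f n \<ge> 0"
  shows "(\<lambda>k::int. f (nat \<bar>k\<bar>)) summable_on UNIV"
proof -
  have f: "f summable_on UNIV" using assms by (simp add: summable_on_UNIV_nonneg_real_iff)
  have "(\<lambda>k::int. f (nat \<bar>k\<bar>)) summable_on (int ` UNIV)"
    by (subst summable_on_reindex) (use f in \<open>auto simp: o_def\<close>)
  moreover have "(\<lambda>k::int. f (nat \<bar>k\<bar>)) summable_on ((\<lambda>n. - int n) ` UNIV)"
    by (subst summable_on_reindex) (use f in \<open>auto simp: o_def inj_def\<close>)
  ultimately have "(\<lambda>k::int. f (nat \<bar>k\<bar>)) summable_on (int ` UNIV \<union> (\<lambda>n. - int n) ` UNIV)"
    by (rule summable_on_union)
  moreover have "int ` UNIV \<union> (\<lambda>n. - int n) ` UNIV = UNIV"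
  proof -
    have "k \<in> int ` UNIV \<union> (\<lambda>n. - int n) ` UNIV" for k by (cases k rule: int_cases2) auto
    then show ?thesis by auto
  qed
  ultimately show ?thesis by simp
qed

lemma summable_on_int_inverse_square: "(\<lambda>k::int. c / (real_of_int k)\<^sup>2) summable_on UNIV"
proof -
  have "summable (\<lambda>n. 1 / (real n)\<^sup>2)" using inverse_power_summable[of 2, where 'a=real] by (simp add: inverse_eq_divide)
  from summable_on_int_abs[OF this] have "(\<lambda>k::int. 1 / (real_of_int k)\<^sup>2) summable_on UNIV" by simp
  from summable_on_cmult_right[OF this, of c] show ?thesis by simp
qed

lemma summable_on_int_exp:
  assumes "L > 0"
  shows "(\<lambda>k::int. c * exp (- L * \<bar>real_of_int k\<bar>)) summable_on UNIV"
proof -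
  have "summable (\<lambda>n. exp (- L) ^ n)" using assms by (intro summable_geometric) auto
  from summable_on_int_abs[OF this] have "(\<lambda>k::int. exp (- L) ^ nat \<bar>k\<bar>) summable_on UNIV" by simp
  moreover have "exp (- L) ^ nat \<bar>k\<bar> = exp (- L * \<bar>real_of_int k\<bar>)" for k :: int
    by (simp add: exp_of_nat_mult[symmetric] mult.commute)
  ultimately show ?thesis by (simp add: summable_on_cmult_right)
qed

lemma power_le_fact_exp:
  fixes y :: real
  assumes "y \<ge> 0"
  shows "y ^ n \<le> fact n * exp y"
proof -
  have "(\<Sum>k\<in>{n}. inverse (fact k) * y ^ k) \<le> (\<Sum>k. inverse (fact k) * y ^ k)"
    using assms by (intro sum_le_suminf summable_exp) auto
  then show ?thesis by (simp add: exp_def field_simps)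
qed

text \<open>Dominated convergence with the Gamma integrand itself as majorant. The moving limits
  will be those of the substitution y = x e^(L t) on [-N, N].\<close>

lemma tendsto_integral_Gamma:
  assumes "Re s > 0" "filterlim a (at_right 0) sequentially" "filterlim b at_top sequentially"
  shows "(\<lambda>N. integral {a N..b N} (\<lambda>y. complex_of_real y powr (s - 1) / of_real (exp y))) \<longlonglongrightarrow> Gamma s"
proof -
  define G where "G y = complex_of_real y powr (s - 1) / of_real (exp y)" for y
  have ai: "G absolutely_integrable_on {0<..}"
    unfolding G_def by (rule absolutely_integrable_Gamma_integral'[OF assms(1)])
  have Gc: "continuous_on {0<..} G"
    unfolding G_def by (intro continuous_intros) auto
  define f where "f N y = (if y \<in> {a N..b N} then G y else 0)" for N y
  have apos: "\<forall>\<^sub>F N in sequentially. a N > 0"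
    using assms(2) by (auto simp: filterlim_at elim: eventually_mono)
  \<comment> \<open>\<open>a N > 0\<close> holds only eventually; shifting the sequence by
    \<open>N0\<close> keeps every interval inside the positive half-line.\<close>
  then obtain N0 where N0: "\<And>N. N \<ge> N0 \<Longrightarrow> a N > 0" by (auto simp: eventually_sequentially)
  have fi: "integral {0<..} (f (N + N0)) = integral {a (N + N0)..b (N + N0)} G" "f (N + N0) integrable_on {0<..}" for N
  proof -
    have sub: "{a (N + N0)..b (N + N0)} \<subseteq> {0<..}" using N0[of "N + N0"] by auto
    then have "{a (N + N0)..b (N + N0)} \<inter> {0<..} = {a (N + N0)..b (N + N0)}" by auto
    moreover have "G integrable_on {a (N + N0)..b (N + N0)}"
      by (intro integrable_continuous_real continuous_on_subset[OF Gc sub])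
    ultimately show "integral {0<..} (f (N + N0)) = integral {a (N + N0)..b (N + N0)} G" "f (N + N0) integrable_on {0<..}"
      unfolding f_def integral_restrict_Int integrable_restrict_Int by auto
  qed
  have "(\<lambda>N. integral {0<..} (f (N + N0))) \<longlonglongrightarrow> integral {0<..} G"
  proof (rule dominated_convergence(2)[where h = "\<lambda>y. norm (G y)"])
    show "(\<lambda>y. norm (G y)) integrable_on {0<..}" using ai by (simp add: absolutely_integrable_on_def)
    show "norm (f (N + N0) x) \<le> norm (G x)" for N x by (simp add: f_def)
    show "(\<lambda>N. f (N + N0) x) \<longlonglongrightarrow> G x" if "x \<in> {0<..}" for x
    proof (rule tendsto_eventually)
      have "\<forall>\<^sub>F N in sequentially. a N < x"
        using assms(2) that by (auto simp: filterlim_at intro: order_tendstoD)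
      moreover have "\<forall>\<^sub>F N in sequentially. b N \<ge> x" using assms(3) by (simp add: filterlim_at_top)
      ultimately have "\<forall>\<^sub>F N in sequentially. f N x = G x" by eventually_elim (simp add: f_def)
      then show "\<forall>\<^sub>F N in sequentially. f (N + N0) x = G x" by (rule sequentially_offset)
    qed
  qed (rule fi)
  then have "(\<lambda>N. integral {a (N + N0)..b (N + N0)} G) \<longlonglongrightarrow> Gamma s"
    unfolding fi G_def using Gamma_integral_complex'[OF assms(1)] by (simp add: has_integral_iff)
  then show ?thesis unfolding G_def by (rule LIMSEQ_offset)
qed

lemma cos_ge_half: "\<bar>x\<bar> \<le> pi / 3 \<Longrightarrow> cos x \<ge> 1 / 2"
  using cos_monotone_0_pi_le[of "\<bar>x\<bar>" "pi / 3"] by (simp add: cos_60)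

text \<open>\<open>Y\<close> will be x e^(L (Re v + n)), so a bound by \<open>Y\<close> decays as n
  tends to minus infinity and a bound by \<open>1 / Y\<close> as n tends to infinity. For Y \<le> 1
  it is used that Y^a \<le> Y, beyond that Y^a \<le> Y^2. The constant 48 is 3! 2^3, from Y^3 \<le>
  3! 2^3 e^(Y/2).\<close>

lemma bilateral_integrand_bound:
  fixes a Y :: real
  assumes "1 < a" "a < 2" "Y > 0" "c \<ge> 1 / 2"
  shows "exp (a * ln Y - Y * c) \<le> 48 * Y" "exp (a * ln Y - Y * c) \<le> 48 / Y"
proof -
  have e: "Y ^ n \<le> fact n * 2 ^ n * exp (Y / 2)" for n
    using power_le_fact_exp[of "Y / 2" n] assms(3) by (simp add: power_divide field_simps)
  have "exp (a * ln Y - Y * c) \<le> 48 * Y \<and> exp (a * ln Y - Y * c) \<le> 48 / Y"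
  proof (cases "Y \<le> 1")
    case True
    have "a * ln Y \<le> 1 * ln Y" using assms True by (intro mult_right_mono_neg) auto
    moreover have "Y * c \<ge> 0" using assms by simp
    ultimately have "exp (a * ln Y - Y * c) \<le> exp (ln Y)" by simp
    then have 1: "exp (a * ln Y - Y * c) \<le> Y" using assms by simp
    moreover have "Y \<le> 1 / Y" using True assms(3) by (simp add: field_simps mult_le_one)
    moreover have "Y \<le> 48 * Y" "1 / Y \<le> 48 / Y" using assms(3) by (simp_all add: divide_right_mono)
    ultimately show ?thesis by linarith
  next
    case False
    have "a * ln Y \<le> real 2 * ln Y" using assms False by (intro mult_right_mono) auto
    moreover have "Y * c \<ge> Y * (1 / 2)" using assms by (intro mult_left_mono) auto
    ultimately have "exp (a * ln Y - Y * c) \<le> exp (real 2 * ln Y - Y / 2)" by simp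
    also have "\<dots> = Y ^ 2 / exp (Y / 2)" using assms by (simp only: exp_diff exp_of_nat_mult exp_ln)
    finally have 1: "exp (a * ln Y - Y * c) \<le> Y ^ 2 / exp (Y / 2)" .
    have "Y ^ 2 / exp (Y / 2) \<le> 48 / Y" using e[of 3] assms
      by (simp add: field_simps fact_numeral power3_eq_cube power2_eq_square)
    moreover have "48 / Y \<le> 48 * Y"
    proof -
      have "1 * 1 \<le> Y * Y" using False by (intro mult_mono) auto
      then show ?thesis using assms by (simp add: field_simps)
    qed
    ultimately show ?thesis using 1 by linarith
  qed
  then show "exp (a * ln Y - Y * c) \<le> 48 * Y" "exp (a * ln Y - Y * c) \<le> 48 / Y" by auto
qed

section \<open>The exponential sum over the integers\<close>

definition gam_term :: "real \<Rightarrow> real \<Rightarrow> int \<Rightarrow> complex \<Rightarrow> complex" where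
  "gam_term L x k z = Gamma (z + \<i> * of_real (2 * pi / L * of_int k)) *
      exp (- (z + \<i> * of_real (2 * pi / L * of_int k)) * of_real (ln x))"

text \<open>For large |k| the argument has height about 2 \<pi> |k| / L, where Gamma decays like
  1/k^2, while the exponential factor stays bounded as long as Re z does.\<close>

lemma loc_dominated_gam_term:
  assumes "L > 0"
  shows "loc_dominated UNIV (gam_term L x) UNIV"
proof (rule loc_dominatedI)
  fix s :: complex
  define y0 where "y0 = 2 * pi / L"
  have y0: "y0 > 0" using assms by (simp add: y0_def)
  define R where "R = norm s + 1"
  have R: "R \<ge> 1" by (simp add: R_def)
  obtain C where C: "C > 0" "\<And>s. \<bar>Re s\<bar> \<le> R \<Longrightarrow> \<bar>Im s\<bar> \<ge> 1 \<Longrightarrow> norm (Gamma s) \<le> C / (Im s)\<^sup>2"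
    using norm_Gamma_strip_le by metis
  \<comment> \<open>Beyond this threshold the height y0 |k| is at least 2 R, so subtracting |Im z|
    \<le> R leaves at least half of it, and at least 1.\<close>
  define F where "F = {k::int. \<bar>k\<bar> \<le> \<lceil>2 * R / y0\<rceil>}"
  have fin: "finite F" unfolding F_def by (rule finite_subset[of _ "{- \<lceil>2 * R / y0\<rceil>..\<lceil>2 * R / y0\<rceil>}"]) auto
  define c where "c = 4 * C / y0\<^sup>2 * exp (R * \<bar>ln x\<bar>)"
  have "norm (gam_term L x k z) \<le> c / (real_of_int k)\<^sup>2" if k: "k \<in> UNIV - F" and z: "z \<in> cball s 1" for k z
  proof -
    define w where "w = z + \<i> * of_real (y0 * of_int k)"
    have "norm z \<le> R" using z norm_triangle_ineq2[of z s] by (simp add: R_def dist_norm norm_minus_commute)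
    then have reim: "\<bar>Re z\<bar> \<le> R" "\<bar>Im z\<bar> \<le> R" using abs_Re_le_cmod abs_Im_le_cmod order_trans by blast+
    have "\<bar>k\<bar> > \<lceil>2 * R / y0\<rceil>" using k by (simp add: F_def)
    then have "\<bar>real_of_int k\<bar> > 2 * R / y0" by linarith
    then have kk: "y0 * \<bar>real_of_int k\<bar> \<ge> 2 * R" using y0 by (simp add: field_simps)
    have k0: "k \<noteq> 0" using kk R by auto
    have Imw: "Im w = Im z + y0 * of_int k" by (simp add: w_def)
    have absk: "\<bar>y0 * of_int k\<bar> = y0 * \<bar>real_of_int k\<bar>" using y0 by (simp add: abs_mult)
    have im: "\<bar>Im w\<bar> \<ge> y0 * \<bar>of_int k\<bar> / 2" "\<bar>Im w\<bar> \<ge> 1"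
      using reim(2) kk R absk unfolding Imw by linarith+
    have "norm (Gamma w) \<le> C / (Im w)\<^sup>2" using im reim by (intro C(2)) (auto simp: w_def)
    also have "\<dots> \<le> C / (y0 * \<bar>of_int k\<bar> / 2)\<^sup>2"
    proof (intro divide_left_mono mult_pos_pos)
      show "(y0 * \<bar>real_of_int k\<bar> / 2)\<^sup>2 \<le> (Im w)\<^sup>2"
        using im(1) y0 by (subst power2_abs[symmetric, of "Im w"]) (intro power_mono, auto)
    qed (use C(1) y0 k0 im(2) in auto)
    finally have 1: "norm (Gamma w) \<le> 4 * C / y0\<^sup>2 / (real_of_int k)\<^sup>2"
      by (simp add: power_mult_distrib power_divide mult_ac)
    have "norm (exp (- w * of_real (ln x))) = exp (- Re z * ln x)" by (simp add: w_def)
    also have "\<dots> \<le> exp (R * \<bar>ln x\<bar>)"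
    proof -
      have "- Re z * ln x \<le> \<bar>Re z\<bar> * \<bar>ln x\<bar>" by (metis abs_ge_self abs_minus_cancel abs_mult)
      also have "\<dots> \<le> R * \<bar>ln x\<bar>" using reim by (intro mult_right_mono) auto
      finally show ?thesis by simp
    qed
    finally have 2: "norm (exp (- w * of_real (ln x))) \<le> exp (R * \<bar>ln x\<bar>)" .
    have "norm (gam_term L x k z) = norm (Gamma w) * norm (exp (- w * of_real (ln x)))"
      unfolding gam_term_def w_def y0_def norm_mult ..
    also have "\<dots> \<le> 4 * C / y0\<^sup>2 / (real_of_int k)\<^sup>2 * exp (R * \<bar>ln x\<bar>)"
      using C(1) by (intro mult_mono 1 2) auto
    finally show ?thesis by (simp add: c_def)
  qed
  moreover have "(\<lambda>k::int. c / (real_of_int k)\<^sup>2) summable_on UNIV - F"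
    using summable_on_int_inverse_square summable_on_subset_banach by blast
  ultimately show "\<exists>r>0. \<exists>F M. finite F \<and> M summable_on (UNIV - F) \<and>
      (\<forall>k\<in>UNIV - F. \<forall>z\<in>cball s r. norm (gam_term L x k z) \<le> M k)"
    using fin by (intro exI[of _ 1] conjI exI[of _ F] exI[of _ "\<lambda>k. c / (real_of_int k)\<^sup>2"]) auto
qed

lemma holomorphic_gam_term:
  assumes "\<And>z. z \<in> S \<Longrightarrow> z + \<i> * of_real (2 * pi / L * of_int k) \<notin> \<int>\<^sub>\<le>\<^sub>0"
  shows "gam_term L x k holomorphic_on S"
  unfolding gam_term_def by (intro holomorphic_intros) (use assms in auto)

text \<open>Poisson summation for \<open>F\<close>, which is x^a times the summand. In the Fourier
  integral the substitution y = x e^(L t) produces the Gamma integral at a - 2 \<pi> \<i> k / L. The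
  range 1 < a < 2 is that of the elementary bound on the integrand; the identity is continued
  analytically later.\<close>

lemma bilateral_sum:
  fixes a x L :: real
  assumes a: "1 < a" "a < 2" and x: "x > 0" and L: "L > 0"
  shows "(\<Sum>\<^sub>\<infinity>n::int. complex_of_real (exp (a * L * of_int n - x * exp (L * of_int n)))) =
     (\<Sum>\<^sub>\<infinity>k. gam_term L x k (of_real a)) / of_real L"
proof -
  define F where "F v = exp (of_real a * (of_real (ln x) + of_real L * v) - of_real x * exp (of_real L * v))" for v :: complex
  \<comment> \<open>In this strip |L Im v| \<le> \<pi>/3, so the real part of e^(L v) is at least
    half its modulus and the outer exponential still decays.\<close>
  define S where "S = {v. \<bar>Re v\<bar> < 2 \<and> \<bar>Im v\<bar> < pi / (3 * L)}"
  \<comment> \<open>The k-th coefficient has the Gamma argument a - 2 \<pi> \<i> k / L, hence the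
    index \<open>- k\<close>; the sign disappears in the sum over all k.\<close>
  define c where "c k = gam_term L x (- k) (of_real a) * exp (of_real (a * ln x)) / of_real L" for k
  define M where "M n = 48 * (x + 1 / x) * exp (2 * L) * exp (- L * \<bar>real_of_int n\<bar>)" for n :: int
  have "(\<Sum>\<^sub>\<infinity>n. F (of_int n)) = (\<Sum>\<^sub>\<infinity>k. c k)"
  proof (rule Poisson_summation_holomorphic[where S = S and M = M])
    show "open S" unfolding S_def
      by (intro open_Collect_conj open_Collect_less continuous_intros)
    show "complex_of_real ` {0..1} \<subseteq> S" using L by (auto simp: S_def)
    show "F holomorphic_on UNIV" unfolding F_def by (intro holomorphic_intros)
    show "M summable_on UNIV" unfolding M_def by (rule summable_on_int_exp[OF L])
    show "norm (F (v + of_int n)) \<le> M n" if v: "v \<in> S" for n v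
    proof -
      define Y where "Y = x * exp (L * (Re v + of_int n))"
      have Y: "Y > 0" using x by (simp add: Y_def)
      have "\<bar>L * Im v\<bar> \<le> pi / 3"
        using v L by (simp add: S_def abs_mult field_simps)
      then have cos: "cos (L * Im v) \<ge> 1 / 2" by (rule cos_ge_half)
      have "Re (of_real a * (of_real (ln x) + of_real L * (v + of_int n)) - of_real x * exp (of_real L * (v + of_int n)))
         = a * ln Y - Y * cos (L * Im v)"
        using x by (simp add: Y_def ln_mult Re_exp algebra_simps)
      then have nF: "norm (F (v + of_int n)) = exp (a * ln Y - Y * cos (L * Im v))"
        unfolding F_def norm_exp_eq_Re by simp
      have b: "exp (L * Re v) \<le> exp (2 * L)" "exp (- (L * Re v)) \<le> exp (2 * L)"
      proof -
        have "L * (- Re v) \<le> L * 2" using v L by (intro mult_left_mono) (auto simp: S_def)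
        then show "exp (- (L * Re v)) \<le> exp (2 * L)" by simp
      qed (use v L in \<open>auto simp: S_def\<close>)
      show ?thesis
      proof (cases "n \<ge> 0")
        case True
        have "norm (F (v + of_int n)) \<le> 48 / Y" unfolding nF by (rule bilateral_integrand_bound[OF a Y cos])
        also have "\<dots> = 48 * (1 / x) * exp (- (L * Re v)) * exp (- L * \<bar>real_of_int n\<bar>)"
          using True x by (simp add: Y_def exp_minus exp_add distrib_left field_simps)
        also have "\<dots> \<le> M n" unfolding M_def
          using b x by (intro mult_mono) auto
        finally show ?thesis .
      next
        case False
        have "norm (F (v + of_int n)) \<le> 48 * Y" unfolding nF by (rule bilateral_integrand_bound[OF a Y cos])
        also have "\<dots> = 48 * x * exp (L * Re v) * exp (- L * \<bar>real_of_int n\<bar>)"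
          using False x by (simp add: Y_def exp_minus exp_add distrib_left field_simps)
        also have "\<dots> \<le> M n" unfolding M_def
          using b x by (intro mult_mono) auto
        finally show ?thesis .
      qed
    qed
    have "(\<lambda>k. norm (gam_term L x k (of_real a))) summable_on UNIV"
    proof -
      have S: "open {z::complex. Re z > 0}" by (simp add: open_halfspace_Re_gt)
      have h: "gam_term L x k holomorphic_on {z. Re z > 0}" for k
        by (rule holomorphic_gam_term) (auto elim!: nonpos_Ints_cases simp: complex_eq_iff)
      have d: "loc_dominated UNIV (gam_term L x) {z. Re z > 0}"
        using loc_dominated_gam_term[OF L] unfolding loc_dominated_def by blast
      show ?thesis by (rule abs_summable_loc_dominated[OF S h d]) (use a in auto)
    qed
    then have "(\<lambda>k. gam_term L x k (of_real a)) summable_on UNIV" by (rule abs_summable_summable)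
    then have "(\<lambda>k. gam_term L x (- k) (of_real a)) summable_on UNIV"
      using summable_on_reindex_bij_betw[of uminus "UNIV::int set" UNIV "\<lambda>k. gam_term L x k (of_real a)"]
      by (simp add: bij_uminus)
    then show "c summable_on UNIV"
      unfolding c_def divide_inverse by (intro summable_on_cmult_left)
    show "(\<lambda>N. integral {- real N..real N} (\<lambda>t. F (of_real t) * cis (- (2 * pi * of_int k * t)))) \<longlonglongrightarrow> c k" for k
    proof -
      define s where "s = of_real a - \<i> * of_real (2 * pi / L * of_int k)"
      have s: "Re s > 0" using a by (simp add: s_def)
      define f where "f y = complex_of_real y powr (s - 1) / of_real (exp y)" for y
      define g where "g t = x * exp (L * t)" for t
      have fg: "(L * g t) *\<^sub>R f (g t) = of_real L * exp (- \<i> * of_real (2 * pi / L * of_int k * ln x)) *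
          (F (of_real t) * cis (- (2 * pi * of_int k * t)))" for t
      proof -
        have g0: "g t > 0" using x by (simp add: g_def)
        have "of_real (g t) * f (g t) = complex_of_real (g t) powr s * exp (- of_real (g t))"
        proof -
          have "complex_of_real (g t) powr s = complex_of_real (g t) powr (s - 1) * complex_of_real (g t)"
            using g0 powr_add[of "complex_of_real (g t)" "s - 1" 1] by simp
          then show ?thesis by (simp add: f_def exp_minus exp_of_real[symmetric] divide_inverse)
        qed
        also have "\<dots> = exp (s * (of_real (ln x) + of_real L * of_real t) - of_real (g t))"
        proof -
          have "ln (g t) = ln x + L * t" using x by (simp add: g_def ln_mult)
          then show ?thesis using g0
            by (simp add: powr_def Ln_of_real mult_exp_exp)
        qed
        also have "\<dots> = exp (- \<i> * of_real (2 * pi / L * of_int k * ln x)) *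
          (F (of_real t) * cis (- (2 * pi * of_int k * t)))"
          unfolding F_def cis_conv_exp mult_exp_exp s_def g_def
          using L by (intro arg_cong[of _ _ exp]) (simp add: field_simps exp_of_real[symmetric])
        finally show ?thesis by (simp add: scaleR_conv_of_real)
      qed
      have int: "integral {- real N..real N} (\<lambda>t. F (of_real t) * cis (- (2 * pi * of_int k * t))) =
         exp (\<i> * of_real (2 * pi / L * of_int k * ln x)) / of_real L * integral {g (- real N)..g (real N)} f" for N
      proof -
        have mono: "g t \<le> g t'" if "t \<le> t'" for t t' using that x L by (simp add: g_def)
        have "((\<lambda>t. (L * g t) *\<^sub>R f (g t)) has_integral (integral {g (- real N)..g (real N)} f)) {- real N..real N}"
        proof (rule has_integral_substitution)
          show "g ` {- real N..real N} \<subseteq> {g (- real N)..g (real N)}" using mono by auto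
          have "g (- real N) > 0" using x by (simp add: g_def)
          then show "continuous_on {g (- real N)..g (real N)} f"
            unfolding f_def by (intro continuous_intros) auto
          show "(g has_field_derivative L * g t) (at t within {- real N..real N})" for t
            unfolding g_def by (auto intro!: derivative_eq_intros)
        qed (auto intro: mono)
        then have "((\<lambda>t. exp (\<i> * of_real (2 * pi / L * of_int k * ln x)) / of_real L * ((L * g t) *\<^sub>R f (g t))) has_integral
          (exp (\<i> * of_real (2 * pi / L * of_int k * ln x)) / of_real L * (integral {g (- real N)..g (real N)} f))) {- real N..real N}"
          by (rule has_integral_mult_right)
        moreover have "exp (\<i> * of_real (2 * pi / L * of_int k * ln x)) / of_real L * ((L * g t) *\<^sub>R f (g t))
            = F (of_real t) * cis (- (2 * pi * of_int k * t))" for t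
          unfolding fg using L by (simp add: exp_minus)
        ultimately show ?thesis by (simp add: has_integral_iff)
      qed
      have "(\<lambda>N. integral {g (- real N)..g (real N)} f) \<longlonglongrightarrow> Gamma s"
        unfolding f_def g_def using x L
        by (intro tendsto_integral_Gamma s) real_asymp+
      then have "(\<lambda>N. exp (\<i> * of_real (2 * pi / L * of_int k * ln x)) / of_real L * integral {g (- real N)..g (real N)} f)
         \<longlonglongrightarrow> exp (\<i> * of_real (2 * pi / L * of_int k * ln x)) / of_real L * Gamma s"
        by (intro tendsto_intros)
      moreover have "exp (\<i> * of_real (2 * pi / L * of_int k * ln x)) / of_real L * Gamma s = c k"
      proof -
        have "exp (- s * of_real (ln x)) * exp (of_real (a * ln x)) = exp (\<i> * of_real (2 * pi / L * of_int k * ln x))"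
          unfolding s_def mult_exp_exp by (intro arg_cong[of _ _ exp]) (simp add: algebra_simps)
        then show ?thesis
          unfolding c_def gam_term_def s_def by (simp add: mult_ac)
      qed
      ultimately show ?thesis unfolding int by simp
    qed
  qed
  also have "\<dots> = (\<Sum>\<^sub>\<infinity>k. gam_term L x k (of_real a)) * (exp (of_real (a * ln x)) / of_real L)"
  proof -
    have "(\<Sum>\<^sub>\<infinity>k. c k) = (\<Sum>\<^sub>\<infinity>k. gam_term L x (- k) (of_real a) * (exp (of_real (a * ln x)) / of_real L))"
      unfolding c_def by simp
    also have "\<dots> = (\<Sum>\<^sub>\<infinity>k. gam_term L x (- k) (of_real a)) * (exp (of_real (a * ln x)) / of_real L)"
      by (rule infsum_cmult_left')
    also have "(\<Sum>\<^sub>\<infinity>k. gam_term L x (- k) (of_real a)) = (\<Sum>\<^sub>\<infinity>k. gam_term L x k (of_real a))"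
      by (rule infsum_reindex_bij_witness[of _ uminus uminus]) auto
    finally show ?thesis .
  qed
  finally have A: "(\<Sum>\<^sub>\<infinity>n. F (of_int n)) = (\<Sum>\<^sub>\<infinity>k. gam_term L x k (of_real a)) * (exp (of_real (a * ln x)) / of_real L)" .
  have "F (of_int n) = exp (of_real (a * ln x)) * complex_of_real (exp (a * L * of_int n - x * exp (L * of_int n)))" for n
    unfolding F_def exp_of_real[symmetric] mult_exp_exp
    by (intro arg_cong[of _ _ exp]) (simp add: algebra_simps exp_of_real[symmetric])
  then have "(\<Sum>\<^sub>\<infinity>n. F (of_int n)) = exp (of_real (a * ln x)) * (\<Sum>\<^sub>\<infinity>n::int. complex_of_real (exp (a * L * of_int n - x * exp (L * of_int n))))"
    by (simp add: infsum_cmult_right')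
  with A have "exp (of_real (a * ln x)) * (\<Sum>\<^sub>\<infinity>n::int. complex_of_real (exp (a * L * of_int n - x * exp (L * of_int n))))
     = exp (of_real (a * ln x)) * ((\<Sum>\<^sub>\<infinity>k. gam_term L x k (of_real a)) / of_real L)"
    by (simp only: mult_ac times_divide_eq_right)
  then show ?thesis by (rule mult_left_cancel[THEN iffD1, rotated]) simp
qed

section \<open>Second order Taylor expansions and residues\<close>

text \<open>A germ at a possibly removable singularity: stated through Laurent expansions, it does
  not see the value at 0, which for functions such as \<open>w * Gamma (w - of_nat m)\<close> is not
  the limit.\<close>

definition taylor2 :: "(complex \<Rightarrow> complex) \<Rightarrow> complex \<Rightarrow> complex \<Rightarrow> complex \<Rightarrow> bool" where
  "taylor2 f c0 c1 c2 \<longleftrightarrow> (\<exists>F. f has_laurent_expansion fps_to_fls F \<and>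
     fps_nth F 0 = c0 \<and> fps_nth F 1 = c1 \<and> fps_nth F 2 = c2)"

lemma taylor2_cong:
  assumes "taylor2 f c0 c1 c2" "eventually (\<lambda>w. f w = g w) (at 0)" "c0 = d0" "c1 = d1" "c2 = d2"
  shows "taylor2 g d0 d1 d2"
  using assms has_laurent_expansion_cong[OF assms(2) refl] unfolding taylor2_def by blast

lemma taylor2_fps:
  assumes "f has_fps_expansion F"
  shows "taylor2 f (fps_nth F 0) (fps_nth F 1) (fps_nth F 2)"
  using has_laurent_expansion_fps[OF assms] unfolding taylor2_def by blast

lemma taylor2_analytic:
  assumes "f analytic_on {0}"
  shows "taylor2 f (f 0) (deriv f 0) (deriv (deriv f) 0 / 2)"
  using taylor2_fps[OF analytic_at_imp_has_fps_expansion_0[OF assms]]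
  by (simp add: fps_expansion_def fact_numeral numeral_2_eq_2)

lemma taylor2_divide_ident:
  assumes "f has_fps_expansion F" "fps_nth F 0 = 0"
  shows "taylor2 (\<lambda>w. f w / w) (fps_nth F 1) (fps_nth F 2) (fps_nth F 3)"
proof -
  have "(\<lambda>w. f w * w powi (- 1)) has_laurent_expansion fls_shift 1 (fps_to_fls F)"
    by (intro has_laurent_expansion_shift' has_laurent_expansion_fps assms)
  moreover have "fls_shift 1 (fps_to_fls F) = fps_to_fls (fps_shift 1 F)"
  proof (rule fls_eqI)
    fix n :: int
    show "fls_nth (fls_shift 1 (fps_to_fls F)) n = fls_nth (fps_to_fls (fps_shift 1 F)) n"
    proof (cases "n < 0")
      case True
      then consider "n = -1" | "n + 1 < 0" by linarith
      then show ?thesis using assms(2) by cases auto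
    next
      case False
      then have "nat (n + 1) = Suc (nat n)" by simp
      then show ?thesis using False by simp
    qed
  qed
  ultimately show ?thesis unfolding taylor2_def
    by (intro exI[of _ "fps_shift 1 F"]) (simp add: power_int_minus divide_inverse eval_nat_numeral)
qed

lemma taylor2_mult:
  assumes "taylor2 f a0 a1 a2" "taylor2 g b0 b1 b2"
  shows "taylor2 (\<lambda>w. f w * g w) (a0 * b0) (a0 * b1 + a1 * b0) (a0 * b2 + a1 * b1 + a2 * b0)"
proof -
  obtain F G where F: "f has_laurent_expansion fps_to_fls F" "fps_nth F 0 = a0" "fps_nth F 1 = a1" "fps_nth F 2 = a2"
    and G: "g has_laurent_expansion fps_to_fls G" "fps_nth G 0 = b0" "fps_nth G 1 = b1" "fps_nth G 2 = b2"
    using assms unfolding taylor2_def by blast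
  have "(\<lambda>w. f w * g w) has_laurent_expansion fps_to_fls (F * G)"
    using has_laurent_expansion_mult[OF F(1) G(1)] by (simp add: fls_times_fps_to_fls)
  then show ?thesis unfolding taylor2_def
    using F G by (intro exI[of _ "F * G"]) (simp add: fps_mult_nth numeral_2_eq_2)
qed

lemma taylor2_cmult:
  assumes "taylor2 f a0 a1 a2"
  shows "taylor2 (\<lambda>w. c * f w) (c * a0) (c * a1) (c * a2)"
proof -
  have "taylor2 (\<lambda>w. c) c 0 0" using taylor2_analytic[of "\<lambda>w. c"] by simp
  from taylor2_mult[OF this assms] show ?thesis by simp
qed

lemma taylor2_add:
  assumes "taylor2 f a0 a1 a2" "taylor2 g b0 b1 b2"
  shows "taylor2 (\<lambda>w. f w + g w) (a0 + b0) (a1 + b1) (a2 + b2)"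
proof -
  obtain F G where F: "f has_laurent_expansion fps_to_fls F" "fps_nth F 0 = a0" "fps_nth F 1 = a1" "fps_nth F 2 = a2"
    and G: "g has_laurent_expansion fps_to_fls G" "fps_nth G 0 = b0" "fps_nth G 1 = b1" "fps_nth G 2 = b2"
    using assms unfolding taylor2_def by blast
  have "(\<lambda>w. f w + g w) has_laurent_expansion fps_to_fls (F + G)"
    using has_laurent_expansion_add[OF F(1) G(1)] by (simp add: fps_to_fls_plus)
  then show ?thesis unfolding taylor2_def
    using F G by (intro exI[of _ "F + G"]) simp
qed

lemma taylor2_inverse:
  assumes "taylor2 f a0 a1 a2" "a0 \<noteq> 0"
  shows "taylor2 (\<lambda>w. inverse (f w)) (1 / a0) (- a1 / a0 ^ 2) (a1 ^ 2 / a0 ^ 3 - a2 / a0 ^ 2)"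
proof -
  obtain F where F: "f has_laurent_expansion fps_to_fls F" "fps_nth F 0 = a0" "fps_nth F 1 = a1" "fps_nth F 2 = a2"
    using assms unfolding taylor2_def by blast
  have "(\<lambda>w. if w = 0 then fps_nth F 0 else f w) has_fps_expansion F"
    by (rule has_fps_expansion_fps_to_fls[OF F(1)])
  then have "(\<lambda>w. inverse (if w = 0 then fps_nth F 0 else f w)) has_fps_expansion inverse F"
    using F assms by (intro has_fps_expansion_inverse) auto
  from taylor2_fps[OF this] have t: "taylor2 (\<lambda>w. inverse (if w = 0 then fps_nth F 0 else f w))
     (fps_nth (inverse F) 0) (fps_nth (inverse F) 1) (fps_nth (inverse F) 2)" .
  define G where "G = inverse F"
  have FG: "F * G = 1" using F assms by (simp add: G_def inverse_mult_eq_1' )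
  have g0: "fps_nth G 0 = 1 / a0" using F by (simp add: G_def inverse_eq_divide)
  have "fps_nth (F * G) 1 = 0" "fps_nth (F * G) 2 = 0" by (simp_all add: FG)
  then have "a0 * fps_nth G 1 + a1 * (1 / a0) = 0" "a0 * fps_nth G 2 + a1 * fps_nth G 1 + a2 * (1 / a0) = 0"
    using F g0 by (simp_all add: fps_mult_nth numeral_2_eq_2 add_ac)
  then have "a0 * fps_nth G 1 = - (a1 * (1 / a0))" and g2: "a0 * fps_nth G 2 = - a1 * fps_nth G 1 - a2 * (1 / a0)"
    by (simp_all add: add_eq_0_iff algebra_simps) (metis add.commute add_diff_cancel_right' diff_0 diff_diff_eq2 minus_add_distrib uminus_add_conv_diff)
  then have g1: "fps_nth G 1 = - a1 / a0 ^ 2" using assms(2) by (simp add: field_simps power2_eq_square)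
  have "- a1 * (- a1 / a0 ^ 2) - a2 * (1 / a0) = a0 * (a1 ^ 2 / a0 ^ 3 - a2 / a0 ^ 2)"
    using assms(2) by (simp add: field_simps power2_eq_square power3_eq_cube)
  then have "a0 * fps_nth G 2 = a0 * (a1 ^ 2 / a0 ^ 3 - a2 / a0 ^ 2)"
    unfolding g2 g1 .
  then have "fps_nth G 2 = a1 ^ 2 / a0 ^ 3 - a2 / a0 ^ 2"
    using assms(2) by (rule mult_left_cancel[THEN iffD1, rotated])
  then show ?thesis using t g0 g1 unfolding G_def[symmetric]
    by (elim taylor2_cong) (auto simp: eventually_at_filter)
qed

lemma taylor2_exp: "taylor2 (\<lambda>w. exp (c * w)) 1 c (c ^ 2 / 2)"
  using taylor2_fps[OF has_fps_expansion_exp[of c]] by (simp add: fact_numeral numeral_2_eq_2)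

text \<open>Division by \<open>w\<close> of an expansion without constant term. It serves the
  difference of two terms whose poles cancel, where \<open>c2\<close> becomes a derivative.\<close>

lemma taylor2_quotient_analytic:
  assumes "taylor2 f 0 c1 c2"
  obtains R where "R analytic_on {0}" "R 0 = c1" "deriv R 0 = c2" "eventually (\<lambda>w. f w / w = R w) (at 0)"
proof -
  obtain F where F: "f has_laurent_expansion fps_to_fls F" "fps_nth F 0 = 0" "fps_nth F 1 = c1" "fps_nth F 2 = c2"
    using assms unfolding taylor2_def by blast
  have f: "(\<lambda>w. if w = 0 then fps_nth F 0 else f w) has_fps_expansion F"
    by (rule has_fps_expansion_fps_to_fls[OF F(1)])
  define G where "G = fps_shift 1 F"
  have r: "fps_conv_radius G > 0" using f by (simp add: G_def has_fps_expansion_def)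
  then have G: "eval_fps G has_fps_expansion G" by (rule eval_fps_has_fps_expansion)
  have FG: "F = fps_X * G" unfolding G_def by (rule fps_ext) (use F(2) in \<open>simp\<close>)
  have e: "eventually (\<lambda>w. eval_fps F w = (if w = 0 then fps_nth F 0 else f w)) (at 0)"
    using f by (auto simp: has_fps_expansion_def eventually_at_filter elim: eventually_mono)
  show ?thesis
  proof (rule that[of "eval_fps G"])
    show "eval_fps G analytic_on {0}" using G by (rule has_fps_expansion_imp_analytic_0)
    show "eval_fps G 0 = c1" using F by (simp add: eval_fps_at_0 G_def)
    have "fps_nth G 1 = (deriv ^^ 1) (eval_fps G) 0 / fact 1" using fps_nth_fps_expansion[OF G] by blast
    then show "deriv (eval_fps G) 0 = c2" using F by (simp add: G_def numeral_2_eq_2)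
    have "eventually (\<lambda>w. w \<in> eball 0 (fps_conv_radius G) - {0}) (at 0)"
      using r by (intro eventually_at_in_open) (auto simp: zero_ereal_def)
    then show "\<forall>\<^sub>F w in at 0. f w / w = eval_fps G w"
      using e
    proof eventually_elim
      case (elim w)
      have "eval_fps F w = w * eval_fps G w" unfolding FG using elim
        by (subst eval_fps_mult) auto
      then show ?case using elim by auto
    qed
  qed
qed

text \<open>\<open>H\<close> has a pole of order at most three, and multiplication by (s -
  \<alpha>)^p moves the coefficient number 2 - p of \<open>P\<close> into the position of the
  residue.\<close>

lemma residue_taylor2:
  assumes t: "taylor2 P b0 b1 b2" and H: "eventually (\<lambda>w. H (\<alpha> + w) = P w / w ^ 3) (at 0)"
  shows "residue H \<alpha> = b2" "residue (\<lambda>s. (s - \<alpha>) * H s) \<alpha> = b1" "residue (\<lambda>s. (s - \<alpha>) ^ 2 * H s) \<alpha> = b0"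
proof -
  obtain F where F: "P has_laurent_expansion fps_to_fls F" "fps_nth F 0 = b0" "fps_nth F 1 = b1" "fps_nth F 2 = b2"
    using t unfolding taylor2_def by blast
  have *: "residue (\<lambda>s. (s - \<alpha>) ^ p * H s) \<alpha> = fps_nth F (2 - p)" if "p \<le> 2" for p
  proof -
    have "(\<lambda>w. P w * w powi (- int (3 - p))) has_laurent_expansion fls_shift (int (3 - p)) (fps_to_fls F)"
      by (rule has_laurent_expansion_shift'[OF F(1)])
    also have "?this \<longleftrightarrow> (\<lambda>w. (\<alpha> + w - \<alpha>) ^ p * H (\<alpha> + w)) has_laurent_expansion fls_shift (int (3 - p)) (fps_to_fls F)"
    proof (rule has_laurent_expansion_cong)
      have "eventually (\<lambda>w. w \<noteq> 0) (at (0::complex))" by (simp add: eventually_at_filter)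
      with H show "eventually (\<lambda>w. P w * w powi (- int (3 - p)) = (\<alpha> + w - \<alpha>) ^ p * H (\<alpha> + w)) (at 0)"
      proof eventually_elim
        case (elim w)
        have "w ^ p * (P w / w ^ 3) = P w * inverse (w ^ (3 - p))"
          using that elim by (simp add: field_simps flip: power_add)
        moreover have "w powi (- int (3 - p)) = inverse (w ^ (3 - p))"
          by (simp only: power_int_minus power_int_of_nat)
        ultimately show ?case using elim by simp
      qed
    qed simp
    finally have "residue (\<lambda>s. (s - \<alpha>) ^ p * H s) \<alpha> = fls_residue (fls_shift (int (3 - p)) (fps_to_fls F))"
      by (rule has_laurent_expansion_residue)
    also have "\<dots> = fps_nth F (2 - p)"
    proof -
      have "nat (- 1 + int (3 - p)) = 2 - p" "- 1 + int (3 - p) \<ge> 0" using that by auto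
      then show ?thesis by simp
    qed
    finally show ?thesis .
  qed
  show "residue H \<alpha> = b2" "residue (\<lambda>s. (s - \<alpha>) * H s) \<alpha> = b1" "residue (\<lambda>s. (s - \<alpha>) ^ 2 * H s) \<alpha> = b0"
    using *[of 0] *[of 1] *[of 2] F by simp_all
qed

text \<open>For L = 1 this is the Todd function w/(1 - e^(-w)), whose coefficients are the Bernoulli
  numbers 1, 1/2, 1/6 divided by factorials.\<close>

lemma taylor2_Bernoulli:
  assumes "L \<noteq> 0"
  shows "taylor2 (\<lambda>w. w / (1 - exp (- L * w))) (1 / L) (1 / 2) (L / 12)"
proof -
  have "(\<lambda>w. 1 - exp (- L * w)) has_fps_expansion 1 - fps_exp (- L)"
    by (intro fps_expansion_intros)
  from taylor2_divide_ident[OF this] have "taylor2 (\<lambda>w. (1 - exp (- L * w)) / w) L (- (L ^ 2 / 2)) (L ^ 3 / 6)"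
    by (simp add: fact_numeral power3_eq_cube power2_eq_square)
  from taylor2_inverse[OF this assms] show ?thesis
    by (rule taylor2_cong) (use assms in \<open>simp_all add: field_simps power2_eq_square power3_eq_cube\<close>)
qed

text \<open>The kernel is 1/(4 sinh^2 (L w/2)), an even function, so the linear coefficient
  vanishes. With the factor w^2 it is the product of e^(-L w) and two functions of Bernoulli
  type.\<close>

lemma taylor2_sinh_kernel:
  assumes "L \<noteq> 0"
  shows "taylor2 (\<lambda>w. w ^ 2 * (exp (- L * w) / (1 - exp (- L * w)) ^ 2)) (1 / L ^ 2) 0 (- 1 / 12)"
proof -
  note b = taylor2_Bernoulli[OF assms]
  from taylor2_mult[OF taylor2_exp[of "- L"] taylor2_mult[OF b b]]
  show ?thesis
    by (rule taylor2_cong) (use assms in \<open>simp_all add: field_simps power2_eq_square power3_eq_cube\<close>)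
qed

text \<open>The logarithmic derivative of the reciprocal Gamma function is minus Digamma; since the
  argument decreases with w, the first two derivatives carry the factors \<psi> and \<psi>^2 -
  \<psi>'.\<close>

lemma taylor2_rGamma:
  "taylor2 (\<lambda>w. rGamma (of_nat m + 1 - w)) (1 / fact m) (1 / fact m * Digamma (of_nat m + 1))
     (1 / fact m * ((Digamma (of_nat m + 1)) ^ 2 - Polygamma 1 (of_nat m + 1)) / 2)"
proof -
  define g :: "complex \<Rightarrow> complex" where "g = (\<lambda>w. rGamma (of_nat m + 1 - w))"
  have nn: "of_nat m + 1 - w \<notin> \<int>\<^sub>\<le>\<^sub>0" if "w \<in> ball 0 1" for w :: complex
  proof
    assume "of_nat m + 1 - w \<in> \<int>\<^sub>\<le>\<^sub>0"
    then obtain n where "of_nat m + 1 - w = - of_nat n" by (elim nonpos_Ints_cases')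
    then have "w = of_nat (m + 1 + n)" by (simp add: algebra_simps)
    then have "norm w = real (m + 1 + n)" by (simp only: norm_of_nat)
    then show False using that by simp
  qed
  have d: "(g has_field_derivative rGamma (of_nat m + 1 - w) * Digamma (of_nat m + 1 - w)) (at w)" if "w \<in> ball 0 1" for w
    unfolding g_def using nn[OF that] by (auto intro!: derivative_eq_intros)
  have d1: "deriv g w = rGamma (of_nat m + 1 - w) * Digamma (of_nat m + 1 - w)" if "w \<in> ball 0 1" for w
    using d[OF that] by (rule DERIV_imp_deriv)
  have "deriv (deriv g) 0 = deriv (\<lambda>w. rGamma (of_nat m + 1 - w) * Digamma (of_nat m + 1 - w)) 0"
  proof (rule deriv_cong_ev)
    show "\<forall>\<^sub>F w in nhds 0. deriv g w = rGamma (of_nat m + 1 - w) * Digamma (of_nat m + 1 - w)"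
      by (rule eventually_mono[OF eventually_nhds_in_open[of "ball 0 1"] d1]) auto
  qed simp
  also have "((\<lambda>w. rGamma (of_nat m + 1 - w) * Digamma (of_nat m + 1 - w)) has_field_derivative
     rGamma (of_nat m + 1) * Digamma (of_nat m + 1) * Digamma (of_nat m + 1) - Polygamma 1 (of_nat m + 1) * rGamma (of_nat m + 1)) (at (0::complex))"
    using nn[of 0] by (auto intro!: derivative_eq_intros)
  then have "deriv (\<lambda>w. rGamma (of_nat m + 1 - w) * Digamma (of_nat m + 1 - w)) (0::complex) =
     rGamma (of_nat m + 1) * Digamma (of_nat m + 1) * Digamma (of_nat m + 1) - Polygamma 1 (of_nat m + 1) * rGamma (of_nat m + 1)"
    by (rule DERIV_imp_deriv)
  finally have d2: "deriv (deriv g) 0 = rGamma (of_nat m + 1) * Digamma (of_nat m + 1) * Digamma (of_nat m + 1) - Polygamma 1 (of_nat m + 1) * rGamma (of_nat m + 1)" .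
  have rG: "rGamma (of_nat m + 1 :: complex) = 1 / fact m"
    using Gamma_fact[of m, where 'a = complex] by (simp add: rGamma_inverse_Gamma inverse_eq_divide add.commute)
  have "g holomorphic_on ball 0 1"
    unfolding holomorphic_on_open[OF open_ball] using d by blast
  then have "g analytic_on {0}" using analytic_at by fastforce
  then have "taylor2 g (g 0) (deriv g 0) (deriv (deriv g) 0 / 2)" by (rule taylor2_analytic)
  moreover have "g 0 = 1 / fact m" by (simp add: g_def rG)
  moreover have "deriv g 0 = 1 / fact m * Digamma (of_nat m + 1)" using d1[of 0] by (simp add: rG)
  moreover have "deriv (deriv g) 0 / 2 = 1 / fact m * ((Digamma (of_nat m + 1)) ^ 2 - Polygamma 1 (of_nat m + 1)) / 2"
    unfolding d2 rG by (simp add: diff_divide_distrib power2_eq_square)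
  ultimately show ?thesis unfolding g_def[symmetric] by (simp only:)
qed

text \<open>By reflection, Gamma (w - m) is (-1)^m \<pi> / sin (\<pi> w) times the reciprocal of
  Gamma (m + 1 - w). The term \<pi>^2/6 comes from \<pi> w / sin (\<pi> w).\<close>

lemma taylor2_Gamma_pole:
  "taylor2 (\<lambda>w. w * Gamma (w - of_nat m)) ((- 1) ^ m / fact m) ((- 1) ^ m / fact m * Digamma (of_nat m + 1))
     ((- 1) ^ m / fact m * (((Digamma (of_nat m + 1)) ^ 2 - Polygamma 1 (of_nat m + 1)) / 2 + of_real pi ^ 2 / 6))"
proof -
  have "taylor2 (\<lambda>w. sin (of_real pi * w) / w) (of_real pi) 0 (- (of_real pi ^ 3 / 6))"
    using taylor2_divide_ident[OF has_fps_expansion_sin[of "complex_of_real pi"]]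
    by (simp add: fps_sin_def fact_numeral)
  from taylor2_inverse[OF this] have "taylor2 (\<lambda>w. inverse (sin (of_real pi * w) / w)) (1 / of_real pi) 0 (of_real pi / 6)"
    by (simp add: power2_eq_square power3_eq_cube field_simps)
  from taylor2_cmult[OF taylor2_mult[OF this taylor2_rGamma[of m]], of "of_real pi * (- 1) ^ m"]
  show ?thesis
  proof (rule taylor2_cong)
    have "eventually (\<lambda>w. w \<in> ball 0 1 - {0}) (at (0::complex))" by (intro eventually_at_in_open) auto
    then show "\<forall>\<^sub>F w in at (0::complex). of_real pi * (- 1) ^ m * (inverse (sin (of_real pi * w) / w) * rGamma (of_nat m + 1 - w)) = w * Gamma (w - of_nat m)"
    proof eventually_elim
      case (elim w)
      have "1 - (w - of_nat m) \<notin> \<int>\<^sub>\<le>\<^sub>0"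
      proof
        assume "1 - (w - of_nat m) \<in> \<int>\<^sub>\<le>\<^sub>0"
        then obtain n where "1 - (w - of_nat m) = - of_nat n" by (elim nonpos_Ints_cases')
        then have "w = of_nat (m + 1 + n)" by (simp add: algebra_simps)
        then have "norm w = real (m + 1 + n)" by (simp only: norm_of_nat)
        then show False using elim by simp
      qed
      then have "Gamma (1 - (w - of_nat m)) * rGamma (1 - (w - of_nat m)) = 1"
        by (simp add: rGamma_inverse_Gamma Gamma_eq_zero_iff)
      then have "Gamma (w - of_nat m) = Gamma (w - of_nat m) * Gamma (1 - (w - of_nat m)) * rGamma (1 - (w - of_nat m))"
        by (simp add: mult.assoc)
      also have "\<dots> = of_real pi / sin (of_real pi * (w - of_nat m)) * rGamma (1 - (w - of_nat m))"
        by (simp only: Gamma_reflection_complex)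
      also have "sin (of_real pi * (w - of_nat m)) = (- 1) ^ m * sin (of_real pi * w)"
      proof -
        have "of_real pi * (w - of_nat m) = of_real pi * w - of_real (real m * pi)" by (simp add: algebra_simps)
        then show ?thesis
          by (simp only: sin_diff sin_of_real cos_of_real sin_npi cos_npi) simp
      qed
      also have "1 - (w - of_nat m) = of_nat m + 1 - w" by simp
      finally show ?case using elim by (cases "even m") (simp_all add: field_simps)
    qed
  qed (simp_all add: field_simps power2_eq_square)
qed

section \<open>The exponential sum over the positive integers\<close>

lemma infsum_delta_eq:
  fixes f :: "'i \<Rightarrow> complex"
  assumes "f summable_on A" "a \<in> A"
  shows "infsum f A = f a + infsum f (A - {a})"
  using infsum_insert[of f "A - {a}" a] assms summable_on_subset_banach[OF assms(1)]
  by (simp add: insert_absorb)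

lemma abs_summable_on_times:
  fixes f :: "'i \<Rightarrow> real" and g :: "'j \<Rightarrow> real"
  assumes "f summable_on A" "g summable_on B" "\<And>x. f x \<ge> 0" "\<And>y. g y \<ge> 0"
  shows "(\<lambda>(x, y). f x * g y) summable_on A \<times> B"
proof (rule summable_on_SigmaI)
  show "((\<lambda>y. (case (x, y) of (x, y) \<Rightarrow> f x * g y)) has_sum f x * infsum g B) B" for x
    using assms(2) by (simp add: has_sum_cmult_right)
  show "(\<lambda>x. f x * infsum g B) summable_on A" using assms(1) by (rule summable_on_cmult_left)
qed (use assms in auto)

text \<open>The i-th Taylor term of exp (-x e^(-L j)), taken against e^(-z L j) and summed over j
  \<ge> 0 in closed form: what the half n = -j \<le> 0 of the exponential sum becomes. The poles lie
  on the line Re z = -i, spaced by 2 \<pi> / L.\<close>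

definition pole_term :: "real \<Rightarrow> real \<Rightarrow> nat \<Rightarrow> complex \<Rightarrow> complex" where
  "pole_term L x i z = (- of_real x) ^ i / fact i / (1 - exp (- of_real L * (z + of_nat i)))"

definition up_term :: "real \<Rightarrow> real \<Rightarrow> nat \<Rightarrow> complex \<Rightarrow> complex" where
  "up_term L x n z = exp (of_real (L * real n) * z - of_real (x * exp (L * real n)))"

lemma holomorphic_pole_term:
  assumes "\<And>z. z \<in> S \<Longrightarrow> exp (- of_real L * (z + of_nat i)) \<noteq> 1"
  shows "pole_term L x i holomorphic_on S"
  unfolding pole_term_def by (intro holomorphic_intros) (use assms in force)

lemma holomorphic_up_term: "up_term L x n holomorphic_on S"
  unfolding up_term_def by (intro holomorphic_intros)

lemma loc_dominated_subset:
  assumes "loc_dominated A f S" "B \<subseteq> A" "T \<subseteq> S"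
  shows "loc_dominated B f T"
proof (rule loc_dominatedI)
  fix s assume "s \<in> T"
  then obtain r F M where *: "r > 0" "finite F" "M summable_on (A - F)"
     "\<And>i z. i \<in> A - F \<Longrightarrow> z \<in> cball s r \<Longrightarrow> norm (f i z) \<le> M i"
    using assms(1,3) unfolding loc_dominated_def by (meson subsetD)
  have "M summable_on (B - F)" 
  proof (rule summable_on_subset_banach[OF *(3)])
    show "B - F \<subseteq> A - F" using assms(2) by auto
  qed
  then show "\<exists>r>0. \<exists>F M. finite F \<and> M summable_on (B - F) \<and> (\<forall>i\<in>B - F. \<forall>z\<in>cball s r. norm (f i z) \<le> M i)"
    using * assms(2) by (intro exI[of _ r] conjI exI[of _ F] exI[of _ M]) auto
qed

lemma summable_on_exp_series:
  fixes x :: real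
  assumes "x \<ge> 0"
  shows "(\<lambda>i. c * (x ^ i / fact i)) summable_on (A :: nat set)"
proof -
  have "summable (\<lambda>i. x ^ i / fact i)" using summable_exp[of x] by (simp add: field_simps)
  then have "(\<lambda>i. x ^ i / fact i) summable_on UNIV" using assms by (simp add: summable_on_UNIV_nonneg_real_iff)
  then show ?thesis by (intro summable_on_cmult_right) (rule summable_on_subset_banach[OF _ subset_UNIV])
qed

lemma loc_dominated_pole_term:
  assumes "L > 0" "x > 0"
  shows "loc_dominated UNIV (pole_term L x) UNIV"
proof (rule loc_dominatedI)
  fix s :: complex
  \<comment> \<open>From this index on L (Re z + i) \<ge> 1 on the unit ball around
    \<open>s\<close>, and e^(-1) \<le> 1/2 keeps the denominators away from 0.\<close>
  define N where "N = nat \<lceil>norm s + 1 + 1 / L\<rceil>"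
  have "norm (pole_term L x i z) \<le> 2 * (x ^ i / fact i)" if i: "i \<in> UNIV - {..<N}" and z: "z \<in> cball s 1" for i z
  proof -
    have "real N \<ge> norm s + 1 + 1 / L" unfolding N_def by (rule real_nat_ceiling_ge)
    then have "real i \<ge> norm s + 1 + 1 / L" using i by auto
    moreover have "norm z \<le> norm s + 1" using z norm_triangle_ineq2[of z s] by (simp add: dist_norm norm_minus_commute)
    ultimately have "Re z + real i \<ge> 1 / L" using abs_Re_le_cmod[of z] by linarith
    then have "L * (Re z + real i) \<ge> 1" using assms by (simp add: field_simps)
    then have "exp (- (L * (Re z + real i))) \<le> exp (- 1)" by simp
    also have "\<dots> \<le> 1 / 2" using exp_ge_add_one_self[of 1] by (simp add: exp_minus field_simps)
    finally have "norm (exp (- of_real L * (z + of_nat i))) \<le> 1 / 2" by simp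
    then have "norm (1 - exp (- of_real L * (z + of_nat i))) \<ge> 1 / 2"
      using norm_triangle_ineq2[of 1 "exp (- of_real L * (z + of_nat i))"] by simp
    then have "inverse (norm (1 - exp (- of_real L * (z + of_nat i)))) \<le> 2"
      using le_imp_inverse_le[of "1/2"] by simp
    then have "x ^ i / fact i * inverse (norm (1 - exp (- of_real L * (z + of_nat i)))) \<le> x ^ i / fact i * 2"
      using assms by (intro mult_left_mono) auto
    then show ?thesis using assms
      by (simp add: pole_term_def norm_divide norm_mult norm_power divide_inverse norm_inverse mult_ac)
  qed
  then show "\<exists>r>0. \<exists>F M. finite F \<and> M summable_on (UNIV - F) \<and>
      (\<forall>i\<in>UNIV - F. \<forall>z\<in>cball s r. norm (pole_term L x i z) \<le> M i)"
    using summable_on_exp_series[of x 2] assms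
    by (intro exI[of _ 1] conjI exI[of _ "{..<N}"] exI[of _ "\<lambda>i. 2 * (x ^ i / fact i)"]) auto
qed

text \<open>The growth e^(L n Re z) is beaten by exp (-x e^(L n)): from the exponential series one
  power of e^(L n) more than required is taken, and the surplus power leaves the summable factor
  e^(-L n).\<close>

lemma loc_dominated_up_term:
  assumes "L > 0" "x > 0"
  shows "loc_dominated {1..} (up_term L x) UNIV"
proof (rule loc_dominatedI)
  fix s :: complex
  define N where "N = nat \<lceil>norm s + 1\<rceil>"
  define c where "c = fact (Suc N) / x ^ Suc N"
  have "norm (up_term L x n z) \<le> c * exp (- L * real n)" if z: "z \<in> cball s 1" for n z
  proof -
    have "norm z \<le> norm s + 1" using z norm_triangle_ineq2[of z s] by (simp add: dist_norm norm_minus_commute)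
    then have "Re z \<le> real N" using abs_Re_le_cmod[of z] unfolding N_def by linarith
    then have "L * real n * Re z \<le> L * real n * real N" using assms by (intro mult_left_mono) auto
    then have "norm (up_term L x n z) \<le> exp (L * real n * real N - x * exp (L * real n))"
      unfolding up_term_def norm_exp_eq_Re by simp
    also have "\<dots> = exp (- L * real n) * (exp (L * real n) ^ Suc N / exp (x * exp (L * real n)))"
      by (simp add: exp_of_nat_mult[symmetric] exp_diff[symmetric] exp_add[symmetric] distrib_right distrib_left algebra_simps)
    also have "\<dots> \<le> exp (- L * real n) * c"
    proof (intro mult_left_mono)
      have "(x * exp (L * real n)) ^ Suc N \<le> fact (Suc N) * exp (x * exp (L * real n))"
        using assms by (intro power_le_fact_exp) auto
      then show "exp (L * real n) ^ Suc N / exp (x * exp (L * real n)) \<le> c"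
        using assms unfolding c_def power_mult_distrib by (simp add: field_simps)
    qed auto
    finally show ?thesis by (simp add: mult_ac)
  qed
  moreover have "(\<lambda>n. c * exp (- L * real n)) summable_on ({1..} - {} :: nat set)"
  proof -
    have "summable (\<lambda>n. exp (- L) ^ n)" using assms by (intro summable_geometric) auto
    then have "(\<lambda>n. exp (- L * real n)) summable_on UNIV"
      by (simp add: summable_on_UNIV_nonneg_real_iff exp_of_nat_mult[symmetric] mult.commute)
    then show ?thesis by (intro summable_on_cmult_right) (rule summable_on_subset_banach[OF _ subset_UNIV])
  qed
  ultimately show "\<exists>r>0. \<exists>F M. finite F \<and> M summable_on ({1..} - F) \<and>
      (\<forall>i\<in>{1..} - F. \<forall>z\<in>cball s r. norm (up_term L x i z) \<le> M i)"
    by (intro exI[of _ 1] conjI exI[of _ "{}"] exI[of _ "\<lambda>n. c * exp (- L * real n)"]) auto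
qed

text \<open>The half n = -j \<le> 0 of the sum. Expanding the exponential and exchanging the sums is
  justified by the majorant e^(-L a j) x^i / i!, which is summable because a > 0.\<close>

lemma down_sum:
  fixes a x L :: real
  assumes a: "a > 0" and x: "x > 0" and L: "L > 0"
  shows "((\<lambda>j::nat. complex_of_real (exp (- (a * L * real j) - x * exp (- (L * real j))))) has_sum
     (\<Sum>\<^sub>\<infinity>i. pole_term L x i (of_real a))) UNIV"
proof -
  define f where "f j i = (- of_real x) ^ i / fact i * complex_of_real (exp (- L * (a + real i))) ^ j" for j i :: nat
  have *: "((\<lambda>i. f j i) has_sum complex_of_real (exp (- (a * L * real j) - x * exp (- (L * real j))))) UNIV" for j
  proof -
    define c where "c = complex_of_real (exp (- (a * L * real j)))"
    define y where "y = - of_real x * complex_of_real (exp (- (L * real j)))"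
    have "((\<lambda>i. y ^ i /\<^sub>R fact i) has_sum exp y) UNIV"
      by (intro norm_summable_imp_has_sum exp_converges summable_norm_exp)
    from has_sum_cmult_right[OF this, of c] have "((\<lambda>i. c * (y ^ i /\<^sub>R fact i)) has_sum c * exp y) UNIV" .
    moreover have "c * (y ^ i /\<^sub>R fact i) = f j i" for i
    proof -
      have "y ^ i = (- of_real x) ^ i * complex_of_real (exp (- (L * real j)) ^ i)"
        unfolding y_def of_real_power by (rule power_mult_distrib)
      moreover have "exp (- (a * L * real j)) * exp (- (L * real j)) ^ i = exp (- L * (a + real i)) ^ j"
        by (simp add: exp_of_nat_mult[symmetric] exp_add[symmetric] algebra_simps)
      then have "c * complex_of_real (exp (- (L * real j)) ^ i) = complex_of_real (exp (- L * (a + real i)) ^ j)"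
        unfolding c_def by (simp only: of_real_mult[symmetric])
      ultimately show ?thesis
        unfolding f_def by (simp add: scaleR_conv_of_real field_simps)
    qed
    moreover have "c * exp y = complex_of_real (exp (- (a * L * real j) - x * exp (- (L * real j))))"
    proof -
      have "y = of_real (- x * exp (- (L * real j)))" by (simp add: y_def)
      then have "c * exp y = of_real (exp (- (a * L * real j)) * exp (- x * exp (- (L * real j))))"
        unfolding c_def by (simp only: exp_of_real of_real_mult[symmetric])
      then show ?thesis by (simp only: exp_add[symmetric]) simp
    qed
    ultimately show ?thesis by simp
  qed
  have sm: "(\<lambda>(j, i). f j i) summable_on UNIV \<times> UNIV"
  proof (rule abs_summable_summable, rule summable_on_comparison_test)
    have "summable (\<lambda>j. exp (- L * a) ^ j)" using a L by (intro summable_geometric) auto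
    then have "(\<lambda>j. exp (- L * a) ^ j) summable_on UNIV" by (simp add: summable_on_UNIV_nonneg_real_iff)
    then show "(\<lambda>(j, i). exp (- L * a) ^ j * (1 * (x ^ i / fact i))) summable_on UNIV \<times> UNIV"
      using summable_on_exp_series[of x 1 UNIV] x by (intro abs_summable_on_times) auto
    fix p :: "nat \<times> nat"
    obtain j i where p: "p = (j, i)" by force
    have "norm (f j i) = x ^ i / fact i * exp (- L * (a + real i)) ^ j"
      using x by (simp add: f_def norm_mult norm_divide norm_power)
    also have "\<dots> \<le> x ^ i / fact i * exp (- L * a) ^ j"
      using x L by (intro mult_left_mono power_mono) auto
    finally show "norm (case p of (j, i) \<Rightarrow> f j i) \<le> (case p of (j, i) \<Rightarrow> exp (- L * a) ^ j * (1 * (x ^ i / fact i)))"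
      by (simp add: p mult_ac)
  qed auto
  have col: "(\<Sum>\<^sub>\<infinity>j. f j i) = pole_term L x i (of_real a)" for i
  proof -
    define r where "r = complex_of_real (exp (- L * (a + real i)))"
    have r: "norm r < 1" using a L by (simp add: r_def add_pos_nonneg)
    have "((\<lambda>j. r ^ j) has_sum (1 / (1 - r))) UNIV"
      using r by (intro norm_summable_imp_has_sum geometric_sums) (simp_all add: norm_power summable_geometric)
    from has_sum_cmult_right[OF this, of "(- of_real x) ^ i / fact i"]
    have "((\<lambda>j. f j i) has_sum ((- of_real x) ^ i / fact i * (1 / (1 - r)))) UNIV"
      by (simp add: f_def r_def)
    then show ?thesis unfolding pole_term_def r_def by (simp add: has_sum_iff exp_of_real[symmetric])
  qed
  have "(\<Sum>\<^sub>\<infinity>j. \<Sum>\<^sub>\<infinity>i. f j i) = (\<Sum>\<^sub>\<infinity>i. \<Sum>\<^sub>\<infinity>j. f j i)"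
    by (rule infsum_swap_banach[OF sm])
  moreover have "(\<lambda>j. \<Sum>\<^sub>\<infinity>i. f j i) summable_on UNIV" using summable_on_Sigma_banach[OF sm] by simp
  moreover have "(\<Sum>\<^sub>\<infinity>i. f j i) = complex_of_real (exp (- (a * L * real j) - x * exp (- (L * real j))))" for j
    using *[of j] by (simp add: has_sum_iff)
  ultimately show ?thesis by (simp add: col has_sum_iff)
qed

lemma one_sided_sum_real:
  fixes a x L :: real
  assumes a: "1 < a" "a < 2" and x: "x > 0" and L: "L > 0"
  shows "(\<Sum>\<^sub>\<infinity>n\<in>{1..}. up_term L x n (of_real a)) + (\<Sum>\<^sub>\<infinity>i. pole_term L x i (of_real a))
    = (\<Sum>\<^sub>\<infinity>k. gam_term L x k (of_real a)) / of_real L"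
proof -
  define f where "f n = complex_of_real (exp (a * L * of_int n - x * exp (L * of_int n)))" for n :: int
  have "(\<lambda>n. norm (up_term L x n (of_real a))) summable_on {1..}"
    using abs_summable_loc_dominated[of UNIV "{1..}" "up_term L x" "of_real a"]
      holomorphic_up_term loc_dominated_up_term[OF L x] by simp
  then have "((\<lambda>n. up_term L x n (of_real a)) has_sum (\<Sum>\<^sub>\<infinity>n\<in>{1..}. up_term L x n (of_real a))) {1..}"
    by (rule has_sum_infsum[OF abs_summable_summable])
  moreover have "up_term L x n (of_real a) = f (int n)" for n
    unfolding up_term_def f_def by (simp add: exp_of_real[symmetric] mult_ac)
  ultimately have "(f has_sum (\<Sum>\<^sub>\<infinity>n\<in>{1..}. up_term L x n (of_real a))) (int ` {1..})"
    by (subst has_sum_reindex) (auto simp: o_def)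
  moreover have "(f has_sum (\<Sum>\<^sub>\<infinity>i. pole_term L x i (of_real a))) ((\<lambda>j. - int j) ` UNIV)"
    using down_sum[of a x L] a x L by (subst has_sum_reindex) (auto simp: o_def f_def inj_def)
  ultimately have "(f has_sum ((\<Sum>\<^sub>\<infinity>n\<in>{1..}. up_term L x n (of_real a)) + (\<Sum>\<^sub>\<infinity>i. pole_term L x i (of_real a))))
     (int ` {1..} \<union> (\<lambda>j. - int j) ` UNIV)"
    by (rule has_sum_Un_disjoint) auto
  moreover have "int ` {1..} \<union> (\<lambda>j. - int j) ` UNIV = UNIV"
  proof -
    have "k \<in> int ` {1..} \<union> (\<lambda>n. - int n) ` UNIV" for k by (cases k rule: int_cases3) auto
    then show ?thesis by auto
  qed
  moreover have "infsum f UNIV = (\<Sum>\<^sub>\<infinity>k. gam_term L x k (of_real a)) / of_real L"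
    using bilateral_sum[OF a x L] by (simp add: f_def[abs_def])
  ultimately show ?thesis by (simp only: has_sum_iff)
qed

lemma exp_eq_1_cases:
  assumes "exp (- of_real L * z) = 1" "L > 0"
  obtains n :: int where "z = \<i> * of_real (2 * pi / L * of_int n)"
proof -
  from assms(1) obtain n :: int where n: "- L * Re z = 0" "- L * Im z = of_int (2 * n) * pi"
    unfolding exp_eq_1 by auto
  have "z = \<i> * of_real (2 * pi / L * of_int (- n))"
    using n assms(2) by (simp add: complex_eq_iff field_simps)
  then show ?thesis by (rule that)
qed

text \<open>
  Both sides are holomorphic off a discrete set, so that the identity extends from the strip
  \<open>1 < Re z < 2\<close>.  The derivatives at \<open>z = -m\<close>, where the poles on the two sides cancel, give the
  sums in which a factor \<open>n\<close> appears.
\<close>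

lemma one_sided_sum:
  fixes x L :: real and z :: complex
  assumes x: "x > 0" and L: "L > 0"
    and z: "Re z > - real m - 1" "\<And>i. i \<le> m \<Longrightarrow> exp (- of_real L * (z + of_nat i)) \<noteq> 1"
  shows "(\<Sum>\<^sub>\<infinity>n\<in>{1..}. up_term L x n z) + (\<Sum>\<^sub>\<infinity>i. pole_term L x i z)
    = (\<Sum>\<^sub>\<infinity>k. gam_term L x k z) / of_real L"
    and "pole_term L x i field_differentiable (at z)" "gam_term L x k field_differentiable (at z)"
    and "(\<lambda>i. pole_term L x i z) summable_on UNIV" "(\<lambda>k. gam_term L x k z) summable_on UNIV"
proof -
  define P where "P = (\<Union>i\<in>{..m}. {z::complex. exp (- of_real L * (z + of_nat i)) = 1})"
  define S where "S = {z. Re z > - real m - 1} - P"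
  have "closed {z::complex. exp (- of_real L * (z + of_nat i)) = 1}" for i
    by (intro closed_Collect_eq continuous_intros)
  then have "closed P" unfolding P_def by (intro closed_UN) auto
  then have S: "open S" unfolding S_def by (intro open_Diff open_halfspace_Re_gt)
  have "countable P"
  proof (rule countable_subset)
    show "P \<subseteq> (\<lambda>(i, n). \<i> * of_real (2 * pi / L * of_int n) - of_nat i) ` (UNIV \<times> UNIV)"
    proof
      fix z assume "z \<in> P"
      then obtain i where "exp (- of_real L * (z + of_nat i)) = 1" by (auto simp: P_def)
      then obtain n where "z + of_nat i = \<i> * of_real (2 * pi / L * of_int n)" by (rule exp_eq_1_cases[OF _ L])
      then show "z \<in> (\<lambda>(i, n). \<i> * of_real (2 * pi / L * of_int n) - of_nat i) ` (UNIV \<times> UNIV)"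
        by (intro image_eqI[of _ _ "(i, n)"]) (auto simp: eq_diff_eq)
    qed
  qed auto
  \<comment> \<open>Removing a countable set does not disconnect the half-plane; this makes
    continuation across the lines of poles possible.\<close>
  then have conn: "connected S" unfolding S_def
    by (intro connected_open_diff_countable open_halfspace_Re_gt convex_connected convex_halfspace_Re_gt) simp_all
  have ne: "exp (- of_real L * (z + of_nat i)) \<noteq> 1" if "z \<in> S" for z i
  proof (cases "i \<le> m")
    case True
    then show ?thesis using that by (auto simp: S_def P_def)
  next
    case False
    then have "Re (z + of_nat i) > 0" using that by (auto simp: S_def)
    moreover have "Re (z + of_nat i) = 0" if "exp (- of_real L * (z + of_nat i)) = 1"
      by (rule exp_eq_1_cases[OF that L]) simp
    ultimately show ?thesis by auto
  qed
  have holo_p: "pole_term L x i holomorphic_on S" for i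
    by (intro holomorphic_pole_term ne)
  \<comment> \<open>The poles of the Gamma factors are solutions of e^(-L (z + n)) = 1 as well, so
    deleting \<open>P\<close> removes the poles of both sides.\<close>
  have holo_g: "gam_term L x k holomorphic_on S" for k
  proof (rule holomorphic_gam_term)
    fix z assume "z \<in> S"
    show "z + \<i> * of_real (2 * pi / L * of_int k) \<notin> \<int>\<^sub>\<le>\<^sub>0"
    proof
      assume "z + \<i> * of_real (2 * pi / L * of_int k) \<in> \<int>\<^sub>\<le>\<^sub>0"
      then obtain n where "z + \<i> * of_real (2 * pi / L * of_int k) = - of_nat n" by (elim nonpos_Ints_cases')
      then have "z + of_nat n = - (\<i> * of_real (2 * pi / L * of_int k))"
        by (simp add: eq_neg_iff_add_eq_0 add_ac)
      then have "- of_real L * (z + of_nat n) = of_real L * (\<i> * of_real (2 * pi / L * of_int k))"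
        by (simp only: mult_minus_left mult_minus_right minus_minus)
      also have "\<dots> = \<i> * of_real (of_int (2 * k) * pi)" using L by simp
      finally have "exp (- of_real L * (z + of_nat n)) = 1"
        by (simp add: exp_eq_1)
      with ne[OF \<open>z \<in> S\<close>] show False by blast
    qed
  qed
  have domp: "loc_dominated UNIV (pole_term L x) S" 
    using loc_dominated_subset[OF loc_dominated_pole_term[OF L x]] by simp
  have domg: "loc_dominated UNIV (gam_term L x) S" 
    using loc_dominated_subset[OF loc_dominated_gam_term[OF L]] by simp
  have domu: "loc_dominated {1..} (up_term L x) S" 
    using loc_dominated_subset[OF loc_dominated_up_term[OF L x]] by simp
  define h where "h z = (\<Sum>\<^sub>\<infinity>n\<in>{1..}. up_term L x n z) + (\<Sum>\<^sub>\<infinity>i. pole_term L x i z)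
     - (\<Sum>\<^sub>\<infinity>k. gam_term L x k z) / of_real L" for z
  have zS: "z \<in> S" using z by (auto simp: S_def P_def)
  \<comment> \<open>The identity is known on the real segment (1, 2), which accumulates at
    3/2.\<close>
  have "h z = 0"
  proof (rule analytic_continuation[where f = h and S = S and U = "complex_of_real ` {1<..<2}" and \<xi> = "complex_of_real (3 / 2)"])
    show "h holomorphic_on S" unfolding h_def using L
      by (intro holomorphic_intros holomorphic_on_infsum S holo_p holo_g holomorphic_up_term domp domg domu) auto
    have r: "of_real a \<in> S" if "a > 0" for a :: real
    proof -
      have "exp (- of_real L * (of_real a + of_nat i)) \<noteq> (1 :: complex)" for i
      proof
        assume "exp (- of_real L * (of_real a + of_nat i)) = (1 :: complex)"
        then obtain n where "of_real a + of_nat i = \<i> * of_real (2 * pi / L * of_int n)" by (rule exp_eq_1_cases[OF _ L])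
        then have "Re (of_real a + of_nat i) = Re (\<i> * of_real (2 * pi / L * of_int n))" by (rule arg_cong)
        then show False using that by simp
      qed
      then show ?thesis using that by (auto simp: S_def P_def)
    qed
    show "of_real ` {1<..<2} \<subseteq> S" using r by auto
    show "of_real (3 / 2) \<in> S" by (rule r) simp
    show "complex_of_real (3 / 2) islimpt of_real ` {1<..<2}"
      unfolding islimpt_approachable
    proof safe
      fix e :: real assume e: "e > 0"
      define t where "t = min (e / 2) (1 / 4)"
      have "0 < t" "t < e" "t < 1/2" using e by (auto simp: t_def)
      then show "\<exists>y\<in>complex_of_real ` {1<..<2}. y \<noteq> of_real (3 / 2) \<and> dist y (of_real (3 / 2)) < e"
        by (intro bexI[of _ "of_real (3 / 2 + t)"]) (auto simp: dist_of_real simp del: of_real_add of_real_divide, simp add: dist_real_def)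
    qed
    show "h y = 0" if "y \<in> of_real ` {1<..<2}" for y
      using that one_sided_sum_real[OF _ _ x L] by (auto simp: h_def)
  qed (use S conn zS in auto)
  then show "(\<Sum>\<^sub>\<infinity>n\<in>{1..}. up_term L x n z) + (\<Sum>\<^sub>\<infinity>i. pole_term L x i z)
    = (\<Sum>\<^sub>\<infinity>k. gam_term L x k z) / of_real L" by (simp add: h_def)
  show "pole_term L x i field_differentiable (at z)" "gam_term L x k field_differentiable (at z)"
    using holo_p holo_g S zS holomorphic_on_imp_differentiable_at by blast+
  show "(\<lambda>i. pole_term L x i z) summable_on UNIV" "(\<lambda>k. gam_term L x k z) summable_on UNIV"
    by (rule abs_summable_summable[OF abs_summable_loc_dominated[OF S holo_p domp zS]])
       (rule abs_summable_summable[OF abs_summable_loc_dominated[OF S holo_g domg zS]])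
qed

section \<open>Sums weighted by \<open>n\<close>: differentiation at the points z = -m\<close>

definition heat_sum :: "real \<Rightarrow> real \<Rightarrow> nat \<Rightarrow> complex" where
  "heat_sum L x m = (\<Sum>\<^sub>\<infinity>n\<in>{1..}. complex_of_real (real n * exp (- L * real n * real m) * exp (- x * exp (L * real n))))"

lemma deriv_pole_term:
  assumes "exp (- of_real L * (z + of_nat i)) \<noteq> 1"
  shows "deriv (pole_term L x i) z = - ((- of_real x) ^ i / fact i * of_real L * exp (- of_real L * (z + of_nat i)) / (1 - exp (- of_real L * (z + of_nat i)))\<^sup>2)"
proof -
  have "((\<lambda>z. C / (1 - exp (- of_real L * (z + of_nat i)))) has_field_derivative
      - (C * of_real L * exp (- of_real L * (z + of_nat i)) / (1 - exp (- of_real L * (z + of_nat i)))\<^sup>2)) (at z)" for C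
    using assms by (auto intro!: derivative_eq_intros simp: power2_eq_square mult_ac)
  then show ?thesis unfolding pole_term_def by (intro DERIV_imp_deriv)
qed

lemma deriv_gam_term:
  fixes k :: int and L :: real
  defines "y \<equiv> \<i> * of_real (2 * pi / L * of_int k)"
  assumes "z + y \<notin> \<int>\<^sub>\<le>\<^sub>0"
  shows "deriv (gam_term L x k) z = (deriv Gamma (z + y) - of_real (ln x) * Gamma (z + y)) * exp (- (z + y) * of_real (ln x))"
proof -
  have G: "(Gamma has_field_derivative Gamma (z + y) * Digamma (z + y)) (at (z + y))"
    using assms(2) by (rule has_field_derivative_Gamma)
  have dG: "deriv Gamma (z + y) = Gamma (z + y) * Digamma (z + y)" using G by (rule DERIV_imp_deriv)
  have "((\<lambda>z. exp (- (z + y) * c)) has_field_derivative - c * exp (- (z + y) * c)) (at z)" for c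
    by (auto intro!: derivative_eq_intros)
  moreover have "((\<lambda>z. Gamma (z + y)) has_field_derivative Gamma (z + y) * Digamma (z + y)) (at z)"
    using assms(2) by (auto intro!: derivative_eq_intros)
  ultimately have "((\<lambda>z. Gamma (z + y) * exp (- (z + y) * c)) has_field_derivative
      (Gamma (z + y) * Digamma (z + y) * exp (- (z + y) * c) + - c * exp (- (z + y) * c) * Gamma (z + y))) (at z)" for c
    by (intro DERIV_mult)
  moreover have "g * d * e + - c * e * g = (g * d - c * g) * e" for g d e c :: complex
    by (simp add: algebra_simps)
  ultimately show ?thesis
    unfolding gam_term_def y_def[symmetric] dG by (intro DERIV_imp_deriv) simp
qed

text \<open>At z = -m the k = 0 term of the Gamma side, divided by \<open>L\<close>, and the i = m
  term of the geometric side both have a simple pole with residue (-x)^m / (m! L). Their difference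
  \<open>D\<close> is holomorphic there up to a removable singularity, and \<open>c\<close> is its
  derivative; all other terms are differentiated one by one.\<close>

lemma heat_sum_expansion:
  fixes x L :: real and m :: nat
  assumes x: "x > 0" and L: "L > 0"
  defines "c \<equiv> (- 1) ^ m / fact m * of_real x ^ m * ((of_real (ln x) ^ 2 / 2 - of_real (ln x) * Digamma (of_nat m + 1)
     + ((Digamma (of_nat m + 1)) ^ 2 - Polygamma 1 (of_nat m + 1)) / 2 + of_real pi ^ 2 / 6) / of_real L - of_real L / 12)"
  shows "of_real L * heat_sum L x m = (\<Sum>\<^sub>\<infinity>k\<in>UNIV - {0}. deriv (gam_term L x k) (- of_nat m)) / of_real L
     - (\<Sum>\<^sub>\<infinity>i\<in>UNIV - {m}. deriv (pole_term L x i) (- of_nat m)) + c"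
    and "(\<lambda>k. deriv (gam_term L x k) (- of_nat m)) summable_on UNIV - {0}"
    and "(\<lambda>i. deriv (pole_term L x i) (- of_nat m)) summable_on UNIV - {m}"
    and "(\<lambda>n. complex_of_real (real n * exp (- L * real n * real m) * exp (- x * exp (L * real n)))) summable_on {1..}"
proof -
  define y0 where "y0 = 2 * pi / L"
  have y0: "y0 > 0" using L by (simp add: y0_def)
  \<comment> \<open>All other poles are at distance at least 1 or at least 2 \<pi> / L, so within
    \<open>B\<close> only the indices k = 0 and i = m meet a pole, and only at the centre.\<close>
  define r where "r = min 1 y0"
  have r: "r > 0" "r \<le> 1" "r \<le> y0" using y0 by (auto simp: r_def)
  define B where "B = ball (- of_nat m :: complex) r"
  have B: "open B" "- of_nat m \<in> B" using r by (auto simp: B_def)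
  have Bz: "\<bar>Re z + real m\<bar> < 1" "\<bar>Im z\<bar> < y0" if "z \<in> B" for z
  proof -
    have "norm (z + of_nat m) < r" using that by (simp add: B_def dist_norm norm_minus_commute add.commute)
    then have "\<bar>Re (z + of_nat m)\<bar> < r" "\<bar>Im (z + of_nat m)\<bar> < r"
      using abs_Re_le_cmod abs_Im_le_cmod order_le_less_trans by blast+
    then show "\<bar>Re z + real m\<bar> < 1" "\<bar>Im z\<bar> < y0" using r by auto
  qed
  have ne: "i = m \<and> z = - of_nat m" if z: "z \<in> B" and e: "exp (- of_real L * (z + of_nat i)) = 1" for z i
  proof -
    obtain n where n: "z + of_nat i = \<i> * of_real (2 * pi / L * of_int n)" by (rule exp_eq_1_cases[OF e L])
    have "Re (z + of_nat i) = 0" "Im (z + of_nat i) = y0 * of_int n" unfolding n by (simp_all add: y0_def)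
    then have re: "Re z = - real i" and im: "Im z = y0 * of_int n" by auto
    have "\<bar>real m - real i\<bar> < 1" using Bz(1)[OF z] re by simp
    then have "i = m" by linarith
    have "y0 * \<bar>of_int n\<bar> < y0 * 1" using Bz(2)[OF z] y0 by (simp add: im abs_mult)
    then have "\<bar>real_of_int n\<bar> < 1" using y0 by (rule mult_left_less_imp_less[OF _ less_imp_le])
    then have "n = 0" by linarith
    then show ?thesis using \<open>i = m\<close> re im by (simp add: complex_eq_iff)
  qed
  have holo_p: "pole_term L x i holomorphic_on B" if "i \<in> UNIV - {m}" for i
    by (intro holomorphic_pole_term) (use ne that in auto)
  have holo_g: "gam_term L x k holomorphic_on B" if "k \<in> UNIV - {0}" for k
  proof (rule holomorphic_gam_term, rule nonpos_Ints_Im)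
    fix z assume z: "z \<in> B"
    have "\<bar>y0 * of_int k\<bar> \<ge> y0 * 1" using that y0 by (auto simp: abs_mult)
    then show "Im (z + \<i> * of_real (2 * pi / L * of_int k)) \<noteq> 0"
      using Bz(2)[OF z] unfolding y0_def by auto
  qed
  have domp: "loc_dominated (UNIV - {m}) (pole_term L x) B" 
    using loc_dominated_subset[OF loc_dominated_pole_term[OF L x]] by simp
  have domg: "loc_dominated (UNIV - {0}) (gam_term L x) B" 
    using loc_dominated_subset[OF loc_dominated_gam_term[OF L]] by simp
  define A where "A z = (\<Sum>\<^sub>\<infinity>k\<in>UNIV - {0}. gam_term L x k z)" for z
  define Q where "Q z = (\<Sum>\<^sub>\<infinity>i\<in>UNIV - {m}. pole_term L x i z)" for z
  define U where "U z = (\<Sum>\<^sub>\<infinity>n\<in>{1..}. up_term L x n z)" for z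
  have A: "A holomorphic_on B" "((\<lambda>k. deriv (gam_term L x k) (- of_nat m)) has_sum deriv A (- of_nat m)) (UNIV - {0})"
    unfolding A_def using holomorphic_on_infsum[OF B(1) holo_g domg] has_sum_deriv[OF B(1) holo_g domg B(2)] by auto
  have Q: "Q holomorphic_on B" "((\<lambda>i. deriv (pole_term L x i) (- of_nat m)) has_sum deriv Q (- of_nat m)) (UNIV - {m})"
    unfolding Q_def using holomorphic_on_infsum[OF B(1) holo_p domp] has_sum_deriv[OF B(1) holo_p domp B(2)] by auto
  have U: "U holomorphic_on UNIV" "((\<lambda>n. deriv (up_term L x n) (- of_nat m)) has_sum deriv U (- of_nat m)) {1..}"
    unfolding U_def using holomorphic_on_infsum[OF open_UNIV holomorphic_up_term loc_dominated_up_term[OF L x]]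
      has_sum_deriv[OF open_UNIV holomorphic_up_term loc_dominated_up_term[OF L x], of "- of_nat m"] by auto
  define D where "D z = gam_term L x 0 z / of_real L - pole_term L x m z" for z
  have key: "U z = A z / of_real L - Q z + D z" if z: "z \<in> B - {- of_nat m}" for z
  proof -
    have *: "Re z > - real m - 1" "\<And>i. i \<le> m \<Longrightarrow> exp (- of_real L * (z + of_nat i)) \<noteq> 1"
      using Bz[of z] ne[of z] z by auto
    note os = one_sided_sum[OF x L *]
    have "(\<Sum>\<^sub>\<infinity>i. pole_term L x i z) = pole_term L x m z + Q z"
      unfolding Q_def by (rule infsum_delta_eq[OF os(4)]) auto
    moreover have "(\<Sum>\<^sub>\<infinity>k. gam_term L x k z) = gam_term L x 0 z + A z"
      unfolding A_def by (rule infsum_delta_eq[OF os(5)]) auto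
    ultimately have "U z + (pole_term L x m z + Q z) = (gam_term L x 0 z + A z) / of_real L"
      using os(1) by (simp only: U_def)
    then show ?thesis by (simp add: D_def add_divide_distrib algebra_simps)
  qed
  \<comment> \<open>The vanishing constant coefficient is the cancellation of the residues; the
    quadratic coefficient of \<open>w * D\<close> is the derivative of the extended
    \<open>D\<close>.\<close>
  have "taylor2 (\<lambda>w. w * D (- of_nat m + w)) 0
     ((- 1) ^ m / fact m * of_real x ^ m * ((Digamma (of_nat m + 1) - of_real (ln x)) / of_real L - 1 / 2)) c"
  proof -
    have xm: "exp (of_real (ln x) * of_nat m) = complex_of_real x ^ m"
    proof -
      have "exp (complex_of_real (ln x)) = of_real x" using x by (simp add: exp_of_real)
      then show ?thesis by (simp only: exp_of_nat2_mult)
    qed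
    from taylor2_add[OF taylor2_cmult[OF taylor2_mult[OF taylor2_Gamma_pole[of m] taylor2_exp[of "- of_real (ln x)"]], of "of_real x ^ m / of_real L"]
      taylor2_cmult[OF taylor2_Bernoulli[of "of_real L"], of "- ((- of_real x) ^ m / fact m)"]]
    show ?thesis
    proof (rule taylor2_cong)
      show "\<forall>\<^sub>F w in at 0. of_real x ^ m / of_real L * (w * Gamma (w - of_nat m) * exp (- of_real (ln x) * w)) +
          - ((- of_real x) ^ m / fact m) * (w / (1 - exp (- of_real L * w))) = w * D (- of_nat m + w)"
      proof (intro always_eventually allI)
        fix w :: complex
        have "exp (- (w - of_nat m) * of_real (ln x)) = of_real x ^ m * exp (- of_real (ln x) * w)"
          unfolding xm[symmetric] mult_exp_exp by (simp add: algebra_simps)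
        then have 1: "gam_term L x 0 (- of_nat m + w) = Gamma (w - of_nat m) * (of_real x ^ m * exp (- of_real (ln x) * w))"
          by (simp add: gam_term_def)
        show "of_real x ^ m / of_real L * (w * Gamma (w - of_nat m) * exp (- of_real (ln x) * w)) +
          - ((- of_real x) ^ m / fact m) * (w / (1 - exp (- of_real L * w))) = w * D (- of_nat m + w)"
          unfolding D_def 1 pole_term_def by (simp add: algebra_simps)
      qed
      have pm: "(- complex_of_real x) ^ m = (- 1) ^ m * of_real x ^ m" by (rule power_minus)
      show "of_real x ^ m / of_real L * ((- 1) ^ m / fact m * 1) + - ((- complex_of_real x) ^ m / fact m) * (1 / of_real L) = 0"
        by (simp add: pm)
      show "of_real x ^ m / of_real L * ((- 1) ^ m / fact m * - of_real (ln x) + (- 1) ^ m / fact m * Digamma (of_nat m + 1) * 1)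
         + - ((- complex_of_real x) ^ m / fact m) * (1 / 2) = 
         (- 1) ^ m / fact m * of_real x ^ m * ((Digamma (of_nat m + 1) - of_real (ln x)) / of_real L - 1 / 2)"
        using L unfolding pm by (simp add: field_simps)
      show "of_real x ^ m / of_real L * ((- 1) ^ m / fact m * ((- of_real (ln x)) ^ 2 / 2) + (- 1) ^ m / fact m * Digamma (of_nat m + 1) * - of_real (ln x)
         + (- 1) ^ m / fact m * (((Digamma (of_nat m + 1)) ^ 2 - Polygamma 1 (of_nat m + 1)) / 2 + of_real pi ^ 2 / 6) * 1)
         + - ((- complex_of_real x) ^ m / fact m) * (of_real L / 12) = c"
        using L unfolding pm c_def by (simp add: field_simps)
    qed (use L in auto)
  qed
  then obtain R where R: "R analytic_on {0}" "deriv R 0 = c" "eventually (\<lambda>w. w * D (- of_nat m + w) / w = R w) (at 0)"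
    by (rule taylor2_quotient_analytic)
  define h where "h w = A (- of_nat m + w) / of_real L - Q (- of_nat m + w) + R w" for w
  have at: "eventually (\<lambda>w. U (- of_nat m + w) = h w) (at 0)"
  proof -
    have "eventually (\<lambda>w. w \<in> ball 0 r - {0}) (at (0::complex))" using r by (intro eventually_at_in_open) auto
    with R(3) show ?thesis
    proof eventually_elim
      case (elim w)
      then have "- of_nat m + w \<in> B - {- of_nat m}" by (simp add: B_def dist_norm)
      from key[OF this] show ?case using elim by (simp add: h_def)
    qed
  qed
  have sh: "((\<lambda>w. f (- of_nat m + w)) has_field_derivative d) (at 0)"
    if "(f has_field_derivative d) (at (- of_nat m))" for f :: "complex \<Rightarrow> complex" and d
    using DERIV_shift[of f d 0 "- of_nat m"] that by (simp add: add.commute)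
  note dA = sh[OF holomorphic_derivI[OF A(1) B]]
  note dQ = sh[OF holomorphic_derivI[OF Q(1) B]]
  note dU = sh[OF holomorphic_derivI[OF U(1) open_UNIV UNIV_I]]
  have dR: "(R has_field_derivative c) (at 0)"
    using R(1) unfolding R(2)[symmetric] by (metis DERIV_deriv_iff_field_differentiable analytic_on_imp_differentiable_at singletonI)
  have dh: "(h has_field_derivative (deriv A (- of_nat m) / of_real L - deriv Q (- of_nat m) + c)) (at 0)"
    unfolding h_def by (intro DERIV_add DERIV_diff DERIV_cdivide dA dQ dR)
  \<comment> \<open>The identity is known only off the centre. Continuity of both sides extends it
    to 0, since comparing derivatives requires a full neighbourhood.\<close>
  have "U (- of_nat m + 0) = h 0"
  proof (rule tendsto_unique)
    show "((\<lambda>w. U (- of_nat m + w)) \<longlongrightarrow> U (- of_nat m + 0)) (at 0)"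
      using DERIV_isCont[OF dU] by (simp add: isCont_def)
    have "(h \<longlongrightarrow> h 0) (at 0)" using DERIV_isCont[OF dh] by (simp add: isCont_def)
    then show "((\<lambda>w. U (- of_nat m + w)) \<longlongrightarrow> h 0) (at 0)"
      by (rule Lim_transform_eventually) (use at in \<open>auto elim: eventually_mono\<close>)
  qed simp
  then have "eventually (\<lambda>w. U (- of_nat m + w) = h w) (nhds 0)"
    using at by (simp add: eventually_nhds_conv_at)
  then have "deriv (\<lambda>w. U (- of_nat m + w)) 0 = deriv h 0" by (intro deriv_cong_ev) auto
  then have main: "deriv U (- of_nat m) = deriv A (- of_nat m) / of_real L - deriv Q (- of_nat m) + c"
    using DERIV_imp_deriv[OF dU] DERIV_imp_deriv[OF dh] by simp
  have up: "deriv (up_term L x n) (- of_nat m) = of_real L * complex_of_real (real n * exp (- L * real n * real m) * exp (- x * exp (L * real n)))" for n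
  proof -
    have "deriv (up_term L x n) (- of_nat m) = of_real (L * real n) * up_term L x n (- of_nat m)"
      unfolding up_term_def by (intro DERIV_imp_deriv) (auto intro!: derivative_eq_intros)
    also have "up_term L x n (- of_nat m) = complex_of_real (exp (- L * real n * real m) * exp (- x * exp (L * real n)))"
      unfolding up_term_def mult_exp_exp exp_of_real[symmetric] by (simp add: exp_of_real[symmetric])
    finally show ?thesis by simp
  qed
  have sU: "((\<lambda>n. complex_of_real (real n * exp (- L * real n * real m) * exp (- x * exp (L * real n)))) has_sum deriv U (- of_nat m) / of_real L) {1..}"
    using has_sum_cmult_right[OF U(2), of "1 / of_real L"] L unfolding up by simp
  then have "heat_sum L x m = deriv U (- of_nat m) / of_real L"
    by (simp add: heat_sum_def has_sum_iff)
  then show "of_real L * heat_sum L x m = (\<Sum>\<^sub>\<infinity>k\<in>UNIV - {0}. deriv (gam_term L x k) (- of_nat m)) / of_real L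
     - (\<Sum>\<^sub>\<infinity>i\<in>UNIV - {m}. deriv (pole_term L x i) (- of_nat m)) + c"
    using main A(2) Q(2) L by (simp add: has_sum_iff)
  show "(\<lambda>k. deriv (gam_term L x k) (- of_nat m)) summable_on UNIV - {0}"
    "(\<lambda>i. deriv (pole_term L x i) (- of_nat m)) summable_on UNIV - {m}"
    "(\<lambda>n. complex_of_real (real n * exp (- L * real n * real m) * exp (- x * exp (L * real n)))) summable_on {1..}"
    using A(2) Q(2) sU by (auto simp: has_sum_iff)
qed

section \<open>Weighted permutation operators\<close>

text \<open>Taken with its maximal domain. With \<sigma> the exchange of the two summands this is
  the off-diagonal Dirac operator, with \<sigma> the identity it covers all the diagonal operators
  built from it.\<close>

definition wperm_op :: "'i set \<Rightarrow> ('i \<Rightarrow> 'i) \<Rightarrow> ('i \<Rightarrow> complex) \<Rightarrow> 'i operator" where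
  "wperm_op S \<sigma> c = {(x, y). x \<in> ell2 S \<and> y \<in> ell2 S \<and> (\<forall>i\<in>S. y i = c i * x (\<sigma> i))}"

abbreviation diag_op :: "'i set \<Rightarrow> ('i \<Rightarrow> complex) \<Rightarrow> 'i operator" where
  "diag_op S c \<equiv> wperm_op S (\<lambda>i. i) c"

lemma ell2_ket: "i \<in> S \<Longrightarrow> (\<lambda>j. c * ket i j) \<in> ell2 S"
proof -
  assume i: "i \<in> S"
  have "(\<lambda>j. (cmod (c * ket i j))\<^sup>2) summable_on {i}" by simp
  then have "(\<lambda>j. (cmod (c * ket i j))\<^sup>2) summable_on S"
    by (rule summable_on_cong_neutral[THEN iffD1, rotated -1]) (use i in \<open>auto simp: ket_def\<close>)
  then show ?thesis using i by (auto simp: ell2_def ket_def)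
qed

lemma ket_in_ell2: "i \<in> S \<Longrightarrow> ket i \<in> ell2 S"
  using ell2_ket[of i S 1] by simp

lemma ell2_inner_ket: "i \<in> S \<Longrightarrow> ell2_inner S (ket i) y = y i"
proof -
  assume i: "i \<in> S"
  have "(\<Sum>\<^sub>\<infinity>j\<in>S. cnj (ket i j) * y j) = (\<Sum>\<^sub>\<infinity>j\<in>{i}. cnj (ket i j) * y j)"
    by (rule infsum_cong_neutral) (use i in \<open>auto simp: ket_def\<close>)
  then show ?thesis by (simp add: ell2_inner_def ket_def)
qed

lemma ell2_inner_ket_right: "i \<in> S \<Longrightarrow> ell2_inner S y (\<lambda>j. c * ket i j) = cnj (y i) * c"
proof -
  assume i: "i \<in> S"
  have "(\<Sum>\<^sub>\<infinity>j\<in>S. cnj (y j) * (c * ket i j)) = (\<Sum>\<^sub>\<infinity>j\<in>{i}. cnj (y j) * (c * ket i j))"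
    by (rule infsum_cong_neutral) (use i in \<open>auto simp: ket_def\<close>)
  then show ?thesis by (simp add: ell2_inner_def ket_def)
qed

lemma diag_op_cong: "(\<And>i. i \<in> S \<Longrightarrow> c i = d i) \<Longrightarrow> diag_op S c = diag_op S d"
  unfolding wperm_op_def by auto

text \<open>One inclusion tests the eigenvector condition on the basis vectors. For the other, an
  eigenvector for \<open>l\<close> vanishes at every index whose eigenvalue differs from
  \<open>l\<close>, so \<open>f (ev j)\<close> may be replaced by \<open>f l\<close> under the
  sum.\<close>

lemma op_fun_diag:
  "op_fun S f (diag_op S (\<lambda>i. complex_of_real (ev i))) = diag_op S (\<lambda>i. f (ev i))"
proof (intro set_eqI iffI; clarify)
  fix x y assume xy: "(x, y) \<in> op_fun S f (diag_op S (\<lambda>i. complex_of_real (ev i)))"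
  have "y i = f (ev i) * x i" if i: "i \<in> S" for i
  proof -
    have "(ket i, \<lambda>j. complex_of_real (ev i) * ket i j) \<in> diag_op S (\<lambda>i. complex_of_real (ev i))"
      using i ell2_ket ket_in_ell2 unfolding wperm_op_def by (auto simp: ket_def)
    then have "ell2_inner S (ket i) y = f (ev i) * ell2_inner S (ket i) x"
      using xy unfolding op_fun_def by blast
    then show ?thesis using i by (simp only: ell2_inner_ket)
  qed
  then show "(x, y) \<in> diag_op S (\<lambda>i. f (ev i))" using xy by (auto simp: op_fun_def wperm_op_def)
next
  fix x y assume xy: "(x, y) \<in> diag_op S (\<lambda>i. f (ev i))"
  have "ell2_inner S v y = f l * ell2_inner S v x"
    if "(v, \<lambda>i. complex_of_real l * v i) \<in> diag_op S (\<lambda>i. complex_of_real (ev i))" for v l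
  proof -
    have "ell2_inner S v y = (\<Sum>\<^sub>\<infinity>j\<in>S. f l * (cnj (v j) * x j))"
      unfolding ell2_inner_def
    proof (rule infsum_cong)
      fix j assume "j \<in> S"
      then have "complex_of_real l * v j = complex_of_real (ev j) * v j" "y j = f (ev j) * x j"
        using that xy by (auto simp: wperm_op_def)
      then show "cnj (v j) * y j = f l * (cnj (v j) * x j)" by (cases "v j = 0") auto
    qed
    then show ?thesis by (simp add: ell2_inner_def infsum_cmult_right')
  qed
  then show "(x, y) \<in> op_fun S f (diag_op S (\<lambda>i. complex_of_real (ev i)))"
    using xy by (auto simp: op_fun_def wperm_op_def)
qed

text \<open>The operator sends the basis vector i to \<open>c (\<sigma> i)\<close> times the basis
  vector \<sigma> i; testing the adjoint on these gives one inclusion. For the converse the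
  intermediate vector \<open>y\<close> has to be shown square-summable, knowing only that
  \<open>x\<close> and \<open>z\<close> are.\<close>

lemma wperm_op_adjoint_comp:
  assumes \<sigma>: "\<And>i. i \<in> S \<Longrightarrow> \<sigma> i \<in> S" "\<And>i. i \<in> S \<Longrightarrow> \<sigma> (\<sigma> i) = i"
  shows "wperm_op S \<sigma> c O op_adjoint S (wperm_op S \<sigma> c) =
    diag_op S (\<lambda>i. complex_of_real ((cmod (c (\<sigma> i)))\<^sup>2))"
proof (intro set_eqI iffI; clarify)
  fix x y z assume xy: "(x, y) \<in> wperm_op S \<sigma> c" and yz: "(y, z) \<in> op_adjoint S (wperm_op S \<sigma> c)"
  have "z i = complex_of_real ((cmod (c (\<sigma> i)))\<^sup>2) * x i" if i: "i \<in> S" for i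
  proof -
    have "(\<lambda>j. 1 * ket i j, \<lambda>j. c (\<sigma> i) * ket (\<sigma> i) j) \<in> wperm_op S \<sigma> c"
      using i \<sigma> ell2_ket[of i S 1] ell2_ket[of "\<sigma> i" S] unfolding wperm_op_def by (auto simp: ket_def)
    then have "ell2_inner S y (\<lambda>j. c (\<sigma> i) * ket (\<sigma> i) j) = ell2_inner S z (\<lambda>j. 1 * ket i j)"
      using yz unfolding op_adjoint_def by blast
    then have "cnj (y (\<sigma> i)) * c (\<sigma> i) = cnj (z i)"
      using i \<sigma> by (simp only: ell2_inner_ket_right mult_1_right)
    then have "z i = y (\<sigma> i) * cnj (c (\<sigma> i))"
      by (metis complex_cnj_cnj complex_cnj_mult)
    also have "y (\<sigma> i) = c (\<sigma> i) * x i" using xy i \<sigma> by (auto simp: wperm_op_def)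
    finally show ?thesis by (simp only: complex_norm_square) (simp add: mult_ac)
  qed
  then show "(x, z) \<in> diag_op S (\<lambda>i. complex_of_real ((cmod (c (\<sigma> i)))\<^sup>2))"
    using xy yz by (auto simp: wperm_op_def op_adjoint_def)
next
  fix x z assume xz: "(x, z) \<in> diag_op S (\<lambda>i. complex_of_real ((cmod (c (\<sigma> i)))\<^sup>2))"
  have z: "z i = complex_of_real ((cmod (c (\<sigma> i)))\<^sup>2) * x i" if "i \<in> S" for i
    using xz that by (auto simp: wperm_op_def)
  have bij: "bij_betw \<sigma> S S"
    by (rule bij_betw_byWitness[where f' = \<sigma>]) (use \<sigma> in auto)
  define y where "y j = (if j \<in> S then c j * x (\<sigma> j) else 0)" for j
  have "(\<lambda>i. (cmod (x i))\<^sup>2 + (cmod (z i))\<^sup>2) summable_on S"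
    using xz by (intro summable_on_add) (auto simp: wperm_op_def ell2_def)
  then have "(\<lambda>j. (cmod (x (\<sigma> j)))\<^sup>2 + (cmod (z (\<sigma> j)))\<^sup>2) summable_on S"
    using summable_on_reindex_bij_betw[OF bij, of "\<lambda>i. (cmod (x i))\<^sup>2 + (cmod (z i))\<^sup>2"] by simp
  then have "(\<lambda>j. (cmod (y j))\<^sup>2) summable_on S"
  proof (rule summable_on_comparison_test)
    fix j assume j: "j \<in> S"
    define a where "a = (cmod (c j))\<^sup>2"
    have "a \<ge> 0" by (simp add: a_def)
    \<comment> \<open>With a = |c|^2 this interpolates: |y|^2 = a |x|^2 is at most |x|^2 + a^2 |x|^2
      = |x|^2 + |z|^2.\<close>
    then have "a \<le> 1 + a\<^sup>2" using zero_le_power2[of "a - 1"]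
      by (simp add: power2_diff)
    then have "a * (cmod (x (\<sigma> j)))\<^sup>2 \<le> (1 + a\<^sup>2) * (cmod (x (\<sigma> j)))\<^sup>2" by (intro mult_right_mono) auto
    moreover have "cmod (z (\<sigma> j)) = a * cmod (x (\<sigma> j))"
      using z[of "\<sigma> j"] j \<sigma> by (simp add: norm_mult a_def norm_power)
    ultimately show "(cmod (y j))\<^sup>2 \<le> (cmod (x (\<sigma> j)))\<^sup>2 + (cmod (z (\<sigma> j)))\<^sup>2"
      using j by (simp add: y_def norm_mult power_mult_distrib a_def algebra_simps)
  qed auto
  then have y: "y \<in> ell2 S" by (auto simp: ell2_def y_def)
  have "ell2_inner S y u' = ell2_inner S z u" if u: "(u, u') \<in> wperm_op S \<sigma> c" for u u'
  proof -
    have "ell2_inner S y u' = (\<Sum>\<^sub>\<infinity>j\<in>S. cnj (z (\<sigma> j)) * u (\<sigma> j))"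
      unfolding ell2_inner_def
    proof (rule infsum_cong)
      fix j assume j: "j \<in> S"
      have "u' j = c j * u (\<sigma> j)" using u j by (auto simp: wperm_op_def)
      moreover have "z (\<sigma> j) = c j * cnj (c j) * x (\<sigma> j)"
        using z[of "\<sigma> j"] j \<sigma> by (simp only: complex_norm_square)
      ultimately show "cnj (y j) * u' j = cnj (z (\<sigma> j)) * u (\<sigma> j)"
        using j by (simp add: y_def mult_ac)
    qed
    also have "\<dots> = ell2_inner S z u"
      unfolding ell2_inner_def by (rule infsum_reindex_bij_betw[OF bij])
    finally show ?thesis .
  qed
  then have "(y, z) \<in> op_adjoint S (wperm_op S \<sigma> c)"
    using y xz by (auto simp: op_adjoint_def wperm_op_def)
  moreover have "(x, y) \<in> wperm_op S \<sigma> c" using y xz by (auto simp: wperm_op_def y_def)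
  ultimately show "(x, z) \<in> wperm_op S \<sigma> c O op_adjoint S (wperm_op S \<sigma> c)" by blast
qed

lemma op_abs_wperm:
  assumes "\<And>i. i \<in> S \<Longrightarrow> \<sigma> i \<in> S" "\<And>i. i \<in> S \<Longrightarrow> \<sigma> (\<sigma> i) = i"
  shows "op_abs S (wperm_op S \<sigma> c) = diag_op S (\<lambda>i. complex_of_real (cmod (c (\<sigma> i))))"
proof -
  have e: "wperm_op S \<sigma> c O op_adjoint S (wperm_op S \<sigma> c) = diag_op S (\<lambda>i. complex_of_real ((cmod (c (\<sigma> i)))\<^sup>2))"
    by (rule wperm_op_adjoint_comp) (use assms in auto)
  show ?thesis unfolding op_abs_def e op_fun_diag by simp
qed

lemma op_scale_diag:
  assumes "r \<noteq> 0"
  shows "op_scale r (diag_op S c) = diag_op S (\<lambda>i. r * c i)"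
proof -
  have sc: "(\<lambda>i. a * y i) \<in> ell2 S" if "y \<in> ell2 S" for a and y :: "'a \<Rightarrow> complex"
    using that by (auto simp: ell2_def norm_mult power_mult_distrib intro: summable_on_cmult_right)
  show ?thesis
  proof (intro set_eqI iffI; clarify)
    fix x y assume "(x, y) \<in> op_scale r (diag_op S c)"
    then show "(x, y) \<in> diag_op S (\<lambda>i. r * c i)" using sc by (auto simp: op_scale_def wperm_op_def)
  next
    fix x y assume xy: "(x, y) \<in> diag_op S (\<lambda>i. r * c i)"
    then have "(x, \<lambda>i. (1 / r) * y i) \<in> diag_op S c"
      using assms sc[of y "1 / r"] by (auto simp: wperm_op_def)
    moreover have "y = (\<lambda>i. r * ((1 / r) * y i))" using assms by auto
    ultimately show "(x, y) \<in> op_scale r (diag_op S c)"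
      unfolding op_scale_def mem_Collect_eq
      by (intro exI[of _ x] exI[of _ "\<lambda>i. (1 / r) * y i"] conjI) (simp_all only:)
  qed
qed

lemma diag_op_single_valued: "single_valued (diag_op S c)"
proof (rule single_valuedI)
  fix x y z assume *: "(x, y) \<in> diag_op S c" "(x, z) \<in> diag_op S c"
  show "y = z"
  proof
    fix i show "y i = z i" using * by (cases "i \<in> S") (auto simp: wperm_op_def ell2_def)
  qed
qed

lemma op_apply_diag_ket:
  assumes "i \<in> S"
  shows "op_apply (diag_op S c) (ket i) = (\<lambda>j. c i * ket i j)"
  unfolding op_apply_def
proof (rule the_equality)
  show *: "(ket i, \<lambda>j. c i * ket i j) \<in> diag_op S c"
    using assms ell2_ket ket_in_ell2 unfolding wperm_op_def by (auto simp: ket_def)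
  fix y assume "(ket i, y) \<in> diag_op S c"
  then show "y = (\<lambda>j. c i * ket i j)" using * diag_op_single_valued by (metis single_valuedD)
qed

lemma op_trace_diag: "op_trace S (diag_op S c) = (\<Sum>\<^sub>\<infinity>i\<in>S. c i)"
  unfolding op_trace_def
  by (rule infsum_cong) (simp add: op_apply_diag_ket ell2_inner_ket, simp add: ket_def)

text \<open>The bound \<open>C\<close> makes the operator everywhere defined and bounded; what is
  left of the trace class condition is the summability of its absolute value, which is again
  diagonal.\<close>

lemma op_trace_class_diag:
  assumes C: "\<And>i. i \<in> S \<Longrightarrow> cmod (c i) \<le> C"
  shows "op_trace_class S (diag_op S c) \<longleftrightarrow> (\<lambda>i. cmod (c i)) summable_on S"
proof -
  have bnd: "(cmod (c i * z))\<^sup>2 \<le> C\<^sup>2 * (cmod z)\<^sup>2" if "i \<in> S" for i z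
    unfolding norm_mult power_mult_distrib using C[OF that] by (intro mult_right_mono power_mono) auto
  have C2: "(\<lambda>i. C\<^sup>2 * (cmod (x i))\<^sup>2) summable_on S" if "x \<in> ell2 S" for x
    using that by (auto simp: ell2_def intro: summable_on_cmult_right)
  have mem: "(\<lambda>i. if i \<in> S then c i * x i else 0) \<in> ell2 S" if "x \<in> ell2 S" for x
  proof -
    have "(\<lambda>i. (cmod (if i \<in> S then c i * x i else 0))\<^sup>2) summable_on S"
      by (rule summable_on_comparison_test[OF C2[OF that]]) (use bnd in auto)
    then show ?thesis by (auto simp: ell2_def)
  qed
  have "op_bounded S (diag_op S c)"
    unfolding op_bounded_def
  proof (intro conjI diag_op_single_valued)
    show "Domain (diag_op S c) = ell2 S"
    proof (intro set_eqI iffI)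
      fix x assume "x \<in> ell2 S"
      then have "(x, \<lambda>i. if i \<in> S then c i * x i else 0) \<in> diag_op S c"
        using mem[of x] by (auto simp: wperm_op_def)
      then show "x \<in> Domain (diag_op S c)" by blast
    qed (auto simp: wperm_op_def)
    show "\<exists>C. \<forall>(x, y)\<in>diag_op S c. ell2_norm S y \<le> C * ell2_norm S x"
    proof (intro exI[of _ "\<bar>C\<bar>"] ballI, clarify)
      fix x y assume xy: "(x, y) \<in> diag_op S c"
      have "(\<Sum>\<^sub>\<infinity>i\<in>S. (cmod (y i))\<^sup>2) \<le> (\<Sum>\<^sub>\<infinity>i\<in>S. C\<^sup>2 * (cmod (x i))\<^sup>2)"
        by (rule infsum_mono) (use xy C2[of x] bnd in \<open>auto simp: wperm_op_def ell2_def\<close>)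
      also have "\<dots> = C\<^sup>2 * (\<Sum>\<^sub>\<infinity>i\<in>S. (cmod (x i))\<^sup>2)" by (rule infsum_cmult_right')
      finally show "ell2_norm S y \<le> \<bar>C\<bar> * ell2_norm S x"
        unfolding ell2_norm_def by (metis real_sqrt_le_mono real_sqrt_mult real_sqrt_abs)
    qed
  qed
  moreover have "(\<lambda>i. ell2_inner S (ket i) (op_apply (op_abs S (diag_op S c)) (ket i))) summable_on S
      \<longleftrightarrow> (\<lambda>i. complex_of_real (cmod (c i))) summable_on S"
  proof (rule summable_on_cong)
    fix i assume i: "i \<in> S"
    have "op_abs S (diag_op S c) = diag_op S (\<lambda>i. complex_of_real (cmod (c i)))"
      by (rule op_abs_wperm) auto
    then show "ell2_inner S (ket i) (op_apply (op_abs S (diag_op S c)) (ket i)) = complex_of_real (cmod (c i))"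
      using i by (simp add: op_apply_diag_ket ell2_inner_ket) (simp add: ket_def)
  qed
  moreover have "(\<lambda>i. complex_of_real (cmod (c i))) summable_on S \<longleftrightarrow> (\<lambda>i. cmod (c i)) summable_on S"
    using summable_on_Re[of "\<lambda>i. complex_of_real (cmod (c i))" S] summable_on_of_real[of "\<lambda>i. cmod (c i)" S] by auto
  ultimately show ?thesis unfolding op_trace_class_def by simp
qed

section \<open>The spectrum of the Dirac operator\<close>

definition swap_sum :: "'a + 'a \<Rightarrow> 'a + 'a" where
  "swap_sum i = (case i of Inl p \<Rightarrow> Inr p | Inr p \<Rightarrow> Inl p)"

definition spin_level :: "spinor_label \<Rightarrow> real" where
  "spin_level i = (case i of Inl p \<Rightarrow> fst p + 1 / 2 | Inr p \<Rightarrow> fst p + 1 / 2)"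

definition dirac_coeff :: "real \<Rightarrow> complex \<Rightarrow> spinor_label \<Rightarrow> complex" where
  "dirac_coeff q w i = (case i of Inl p \<Rightarrow> cnj w | Inr p \<Rightarrow> w) * complex_of_real (q_number q (spin_level i))"

lemma summable_on_Un_iff:
  fixes f :: "'a \<Rightarrow> real"
  shows "f summable_on A \<union> B \<longleftrightarrow> f summable_on A \<and> f summable_on B"
proof
  assume "f summable_on A \<union> B"
  then show "f summable_on A \<and> f summable_on B"
    using summable_on_subset_banach[of f "A \<union> B" A] summable_on_subset_banach[of f "A \<union> B" B] by simp
next
  assume "f summable_on A \<and> f summable_on B"
  then show "f summable_on A \<union> B" using summable_on_union[of f A B] by blast
qed

lemma ell2_Plus:
  "x \<in> ell2 (A <+> B) \<longleftrightarrow> x \<circ> Inl \<in> ell2 A \<and> x \<circ> Inr \<in> ell2 B"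
proof -
  have "(\<lambda>i. (cmod (x i))\<^sup>2) summable_on Inl ` A \<longleftrightarrow> (\<lambda>i. (cmod ((x \<circ> Inl) i))\<^sup>2) summable_on A"
    by (subst summable_on_reindex) (auto simp: o_def)
  moreover have "(\<lambda>i. (cmod (x i))\<^sup>2) summable_on Inr ` B \<longleftrightarrow> (\<lambda>i. (cmod ((x \<circ> Inr) i))\<^sup>2) summable_on B"
    by (subst summable_on_reindex) (auto simp: o_def)
  moreover have "(\<lambda>i. (cmod (x i))\<^sup>2) summable_on A <+> B \<longleftrightarrow>
     (\<lambda>i. (cmod (x i))\<^sup>2) summable_on Inl ` A \<and> (\<lambda>i. (cmod (x i))\<^sup>2) summable_on Inr ` B"
    unfolding Plus_def by (rule summable_on_Un_iff)
  moreover have "(\<forall>i. i \<notin> A <+> B \<longrightarrow> x i = 0) \<longleftrightarrow> (\<forall>i. i \<notin> A \<longrightarrow> (x \<circ> Inl) i = 0) \<and> (\<forall>i. i \<notin> B \<longrightarrow> (x \<circ> Inr) i = 0)"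
    by (auto simp: split_sum_all)
  ultimately show ?thesis unfolding ell2_def by blast
qed

text \<open>As w \<noteq> 0, the vectors \<open>a\<close> and \<open>b\<close> are recovered from
  \<open>y\<close> by division and are again square-summable, so the domain of the matrix operator
  is the maximal one.\<close>

lemma podles_dirac_eq:
  assumes "w \<noteq> 0"
  shows "podles_dirac q w = wperm_op spinor_labels swap_sum (dirac_coeff q w)"
proof (intro set_eqI iffI; clarify)
  fix x y assume "(x, y) \<in> podles_dirac q w"
  then obtain a b where *: "x \<in> ell2 spinor_labels" "y \<in> ell2 spinor_labels"
    "(x \<circ> Inl, a) \<in> podles_D q" "(x \<circ> Inr, b) \<in> podles_D q"
    "y \<circ> Inl = (\<lambda>i. cnj w * b i)" "y \<circ> Inr = (\<lambda>i. w * a i)" unfolding podles_dirac_def by blast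
  have yl: "y (Inl p) = cnj w * b p" "y (Inr p) = w * a p" for p
    using fun_cong[OF *(5), of p] fun_cong[OF *(6), of p] by auto
  have "y i = dirac_coeff q w i * x (swap_sum i)" if "i \<in> spinor_labels" for i
    using that *(3,4) yl
    by (cases i) (auto simp: spinor_labels_def dirac_coeff_def swap_sum_def spin_level_def podles_D_def)
  then show "(x, y) \<in> wperm_op spinor_labels swap_sum (dirac_coeff q w)"
    using * by (auto simp: wperm_op_def)
next
  fix x y assume xy: "(x, y) \<in> wperm_op spinor_labels swap_sum (dirac_coeff q w)"
  have xm: "x \<circ> Inl \<in> ell2 podles_labels" "x \<circ> Inr \<in> ell2 podles_labels"
    and ym: "y \<circ> Inl \<in> ell2 podles_labels" "y \<circ> Inr \<in> ell2 podles_labels"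
    using xy unfolding wperm_op_def spinor_labels_def ell2_Plus by auto
  have sc: "(\<lambda>i. a * z i) \<in> ell2 podles_labels" if "z \<in> ell2 podles_labels" for a z
    using that by (auto simp: ell2_def norm_mult power_mult_distrib intro: summable_on_cmult_right)
  have e: "y (Inl p) = cnj w * q_number q (fst p + 1 / 2) * x (Inr p)"
     "y (Inr p) = w * q_number q (fst p + 1 / 2) * x (Inl p)" if "p \<in> podles_labels" for p
  proof -
    have h: "y i = dirac_coeff q w i * x (swap_sum i)" if "i \<in> spinor_labels" for i
      using xy that by (auto simp: wperm_op_def)
    have "Inl p \<in> spinor_labels" "Inr p \<in> spinor_labels" using that by (auto simp: spinor_labels_def)
    from h[OF this(1)] h[OF this(2)] show "y (Inl p) = cnj w * q_number q (fst p + 1 / 2) * x (Inr p)"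
     "y (Inr p) = w * q_number q (fst p + 1 / 2) * x (Inl p)"
      by (auto simp: dirac_coeff_def swap_sum_def spin_level_def)
  qed
  have "(x \<circ> Inl, \<lambda>p. (1 / w) * (y \<circ> Inr) p) \<in> podles_D q"
    unfolding podles_D_def using sc[OF ym(2), of "1 / w"] xm(1) e assms by auto
  moreover have "(x \<circ> Inr, \<lambda>p. (1 / cnj w) * (y \<circ> Inl) p) \<in> podles_D q"
    unfolding podles_D_def using sc[OF ym(1), of "1 / cnj w"] xm(2) e assms by auto
  moreover have "y \<circ> Inl = (\<lambda>p. cnj w * ((1 / cnj w) * (y \<circ> Inl) p))" "y \<circ> Inr = (\<lambda>p. w * ((1 / w) * (y \<circ> Inr) p))"
    using assms by auto
  ultimately show "(x, y) \<in> podles_dirac q w"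
    unfolding podles_dirac_def mem_Collect_eq prod.case using xy
    by (intro conjI exI[of _ "\<lambda>p. (1 / w) * (y \<circ> Inr) p"] exI[of _ "\<lambda>p. (1 / cnj w) * (y \<circ> Inl) p"])
       (simp_all only: wperm_op_def mem_Collect_eq prod.case)
qed

lemma q_number_pos:
  assumes "0 < q" "q < 1" "x > 0"
  shows "q_number q x > 0"
proof -
  have "q powr x < q powr (- x)" by (rule powr_less_mono') (use assms in auto)
  moreover have "q powr 1 < q powr (- 1)" by (rule powr_less_mono') (use assms in auto)
  ultimately show ?thesis unfolding q_number_def using assms by (intro divide_pos_pos) auto
qed

lemma spin_level_cases:
  assumes "i \<in> spinor_labels"
  obtains n :: nat where "n \<ge> 1" "spin_level i = real n"
proof -
  obtain l m where lm: "(l, m) \<in> podles_labels" "spin_level i = l + 1 / 2"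
    using assms by (cases i) (auto simp: spinor_labels_def spin_level_def)
  then obtain n :: nat where "l = 1 / 2 + real n" by (auto simp: podles_labels_def)
  then show ?thesis using lm by (intro that[of "Suc n"]) auto
qed

lemma abs_dirac_eq:
  assumes "w \<noteq> 0" "0 < q" "q < 1"
  shows "abs_dirac q w = diag_op spinor_labels (\<lambda>i. complex_of_real (cmod w * q_number q (spin_level i)))"
proof -
  have "abs_dirac q w = diag_op spinor_labels (\<lambda>i. complex_of_real (cmod (dirac_coeff q w (swap_sum i))))"
    unfolding podles_dirac_eq[OF assms(1)]
    by (rule op_abs_wperm) (auto simp: swap_sum_def spinor_labels_def split: sum.splits)
  also have "\<dots> = diag_op spinor_labels (\<lambda>i. complex_of_real (cmod w * q_number q (spin_level i)))"
  proof (rule diag_op_cong)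
    fix i assume i: "i \<in> spinor_labels"
    obtain n :: nat where n: "n \<ge> 1" "spin_level i = real n" using spin_level_cases[OF i] .
    have "spin_level (swap_sum i) = spin_level i" by (auto simp: spin_level_def swap_sum_def split: sum.splits)
    moreover have "q_number q (spin_level i) > 0" using n assms by (intro q_number_pos) auto
    ultimately show "complex_of_real (cmod (dirac_coeff q w (swap_sum i))) = complex_of_real (cmod w * q_number q (spin_level i))"
      by (auto simp: dirac_coeff_def norm_mult swap_sum_def split: sum.splits)
  qed
  finally show ?thesis .
qed

text \<open>Here n = l + 1/2 and j = m + l, so that j runs through the 2 l + 1 = 2 n values below 2
  n.\<close>

lemma bij_betw_podles_labels:
  "bij_betw (\<lambda>(n, j). (real n - 1 / 2, real j - (real n - 1 / 2))) (SIGMA n:{1..}. {..<2 * n}) podles_labels"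
proof (rule bij_betw_imageI)
  show "inj_on (\<lambda>(n, j). (real n - 1 / 2, real j - (real n - 1 / 2))) (SIGMA n:{1..}. {..<2 * n})"
    by (auto simp: inj_on_def)
  show "(\<lambda>(n, j). (real n - 1 / 2, real j - (real n - 1 / 2))) ` (SIGMA n:{1..}. {..<2 * n}) = podles_labels"
  proof (intro set_eqI iffI)
    fix p assume "p \<in> (\<lambda>(n, j). (real n - 1 / 2, real j - (real n - 1 / 2))) ` (SIGMA n:{1..}. {..<2 * n})"
    then obtain n j :: nat where nj: "n \<ge> 1" "j < 2 * n" and p: "p = (real n - 1 / 2, real j - (real n - 1 / 2))" by auto
    have "real n - 1 / 2 = 1 / 2 + real (n - 1)" using nj by (simp add: of_nat_diff)
    moreover have "real j - (real n - 1 / 2) = - (real n - 1 / 2) + real j" by simp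
    moreover have "real j - (real n - 1 / 2) \<le> real n - 1 / 2"
    proof -
      have "real j \<le> real (2 * n - 1)" using nj by (simp only: of_nat_le_iff)
      then show ?thesis using nj by (simp add: of_nat_diff)
    qed
    ultimately show "p \<in> podles_labels" unfolding podles_labels_def p by blast
  next
    fix p assume "p \<in> podles_labels"
    then obtain k j :: nat and l m where p: "p = (l, m)" "l = 1 / 2 + real k" "m = - l + real j" "m \<le> l"
      by (auto simp: podles_labels_def)
    have "real j \<le> real (2 * k + 1)" using p by simp
    then have "j < 2 * Suc k" unfolding of_nat_le_iff by simp
    then have "(Suc k, j) \<in> (SIGMA n:{1..}. {..<2 * n})" by auto
    then show "p \<in> (\<lambda>(n, j). (real n - 1 / 2, real j - (real n - 1 / 2))) ` (SIGMA n:{1..}. {..<2 * n})"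
      by (rule rev_image_eqI) (use p in auto)
  qed
qed

lemma podles_labels_sum:
  fixes g :: "real \<Rightarrow> 'b::banach"
  shows "(\<lambda>n. (2 * real n) *\<^sub>R norm (g (real n))) summable_on {1..} \<longleftrightarrow>
       (\<lambda>p. norm (g (fst p + 1 / 2))) summable_on podles_labels" (is "?A \<longleftrightarrow> ?B")
    and "(\<lambda>p. norm (g (fst p + 1 / 2))) summable_on podles_labels \<Longrightarrow>
      ((\<lambda>n. (2 * real n) *\<^sub>R g (real n)) has_sum (\<Sum>\<^sub>\<infinity>p\<in>podles_labels. g (fst p + 1 / 2))) {1..}"
proof -
  let ?\<Sigma> = "SIGMA n:{1::nat..}. {..<2 * n}"
  have eq: "h (fst ((\<lambda>(n, j). (real n - 1 / 2, real j - (real n - 1 / 2))) p) + 1 / 2) = h (real (fst p))"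
    for h :: "real \<Rightarrow> 'c" and p :: "nat \<times> nat" by (cases p) simp
  have B: "?B \<longleftrightarrow> (\<lambda>p. norm (g (real (fst p)))) summable_on ?\<Sigma>"
    using summable_on_reindex_bij_betw[OF bij_betw_podles_labels, of "\<lambda>p. norm (g (fst p + 1 / 2))"]
    unfolding eq by simp
  have fib: "((\<lambda>j. h (real (fst (n, j)))) has_sum (2 * real n) *\<^sub>R h (real n)) {..<2 * n}" for n and h :: "real \<Rightarrow> 'c::banach"
    by (rule has_sum_finiteI) (simp_all add: sum_constant_scaleR)
  show "?A \<longleftrightarrow> ?B"
  proof
    assume ?A
    show ?B unfolding B
      by (rule summable_on_SigmaI[where g = "\<lambda>n. (2 * real n) *\<^sub>R norm (g (real n))"])
         (use fib[of "\<lambda>x. norm (g x)"] \<open>?A\<close> in auto)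
  next
    assume ?B
    then have "((\<lambda>p. norm (g (real (fst p)))) has_sum (\<Sum>\<^sub>\<infinity>p\<in>?\<Sigma>. norm (g (real (fst p))))) ?\<Sigma>" unfolding B by (rule has_sum_infsum)
    from has_sum_SigmaD[OF this fib[of "\<lambda>x. norm (g x)"]] show ?A by (rule has_sum_imp_summable)
  qed
  assume ?B
  then have "(\<lambda>p. norm (g (real (fst p)))) summable_on ?\<Sigma>" unfolding B .
  then have "(\<lambda>p. g (real (fst p))) summable_on ?\<Sigma>" by (rule abs_summable_summable)
  then have "((\<lambda>p. g (real (fst p))) has_sum (\<Sum>\<^sub>\<infinity>p\<in>?\<Sigma>. g (real (fst p)))) ?\<Sigma>" by (rule has_sum_infsum)
  from has_sum_SigmaD[OF this fib[of g]]
  have "((\<lambda>n. (2 * real n) *\<^sub>R g (real n)) has_sum (\<Sum>\<^sub>\<infinity>p\<in>?\<Sigma>. g (real (fst p)))) {1..}" .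
  also have "(\<Sum>\<^sub>\<infinity>p\<in>?\<Sigma>. g (real (fst p))) = (\<Sum>\<^sub>\<infinity>p\<in>podles_labels. g (fst p + 1 / 2))"
    using infsum_reindex_bij_betw[OF bij_betw_podles_labels, of "\<lambda>p. g (fst p + 1 / 2)"] unfolding eq .
  finally show "((\<lambda>n. (2 * real n) *\<^sub>R g (real n)) has_sum (\<Sum>\<^sub>\<infinity>p\<in>podles_labels. g (fst p + 1 / 2))) {1..}" .
qed

text \<open>The two summands and the 2 n values of m give the multiplicity 4 n of level n.\<close>

lemma spinor_labels_sum:
  fixes g :: "real \<Rightarrow> complex"
  shows "(\<lambda>n. 4 * real n * norm (g (real n))) summable_on {1..} \<longleftrightarrow>
       (\<lambda>i. norm (g (spin_level i))) summable_on spinor_labels"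
    and "(\<lambda>i. norm (g (spin_level i))) summable_on spinor_labels \<Longrightarrow>
      ((\<lambda>n. of_real (4 * real n) * g (real n)) has_sum (\<Sum>\<^sub>\<infinity>i\<in>spinor_labels. g (spin_level i))) {1..}"
proof -
  have spl: "spinor_labels = Inl ` podles_labels \<union> Inr ` podles_labels" "Inl ` podles_labels \<inter> Inr ` podles_labels = {}"
    by (auto simp: spinor_labels_def Plus_def)
  have o: "(h \<circ> spin_level) \<circ> Inl = (\<lambda>p. h (fst p + 1 / 2))" "(h \<circ> spin_level) \<circ> Inr = (\<lambda>p. h (fst p + 1 / 2))" for h :: "real \<Rightarrow> 'c"
    by (auto simp: spin_level_def)
  have sm: "(h \<circ> spin_level) summable_on spinor_labels \<longleftrightarrow> (\<lambda>p. h (fst p + 1 / 2)) summable_on podles_labels" for h :: "real \<Rightarrow> real"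
  proof -
    have "(h \<circ> spin_level) summable_on Inl ` podles_labels \<longleftrightarrow> (\<lambda>p. h (fst p + 1 / 2)) summable_on podles_labels"
      "(h \<circ> spin_level) summable_on Inr ` podles_labels \<longleftrightarrow> (\<lambda>p. h (fst p + 1 / 2)) summable_on podles_labels"
      using o[of h] by (simp_all add: summable_on_reindex)
    then show ?thesis unfolding spl(1) summable_on_Un_iff by simp
  qed
  have "(\<lambda>n. 4 * real n * norm (g (real n))) summable_on {1..} \<longleftrightarrow> (\<lambda>n. (2 * real n) *\<^sub>R norm (g (real n))) summable_on {1..}"
    using summable_on_cmult_right'[of 2 "\<lambda>n. (2 * real n) *\<^sub>R norm (g (real n))" "{1..}"]
    by (simp add: mult_ac)
  also have "\<dots> \<longleftrightarrow> (\<lambda>p. norm (g (fst p + 1 / 2))) summable_on podles_labels" by (rule podles_labels_sum)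
  also have "\<dots> \<longleftrightarrow> (\<lambda>i. norm (g (spin_level i))) summable_on spinor_labels"
    using sm[of "\<lambda>x. norm (g x)"] by (simp add: o_def)
  finally show iff: "(\<lambda>n. 4 * real n * norm (g (real n))) summable_on {1..} \<longleftrightarrow>
       (\<lambda>i. norm (g (spin_level i))) summable_on spinor_labels" .
  assume "(\<lambda>i. norm (g (spin_level i))) summable_on spinor_labels"
  then have P: "(\<lambda>p. norm (g (fst p + 1 / 2))) summable_on podles_labels"
    using sm[of "\<lambda>x. norm (g x)"] by (simp add: o_def)
  then have "(\<lambda>p. g (fst p + 1 / 2)) summable_on podles_labels" by (rule abs_summable_summable)
  then have hs: "((\<lambda>p. g (fst p + 1 / 2)) has_sum (\<Sum>\<^sub>\<infinity>p\<in>podles_labels. g (fst p + 1 / 2))) podles_labels" by (rule has_sum_infsum)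
  have "((g \<circ> spin_level) has_sum (\<Sum>\<^sub>\<infinity>p\<in>podles_labels. g (fst p + 1 / 2))) (Inl ` podles_labels)"
    "((g \<circ> spin_level) has_sum (\<Sum>\<^sub>\<infinity>p\<in>podles_labels. g (fst p + 1 / 2))) (Inr ` podles_labels)"
    using hs o[of g] by (simp_all add: has_sum_reindex)
  from has_sum_Un_disjoint[OF this spl(2)]
  have "(\<Sum>\<^sub>\<infinity>i\<in>spinor_labels. g (spin_level i)) = 2 * (\<Sum>\<^sub>\<infinity>p\<in>podles_labels. g (fst p + 1 / 2))"
    unfolding spl(1)[symmetric] by (simp add: has_sum_iff o_def)
  moreover have "((\<lambda>n. 2 * ((2 * real n) *\<^sub>R g (real n))) has_sum (2 * (\<Sum>\<^sub>\<infinity>p\<in>podles_labels. g (fst p + 1 / 2)))) {1..}"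
    by (intro has_sum_cmult_right podles_labels_sum P)
  ultimately show "((\<lambda>n. of_real (4 * real n) * g (real n)) has_sum (\<Sum>\<^sub>\<infinity>i\<in>spinor_labels. g (spin_level i))) {1..}"
    by (simp add: scaleR_conv_of_real mult_ac)
qed

section \<open>Meromorphic continuation of the zeta function\<close>

text \<open>This is 1/(4 sinh^2 (L z/2)), and for Re z > 0 the sum of n e^(-L n z) over n \<ge> 1.
  It arises twice, from summing the zeta function over the levels and, up to a factor, as the
  derivative of \<open>pole_term\<close>; this is what lets the two expansions match.\<close>

definition csch_kernel :: "real \<Rightarrow> complex \<Rightarrow> complex" where
  "csch_kernel L z = exp (- of_real L * z) / (1 - exp (- of_real L * z))\<^sup>2"

text \<open>The j-th term of the binomial series of (1 - e^(-2 L n))^(-s), multiplied by n e^(-L n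
  s) and summed over n. Its poles lie on the line Re s = -2 j.\<close>

definition zeta_term :: "real \<Rightarrow> nat \<Rightarrow> complex \<Rightarrow> complex" where
  "zeta_term L j s = pochhammer s j / fact j * csch_kernel L (s + 2 * of_nat j)"

definition zeta_series :: "real \<Rightarrow> real \<Rightarrow> complex \<Rightarrow> complex" where
  "zeta_series L u s = 4 * exp (- s * of_real (ln u)) * (\<Sum>\<^sub>\<infinity>j. zeta_term L j s)"

lemma norm_pochhammer_le:
  fixes s :: complex
  assumes "norm s \<le> R"
  shows "norm (pochhammer s j) \<le> pochhammer R j"
proof -
  have "norm (s + of_nat i) \<le> R + real i" for i
    using norm_triangle_ineq[of s "of_nat i"] assms by simp
  then show ?thesis unfolding pochhammer_prod prod_norm[symmetric] by (intro prod_mono) auto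
qed

lemma pochhammer_real_nonneg: "R \<ge> 0 \<Longrightarrow> pochhammer R j \<ge> (0 :: real)"
  unfolding pochhammer_prod by (intro prod_nonneg) auto

text \<open>The binomial series of (1 - y)^(-R), which has nonnegative terms; it dominates the
  complex series with exponent s when |s| \<le> R.\<close>

lemma pochhammer_series:
  fixes R y :: real
  assumes "R \<ge> 0" "0 \<le> y" "y < 1"
  shows "(\<lambda>j. pochhammer R j / fact j * y ^ j) summable_on A"
proof -
  have "(\<lambda>j. (- R gchoose j) * (- y) ^ j) sums (1 + - y) powr (- R)"
    using assms by (intro gen_binomial_real) auto
  moreover have "(- R gchoose j) * (- y) ^ j = pochhammer R j / fact j * y ^ j" for j
    unfolding gbinomial_pochhammer power_minus[of y]
    by (cases "even j") auto
  ultimately have "summable (\<lambda>j. pochhammer R j / fact j * y ^ j)" by (simp add: sums_iff)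
  then have "(\<lambda>j. pochhammer R j / fact j * y ^ j) summable_on UNIV"
    using assms by (subst summable_on_UNIV_nonneg_real_iff) (auto intro!: mult_nonneg_nonneg divide_nonneg_nonneg pochhammer_real_nonneg)
  then show ?thesis by (rule summable_on_subset_banach) simp
qed

lemma has_sum_nat_geometric:
  fixes z :: complex
  assumes "norm z < 1"
  shows "((\<lambda>n. of_nat n * z ^ n) has_sum (z / (1 - z)\<^sup>2)) {1..}" "(\<lambda>n. real n * norm z ^ n) summable_on {1..}"
proof -
  have im: "{1..} = Suc ` UNIV" using image_Suc_atLeastLessThan by (auto simp: image_iff Suc_le_eq gr0_conv_Suc)
  have s: "summable (\<lambda>n. real (Suc n) * r ^ n)" if "0 \<le> r" "r < 1" for r :: real
    using geometric_deriv_sums[of r] that by (simp add: sums_iff)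
  have "summable (\<lambda>n. norm (of_nat (Suc n) * z ^ n))"
    using s[of "norm z"] assms by (simp add: norm_mult norm_power del: of_nat_Suc)
  then have "((\<lambda>n. of_nat (Suc n) * z ^ n) has_sum (1 / (1 - z)\<^sup>2)) UNIV"
    using geometric_deriv_sums[OF assms] by (intro norm_summable_imp_has_sum)
  from has_sum_cmult_right[OF this, of z] show "((\<lambda>n. of_nat n * z ^ n) has_sum (z / (1 - z)\<^sup>2)) {1..}"
    unfolding im by (subst has_sum_reindex) (auto simp: o_def mult_ac)
  have "summable (\<lambda>n. norm z * (real (Suc n) * norm z ^ n))"
    by (intro summable_mult s) (use assms in auto)
  then have "(\<lambda>n. norm z * (real (Suc n) * norm z ^ n)) summable_on UNIV"
    by (subst summable_on_UNIV_nonneg_real_iff) auto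
  then show "(\<lambda>n. real n * norm z ^ n) summable_on {1..}"
    unfolding im by (subst summable_on_reindex) (auto simp: o_def mult_ac)
qed

lemma csch_kernel_analytic:
  assumes "exp (- of_real L * z) \<noteq> 1"
  shows "csch_kernel L analytic_on {z}"
  unfolding csch_kernel_def using assms by (intro analytic_intros) auto

lemma holomorphic_zeta_term:
  assumes "\<And>s. s \<in> S \<Longrightarrow> exp (- of_real L * (s + 2 * of_nat j)) \<noteq> 1"
  shows "zeta_term L j holomorphic_on S"
proof -
  have "(1 - exp (- of_real L * (s + 2 * of_nat j)))\<^sup>2 \<noteq> 0" if "s \<in> S" for s
    using assms[OF that] by (metis eq_iff_diff_eq_0 power_eq_0_iff)
  then show ?thesis
    unfolding zeta_term_def csch_kernel_def pochhammer_prod by (intro holomorphic_intros) auto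
qed

text \<open>Near \<open>s\<close> the Pochhammer symbol is dominated by its value at
  \<open>R\<close>, and the kernel contributes e^(-2 L j); the binomial series at y = e^(-2 L) is a
  majorant.\<close>

lemma loc_dominated_zeta_term:
  assumes "L > 0"
  shows "loc_dominated UNIV (zeta_term L) UNIV"
proof (rule loc_dominatedI)
  fix s :: complex
  define R where "R = norm s + 1"
  have R: "R \<ge> 0" by (simp add: R_def)
  \<comment> \<open>Past this index L (Re z + 2 j) \<ge> 1, so the denominator of the kernel is at
    least 1/4 in modulus.\<close>
  define N where "N = nat \<lceil>R + 1 / L\<rceil>"
  define M where "M j = 4 * exp (L * R) * (pochhammer R j / fact j * exp (- 2 * L) ^ j)" for j
  have "norm (zeta_term L j z) \<le> M j" if j: "j \<in> UNIV - {..<N}" and z: "z \<in> cball s 1" for j z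
  proof -
    have zR: "norm z \<le> R" using z norm_triangle_ineq2[of z s] by (simp add: R_def dist_norm norm_minus_commute)
    have "real N \<ge> R + 1 / L" unfolding N_def by (rule real_nat_ceiling_ge)
    then have "real j \<ge> R + 1 / L" using j by auto
    moreover have Rez: "Re z \<ge> - R" using abs_Re_le_cmod[of z] zR by linarith
    ultimately have "Re z + 2 * real j \<ge> 1 / L" using R assms by simp
    then have "L * (Re z + 2 * real j) \<ge> 1" using assms by (simp add: field_simps)
    then have "exp (- (L * (Re z + 2 * real j))) \<le> exp (- 1)" by simp
    also have "\<dots> \<le> 1 / 2" using exp_ge_add_one_self[of 1] by (simp add: exp_minus field_simps)
    finally have "norm (exp (- of_real L * (z + 2 * of_nat j))) \<le> 1 / 2" by simp
    then have "norm (1 - exp (- of_real L * (z + 2 * of_nat j))) \<ge> 1 / 2"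
      using norm_triangle_ineq2[of 1 "exp (- of_real L * (z + 2 * of_nat j))"] by simp
    then have "(1 / 2)\<^sup>2 \<le> (norm (1 - exp (- of_real L * (z + 2 * of_nat j))))\<^sup>2" by (intro power_mono) auto
    then have "inverse ((norm (1 - exp (- of_real L * (z + 2 * of_nat j))))\<^sup>2) \<le> inverse ((1 / 2)\<^sup>2)"
      by (rule le_imp_inverse_le) simp
    then have i: "inverse ((norm (1 - exp (- of_real L * (z + 2 * of_nat j))))\<^sup>2) \<le> 4" by (simp add: power2_eq_square)
    have e: "norm (exp (- of_real L * (z + 2 * of_nat j))) \<le> exp (L * R) * exp (- 2 * L) ^ j"
    proof -
      have "- L * (Re z + 2 * real j) \<le> L * R + real j * (- 2 * L)"
        using mult_left_mono[OF Rez, of L] assms by (simp add: algebra_simps)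
      then have "exp (- L * (Re z + 2 * real j)) \<le> exp (L * R + real j * (- 2 * L))" by simp
      also have "\<dots> = exp (L * R) * exp (- 2 * L) ^ j" by (simp only: exp_add exp_of_nat_mult)
      finally show ?thesis by simp
    qed
    have p: "norm (pochhammer z j) \<le> pochhammer R j" by (rule norm_pochhammer_le[OF zR])
    have "norm (zeta_term L j z) = norm (pochhammer z j) / fact j * (norm (exp (- of_real L * (z + 2 * of_nat j))) *
        inverse ((norm (1 - exp (- of_real L * (z + 2 * of_nat j))))\<^sup>2))"
      by (simp add: zeta_term_def csch_kernel_def norm_mult norm_divide norm_power divide_inverse norm_inverse power_inverse)
    also have "\<dots> \<le> pochhammer R j / fact j * ((exp (L * R) * exp (- 2 * L) ^ j) * 4)"
      using R by (intro mult_mono divide_right_mono p e i) (auto intro!: divide_nonneg_nonneg pochhammer_real_nonneg)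
    finally show ?thesis by (simp add: M_def mult_ac)
  qed
  moreover have "M summable_on UNIV - {..<N}"
    unfolding M_def using assms R by (intro summable_on_cmult_right pochhammer_series) auto
  ultimately show "\<exists>r>0. \<exists>F M. finite F \<and> M summable_on (UNIV - F) \<and>
      (\<forall>i\<in>UNIV - F. \<forall>z\<in>cball s r. norm (zeta_term L i z) \<le> M i)"
    by (intro exI[of _ 1] conjI exI[of _ "{..<N}"] exI[of _ M]) auto
qed

definition zeta_tail :: "real \<Rightarrow> nat \<Rightarrow> complex \<Rightarrow> complex" where
  "zeta_tail L N s = (\<Sum>\<^sub>\<infinity>j\<in>{N..}. zeta_term L j s)"

text \<open>The poles of the j-th term have real part -2 j, so dropping the first \<open>N\<close>
  terms leaves a function holomorphic for Re s > -2 N. Every local question about the zeta series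
  thus concerns finitely many explicit terms.\<close>

lemma
  assumes L: "L > 0"
  shows holomorphic_zeta_tail: "zeta_tail L N holomorphic_on {s. Re s > - 2 * real N}"
    and zeta_series_split: "Re s > - 2 * real N \<Longrightarrow>
       zeta_series L u s = 4 * exp (- s * of_real (ln u)) * ((\<Sum>j<N. zeta_term L j s) + zeta_tail L N s)"
proof -
  have o: "open {s::complex. Re s > - 2 * real N}" by (rule open_halfspace_Re_gt)
  have h: "zeta_term L j holomorphic_on {s. Re s > - 2 * real N}" if j: "j \<in> {N..}" for j
  proof (rule holomorphic_zeta_term)
    fix s :: complex assume s: "s \<in> {s. Re s > - 2 * real N}"
    then have "Re (s + 2 * of_nat j) > 0" using j by simp
    then have "norm (exp (- of_real L * (s + 2 * of_nat j))) < 1" using L by simp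
    then show "exp (- of_real L * (s + 2 * of_nat j)) \<noteq> 1" by (metis norm_one less_irrefl)
  qed
  have d: "loc_dominated {N..} (zeta_term L) {s. Re s > - 2 * real N}"
    using loc_dominated_subset[OF loc_dominated_zeta_term[OF L]] by simp
  show "zeta_tail L N holomorphic_on {s. Re s > - 2 * real N}"
    unfolding zeta_tail_def[abs_def] by (rule holomorphic_on_infsum[OF o h d])
  show "zeta_series L u s = 4 * exp (- s * of_real (ln u)) * ((\<Sum>j<N. zeta_term L j s) + zeta_tail L N s)"
    if s: "Re s > - 2 * real N"
  proof -
    have "(\<lambda>j. norm (zeta_term L j s)) summable_on {N..}"
      by (rule abs_summable_loc_dominated[OF o h d]) (use s in auto)
    then have "(\<lambda>j. zeta_term L j s) summable_on {N..}" by (rule abs_summable_summable)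
    then have "(\<Sum>\<^sub>\<infinity>j\<in>{..<N} \<union> {N..}. zeta_term L j s) = (\<Sum>\<^sub>\<infinity>j\<in>{..<N}. zeta_term L j s) + (\<Sum>\<^sub>\<infinity>j\<in>{N..}. zeta_term L j s)"
      by (intro infsum_Un_disjoint) auto
    moreover have "{..<N} \<union> {N..} = UNIV" by auto
    ultimately show ?thesis by (simp add: zeta_series_def zeta_tail_def)
  qed
qed

lemma meromorphic_zeta_series:
  assumes L: "L > 0"
  shows "zeta_series L u meromorphic_on UNIV"
proof -
  have "zeta_series L u meromorphic_on {z}" for z
  proof -
    define N where "N = nat \<lceil>norm z\<rceil> + 1"
    define H where "H = {s::complex. Re s > - 2 * real N}"
    have H: "open H" unfolding H_def by (rule open_halfspace_Re_gt)
    have "real N \<ge> norm z + 1"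
      unfolding N_def of_nat_add of_nat_1 using real_nat_ceiling_ge[of "norm z"] by linarith
    then have "Re z > - 2 * real N" using abs_Re_le_cmod[of z] norm_ge_zero[of z] by linarith
    then have zH: "z \<in> H" by (simp add: H_def)
    have "zeta_tail L N analytic_on {z}"
      using holomorphic_zeta_tail[OF L, of N] H zH analytic_at unfolding H_def by blast
    then have t: "zeta_tail L N meromorphic_on {z}" by (rule analytic_on_imp_meromorphic_on)
    have zt: "zeta_term L j meromorphic_on {z}" for j
      unfolding zeta_term_def csch_kernel_def pochhammer_prod
      by (intro meromorphic_intros analytic_on_imp_meromorphic_on analytic_intros)
    have "(\<lambda>s. exp (- s * of_real (ln u))) meromorphic_on {z}"
      by (intro analytic_on_imp_meromorphic_on analytic_intros)
    then have "(\<lambda>s. 4 * exp (- s * of_real (ln u)) * ((\<Sum>j<N. zeta_term L j s) + zeta_tail L N s)) meromorphic_on {z}"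
      by (intro meromorphic_intros t zt)
    also have "?this \<longleftrightarrow> zeta_series L u meromorphic_on {z}"
    proof (rule meromorphic_on_cong)
      fix z' assume "z' \<in> {z}"
      then have "eventually (\<lambda>w. w \<in> H) (at z')" using H zH by (intro eventually_at_in_open') auto
      then show "eventually (\<lambda>s. 4 * exp (- s * of_real (ln u)) * ((\<Sum>j<N. zeta_term L j s) + zeta_tail L N s) = zeta_series L u s) (at z')"
        by eventually_elim (simp add: zeta_series_split[OF L, of N] H_def)
    qed simp
    finally show ?thesis .
  qed
  then show ?thesis unfolding meromorphic_on_def by blast
qed

text \<open>The identity theorem gives equality off a sparse set, hence the same poles and the same
  limits everywhere; the normalisation of nicely meromorphic functions then fixes the value at each
  point.\<close>

lemma nicely_meromorphic_unique:
  assumes Z: "Z1 nicely_meromorphic_on UNIV" "Z2 nicely_meromorphic_on UNIV"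
    and eq: "\<And>s. Re s > 0 \<Longrightarrow> Z1 s = Z2 s"
  shows "Z1 = Z2"
proof -
  have m: "Z1 meromorphic_on UNIV" "Z2 meromorphic_on UNIV" using Z by (auto simp: nicely_meromorphic_on_def)
  have "(\<lambda>s. Z1 s - Z2 s) meromorphic_on UNIV" using m by (intro meromorphic_intros)
  then have "(\<forall>\<^sub>\<approx>x\<in>UNIV. Z1 x - Z2 x = 0) \<or> (\<forall>\<^sub>\<approx>x\<in>UNIV. Z1 x - Z2 x \<noteq> 0)"
    by (rule meromorphic_imp_constant_or_avoid) auto
  then have "\<forall>\<^sub>\<approx>x\<in>UNIV. Z1 x - Z2 x = 0"
  proof
    assume "\<forall>\<^sub>\<approx>x\<in>UNIV. Z1 x - Z2 x \<noteq> 0"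
    then have 1: "eventually (\<lambda>x. Z1 x - Z2 x \<noteq> 0) (at 1)"
      by (rule eventually_cosparse_imp_eventually_at) simp
    have "eventually (\<lambda>x. x \<in> {s. Re s > 0}) (at (1::complex))"
      by (intro eventually_at_in_open') (auto simp: open_halfspace_Re_gt)
    with 1 have "eventually (\<lambda>x. False) (at (1::complex))"
      by eventually_elim (use eq in auto)
    then show ?thesis by simp
  qed
  then have ev: "eventually (\<lambda>x. Z1 x = Z2 x) (at z)" for z
    using eventually_cosparse_imp_eventually_at[of "\<lambda>x. Z1 x - Z2 x = 0" UNIV z UNIV] by simp
  show ?thesis
  proof
    fix z
    have pole: "is_pole Z1 z \<longleftrightarrow> is_pole Z2 z" by (rule is_pole_cong[OF ev refl])
    have n: "(is_pole Z1 z \<and> Z1 z = 0) \<or> Z1 \<midarrow>z\<rightarrow> Z1 z" "(is_pole Z2 z \<and> Z2 z = 0) \<or> Z2 \<midarrow>z\<rightarrow> Z2 z"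
      using Z by (auto simp: nicely_meromorphic_on_def)
    have np: "\<not> is_pole f z" if "f \<midarrow>z\<rightarrow> c" for f and c :: complex
      using not_tendsto_and_filterlim_at_infinity[of "at z" f c] that by (auto simp: is_pole_def)
    show "Z1 z = Z2 z"
    proof (cases "is_pole Z1 z")
      case True
      then show ?thesis using n pole np by metis
    next
      case False
      then have "Z1 \<midarrow>z\<rightarrow> Z1 z" "Z2 \<midarrow>z\<rightarrow> Z2 z" using n pole by auto
      moreover have "Z1 \<midarrow>z\<rightarrow> Z2 z"
        using \<open>Z2 \<midarrow>z\<rightarrow> Z2 z\<close> by (rule Lim_transform_eventually) (use ev[of z] in \<open>auto elim: eventually_mono\<close>)
      ultimately show ?thesis using LIM_unique by blast
    qed
  qed
qed

section \<open>The zeta function of the Dirac operator\<close>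

locale podles =
  fixes q u L :: real and w :: complex
  assumes q: "0 < q" "q < 1" and w: "w \<noteq> 0" and u_def: "u = cmod w * q / (1 - q\<^sup>2)" and L_def: "L = - ln q"
begin

lemma L_pos: "L > 0" using q by (simp add: L_def)

lemma u_pos: "u > 0"
proof -
  have "q\<^sup>2 < 1" using q by (simp add: power_less_one_iff)
  then show ?thesis unfolding u_def using q w by simp
qed

lemma q_powr: "q powr x = exp (- L * x)"
  using q by (simp add: powr_def L_def mult.commute)

text \<open>Since q^(-1) - q = (1 - q^2)/q, the constant \<open>u\<close> is |w| divided by the
  denominator of the q-number.\<close>

lemma dirac_eigenvalue:
  "cmod w * q_number q x = u * (exp (L * x) - exp (- L * x))"
proof -
  have "q powr (- 1) - q = (1 - q\<^sup>2) / q"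
    using q by (simp add: powr_minus field_simps power2_eq_square)
  then show ?thesis
    unfolding q_number_def u_def q_powr using q by simp
qed

lemma dirac_eigenvalue_pos: "x > 0 \<Longrightarrow> u * (exp (L * x) - exp (- L * x)) > 0"
proof -
  assume "x > 0"
  then have "- L * x < L * x" using L_pos mult_pos_pos[OF L_pos, of x] by linarith
  then show ?thesis using u_pos by simp
qed

text \<open>The eigenvalue of level n is u e^(L n) (1 - e^(-2 L n)). Its power -s is expanded by the
  binomial series; for Re s > 0 the double series converges absolutely, so the sum over n can be
  carried out first and yields \<open>csch_kernel\<close>.\<close>

lemma zeta_trace:
  assumes s: "Re s > 0"
  shows "op_trace spinor_labels (op_fun spinor_labels (\<lambda>x. complex_of_real x powr (- s)) (abs_dirac q w)) = zeta_series L u s"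
proof -
  define g where "g x = complex_of_real (u * (exp (L * x) - exp (- L * x))) powr (- s)" for x
  have tr: "op_trace spinor_labels (op_fun spinor_labels (\<lambda>x. complex_of_real x powr (- s)) (abs_dirac q w)) =
     (\<Sum>\<^sub>\<infinity>i\<in>spinor_labels. g (spin_level i))"
    unfolding abs_dirac_eq[OF w q] op_fun_diag op_trace_diag dirac_eigenvalue g_def ..
  define F where "F n j = of_nat n * exp (- of_real L * (s + 2 * of_nat j)) ^ n * (pochhammer s j / fact j)" for n j :: nat
  have F1: "((\<lambda>j. F n j) has_sum (of_real (real n) * g (real n) * exp (s * of_real (ln u)))) UNIV" if n: "n \<ge> 1" for n
  proof -
    define y where "y = exp (- 2 * L * real n)"
    have y: "0 < y" "y < 1" using L_pos n by (auto simp: y_def)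
    have 1: "(\<lambda>j. (- s gchoose j) * (- of_real y) ^ j) sums (1 + - of_real y) powr (- s)"
      using y by (intro gen_binomial_complex) auto
    have t: "(- s gchoose j) * (- of_real y) ^ j = pochhammer s j / fact j * of_real y ^ j" for j
      unfolding gbinomial_pochhammer power_minus[of "of_real y"] by (cases "even j") auto
    have sm: "summable (\<lambda>j. norm (pochhammer s j / fact j * complex_of_real y ^ j))"
    proof (rule summable_comparison_test')
      have "(\<lambda>j. pochhammer (norm s) j / fact j * y ^ j) summable_on UNIV" using y by (intro pochhammer_series) auto
      then show "summable (\<lambda>j. pochhammer (norm s) j / fact j * y ^ j)" by (rule summable_on_imp_summable)
      show "norm (norm (pochhammer s j / fact j * complex_of_real y ^ j)) \<le> pochhammer (norm s) j / fact j * y ^ j" if "j \<ge> 0" for j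
        using norm_pochhammer_le[of s "norm s" j] y
        by (simp add: norm_mult norm_divide norm_power divide_right_mono mult_right_mono)
    qed
    have 2: "((\<lambda>j. pochhammer s j / fact j * of_real y ^ j) has_sum (1 + - of_real y) powr (- s)) UNIV"
      using 1 sm unfolding t by (intro norm_summable_imp_has_sum)
    have ln: "ln (u * (exp (L * real n) - exp (- L * real n))) = ln u + L * real n + ln (1 - y)"
    proof -
      have "exp (L * real n) - exp (- L * real n) = exp (L * real n) * (1 - y)"
        by (simp add: y_def algebra_simps exp_add[symmetric])
      then show ?thesis using u_pos y by (simp add: ln_mult)
    qed
    have "g (real n) = exp (- s * of_real (ln (u * (exp (L * real n) - exp (- L * real n)))))"
    proof -
      define t where "t = u * (exp (L * real n) - exp (- L * real n))"
      have "t > 0" unfolding t_def using n by (intro dirac_eigenvalue_pos) simp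
      then show ?thesis unfolding g_def t_def[symmetric] by (simp add: powr_def Ln_of_real)
    qed
    also have "\<dots> = exp (- s * of_real (ln u)) * exp (- s * of_real (L * real n)) * exp (- s * of_real (ln (1 - y)))"
      unfolding ln mult_exp_exp by (simp add: algebra_simps)
    also have "exp (- s * of_real (ln (1 - y))) = (1 + - of_real y) powr (- s)"
    proof -
      have "complex_of_real (1 - y) powr (- s) = exp (- s * of_real (ln (1 - y)))"
        using y by (simp add: powr_def Ln_of_real del: of_real_diff)
      then show ?thesis by simp
    qed
    finally have g: "g (real n) = exp (- s * of_real (ln u)) * exp (- s * of_real (L * real n)) * (1 + - of_real y) powr (- s)" .
    have "of_real (real n) * g (real n) * exp (s * of_real (ln u)) =
      (of_nat n * exp (- s * of_real (L * real n))) * (1 + - of_real y) powr (- s)"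
      unfolding g by (simp add: exp_minus)
    moreover have "(of_nat n * exp (- s * of_real (L * real n))) * (pochhammer s j / fact j * of_real y ^ j) = F n j" for j
    proof -
      have "exp (- s * of_real (L * real n)) * of_real y ^ j = exp (- of_real L * (s + 2 * of_nat j)) ^ n"
        unfolding y_def exp_of_real[symmetric] exp_of_nat_mult[symmetric] mult_exp_exp
        by (intro arg_cong[of _ _ exp]) (simp add: algebra_simps)
      then show ?thesis unfolding F_def by (simp add: mult_ac)
    qed
    ultimately show ?thesis using has_sum_cmult_right[OF 2, of "of_nat n * exp (- s * of_real (L * real n))"] by (simp only:)
  qed
  \<comment> \<open>As n \<ge> 1, the factor (e^(-2 L j))^n is at most e^(-2 L j); this separates
    the two indices.\<close>
  have bound: "norm (F n j) \<le> real n * exp (- L * Re s) ^ n * (pochhammer (norm s) j / fact j * exp (- 2 * L) ^ j)"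
    if n: "n \<ge> 1" for n j
  proof -
    have "norm (F n j) = real n * exp (- L * (Re s + 2 * real j)) ^ n * (norm (pochhammer s j) / fact j)"
      by (simp add: F_def norm_mult norm_divide norm_power)
    also have "exp (- L * (Re s + 2 * real j)) ^ n = exp (- L * Re s) ^ n * (exp (- 2 * L) ^ j) ^ n"
      by (simp add: exp_of_nat_mult[symmetric] mult_exp_exp algebra_simps)
    also have "(exp (- 2 * L) ^ j) ^ n \<le> exp (- 2 * L) ^ j"
    proof -
      have "(exp (- 2 * L) ^ j) ^ n \<le> (exp (- 2 * L) ^ j) ^ 1"
        using n L_pos by (intro power_decreasing) (auto simp: power_le_one)
      then show ?thesis by simp
    qed
    finally show ?thesis
      using norm_pochhammer_le[of s "norm s" j]
      by (smt (verit, del_insts) divide_right_mono exp_ge_zero fact_ge_zero mult.assoc mult.commute mult_left_mono mult_mono mult_nonneg_nonneg norm_ge_zero of_nat_0_le_iff zero_le_divide_iff zero_le_power)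
  qed
  have r: "exp (- L * Re s) < 1" using L_pos s by simp
  have sn: "(\<lambda>n. real n * exp (- L * Re s) ^ n) summable_on {1..}"
    using has_sum_nat_geometric(2)[of "of_real (exp (- L * Re s))"] r by simp
  have sj: "(\<lambda>j. pochhammer (norm s) j / fact j * exp (- 2 * L) ^ j) summable_on UNIV"
    using L_pos by (intro pochhammer_series) auto
  have "(\<lambda>(n, j). real n * exp (- L * Re s) ^ n * (pochhammer (norm s) j / fact j * exp (- 2 * L) ^ j)) summable_on {1..} \<times> UNIV"
    by (rule abs_summable_on_times[OF sn sj]) (auto intro!: divide_nonneg_nonneg mult_nonneg_nonneg pochhammer_real_nonneg)
  then have Fabs: "(\<lambda>p. norm (case p of (n, j) \<Rightarrow> F n j)) summable_on {1..} \<times> UNIV"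
    by (rule summable_on_comparison_test) (use bound in auto)
  then have Fs: "(\<lambda>(n, j). F n j) summable_on {1..} \<times> UNIV" by (rule abs_summable_summable)
  have col: "(\<Sum>\<^sub>\<infinity>n\<in>{1..}. F n j) = zeta_term L j s" for j
  proof -
    define z where "z = exp (- of_real L * (s + 2 * of_nat j))"
    have "Re s + 2 * real j > 0" using s by (simp add: add_pos_nonneg)
    then have "norm z < 1" using L_pos by (simp add: z_def)
    from has_sum_cmult_left[OF has_sum_nat_geometric(1)[OF this], of "pochhammer s j / fact j"]
    have "((\<lambda>n. F n j) has_sum (z / (1 - z)\<^sup>2 * (pochhammer s j / fact j))) {1..}"
      unfolding F_def z_def .
    then show ?thesis by (simp add: has_sum_iff zeta_term_def csch_kernel_def z_def mult_ac)
  qed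
  define E where "E = exp (s * of_real (ln u))"
  have E: "E \<noteq> 0" "exp (- s * of_real (ln u)) = 1 / E" by (simp_all add: E_def exp_minus inverse_eq_divide)
  have "(\<Sum>\<^sub>\<infinity>n\<in>{1..}. \<Sum>\<^sub>\<infinity>j. F n j) = (\<Sum>\<^sub>\<infinity>j. \<Sum>\<^sub>\<infinity>n\<in>{1..}. F n j)" by (rule infsum_swap_banach[OF Fs])
  moreover have "(\<Sum>\<^sub>\<infinity>n\<in>{1..}. \<Sum>\<^sub>\<infinity>j. F n j) = (\<Sum>\<^sub>\<infinity>n\<in>{1..}. of_real (real n) * g (real n) * E)"
    by (rule infsum_cong) (use F1 in \<open>auto simp: has_sum_iff E_def\<close>)
  ultimately have sum1: "(\<Sum>\<^sub>\<infinity>n\<in>{1..}. of_real (real n) * g (real n) * E) = (\<Sum>\<^sub>\<infinity>j. zeta_term L j s)"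
    by (simp only: col)
  have "(\<lambda>n. 4 * real n * norm (g (real n))) summable_on {1..}"
  proof -
    have "(\<lambda>n. \<Sum>\<^sub>\<infinity>j. norm (F n j)) summable_on {1..}"
    proof (rule summable_on_Sigma_banach)
      show "(\<lambda>(n, j). norm (F n j)) summable_on {1..} \<times> UNIV" 
        by (rule summable_on_cong[THEN iffD1, OF _ Fabs]) auto
    qed
    then have "(\<lambda>n. (4 / norm E) * (\<Sum>\<^sub>\<infinity>j. norm (F n j))) summable_on {1..}" by (rule summable_on_cmult_right)
    then show ?thesis
    proof (rule summable_on_comparison_test)
      fix n :: nat assume n: "n \<in> {1..}"
      have "(\<lambda>j. norm (F n j)) summable_on UNIV"
        by (rule summable_on_comparison_test[OF summable_on_cmult_right[OF sj, of "real n * exp (- L * Re s) ^ n"]]) (use bound n in auto)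
      then have "norm (\<Sum>\<^sub>\<infinity>j. F n j) \<le> (\<Sum>\<^sub>\<infinity>j. norm (F n j))"
        by (rule norm_infsum_bound)
      also have "(\<Sum>\<^sub>\<infinity>j. F n j) = of_real (real n) * g (real n) * E"
      proof -
        have "n \<ge> 1" using n by simp
        from F1[OF this] show ?thesis by (simp only: has_sum_iff E_def)
      qed
      finally have "real n * norm (g (real n)) * norm E \<le> (\<Sum>\<^sub>\<infinity>j. norm (F n j))"
        by (simp add: norm_mult)
      then show "4 * real n * norm (g (real n)) \<le> 4 / norm E * (\<Sum>\<^sub>\<infinity>j. norm (F n j))"
        using E(1) by (simp add: field_simps)
    qed auto
  qed
  then have "(\<lambda>i. norm (g (spin_level i))) summable_on spinor_labels" by (simp only: spinor_labels_sum(1))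
  from spinor_labels_sum(2)[OF this]
  have "(\<Sum>\<^sub>\<infinity>i\<in>spinor_labels. g (spin_level i)) = (\<Sum>\<^sub>\<infinity>n\<in>{1..}. of_real (4 * real n) * g (real n))"
    by (simp add: has_sum_iff)
  also have "\<dots> = (\<Sum>\<^sub>\<infinity>n\<in>{1..}. (4 / E) * (of_real (real n) * g (real n) * E))"
    by (rule infsum_cong) (use E in simp)
  also have "\<dots> = (4 / E) * (\<Sum>\<^sub>\<infinity>j. zeta_term L j s)" unfolding infsum_cmult_right' sum1 ..
  finally show ?thesis unfolding tr zeta_series_def E(2) by simp
qed

text \<open>Removing singularities produces the normalised values, and for Re s > 0 it changes
  nothing because the series is holomorphic there.\<close>

lemma podles_zeta_eq: "podles_zeta q w = remove_sings (zeta_series L u)"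
  unfolding podles_zeta_def
proof (rule the_equality)
  have nm: "remove_sings (zeta_series L u) nicely_meromorphic_on UNIV"
    by (rule remove_sings_nicely_meromorphic[OF meromorphic_zeta_series[OF L_pos]])
  have eq: "remove_sings (zeta_series L u) s = zeta_series L u s" if "Re s > 0" for s
  proof (rule remove_sings_at_analytic)
    have "(\<lambda>s. 4 * exp (- s * of_real (ln u)) * zeta_tail L 0 s) holomorphic_on {s. Re s > 0}"
      using holomorphic_zeta_tail[OF L_pos, of 0] by (intro holomorphic_intros) auto
    also have "?this \<longleftrightarrow> zeta_series L u holomorphic_on {s. Re s > 0}"
      by (rule holomorphic_cong) (use zeta_series_split[OF L_pos, of 0] in auto)
    finally show "zeta_series L u analytic_on {s}"
      using that open_halfspace_Re_gt analytic_at by blast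
  qed
  show *: "remove_sings (zeta_series L u) nicely_meromorphic_on UNIV \<and> (\<forall>s. Re s > 0 \<longrightarrow>
        remove_sings (zeta_series L u) s = op_trace spinor_labels
                (op_fun spinor_labels (\<lambda>x. complex_of_real x powr (- s)) (abs_dirac q w)))"
    using nm eq zeta_trace by simp
  fix Z assume "Z nicely_meromorphic_on UNIV \<and> (\<forall>s. Re s > 0 \<longrightarrow>
        Z s = op_trace spinor_labels
                (op_fun spinor_labels (\<lambda>x. complex_of_real x powr (- s)) (abs_dirac q w)))"
  with * show "Z = remove_sings (zeta_series L u)" by (intro nicely_meromorphic_unique) auto
qed

end

section \<open>The residues of the zeta function times Gamma\<close>

lemma taylor2_times_ident:
  assumes "taylor2 f a b c"
  shows "taylor2 (\<lambda>w. w * f w) 0 a b"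
proof -
  have "taylor2 (\<lambda>w. w) 0 1 0" using taylor2_analytic[of "\<lambda>w. w"] by simp
  from taylor2_mult[OF this assms] show ?thesis by simp
qed

lemma taylor2_sum:
  assumes "finite A" "\<And>j. j \<in> A \<Longrightarrow> taylor2 (f j) (a j) (b j) (c j)"
  shows "taylor2 (\<lambda>w. \<Sum>j\<in>A. f j w) (\<Sum>j\<in>A. a j) (\<Sum>j\<in>A. b j) (\<Sum>j\<in>A. c j)"
  using assms
proof (induction A rule: finite_induct)
  case empty
  show ?case using taylor2_analytic[of "\<lambda>w. 0"] by simp
next
  case (insert x F)
  then show ?case using taylor2_add[of "f x" "a x" "b x" "c x"] by simp
qed

lemma taylor2_shift:
  assumes "f analytic_on {z}"
  obtains c where "taylor2 (\<lambda>w. f (z + w)) (f z) (deriv f z) c"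
proof -
  have e: "(\<lambda>x. f (z + x)) has_fps_expansion fps_expansion f z"
    by (rule analytic_at_imp_has_fps_expansion[OF assms])
  from taylor2_fps[OF this] show ?thesis
    by (intro that) (simp add: fps_expansion_def)
qed

lemma csch_kernel_period: "csch_kernel L (z + \<i> * of_real (2 * pi / L * of_int n)) = csch_kernel L z" if "L \<noteq> 0"
proof -
  have "exp (- of_real L * (z + \<i> * of_real (2 * pi / L * of_int n))) = exp (- of_real L * z) * exp (- (of_int n * (of_real (2 * pi) * \<i>)))"
    unfolding mult_exp_exp using that by (intro arg_cong[of _ _ exp]) (simp add: field_simps)
  also have "exp (- (of_int n * (of_real (2 * pi) * \<i>))) = 1"
    by (simp add: exp_eq_1, rule exI[of _ "- n"], simp)
  finally show ?thesis unfolding csch_kernel_def by simp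
qed

context podles
begin

text \<open>\<open>ln q\<close> is - L, so the pole with index n corresponds to the frequency - n of
  the Gamma series.\<close>

lemma Sd_pole_eq: "Sd_pole q m n = - 2 * of_nat m + \<i> * of_real (2 * pi / L * of_int (- n))"
  by (simp add: Sd_pole_def L_def)

lemma csch_kernel_Sd_pole:
  "csch_kernel L (Sd_pole q m n + z + 2 * of_nat j) = csch_kernel L (2 * (of_nat j - of_nat m) + z)"
proof -
  have "Sd_pole q m n + z + 2 * of_nat j = (2 * (of_nat j - of_nat m) + z) + \<i> * of_real (2 * pi / L * of_int (- n))"
    unfolding Sd_pole_eq by (simp add: algebra_simps)
  moreover have "csch_kernel L ((2 * (of_nat j - of_nat m) + z) + \<i> * of_real (2 * pi / L * of_int (- n))) = csch_kernel L (2 * (of_nat j - of_nat m) + z)"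
    by (rule csch_kernel_period) (use L_pos in simp)
  ultimately show ?thesis by (simp only:)
qed

lemma Sd_pole_not_nonpos: "n \<noteq> 0 \<Longrightarrow> Sd_pole q m n + of_nat j \<notin> \<int>\<^sub>\<le>\<^sub>0"
proof (rule nonpos_Ints_Im)
  assume "n \<noteq> 0"
  then show "Im (Sd_pole q m n + of_nat j) \<noteq> 0" using q by (simp add: Sd_pole_def)
qed

text \<open>The quotient formula for the Pochhammer symbol is valid off the poles of Gamma; close to
  a point of \<open>Sd1\<close> it can fail only at the point itself.\<close>

lemma eventually_not_nonpos: "eventually (\<lambda>w. Sd_pole q m n + w \<notin> \<int>\<^sub>\<le>\<^sub>0) (at 0)"
proof (cases "n = 0")
  case True
  have "eventually (\<lambda>w. w \<in> ball 0 1 - {0}) (at (0::complex))" by (intro eventually_at_in_open) auto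
  then show ?thesis
  proof eventually_elim
    case (elim w)
    show ?case
    proof
      assume "Sd_pole q m n + w \<in> \<int>\<^sub>\<le>\<^sub>0"
      then obtain k where "Sd_pole q m n + w = - of_nat k" by (elim nonpos_Ints_cases')
      then have "w = of_int (2 * int m - int k)" using True by (simp add: Sd_pole_def algebra_simps)
      then have "norm w = real_of_int \<bar>2 * int m - int k\<bar>" by (simp only: norm_of_int of_int_abs)
      then have "real_of_int \<bar>2 * int m - int k\<bar> < 1" "w \<noteq> 0" using elim by auto
      then have "2 * int m - int k = 0" by linarith
      then show False using \<open>w = _\<close> \<open>w \<noteq> 0\<close> by simp
    qed
  qed
next
  case False
  define y where "y = \<bar>Im (Sd_pole q m n)\<bar>"
  have y: "y > 0" unfolding y_def zero_less_abs_iff using False q by (simp add: Sd_pole_def)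
  have "eventually (\<lambda>w. w \<in> ball 0 y) (at (0::complex))" using y by (intro eventually_at_in_open') auto
  then show ?thesis
  proof eventually_elim
    case (elim w)
    then have "\<bar>Im w\<bar> < y" using abs_Im_le_cmod[of w] by simp
    then show ?case by (intro nonpos_Ints_Im) (auto simp: y_def)
  qed
qed

lemma csch_kernel_even_analytic:
  assumes "j \<noteq> m"
  shows "csch_kernel L analytic_on {2 * (of_nat j - of_nat m)}"
proof (rule csch_kernel_analytic)
  have "- L * (2 * (real j - real m)) \<noteq> 0" using assms L_pos by simp
  then have "exp (- L * (2 * (real j - real m))) \<noteq> 1" by simp
  then have "complex_of_real (exp (- L * (2 * (real j - real m)))) \<noteq> 1" unfolding of_real_eq_1_iff .
  then show "exp (- of_real L * (2 * (of_nat j - of_nat m))) \<noteq> (1::complex)"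
    by (simp add: exp_of_real[symmetric])
qed

text \<open>
  The \<open>j\<close>-th term of \<open>\<Gamma>(s) \<zeta>(s)\<close> at \<open>s = \<alpha> + z\<close>, up to the exponential factor.  The pole at \<open>\<alpha>\<close> has order
  at most \<open>3\<close>, so multiplying by \<open>z\<^sup>3\<close> turns the residues into Taylor coefficients.
\<close>

definition pole_part :: "nat \<Rightarrow> int \<Rightarrow> nat \<Rightarrow> complex \<Rightarrow> complex" where
  "pole_part m n j z = z ^ 3 * (Gamma (Sd_pole q m n + z + of_nat j) / fact j * csch_kernel L (2 * (of_nat j - of_nat m) + z))"

text \<open>The Pochhammer symbol turns Gamma (s) into Gamma (s + j), and the period 2 \<pi> \<i> /
  L of the kernel removes the imaginary part of the pole from its argument.\<close>

lemma pole_part_eq: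
  "eventually (\<lambda>w. w ^ 3 * (Gamma (Sd_pole q m n + w) * zeta_term L j (Sd_pole q m n + w)) = pole_part m n j w) (at 0)"
  using eventually_not_nonpos[of m n]
proof eventually_elim
  case (elim w)
  have "pochhammer (Sd_pole q m n + w) j = Gamma (Sd_pole q m n + w + of_nat j) / Gamma (Sd_pole q m n + w)"
    by (rule pochhammer_Gamma[OF elim])
  moreover have "Gamma (Sd_pole q m n + w) \<noteq> 0" using elim by (simp add: Gamma_eq_zero_iff)
  ultimately show ?case unfolding pole_part_def zeta_term_def csch_kernel_Sd_pole by simp
qed

text \<open>The one index at which the kernel is singular: its double pole multiplies whatever Gamma
  contributes, and its constant term -1/12 couples to \<open>G0\<close>.\<close>

lemma taylor2_pole_part_diag:
  assumes "taylor2 (\<lambda>w. w * Gamma (Sd_pole q m n + of_nat m + w)) G0 G1 G2"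
  shows "taylor2 (pole_part m n m) (G0 / of_real L ^ 2 / fact m) (G1 / of_real L ^ 2 / fact m) ((G2 / of_real L ^ 2 - G0 / 12) / fact m)"
proof -
  have k: "taylor2 (\<lambda>w. w\<^sup>2 * csch_kernel L w) (1 / of_real L ^ 2) 0 (- 1 / 12)"
    unfolding csch_kernel_def using taylor2_sinh_kernel[of "of_real L"] L_pos by simp
  from taylor2_cmult[OF taylor2_mult[OF assms k], of "1 / fact m"]
  show ?thesis
    by (rule taylor2_cong) (auto simp: pole_part_def power2_eq_square power3_eq_cube field_simps)
qed

text \<open>Away from j = m the kernel is regular, so at most a simple pole of Gamma is left and
  only the coefficient with p = 0 is affected. At the real poles these terms make up d_m.\<close>

lemma taylor2_pole_part_off:
  assumes "j \<noteq> m" "taylor2 (\<lambda>w. w * Gamma (Sd_pole q m n + of_nat j + w)) G0 G1 G2"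
  shows "taylor2 (pole_part m n j) 0 0 (G0 / fact j * csch_kernel L (2 * (of_nat j - of_nat m)))"
proof -
  obtain c where "taylor2 (\<lambda>w. csch_kernel L (2 * (of_nat j - of_nat m) + w)) (csch_kernel L (2 * (of_nat j - of_nat m)))
      (deriv (csch_kernel L) (2 * (of_nat j - of_nat m))) c"
    by (rule taylor2_shift[OF csch_kernel_even_analytic[OF assms(1)]])
  from taylor2_cmult[OF taylor2_times_ident[OF taylor2_times_ident[OF taylor2_mult[OF assms(2) this]]], of "1 / fact j"]
  show ?thesis
    by (rule taylor2_cong) (auto simp: pole_part_def power3_eq_cube field_simps)
qed

lemma taylor2_Gamma_times_0:
  "taylor2 (\<lambda>w. w * Gamma (Sd_pole q m 0 + of_nat j + w)) ((- 1) ^ (2 * m - j) / fact (2 * m - j))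
     ((- 1) ^ (2 * m - j) / fact (2 * m - j) * Digamma (of_nat (2 * m - j) + 1))
     ((- 1) ^ (2 * m - j) / fact (2 * m - j) * (((Digamma (of_nat (2 * m - j) + 1)) ^ 2 - Polygamma 1 (of_nat (2 * m - j) + 1)) / 2 + of_real pi ^ 2 / 6))"
  if "j \<le> 2 * m"
proof -
  have "Sd_pole q m 0 + of_nat j = - of_nat (2 * m - j)" using that by (simp add: Sd_pole_def of_nat_diff)
  then show ?thesis using taylor2_Gamma_pole[of "2 * m - j"] by simp
qed

lemma taylor2_Gamma_times_nz:
  assumes "n \<noteq> 0"
  shows "taylor2 (\<lambda>w. w * Gamma (Sd_pole q m n + of_nat j + w)) 0 (Gamma (Sd_pole q m n + of_nat j))
     (deriv Gamma (Sd_pole q m n + of_nat j))"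
proof -
  have "Gamma analytic_on {Sd_pole q m n + of_nat j}"
    using Sd_pole_not_nonpos[OF assms] by (intro analytic_Gamma) auto
  then obtain c where "taylor2 (\<lambda>w. Gamma (Sd_pole q m n + of_nat j + w)) (Gamma (Sd_pole q m n + of_nat j))
     (deriv Gamma (Sd_pole q m n + of_nat j)) c" by (rule taylor2_shift)
  from taylor2_times_ident[OF this] show ?thesis .
qed

text \<open>\<open>G0\<close>, \<open>G1\<close>, \<open>G2\<close> encode the behaviour of the
  Gamma factors, so that real and nonreal poles are treated at once. With s = \<alpha> + z the
  factor u^(-s) is u^(-\<alpha>) e^(-l z), whose expansion brings in the powers of log u. The
  condition \<open>tail\<close> says that Gamma and the remainder of the zeta series do not produce
  a pole together: either Gamma is regular at \<alpha> or the remainder vanishes there.\<close>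

lemma heat_coeff_taylor2:
  fixes m :: nat and n :: int
  defines "\<alpha> \<equiv> Sd_pole q m n"
  assumes "\<forall>j\<le>2 * m. taylor2 (\<lambda>w. w * Gamma (\<alpha> + of_nat j + w)) (G0 j) (G1 j) (G2 j)"
    and tail: "G0 0 * zeta_tail L (2 * m + 1) \<alpha> = 0"
  defines "r \<equiv> of_real u powr (- \<alpha>) / complex_of_real ((ln q)\<^sup>2)" and "l \<equiv> complex_of_real (ln u)"
  shows "heat_coeff q w \<alpha> 2 = r * (2 * G0 m / fact m)"
    and "heat_coeff q w \<alpha> 1 = r * (4 / fact m * (l * G0 m - G1 m))"
    and "heat_coeff q w \<alpha> 0 = r * (4 / fact m * (G2 m - G0 m * of_real L ^ 2 / 12 - l * G1 m + l ^ 2 / 2 * G0 m)) +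
       4 * of_real u powr (- \<alpha>) * (\<Sum>j\<in>{0..2 * m} - {m}. G0 j / fact j * csch_kernel L (2 * (of_nat j - of_nat m)))"
proof -
  have G: "taylor2 (\<lambda>w. w * Gamma (\<alpha> + of_nat j + w)) (G0 j) (G1 j) (G2 j)" if "j \<le> 2 * m" for j
    using assms(2) that by blast
  \<comment> \<open>The cut is at 2 m + 1 and not at m + 1: for real \<alpha> the terms with m < j
    \<le> 2 m have a regular kernel but still meet a pole of Gamma (s + j).\<close>
  define N where "N = 2 * m + 1"
  define H where "H s = Gamma s * podles_zeta q w s" for s
  define T where "T z = (\<Sum>j\<in>{0..2 * m}. pole_part m n j z) + z ^ 3 * (Gamma (\<alpha> + z) * zeta_tail L N (\<alpha> + z))" for z
  define D where "D = (\<Sum>j\<in>{0..2 * m} - {m}. G0 j / fact j * csch_kernel L (2 * (of_nat j - of_nat m)))"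
  have Lq: "complex_of_real ((ln q)\<^sup>2) = of_real L ^ 2" "(complex_of_real (ln q))\<^sup>2 = of_real L ^ 2" by (simp_all add: L_def)
  have L0: "complex_of_real L \<noteq> 0" using L_pos by simp
  have al: "Re \<alpha> = - 2 * real m" by (simp add: \<alpha>_def Sd_pole_def)
  have T1: "taylor2 (\<lambda>w. \<Sum>j\<in>{0..2 * m}. pole_part m n j w) (G0 m / of_real L ^ 2 / fact m) (G1 m / of_real L ^ 2 / fact m)
     ((G2 m / of_real L ^ 2 - G0 m / 12) / fact m + D)"
  proof -
    have "taylor2 (\<lambda>w. \<Sum>j\<in>{0..2 * m} - {m}. pole_part m n j w) (\<Sum>j\<in>{0..2 * m} - {m}. 0) (\<Sum>j\<in>{0..2 * m} - {m}. 0) D"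
      unfolding D_def
    proof (rule taylor2_sum)
      fix j assume j: "j \<in> {0..2 * m} - {m}"
      show "taylor2 (pole_part m n j) 0 0 (G0 j / fact j * csch_kernel L (2 * (of_nat j - of_nat m)))"
        using j by (intro taylor2_pole_part_off[OF _ G[of j, unfolded \<alpha>_def]]) auto
    qed auto
    from taylor2_add[OF taylor2_pole_part_diag[OF G[of m, unfolded \<alpha>_def]] this]
    have "taylor2 (\<lambda>w. pole_part m n m w + (\<Sum>j\<in>{0..2 * m} - {m}. pole_part m n j w)) (G0 m / of_real L ^ 2 / fact m) (G1 m / of_real L ^ 2 / fact m)
     ((G2 m / of_real L ^ 2 - G0 m / 12) / fact m + D)" by simp
    also have "(\<lambda>w. pole_part m n m w + (\<Sum>j\<in>{0..2 * m} - {m}. pole_part m n j w)) = (\<lambda>w. \<Sum>j\<in>{0..2 * m}. pole_part m n j w)"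
      by (subst sum.remove[of "{0..2 * m}" m]) auto
    finally show ?thesis .
  qed
  have T2: "taylor2 (\<lambda>w. w ^ 3 * (Gamma (\<alpha> + w) * zeta_tail L N (\<alpha> + w))) 0 0 0"
  proof -
    have "open {s. Re s > - 2 * real N}" by (rule open_halfspace_Re_gt)
    then have "zeta_tail L N analytic_on {\<alpha>}"
      using holomorphic_zeta_tail[OF L_pos, of N] analytic_at[of "zeta_tail L N" \<alpha>] al by (force simp: N_def)
    then obtain c where "taylor2 (\<lambda>w. zeta_tail L N (\<alpha> + w)) (zeta_tail L N \<alpha>) (deriv (zeta_tail L N) \<alpha>) c"
      by (rule taylor2_shift)
    from taylor2_times_ident[OF taylor2_times_ident[OF taylor2_mult[OF G[of 0] this]]]
    show ?thesis using tail
      by (rule_tac taylor2_cong) (auto simp: N_def power3_eq_cube mult_ac)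
  qed
  from taylor2_add[OF T1 T2] have T: "taylor2 T (G0 m / of_real L ^ 2 / fact m) (G1 m / of_real L ^ 2 / fact m)
     ((G2 m / of_real L ^ 2 - G0 m / 12) / fact m + D)" unfolding T_def by simp
  define c where "c = of_real u powr (- \<alpha>)"
  define P where "P z = 4 * c * (exp (- l * z) * T z)" for z
  define b0 where "b0 = 4 * c * (G0 m / of_real L ^ 2 / fact m)"
  define b1 where "b1 = 4 * c * (G1 m / of_real L ^ 2 / fact m - l * (G0 m / of_real L ^ 2 / fact m))"
  define b2 where "b2 = 4 * c * (((G2 m / of_real L ^ 2 - G0 m / 12) / fact m + D) - l * (G1 m / of_real L ^ 2 / fact m)
       + l ^ 2 / 2 * (G0 m / of_real L ^ 2 / fact m))"
  have P: "taylor2 P b0 b1 b2"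
    unfolding P_def using taylor2_cmult[OF taylor2_mult[OF taylor2_exp[of "- l"] T], of "4 * c"]
    by (rule taylor2_cong) (simp_all add: b0_def b1_def b2_def algebra_simps)
  have "isolated_singularity_at (zeta_series L u) \<alpha>"
    by (rule meromorphic_on_isolated_singularity, rule meromorphic_on_subset[OF meromorphic_zeta_series[OF L_pos]]) simp
  then have "eventually (\<lambda>s. podles_zeta q w s = zeta_series L u s) (at \<alpha>)"
    unfolding podles_zeta_eq by (rule eventually_remove_sings_eq_at)
  then have e1: "eventually (\<lambda>w'. podles_zeta q w (\<alpha> + w') = zeta_series L u (\<alpha> + w')) (at 0)"
    by (simp add: at_to_0'[of \<alpha>] eventually_filtermap add.commute)
  have e2: "eventually (\<lambda>w. w \<in> ball 0 1 - {0}) (at (0::complex))" by (intro eventually_at_in_open) auto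
  have e3: "eventually (\<lambda>w. \<forall>j\<in>{0..2 * m}. w ^ 3 * (Gamma (\<alpha> + w) * zeta_term L j (\<alpha> + w)) = pole_part m n j w) (at 0)"
    unfolding \<alpha>_def by (intro eventually_ball_finite ballI pole_part_eq) auto
  have H: "eventually (\<lambda>w. H (\<alpha> + w) = P w / w ^ 3) (at 0)"
    using e1 e2 e3
  proof eventually_elim
    case (elim w)
    have w: "w \<noteq> 0" using elim by simp
    have "\<bar>Re w\<bar> < 1" using elim abs_Re_le_cmod[of w] by simp
    then have "Re (\<alpha> + w) > - 2 * real N" using al by (simp add: N_def)
    note split = zeta_series_split[OF L_pos this, of u]
    have "exp (- (\<alpha> + w) * of_real (ln u)) = c * exp (- l * w)"
      using u_pos unfolding c_def l_def by (simp add: powr_def Ln_of_real mult_exp_exp algebra_simps)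
    then have "H (\<alpha> + w) = 4 * c * exp (- l * w) * (Gamma (\<alpha> + w) * (\<Sum>j<N. zeta_term L j (\<alpha> + w)) + Gamma (\<alpha> + w) * zeta_tail L N (\<alpha> + w))"
      unfolding H_def elim(1) split by (simp add: algebra_simps)
    also have "Gamma (\<alpha> + w) * (\<Sum>j<N. zeta_term L j (\<alpha> + w)) = (\<Sum>j\<in>{0..2 * m}. pole_part m n j w) / w ^ 3"
    proof -
      have "{..<N} = {0..2 * m}" by (auto simp: N_def)
      then have "Gamma (\<alpha> + w) * (\<Sum>j<N. zeta_term L j (\<alpha> + w)) = (\<Sum>j\<in>{0..2 * m}. Gamma (\<alpha> + w) * zeta_term L j (\<alpha> + w))"
        by (simp add: sum_distrib_left)
      also have "\<dots> = (\<Sum>j\<in>{0..2 * m}. pole_part m n j w / w ^ 3)"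
        using elim(3) w by (intro sum.cong) (auto simp: field_simps)
      finally show ?thesis by (simp add: sum_divide_distrib)
    qed
    finally show ?case using w unfolding P_def T_def by (simp add: field_simps)
  qed
  note res = residue_taylor2[OF P H]
  show "heat_coeff q w \<alpha> 2 = r * (2 * G0 m / fact m)"
    unfolding heat_coeff_def using res(3) unfolding H_def by (simp add: b0_def r_def c_def Lq)
  show "heat_coeff q w \<alpha> 1 = r * (4 / fact m * (l * G0 m - G1 m))"
    unfolding heat_coeff_def using res(2) unfolding H_def by (simp add: b1_def r_def c_def Lq diff_divide_distrib algebra_simps)
  show "heat_coeff q w \<alpha> 0 = r * (4 / fact m * (G2 m - G0 m * of_real L ^ 2 / 12 - l * G1 m + l ^ 2 / 2 * G0 m)) +
       4 * of_real u powr (- \<alpha>) * (\<Sum>j\<in>{0..2 * m} - {m}. G0 j / fact j * csch_kernel L (2 * (of_nat j - of_nat m)))"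
    unfolding heat_coeff_def using res(1) L0 unfolding H_def D_def[symmetric]
    by (simp add: b2_def r_def c_def[symmetric] Lq) (simp add: field_simps)
qed

lemma zeta_tail_zero: "zeta_tail L (2 * m + 1) (Sd_pole q m 0) = 0"
  unfolding zeta_tail_def
proof (rule infsum_0)
  fix j :: nat assume "j \<in> {2 * m + 1..}"
  then have "pochhammer (- of_nat (2 * m) :: complex) j = 0" by (subst pochhammer_eq_0_iff) (auto intro!: exI[of _ "2 * m"])
  then show "zeta_term L j (Sd_pole q m 0) = 0" by (simp add: zeta_term_def Sd_pole_def)
qed

text \<open>(u/q)^(2 m) q^(2 k) equals u^(2 m) q^(2 (k - m)), and as q = e^(-L) the last power
  together with the inverse square is the kernel at 2 (k - m).\<close>

lemma coeff_d_eq: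
  "coeff_d q u m = 4 * of_real u powr (- Sd_pole q m 0) *
     (\<Sum>j\<in>{0..2 * m} - {m}. (- 1) ^ (2 * m - j) / fact (2 * m - j) / fact j * csch_kernel L (2 * (of_nat j - of_nat m)))"
proof -
  have up: "complex_of_real u powr (- Sd_pole q m 0) = of_real u ^ (2 * m)"
  proof -
    have "- Sd_pole q m 0 = of_nat (2 * m)" by (simp add: Sd_pole_def)
    then show ?thesis using u_pos by (simp only: powr_nat) simp
  qed
  have t: "complex_of_real ((u / q) ^ (2 * m) * ((- 1) ^ j / (fact j * fact (2 * m - j)) * q ^ (2 * j) * (1 - q powi (2 * (int j - int m))) powi (- 2)))
    = of_real u ^ (2 * m) * ((- 1) ^ (2 * m - j) / fact (2 * m - j) / fact j * csch_kernel L (2 * (of_nat j - of_nat m)))"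
    if j: "j \<in> {0..2 * m} - {m}" for j
  proof -
    define z where "z = q powi (2 * (int j - int m))"
    have q0: "q \<noteq> 0" using q by simp
    have z: "z = exp (- L * (2 * (real j - real m)))"
    proof -
      have "z = q powr (real_of_int (2 * (int j - int m)))" unfolding z_def
        by (rule powr_real_of_int'[symmetric]) (use q in auto)
      then show ?thesis by (simp add: q_powr)
    qed
    have "(1 / q) ^ (2 * m) * q ^ (2 * j) = z"
    proof -
      have e: "2 * (int j - int m) = int (2 * j) - int (2 * m)" by simp
      have "z = q powi (int (2 * j)) / q powi (int (2 * m))" unfolding z_def e by (rule power_int_diff) (use q0 in simp)
      then show ?thesis by (simp add: power_divide power_int_of_nat field_simps del: of_nat_mult)
    qed
    then have "u ^ (2 * m) * ((1 / q) ^ (2 * m) * q ^ (2 * j)) = u ^ (2 * m) * z" by (simp only:)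
    then have e: "(u / q) ^ (2 * m) * q ^ (2 * j) = u ^ (2 * m) * z" by (simp add: power_divide)
    have "csch_kernel L (2 * (of_nat j - of_nat m)) = complex_of_real (z / (1 - z) ^ 2)"
      unfolding csch_kernel_def z by (simp add: exp_of_real[symmetric])
    also have "z / (1 - z) ^ 2 = z * (1 - z) powi (- 2)" by (simp add: power_int_minus divide_inverse)
    finally have k: "csch_kernel L (2 * (of_nat j - of_nat m)) = complex_of_real (z * (1 - z) powi (- 2))" .
    have sg: "(- 1) ^ (2 * m - j) = ((- 1) ^ j :: complex)" 
      using j by (cases "even j") (simp_all add: minus_one_power_iff)
    have "(u / q) ^ (2 * m) * ((- 1) ^ j / (fact j * fact (2 * m - j)) * q ^ (2 * j) * (1 - z) powi (- 2))
      = ((u / q) ^ (2 * m) * q ^ (2 * j)) * ((- 1) ^ j / (fact j * fact (2 * m - j)) * (1 - z) powi (- 2))" by simp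
    also have "\<dots> = u ^ (2 * m) * ((- 1) ^ j / fact (2 * m - j) / fact j * (z * (1 - z) powi (- 2)))"
      unfolding e by (simp add: mult_ac)
    finally show ?thesis unfolding z_def[symmetric] k sg by simp
  qed
  have "coeff_d q u m = 4 * (\<Sum>j\<in>{0..2 * m} - {m}. complex_of_real ((u / q) ^ (2 * m) * ((- 1) ^ j / (fact j * fact (2 * m - j)) * q ^ (2 * j) * (1 - q powi (2 * (int j - int m))) powi (- 2))))"
    unfolding coeff_d_def by (simp only: of_real_mult of_real_sum sum_distrib_left mult.assoc of_real_numeral)
  also have "\<dots> = 4 * (\<Sum>j\<in>{0..2 * m} - {m}. of_real u ^ (2 * m) * ((- 1) ^ (2 * m - j) / fact (2 * m - j) / fact j * csch_kernel L (2 * (of_nat j - of_nat m))))"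
    by (simp only: t cong: sum.cong)
  finally show ?thesis unfolding up by (simp only: sum_distrib_left mult.assoc)
qed

text \<open>In c_{m,0} the term 2 \<pi>^2 stems from the \<pi>^2/6 in the expansion of Gamma at its
  pole, and - log^2 q from the constant -1/12 of the kernel.\<close>

theorem heat_coeff_real:
  fixes m :: nat
  defines "\<alpha> \<equiv> Sd_pole q m 0"
  defines "r \<equiv> of_real u powr (- \<alpha>) / complex_of_real ((ln q)\<^sup>2)"
  shows "heat_coeff q w \<alpha> 2 = r * coeff_g m"
    and "heat_coeff q w \<alpha> 1 = r * coeff_h q u m 0"
    and "heat_coeff q w \<alpha> 0 = r * coeff_c q u m 0 + coeff_d q u m"
proof -
  define g0 :: "nat \<Rightarrow> complex" where "g0 j = (- 1) ^ (2 * m - j) / fact (2 * m - j)" for j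
  define g1 :: "nat \<Rightarrow> complex" where "g1 j = (- 1) ^ (2 * m - j) / fact (2 * m - j) * Digamma (of_nat (2 * m - j) + 1)" for j
  define g2 :: "nat \<Rightarrow> complex" where "g2 j = (- 1) ^ (2 * m - j) / fact (2 * m - j) *
    (((Digamma (of_nat (2 * m - j) + 1)) ^ 2 - Polygamma 1 (of_nat (2 * m - j) + 1)) / 2 + of_real pi ^ 2 / 6)" for j
  have G: "\<forall>j\<le>2 * m. taylor2 (\<lambda>w. w * Gamma (Sd_pole q m 0 + of_nat j + w)) (g0 j) (g1 j) (g2 j)"
    unfolding g0_def g1_def g2_def by (intro allI impI taylor2_Gamma_times_0)
  have tail: "g0 0 * zeta_tail L (2 * m + 1) (Sd_pole q m 0) = 0"
    by (simp only: zeta_tail_zero mult_zero_right)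
  note h = heat_coeff_taylor2[OF G tail, unfolded g0_def g1_def g2_def]
  have mm: "2 * m - m = m" by simp
  show "heat_coeff q w \<alpha> 2 = r * coeff_g m"
    unfolding \<alpha>_def r_def h(1) mm coeff_g_def by (simp add: power2_eq_square)
  show "heat_coeff q w \<alpha> 1 = r * coeff_h q u m 0"
    unfolding \<alpha>_def r_def h(2) mm coeff_h_def by (simp add: power2_eq_square field_simps)
  have "4 / fact m * ((- 1) ^ m / fact m * (((Digamma (of_nat m + 1)) ^ 2 - Polygamma 1 (of_nat m + 1)) / 2 + of_real pi ^ 2 / 6)
     - (- 1) ^ m / fact m * of_real L ^ 2 / 12 - of_real (ln u) * ((- 1) ^ m / fact m * Digamma (of_nat m + 1)) + of_real (ln u) ^ 2 / 2 * ((- 1) ^ m / fact m))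
     = coeff_c q u m 0"
    unfolding coeff_c_def by (simp add: L_def power2_eq_square field_simps)
  then show "heat_coeff q w \<alpha> 0 = r * coeff_c q u m 0 + coeff_d q u m"
    unfolding \<alpha>_def r_def h(3) mm coeff_d_eq by simp
qed

text \<open>Gamma is regular at nonreal points, so the double pole of the kernel at j = m is the
  only source; h and c carry the values of Gamma and of its derivative at \<alpha> + m.\<close>

theorem heat_coeff_nonreal:
  fixes m :: nat and n :: int
  defines "\<alpha> \<equiv> Sd_pole q m n"
  defines "r \<equiv> of_real u powr (- \<alpha>) / complex_of_real ((ln q)\<^sup>2)"
  assumes n: "n \<noteq> 0"
  shows "heat_coeff q w \<alpha> 2 = 0"
    and "heat_coeff q w \<alpha> 1 = r * coeff_h q u m (- n)"
    and "heat_coeff q w \<alpha> 0 = r * coeff_c q u m (- n)"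
proof -
  have tail: "0 * zeta_tail L (2 * m + 1) (Sd_pole q m n) = 0" by simp
  have G: "\<forall>j\<le>2 * m. taylor2 (\<lambda>w. w * Gamma (Sd_pole q m n + of_nat j + w)) 0 (Gamma (Sd_pole q m n + of_nat j))
     (deriv Gamma (Sd_pole q m n + of_nat j))"
    by (intro allI impI taylor2_Gamma_times_nz n)
  note h = heat_coeff_taylor2[OF G tail]
  define \<beta> where "\<beta> = - of_nat m - \<i> * complex_of_real (2 * pi / ln q) * of_int (- n)"
  have \<beta>: "Sd_pole q m n + of_nat m = \<beta>" by (simp add: \<beta>_def Sd_pole_def)
  have dG: "deriv Gamma \<beta> = Gamma \<beta> * Digamma \<beta>"
    using Sd_pole_not_nonpos[OF n, of m m] unfolding \<beta> by (intro DERIV_imp_deriv has_field_derivative_Gamma)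
  show "heat_coeff q w \<alpha> 2 = 0" unfolding \<alpha>_def h(1) by simp
  show "heat_coeff q w \<alpha> 1 = r * coeff_h q u m (- n)"
    unfolding \<alpha>_def r_def h(2) \<beta> coeff_h_def \<beta>_def[symmetric] using n by simp
  show "heat_coeff q w \<alpha> 0 = r * coeff_c q u m (- n)"
    unfolding \<alpha>_def r_def h(3) \<beta> coeff_c_def \<beta>_def[symmetric] dG using n q by (simp add: field_simps)
qed

end

section \<open>Growth of the heat coefficients\<close>

text \<open>The central binomial coefficient is at most 4^m. This converts the size u^(2 m)/(m!)^2
  of the coefficients into a term of an exponential series, so that the heat expansion can be
  integrated against measures with exponential moments.\<close>

lemma fact_double_le: "fact (2 * m) \<le> (4 ^ m * (fact m)\<^sup>2 :: real)"
proof (induction m)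
  case (Suc m)
  have "fact (2 * Suc m) = real (2 * m + 2) * (real (2 * m + 1) * fact (2 * m))"
    by (simp add: algebra_simps)
  also have "\<dots> \<le> real (2 * m + 2) * (real (2 * m + 2) * (4 ^ m * (fact m)\<^sup>2))"
    using Suc by (intro mult_left_mono mult_mono) auto
  also have "\<dots> = 4 ^ Suc m * (fact (Suc m))\<^sup>2" by (simp add: power2_eq_square algebra_simps)
  finally show ?case .
qed simp

lemma inverse_fact_square_le: "1 / (fact m)\<^sup>2 \<le> (4 ^ m / fact (2 * m) :: real)"
  using fact_double_le[of m] by (simp add: field_simps)

text \<open>The recurrence adds m terms of modulus at most 1, up to the factor p!, and m \<le> 2^m;
  such a crude bound is enough against the factorials.\<close>

lemma norm_Polygamma_nat_le:
  fixes p :: nat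
  obtains A where "A > 0" "\<And>m. norm (Polygamma p (of_nat m + 1 :: complex)) \<le> A * 2 ^ m"
proof -
  define A where "A = norm (Polygamma p (1 :: complex)) + fact p"
  have "norm (Polygamma p (of_nat m + 1 :: complex)) \<le> A * 2 ^ m" for m
  proof -
    have "Polygamma p (1 + of_nat m :: complex) = Polygamma p 1 + (- 1) ^ p * fact p * (\<Sum>k<m. 1 / (1 + of_nat k) ^ Suc p)"
      by (rule Polygamma_plus_of_nat) (auto simp: complex_eq_iff)
    then have "norm (Polygamma p (of_nat m + 1 :: complex)) \<le> norm (Polygamma p (1 :: complex)) + fact p * norm (\<Sum>k<m. 1 / (1 + of_nat k) ^ Suc p :: complex)"
      using norm_triangle_ineq[of "Polygamma p (1 :: complex)" "(- 1) ^ p * fact p * (\<Sum>k<m. 1 / (1 + of_nat k) ^ Suc p)"]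
      by (simp add: norm_mult norm_power add.commute)
    also have "norm (\<Sum>k<m. 1 / (1 + of_nat k) ^ Suc p :: complex) \<le> (\<Sum>k<m. 1)"
    proof (rule sum_norm_le)
      fix k
      have "norm (1 + of_nat k :: complex) = 1 + real k" by (metis norm_of_nat of_nat_Suc)
      moreover have "1 \<le> (1 + real k) ^ Suc p" by (rule one_le_power) simp
      ultimately show "norm (1 / (1 + of_nat k) ^ Suc p :: complex) \<le> 1"
        by (simp add: norm_divide norm_power norm_mult del: power_Suc)
    qed
    also have "(\<Sum>k<m. 1) \<le> (2 ^ m :: real)" by (simp add: less_imp_le of_nat_less_two_power)
    finally have "norm (Polygamma p (of_nat m + 1 :: complex)) \<le> norm (Polygamma p (1 :: complex)) * 1 + fact p * 2 ^ m" by simp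
    also have "\<dots> \<le> norm (Polygamma p (1 :: complex)) * 2 ^ m + fact p * 2 ^ m"
      by (intro add_right_mono mult_left_mono) auto
    finally show ?thesis by (simp add: A_def algebra_simps)
  qed
  moreover have "A > 0" unfolding A_def by (intro add_nonneg_pos) auto
  ultimately show ?thesis using that[of A] by blast
qed

lemma csch_kernel_minus: "csch_kernel L (- z) = csch_kernel L z"
proof -
  define e where "e = exp (of_real L * z)"
  have e: "e \<noteq> 0" by (simp add: e_def)
  have "exp (- of_real L * - z) = e" "exp (- of_real L * z) = 1 / e" by (simp_all add: e_def exp_minus inverse_eq_divide)
  moreover have "e / (1 - e)\<^sup>2 = (1 / e) / (1 - 1 / e)\<^sup>2"
  proof (cases "e = 1")
    case False
    then have "1 - 1 / e = - ((1 - e) / e)" using e by (simp add: field_simps)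
    then show ?thesis using e False by (simp add: power_divide power2_eq_square)
  qed simp
  ultimately show ?thesis unfolding csch_kernel_def by simp
qed

lemma norm_csch_kernel_int_le:
  fixes d :: int
  assumes "L > 0" "d \<noteq> 0"
  shows "norm (csch_kernel L (of_int d)) \<le> 1 / (1 - exp (- L))\<^sup>2"
proof -
  have *: "norm (csch_kernel L (of_int d)) \<le> 1 / (1 - exp (- L))\<^sup>2" if "d > 0" for d :: int
  proof -
    define e where "e = exp (- L * of_int d)"
    have "exp (- of_real L * of_int d) = complex_of_real e" by (simp add: e_def exp_of_real[symmetric])
    then have "csch_kernel L (of_int d) = of_real (e / (1 - e)\<^sup>2)" by (simp add: csch_kernel_def)
    then have n: "norm (csch_kernel L (of_int d)) = e / (1 - e)\<^sup>2" by (simp add: e_def norm_divide norm_power del: of_real_divide)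
    have "L * 1 \<le> L * of_int d" using that assms(1) by (intro mult_left_mono) auto
    then have "e \<le> exp (- L)" by (simp add: e_def)
    moreover have "exp (- L) < 1" using assms(1) by simp
    moreover from calculation have "(1 - exp (- L))\<^sup>2 \<le> (1 - e)\<^sup>2" by (intro power_mono) linarith+
    moreover have "(1 - exp (- L))\<^sup>2 > 0" using \<open>exp (- L) < 1\<close> by (intro zero_less_power) linarith
    ultimately have "e / (1 - e)\<^sup>2 \<le> 1 / (1 - exp (- L))\<^sup>2"
      by (intro frac_le) linarith+
    then show ?thesis using n by simp
  qed
  show ?thesis
  proof (cases "d > 0")
    case False
    then show ?thesis using *[of "- d"] csch_kernel_minus[of L "of_int d"] assms by simp
  qed (use * in auto)
qed

text \<open>The case n = 0 is separated because 1/0 is 0 in HOL, whereas the real poles need a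
  positive weight.\<close>

definition int_weight :: "int \<Rightarrow> real" where
  "int_weight n = (if n = 0 then 1 else 1 / (of_int n)\<^sup>2)"

lemma summable_int_weight: "int_weight summable_on UNIV"
proof -
  have "int_weight summable_on {0} \<union> (UNIV - {0})"
  proof (rule summable_on_union)
    have "(\<lambda>k::int. 1 / (real_of_int k)\<^sup>2) summable_on UNIV - {0}"
      by (rule summable_on_subset_banach[OF summable_on_int_inverse_square]) simp
    then show "int_weight summable_on UNIV - {0}"
      by (rule summable_on_cong[THEN iffD1, rotated]) (auto simp: int_weight_def)
  qed auto
  moreover have "{0} \<union> (UNIV - {0}) = (UNIV :: int set)" by auto
  ultimately show ?thesis by (simp only:)
qed

context podles
begin

text \<open>Multiplied by t^(2 m) and summed over m, this is a multiple of the even part of the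
  series of e^(4 u t).\<close>

definition coeff_bound :: "real \<Rightarrow> nat \<Rightarrow> int \<Rightarrow> real" where
  "coeff_bound C m n = C * ((4 * u) ^ (2 * m) / fact (2 * m)) * int_weight n"

lemma norm_u_powr: "norm (of_real u powr (- Sd_pole q m n)) = u ^ (2 * m)"
proof -
  have "norm (of_real u powr (- Sd_pole q m n)) = u powr (real (2 * m))"
    using u_pos by (subst norm_powr_real_powr) (auto simp: Sd_pole_def)
  then show ?thesis using u_pos by (simp only: powr_realpow)
qed

lemma u_fact_le:
  "u ^ (2 * m) * 2 ^ m / (fact m)\<^sup>2 \<le> (4 * u) ^ (2 * m) / fact (2 * m)"
  "u ^ (2 * m) * 4 ^ m / (fact m)\<^sup>2 \<le> (4 * u) ^ (2 * m) / fact (2 * m)"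
proof -
  have "u ^ (2 * m) * 4 ^ m * (1 / (fact m)\<^sup>2) \<le> u ^ (2 * m) * 4 ^ m * (4 ^ m / fact (2 * m))"
    using u_pos by (intro mult_left_mono inverse_fact_square_le) auto
  also have "\<dots> = (4 * u) ^ (2 * m) / fact (2 * m)"
    by (simp add: power_mult_distrib power_mult[of 4 2 m, symmetric] power_mult[of 4] flip: power_mult_distrib[of 4 4])
  finally show 4: "u ^ (2 * m) * 4 ^ m / (fact m)\<^sup>2 \<le> (4 * u) ^ (2 * m) / fact (2 * m)" by simp
  have "u ^ (2 * m) * 2 ^ m / (fact m)\<^sup>2 \<le> u ^ (2 * m) * 4 ^ m / (fact m)\<^sup>2"
    using u_pos by (intro divide_right_mono mult_left_mono power_mono) auto
  with 4 show "u ^ (2 * m) * 2 ^ m / (fact m)\<^sup>2 \<le> (4 * u) ^ (2 * m) / fact (2 * m)" by linarith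
qed

text \<open>The kernel is bounded on nonzero integers and 1/(k! (2 m - k)!) is a binomial
  coefficient over (2 m)!, so the sum is at most a constant times 2^(2 m)/(2 m)!.\<close>

lemma norm_coeff_d_le:
  obtains C where "C > 0" "\<And>m. norm (coeff_d q u m) \<le> C * ((4 * u) ^ (2 * m) / fact (2 * m))"
proof -
  define C where "C = 1 / (1 - exp (- L))\<^sup>2"
  have C: "C > 0" using L_pos by (simp add: C_def)
  have "norm (coeff_d q u m) \<le> 4 * C * ((4 * u) ^ (2 * m) / fact (2 * m))" for m
  proof -
    have "norm (\<Sum>j\<in>{0..2 * m} - {m}. (- 1) ^ (2 * m - j) / fact (2 * m - j) / fact j * csch_kernel L (2 * (of_nat j - of_nat m)))
       \<le> (\<Sum>j\<in>{0..2 * m} - {m}. of_nat (2 * m choose j) / fact (2 * m) * C)"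
    proof (rule sum_norm_le)
      fix j assume j: "j \<in> {0..2 * m} - {m}"
      then have d: "2 * (int j - int m) \<noteq> 0" by auto
      have k: "norm (csch_kernel L (2 * (of_nat j - of_nat m))) \<le> C"
        using norm_csch_kernel_int_le[OF L_pos d] by (simp add: C_def)
      have "1 / fact (2 * m - j) / fact j = (of_nat (2 * m choose j) / fact (2 * m) :: real)"
        using j by (simp add: binomial_fact)
      then show "norm ((- 1) ^ (2 * m - j) / fact (2 * m - j) / fact j * csch_kernel L (2 * (of_nat j - of_nat m)))
        \<le> of_nat (2 * m choose j) / fact (2 * m) * C"
      proof -
        define K where "K = norm (csch_kernel L (2 * (of_nat j - of_nat m)))"
        have "norm ((- 1) ^ (2 * m - j) / fact (2 * m - j) / fact j * csch_kernel L (2 * (of_nat j - of_nat m))) = 1 / fact (2 * m - j) / fact j * K"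
          unfolding K_def by (simp add: norm_mult norm_divide norm_power)
        also have "\<dots> \<le> 1 / fact (2 * m - j) / fact j * C" using k by (intro mult_left_mono) (auto simp: K_def)
        finally show ?thesis unfolding \<open>1 / fact (2 * m - j) / fact j = (of_nat (2 * m choose j) / fact (2 * m) :: real)\<close> .
      qed
    qed
    also have "\<dots> \<le> (\<Sum>j\<in>{..2 * m}. of_nat (2 * m choose j) / fact (2 * m) * C)"
      using C by (intro sum_mono2) auto
    also have "\<dots> = 2 ^ (2 * m) / fact (2 * m) * C"
      unfolding sum_distrib_right[symmetric] sum_divide_distrib[symmetric] of_nat_sum[symmetric] choose_row_sum by simp
    finally have S: "norm (\<Sum>j\<in>{0..2 * m} - {m}. (- 1) ^ (2 * m - j) / fact (2 * m - j) / fact j * csch_kernel L (2 * (of_nat j - of_nat m)))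
       \<le> 2 ^ (2 * m) / fact (2 * m) * C" .
    have "norm (coeff_d q u m) \<le> 4 * u ^ (2 * m) * (2 ^ (2 * m) / fact (2 * m) * C)"
      unfolding coeff_d_eq norm_mult norm_u_powr norm_numeral using u_pos by (intro mult_left_mono S) auto
    also have "\<dots> = 4 * C * ((2 * u) ^ (2 * m) / fact (2 * m))" by (simp add: power_mult_distrib)
    also have "\<dots> \<le> 4 * C * ((4 * u) ^ (2 * m) / fact (2 * m))"
      using C u_pos by (intro mult_left_mono divide_right_mono power_mono) auto
    finally show ?thesis .
  qed
  then show ?thesis using that[of "4 * C"] C by auto
qed

text \<open>The fastest growing term is the square of Digamma, at most A^2 4^m.\<close>

lemma norm_coeff_c_le:
  obtains C where "C > 0" "\<And>m. norm (coeff_c q u m 0) \<le> C * 4 ^ m / (fact m)\<^sup>2"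
    "\<And>m. norm (coeff_h q u m 0) \<le> C * 4 ^ m / (fact m)\<^sup>2"
    "\<And>m. norm (coeff_g m) \<le> C * 4 ^ m / (fact m)\<^sup>2"
proof -
  obtain A where A: "A > 0" "\<And>m. norm (Polygamma 0 (of_nat m + 1 :: complex)) \<le> A * 2 ^ m"
    using norm_Polygamma_nat_le[of 0] by blast
  obtain B where B: "B > 0" "\<And>m. norm (Polygamma 1 (of_nat m + 1 :: complex)) \<le> B * 2 ^ m"
    using norm_Polygamma_nat_le[of 1] by blast
  define l where "l = \<bar>ln u\<bar>"
  have l: "l \<ge> 0" by (simp add: l_def)
  define C1 where "C1 = (6 * l\<^sup>2 + L\<^sup>2 + 2 * pi\<^sup>2 + 12 * l * A + 6 * A\<^sup>2 + 6 * B) / 3"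
  define C2 where "C2 = 4 * (l + A)"
  define C where "C = C1 + C2 + 2"
  have pos: "C1 \<ge> 0" "C2 \<ge> 0" using l A(1) B(1) by (auto simp: C1_def C2_def)
  have p: "1 \<le> (4::real) ^ m" "(2::real) ^ m \<le> 4 ^ m" "((2::real) ^ m)\<^sup>2 = 4 ^ m" for m
    by (auto intro: power_mono simp: power2_eq_square simp flip: power_mult_distrib)
  have le: "X / (fact m)\<^sup>2 \<le> C * 4 ^ m / (fact m)\<^sup>2" if "X \<le> D * 4 ^ m" "D \<le> C" for X D :: real and m
  proof -
    have "D * 4 ^ m \<le> C * 4 ^ m" using that(2) by (intro mult_right_mono) auto
    then have "X \<le> C * 4 ^ m" using that(1) by linarith
    then show ?thesis by (intro divide_right_mono) auto
  qed
  show ?thesis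
  proof (rule that)
    show "C > 0" using pos by (simp add: C_def)
    fix m
    define \<psi>0 where "\<psi>0 = Polygamma 0 (of_nat m + 1 :: complex)"
    define \<psi>1 where "\<psi>1 = Polygamma 1 (of_nat m + 1 :: complex)"
    have g0: "norm \<psi>0 \<le> A * 2 ^ m" and g1: "norm \<psi>1 \<le> B * 2 ^ m" using A(2) B(2) by (auto simp: \<psi>0_def \<psi>1_def)
    have g0': "norm \<psi>0 \<le> A * 4 ^ m" and g1': "norm \<psi>1 \<le> B * 4 ^ m"
      using order_trans[OF g0 mult_left_mono[OF p(2)]] order_trans[OF g1 mult_left_mono[OF p(2)]] A(1) B(1) by simp_all
    have g02: "(norm \<psi>0)\<^sup>2 \<le> A\<^sup>2 * 4 ^ m"
      using power_mono[OF g0, of 2] by (simp add: power_mult_distrib p(3))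
    define X where "X = 6 * (complex_of_real (ln u))\<^sup>2 - (complex_of_real (ln q))\<^sup>2 + 2 * (complex_of_real pi)\<^sup>2
            - 12 * complex_of_real (ln u) * \<psi>0 + 6 * \<psi>0\<^sup>2 - 6 * \<psi>1"
    have "norm X \<le> norm (6 * (complex_of_real (ln u))\<^sup>2) + norm ((complex_of_real (ln q))\<^sup>2) + norm (2 * (complex_of_real pi)\<^sup>2)
            + norm (12 * complex_of_real (ln u) * \<psi>0) + norm (6 * \<psi>0\<^sup>2) + norm (6 * \<psi>1)"
      unfolding X_def
      by (intro order_trans[OF norm_triangle_ineq4] order_trans[OF norm_triangle_ineq] add_mono order_refl)
    also have "\<dots> = 6 * l\<^sup>2 + L\<^sup>2 + 2 * pi\<^sup>2 + 12 * l * norm \<psi>0 + 6 * (norm \<psi>0)\<^sup>2 + 6 * norm \<psi>1"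
      by (simp add: norm_mult norm_power l_def L_def)
    also have "\<dots> \<le> 6 * l\<^sup>2 * 4 ^ m + L\<^sup>2 * 4 ^ m + 2 * pi\<^sup>2 * 4 ^ m + 12 * l * (A * 4 ^ m) + 6 * (A\<^sup>2 * 4 ^ m) + 6 * (B * 4 ^ m)"
      using l p(1)[of m] by (intro add_mono mult_left_mono g0' g1' g02) (auto simp: mult_le_cancel_left1)
    finally have "norm X \<le> 3 * C1 * 4 ^ m" by (simp add: C1_def algebra_simps)
    moreover have "norm (coeff_c q u m 0) = norm X / 3 / (fact m)\<^sup>2"
      unfolding coeff_c_def X_def \<psi>0_def \<psi>1_def by (simp add: norm_mult norm_divide norm_power)
    ultimately show "norm (coeff_c q u m 0) \<le> C * 4 ^ m / (fact m)\<^sup>2"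
      using le[of "norm X / 3" C1 m] pos by (simp add: C_def)
    have "norm (complex_of_real (ln u) - \<psi>0) \<le> l + A * 4 ^ m"
      using norm_triangle_ineq4[of "complex_of_real (ln u)" \<psi>0] g0' by (simp add: l_def)
    also have "\<dots> \<le> (l + A) * 4 ^ m" using l p(1)[of m] by (simp add: distrib_right mult_le_cancel_left1)
    finally have "4 * norm (complex_of_real (ln u) - \<psi>0) \<le> C2 * 4 ^ m" unfolding C2_def by linarith
    moreover have "norm (coeff_h q u m 0) = 4 * norm (complex_of_real (ln u) - \<psi>0) / (fact m)\<^sup>2"
      unfolding coeff_h_def \<psi>0_def by (simp add: norm_mult norm_divide norm_power)
    ultimately show "norm (coeff_h q u m 0) \<le> C * 4 ^ m / (fact m)\<^sup>2"
      using le[of "4 * norm (complex_of_real (ln u) - \<psi>0)" C2 m] pos by (simp add: C_def)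
    have "norm (coeff_g m) = 2 / (fact m)\<^sup>2" by (simp add: coeff_g_def norm_mult norm_divide norm_power)
    then show "norm (coeff_g m) \<le> C * 4 ^ m / (fact m)\<^sup>2" using le[of 2 2 m] p(1)[of m] pos by (simp add: C_def)
  qed
qed

text \<open>The same coefficients with \<open>deriv Gamma\<close> in place of Gamma times Digamma:
  this form is covered by the Cauchy estimate and agrees with the derivative of
  \<open>gam_term\<close>.\<close>

lemma heat_coeff_nonreal_Gamma:
  fixes m :: nat and n :: int
  assumes "n \<noteq> 0"
  defines "s \<equiv> \<i> * of_real (2 * pi / L * of_int (- n)) - of_nat m"
  defines "r \<equiv> of_real u powr (- Sd_pole q m n) / complex_of_real (L\<^sup>2)"
  shows "heat_coeff q w (Sd_pole q m n) 2 = 0"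
    and "heat_coeff q w (Sd_pole q m n) 1 = r * (- (4 / fact m) * Gamma s)"
    and "heat_coeff q w (Sd_pole q m n) 0 = r * (4 / fact m * (deriv Gamma s - of_real (ln u) * Gamma s))"
proof -
  have tail: "0 * zeta_tail L (2 * m + 1) (Sd_pole q m n) = 0" by simp
  have G: "\<forall>j\<le>2 * m. taylor2 (\<lambda>w. w * Gamma (Sd_pole q m n + of_nat j + w)) 0 (Gamma (Sd_pole q m n + of_nat j))
     (deriv Gamma (Sd_pole q m n + of_nat j))"
    by (intro allI impI taylor2_Gamma_times_nz assms(1))
  note h = heat_coeff_taylor2[OF G tail]
  have s: "Sd_pole q m n + of_nat m = s" unfolding Sd_pole_eq s_def by simp
  have Lq: "(ln q)\<^sup>2 = L\<^sup>2" by (simp add: L_def)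
  show "heat_coeff q w (Sd_pole q m n) 2 = 0"
    "heat_coeff q w (Sd_pole q m n) 1 = r * (- (4 / fact m) * Gamma s)"
    "heat_coeff q w (Sd_pole q m n) 0 = r * (4 / fact m * (deriv Gamma s - of_real (ln u) * Gamma s))"
    unfolding h s Lq r_def by simp_all
qed

text \<open>At the real poles 4^m/(m!)^2 is traded for 4^(2 m)/(2 m)!. At the others the Gamma
  estimate at height 2 \<pi> |n| / L contributes 1/n^2, and its factor 2^m/m! joins the 1/m! of the
  residue.\<close>

lemma norm_heat_coeff_le:
  obtains C where "C > 0" "\<And>m n p. p \<le> 2 \<Longrightarrow> norm (heat_coeff q w (Sd_pole q m n) p) \<le> coeff_bound C m n"
proof -
  define y0 where "y0 = 2 * pi / L"
  have y0: "y0 > 0" using L_pos by (simp add: y0_def)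
  obtain Cd where Cd: "Cd > 0" "\<And>m. norm (coeff_d q u m) \<le> Cd * ((4 * u) ^ (2 * m) / fact (2 * m))"
    using norm_coeff_d_le by blast
  obtain Cc where Cc: "Cc > 0" "\<And>m. norm (coeff_c q u m 0) \<le> Cc * 4 ^ m / (fact m)\<^sup>2"
    "\<And>m. norm (coeff_h q u m 0) \<le> Cc * 4 ^ m / (fact m)\<^sup>2"
    "\<And>m. norm (coeff_g m) \<le> Cc * 4 ^ m / (fact m)\<^sup>2"
    using norm_coeff_c_le by blast
  obtain Cg where Cg: "Cg > 0"
    "\<And>y m. \<bar>y\<bar> \<ge> y0 \<Longrightarrow> norm (Gamma (\<i> * of_real y - of_nat m)) \<le> Cg * 2 ^ m / (fact m * y\<^sup>2)"
    "\<And>y m. \<bar>y\<bar> \<ge> y0 \<Longrightarrow> norm (deriv Gamma (\<i> * of_real y - of_nat m)) \<le> Cg * 2 ^ m / (fact m * y\<^sup>2)"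
    using norm_deriv_Gamma_shift_le[OF y0] by blast
  define l where "l = \<bar>ln u\<bar>"
  have l: "l \<ge> 0" by (simp add: l_def)
  define k where "k = 1 + l"
  have k: "k > 0" using l by (simp add: k_def)
  define C0 where "C0 = Cc / L\<^sup>2 + Cd"
  define C1 where "C1 = 4 * k * Cg / (L\<^sup>2 * y0\<^sup>2)"
  have pos: "C0 > 0" "C1 > 0" unfolding C0_def C1_def
    using Cc(1) Cd(1) Cg(1) L_pos y0 k by (auto intro!: add_nonneg_pos divide_pos_pos mult_pos_pos add_pos_nonneg)
  define b where "b m = (4 * u) ^ (2 * m) / fact (2 * m)" for m
  have b: "b m \<ge> 0" for m using u_pos by (simp add: b_def)
  have real: "norm (heat_coeff q w (Sd_pole q m 0) p) \<le> C0 * b m" if p: "p \<le> 2" for m p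
  proof -
    have rn: "norm (of_real u powr (- Sd_pole q m 0) / complex_of_real ((ln q)\<^sup>2)) = u ^ (2 * m) / L\<^sup>2"
      unfolding norm_divide norm_u_powr by (simp add: L_def norm_power)
    have *: "norm (of_real u powr (- Sd_pole q m 0) / complex_of_real ((ln q)\<^sup>2) * z) \<le> Cc / L\<^sup>2 * b m"
      if z: "norm z \<le> Cc * 4 ^ m / (fact m)\<^sup>2" for z
    proof -
      have "norm (of_real u powr (- Sd_pole q m 0) / complex_of_real ((ln q)\<^sup>2) * z) \<le> u ^ (2 * m) / L\<^sup>2 * (Cc * 4 ^ m / (fact m)\<^sup>2)"
        unfolding norm_mult rn using u_pos by (intro mult_left_mono z) auto
      also have "\<dots> = Cc / L\<^sup>2 * (u ^ (2 * m) * 4 ^ m / (fact m)\<^sup>2)" by simp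
      also have "\<dots> \<le> Cc / L\<^sup>2 * b m" unfolding b_def using Cc(1) by (intro mult_left_mono u_fact_le) auto
      finally show ?thesis .
    qed
    have "Cc / L\<^sup>2 * b m \<le> C0 * b m" using Cd(1) b by (intro mult_right_mono) (auto simp: C0_def)
    moreover have "norm (heat_coeff q w (Sd_pole q m 0) 0) \<le> Cc / L\<^sup>2 * b m + Cd * b m"
      unfolding heat_coeff_real(3)
      by (intro order_trans[OF norm_triangle_ineq] add_mono * Cc(2)) (use Cd(2) in \<open>simp add: b_def\<close>)
    moreover have "\<dots> = C0 * b m" by (simp add: C0_def algebra_simps)
    moreover have "norm (heat_coeff q w (Sd_pole q m 0) 1) \<le> Cc / L\<^sup>2 * b m"
      unfolding heat_coeff_real(2) by (rule *[OF Cc(3)])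
    moreover have "norm (heat_coeff q w (Sd_pole q m 0) 2) \<le> Cc / L\<^sup>2 * b m"
      unfolding heat_coeff_real(1) by (rule *[OF Cc(4)])
    moreover have "p = 0 \<or> p = 1 \<or> p = 2" using p by linarith
    ultimately show ?thesis by auto
  qed
  have nonreal: "norm (heat_coeff q w (Sd_pole q m n) p) \<le> C1 * b m / (of_int n)\<^sup>2" if p: "p \<le> 2" and n: "n \<noteq> 0" for m n p
  proof -
    define y where "y = 2 * pi / L * of_int (- n)"
    have yn: "\<bar>y\<bar> = y0 * \<bar>of_int n\<bar>" using L_pos by (simp add: y_def y0_def abs_mult)
    have "y0 * 1 \<le> y0 * \<bar>of_int n\<bar>" using y0 n by (intro mult_left_mono) auto
    then have y: "\<bar>y\<bar> \<ge> y0" unfolding yn by simp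
    have y2: "y\<^sup>2 = y0\<^sup>2 * (of_int n)\<^sup>2" using yn by (metis power2_abs power_mult_distrib)
    define G where "G = Cg * 2 ^ m / (fact m * y\<^sup>2)"
    have G0: "G \<ge> 0" using Cg(1) by (simp add: G_def)
    have rn: "norm (of_real u powr (- Sd_pole q m n) / complex_of_real (L\<^sup>2)) = u ^ (2 * m) / L\<^sup>2"
      unfolding norm_divide norm_u_powr by (simp add: norm_power)
    have *: "norm (of_real u powr (- Sd_pole q m n) / complex_of_real (L\<^sup>2) * z) \<le> C1 * b m / (of_int n)\<^sup>2"
      if z: "norm z \<le> 4 / fact m * (k * G)" for z
    proof -
      have "norm (of_real u powr (- Sd_pole q m n) / complex_of_real (L\<^sup>2) * z) \<le> u ^ (2 * m) / L\<^sup>2 * (4 / fact m * (k * G))"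
        unfolding norm_mult rn using u_pos by (intro mult_left_mono z) auto
      also have "\<dots> = C1 / (of_int n)\<^sup>2 * (u ^ (2 * m) * 2 ^ m / (fact m)\<^sup>2)"
        unfolding G_def C1_def y2 using n y0 by (simp add: power2_eq_square mult_ac)
      also have "\<dots> \<le> C1 / (of_int n)\<^sup>2 * b m" unfolding b_def using pos(2) by (intro mult_left_mono u_fact_le) auto
      finally show ?thesis by simp
    qed
    have g: "norm (Gamma (\<i> * of_real y - of_nat m)) \<le> G" "norm (deriv Gamma (\<i> * of_real y - of_nat m)) \<le> G"
      using Cg(2,3)[OF y] by (auto simp: G_def)
    have "norm (- (4 / fact m) * Gamma (\<i> * of_real y - of_nat m)) \<le> 4 / fact m * (k * G)"
    proof -
      have "norm (Gamma (\<i> * of_real y - of_nat m)) \<le> k * G"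
        using g(1) mult_nonneg_nonneg[OF l G0] by (simp add: k_def distrib_right)
      then have "4 / fact m * norm (Gamma (\<i> * of_real y - of_nat m)) \<le> 4 / fact m * (k * G)" by (intro mult_left_mono) auto
      then show ?thesis by (simp add: norm_mult norm_divide)
    qed
    then have 1: "norm (heat_coeff q w (Sd_pole q m n) 1) \<le> C1 * b m / (of_int n)\<^sup>2"
      unfolding heat_coeff_nonreal_Gamma(2)[OF n] y_def[symmetric] by (rule *)
    have "norm (4 / fact m * (deriv Gamma (\<i> * of_real y - of_nat m) - of_real (ln u) * Gamma (\<i> * of_real y - of_nat m))) \<le> 4 / fact m * (k * G)"
    proof -
      have "norm (deriv Gamma (\<i> * of_real y - of_nat m) - of_real (ln u) * Gamma (\<i> * of_real y - of_nat m))
        \<le> G + l * G"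
        by (intro order_trans[OF norm_triangle_ineq4] add_mono g) (use mult_left_mono[OF g(1) l] in \<open>simp add: norm_mult l_def\<close>)
      then have "4 / fact m * norm (deriv Gamma (\<i> * of_real y - of_nat m) - of_real (ln u) * Gamma (\<i> * of_real y - of_nat m)) \<le> 4 / fact m * (k * G)"
        by (intro mult_left_mono) (auto simp: k_def distrib_right)
      then show ?thesis unfolding norm_mult norm_divide by simp
    qed
    then have 0: "norm (heat_coeff q w (Sd_pole q m n) 0) \<le> C1 * b m / (of_int n)\<^sup>2"
      unfolding heat_coeff_nonreal_Gamma(3)[OF n] y_def[symmetric] by (rule *)
    have 2: "norm (heat_coeff q w (Sd_pole q m n) 2) \<le> C1 * b m / (of_int n)\<^sup>2"
      unfolding heat_coeff_nonreal_Gamma(1)[OF n] using pos(2) b[of m] by simp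
    have "p = 0 \<or> p = 1 \<or> p = 2" using p by linarith
    then show ?thesis using 0 1 2 by auto
  qed
  show ?thesis
  proof (rule that[of "C0 + C1"])
    show "C0 + C1 > 0" using pos by simp
    fix m n and p :: nat assume p: "p \<le> 2"
    show "norm (heat_coeff q w (Sd_pole q m n) p) \<le> coeff_bound (C0 + C1) m n"
    proof (cases "n = 0")
      case True
      have "C0 * b m \<le> (C0 + C1) * b m" using pos b by (intro mult_right_mono) auto
      then show ?thesis using real[OF p, of m] True by (simp add: coeff_bound_def int_weight_def b_def)
    next
      case False
      have "C1 * b m / (of_int n)\<^sup>2 \<le> (C0 + C1) * b m / (of_int n)\<^sup>2" using pos b by (intro divide_right_mono mult_right_mono) auto
      then show ?thesis using nonreal[OF p False, of m] False by (simp add: coeff_bound_def int_weight_def b_def)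
    qed
  qed
qed

end

section \<open>The expansion of the heat trace\<close>

lemma summable_on_exp_series_product:
  fixes x :: real
  assumes "x \<ge> 0"
  shows "(\<lambda>(m, i). c * (x ^ m / fact m * (x ^ i / fact i))) summable_on (A :: (nat \<times> nat) set)"
proof -
  have "(\<lambda>(m, i). (1 * (x ^ m / fact m)) * (1 * (x ^ i / fact i))) summable_on UNIV \<times> UNIV"
    using assms by (intro abs_summable_on_times summable_on_exp_series) auto
  then have "(\<lambda>p. c * (case p of (m, i) \<Rightarrow> (1 * (x ^ m / fact m)) * (1 * (x ^ i / fact i)))) summable_on UNIV \<times> UNIV"
    by (rule summable_on_cmult_right)
  then have "(\<lambda>p. c * (case p of (m, i) \<Rightarrow> (1 * (x ^ m / fact m)) * (1 * (x ^ i / fact i)))) summable_on A"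
    by (rule summable_on_subset_banach) auto
  then show ?thesis by (simp add: case_prod_unfold)
qed

text \<open>
  Summing along the antidiagonals \<open>m + i = N\<close>: the odd ones vanish because
  \<^const>\<open>csch_kernel\<close> is even while the sign \<open>(-1)\<^sup>i\<close> changes under \<open>i \<mapsto> N - i\<close>.
\<close>

lemma csch_double_series:
  fixes x L :: real
  assumes x: "x > 0" and L: "L > 0"
  defines "E \<equiv> \<lambda>m i. complex_of_real x ^ m / fact m * ((- of_real x) ^ i / fact i * csch_kernel L (of_int (int i - int m)))"
  shows "(\<lambda>p. norm (E (fst p) (snd p))) summable_on {p. fst p \<noteq> snd p}"
    and "((\<lambda>m. \<Sum>j\<in>{0..2 * m} - {m}. E (2 * m - j) j) has_sum (\<Sum>\<^sub>\<infinity>p\<in>{p. fst p \<noteq> snd p}. E (fst p) (snd p))) UNIV"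
proof -
  define Cs where "Cs = 1 / (1 - exp (- L))\<^sup>2"
  show abs: "(\<lambda>p. norm (E (fst p) (snd p))) summable_on {p. fst p \<noteq> snd p}"
  proof (rule summable_on_comparison_test)
    show "(\<lambda>(m, i). Cs * (x ^ m / fact m * (x ^ i / fact i))) summable_on {p. fst p \<noteq> snd p}"
      using x by (intro summable_on_exp_series_product) simp
    fix p :: "nat \<times> nat" assume p: "p \<in> {p. fst p \<noteq> snd p}"
    obtain m i where mi: "p = (m, i)" by force
    have "norm (csch_kernel L (of_int (int i - int m))) \<le> Cs"
      unfolding Cs_def using p mi L by (intro norm_csch_kernel_int_le) auto
    then have "x ^ m / fact m * (x ^ i / fact i) * norm (csch_kernel L (of_int (int i - int m))) \<le> x ^ m / fact m * (x ^ i / fact i) * Cs"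
      using x by (intro mult_left_mono) auto
    then show "norm (E (fst p) (snd p)) \<le> (case p of (m, i) \<Rightarrow> Cs * (x ^ m / fact m * (x ^ i / fact i)))"
      using x by (simp add: mi E_def norm_mult norm_divide norm_power mult_ac)
  qed auto
  \<comment> \<open>The middle index 2 i = N is left out: it is the diagonal of the double series,
    met only for even N.\<close>
  define S where "S N = {i. i \<le> N \<and> 2 * i \<noteq> N}" for N :: nat
  have bij: "bij_betw (\<lambda>(N, i). (N - i, i)) (Sigma UNIV S) {p. fst p \<noteq> snd p}"
    by (rule bij_betw_byWitness[where f' = "\<lambda>(m, i). (m + i, i)"]) (auto simp: S_def)
  have "(\<lambda>p. E (fst p) (snd p)) summable_on {p. fst p \<noteq> snd p}" by (rule abs_summable_summable[OF abs])
  then have "((\<lambda>p. E (fst p) (snd p)) has_sum (\<Sum>\<^sub>\<infinity>p\<in>{p. fst p \<noteq> snd p}. E (fst p) (snd p))) {p. fst p \<noteq> snd p}"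
    by (rule has_sum_infsum)
  then have "((\<lambda>p. E (fst p - snd p) (snd p)) has_sum (\<Sum>\<^sub>\<infinity>p\<in>{p. fst p \<noteq> snd p}. E (fst p) (snd p))) (Sigma UNIV S)"
    using has_sum_reindex_bij_betw[OF bij, of "\<lambda>p. E (fst p) (snd p)"] by (simp add: case_prod_beta)
  moreover have "((\<lambda>i. E (fst (N, i) - snd (N, i)) (snd (N, i))) has_sum (\<Sum>i\<in>S N. E (N - i) i)) (S N)" for N
    by (rule has_sum_finiteI) (auto simp: S_def)
  ultimately have hs: "((\<lambda>N. \<Sum>i\<in>S N. E (N - i) i) has_sum (\<Sum>\<^sub>\<infinity>p\<in>{p. fst p \<noteq> snd p}. E (fst p) (snd p))) UNIV"
    by (rule has_sum_SigmaD)
  have odd0: "(\<Sum>i\<in>S N. E (N - i) i) = 0" if N: "odd N" for N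
  proof -
    have "(\<Sum>i\<in>S N. E (N - i) i) = (\<Sum>i\<in>S N. E (N - (N - i)) (N - i))"
      by (rule sum.reindex_bij_witness[of _ "\<lambda>i. N - i" "\<lambda>i. N - i"]) (auto simp: S_def)
    also have "\<dots> = (\<Sum>i\<in>S N. - E (N - i) i)"
    proof (rule sum.cong)
      fix i assume "i \<in> S N"
      then have i: "i \<le> N" by (simp add: S_def)
      have sg: "(- complex_of_real x) ^ (N - i) = - ((- 1) ^ i * of_real x ^ (N - i))"
        unfolding power_minus[of "complex_of_real x"] using N i by (cases "even i") auto
      have cs: "csch_kernel L (of_int (int (N - i) - int (N - (N - i)))) = csch_kernel L (of_int (int i - int (N - i)))"
        using csch_kernel_minus[of L "of_int (int i - int (N - i))"] i by simp
      show "E (N - (N - i)) (N - i) = - E (N - i) i"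
        unfolding E_def cs sg power_minus[of "complex_of_real x" i] using i by (simp add: mult_ac)
    qed auto
    finally show ?thesis by (simp add: sum_negf)
  qed
  have "((\<lambda>N. \<Sum>i\<in>S N. E (N - i) i) has_sum (\<Sum>\<^sub>\<infinity>p\<in>{p. fst p \<noteq> snd p}. E (fst p) (snd p))) (range (\<lambda>m. 2 * m))"
    by (rule has_sum_cong_neutral[THEN iffD1, OF _ _ _ hs]) (use odd0 in \<open>auto elim!: evenE simp: image_iff\<close>)
  then have "((\<lambda>m. \<Sum>i\<in>S (2 * m). E (2 * m - i) i) has_sum (\<Sum>\<^sub>\<infinity>p\<in>{p. fst p \<noteq> snd p}. E (fst p) (snd p))) UNIV"
    by (subst (asm) has_sum_reindex) (auto simp: inj_def o_def)
  moreover have "S (2 * m) = {0..2 * m} - {m}" for m by (auto simp: S_def)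
  ultimately show "((\<lambda>m. \<Sum>j\<in>{0..2 * m} - {m}. E (2 * m - j) j) has_sum (\<Sum>\<^sub>\<infinity>p\<in>{p. fst p \<noteq> snd p}. E (fst p) (snd p))) UNIV"
    by simp
qed

context podles
begin

text \<open>For a pole of order at most three this is the residue at \<alpha> of Gamma (s)
  \<zeta>(s) t^(-s), with t^(-s) expanded in powers of -(s - \<alpha>) log t; hence the
  normalisation (-1)^p/p! in \<open>heat_coeff\<close>.\<close>

definition heat_term :: "real \<Rightarrow> complex \<Rightarrow> complex" where
  "heat_term t \<alpha> = (\<Sum>p=0..2. heat_coeff q w \<alpha> p * (of_real t powr (- \<alpha>) * of_real (ln t) ^ p))"

definition heat_majorant :: "real \<Rightarrow> real" where
  "heat_majorant t = (1 + \<bar>ln t\<bar> + (ln t)\<^sup>2) * exp (4 * u * t)"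

lemma norm_t_powr: "t > 0 \<Longrightarrow> norm (of_real t powr (- Sd_pole q m n)) = t ^ (2 * m)"
proof -
  assume t: "t > 0"
  have "norm (of_real t powr (- Sd_pole q m n)) = t powr (real (2 * m))"
    using t by (subst norm_powr_real_powr) (auto simp: Sd_pole_def)
  then show ?thesis using t by (simp only: powr_realpow)
qed

lemma norm_heat_term_le:
  assumes C: "\<And>m n p. p \<le> 2 \<Longrightarrow> norm (heat_coeff q w (Sd_pole q m n) p) \<le> coeff_bound C m n" and t: "t > 0"
  shows "norm (heat_term t (Sd_pole q m n)) \<le> coeff_bound C m n * (t ^ (2 * m) * (1 + \<bar>ln t\<bar> + (ln t)\<^sup>2))"
proof -
  have "norm (heat_term t (Sd_pole q m n)) \<le> (\<Sum>p=0..2. norm (heat_coeff q w (Sd_pole q m n) p) * (t ^ (2 * m) * \<bar>ln t\<bar> ^ p))"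
    unfolding heat_term_def by (intro sum_norm_le) (simp add: norm_mult norm_t_powr[OF t] norm_power)
  also have "\<dots> \<le> (\<Sum>p=0..2. coeff_bound C m n * (t ^ (2 * m) * \<bar>ln t\<bar> ^ p))"
    using t by (intro sum_mono mult_right_mono C) auto
  also have "\<dots> = coeff_bound C m n * (t ^ (2 * m) * (1 + \<bar>ln t\<bar> + (ln t)\<^sup>2))"
    by (simp add: numeral_2_eq_2 algebra_simps power2_eq_square)
  finally show ?thesis .
qed

lemma summable_coeff_bound:
  assumes "t > 0"
  shows "(\<lambda>(m, n). coeff_bound C m n * t ^ (2 * m)) summable_on UNIV"
    and "(\<Sum>\<^sub>\<infinity>(m, n)\<in>UNIV. coeff_bound C m n * t ^ (2 * m)) = C * (\<Sum>\<^sub>\<infinity>n. int_weight n) * (\<Sum>\<^sub>\<infinity>m. (4 * u * t) ^ (2 * m) / fact (2 * m))"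
    and "(\<Sum>\<^sub>\<infinity>m. (4 * u * t) ^ (2 * m) / fact (2 * m)) \<le> exp (4 * u * t)"
proof -
  define X where "X = 4 * u * t"
  have X: "X > 0" using u_pos assms by (simp add: X_def)
  define f where "f i = X ^ i / fact i" for i
  have f: "f i \<ge> 0" for i using X by (simp add: f_def)
  have fs: "f summable_on A" for A :: "nat set" using summable_on_exp_series[of X 1 A] X by (simp add: f_def[abs_def])
  have "(\<lambda>m. f (2 * m)) summable_on UNIV \<longleftrightarrow> f summable_on (range (\<lambda>m. 2 * m))"
    by (subst summable_on_reindex) (auto simp: inj_def o_def)
  then have es: "(\<lambda>m. f (2 * m)) summable_on UNIV" using fs by simp
  have iw: "int_weight n \<ge> 0" for n by (simp add: int_weight_def)
  have "(\<lambda>(m, n). f (2 * m) * int_weight n) summable_on UNIV \<times> UNIV"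
    by (rule abs_summable_on_times[OF es summable_int_weight]) (rule f iw)+
  then have pr: "(\<lambda>p. case p of (m, n) \<Rightarrow> f (2 * m) * int_weight n) summable_on UNIV \<times> UNIV" by simp
  have eq: "(case p of (m, n) \<Rightarrow> coeff_bound C m n * t ^ (2 * m)) = C * (case p of (m, n) \<Rightarrow> f (2 * m) * int_weight n)" for p
    by (cases p) (simp add: coeff_bound_def f_def X_def power_mult_distrib)
  show "(\<lambda>(m, n). coeff_bound C m n * t ^ (2 * m)) summable_on UNIV"
    unfolding eq using summable_on_cmult_right[OF pr, of C] by simp
  have "(\<Sum>\<^sub>\<infinity>p\<in>UNIV. case p of (m, n) \<Rightarrow> coeff_bound C m n * t ^ (2 * m)) = C * (\<Sum>\<^sub>\<infinity>p\<in>UNIV \<times> UNIV. case p of (m, n) \<Rightarrow> f (2 * m) * int_weight n)"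
    unfolding eq by (simp add: infsum_cmult_right')
  also have "(\<Sum>\<^sub>\<infinity>p\<in>UNIV \<times> UNIV. case p of (m, n) \<Rightarrow> f (2 * m) * int_weight n) = (\<Sum>\<^sub>\<infinity>m. \<Sum>\<^sub>\<infinity>n. f (2 * m) * int_weight n)"
    using infsum_Sigma'_banach[of "\<lambda>m n. f (2 * m) * int_weight n" UNIV "\<lambda>_. UNIV"] pr by simp
  also have "\<dots> = (\<Sum>\<^sub>\<infinity>m. f (2 * m)) * (\<Sum>\<^sub>\<infinity>n. int_weight n)"
    by (simp add: infsum_cmult_right' infsum_cmult_left')
  finally show "(\<Sum>\<^sub>\<infinity>(m, n)\<in>UNIV. coeff_bound C m n * t ^ (2 * m)) = C * (\<Sum>\<^sub>\<infinity>n. int_weight n) * (\<Sum>\<^sub>\<infinity>m. (4 * u * t) ^ (2 * m) / fact (2 * m))"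
    by (simp add: f_def X_def mult_ac)
  have "(\<Sum>\<^sub>\<infinity>m. f (2 * m)) = infsum f (range (\<lambda>m. 2 * m))"
    by (subst infsum_reindex) (auto simp: inj_def o_def)
  also have "\<dots> \<le> infsum f UNIV"
    by (rule infsum_mono_neutral) (use fs f in auto)
  also have "infsum f UNIV = exp X"
  proof -
    have "((\<lambda>i. X ^ i /\<^sub>R fact i) has_sum exp X) UNIV"
      by (intro norm_summable_imp_has_sum exp_converges summable_norm_exp)
    then show ?thesis by (simp add: has_sum_iff f_def[abs_def] divide_inverse mult.commute)
  qed
  finally show "(\<Sum>\<^sub>\<infinity>m. (4 * u * t) ^ (2 * m) / fact (2 * m)) \<le> exp (4 * u * t)"
    by (simp add: f_def X_def)
qed

lemma summable_heat_term:
  assumes C: "\<And>m n p. p \<le> 2 \<Longrightarrow> norm (heat_coeff q w (Sd_pole q m n) p) \<le> coeff_bound C m n" and t: "t > 0"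
  shows "(\<lambda>(m, n). norm (heat_term t (Sd_pole q m n))) summable_on UNIV"
proof -
  have "(\<lambda>p. (case p of (m, n) \<Rightarrow> coeff_bound C m n * t ^ (2 * m)) * (1 + \<bar>ln t\<bar> + (ln t)\<^sup>2)) summable_on UNIV"
    by (rule summable_on_cmult_left[OF summable_coeff_bound(1)[OF t]])
  then show ?thesis
    by (rule summable_on_comparison_test) (use norm_heat_term_le[OF C t] in \<open>auto simp: mult_ac\<close>)
qed

definition heat_trace :: "real \<Rightarrow> real" where
  "heat_trace t = (\<Sum>\<^sub>\<infinity>n\<in>{1..}. 4 * real n * exp (- t * (u * (exp (L * real n) - exp (- L * real n)))))"

text \<open>Each exp (x e^(-L n)) is expanded and the order of summation exchanged; the terms are
  nonnegative and dominated by n exp (-x e^(L n)) x^m/m!.\<close>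

lemma heat_trace_heat_sum:
  assumes t: "t > 0"
  defines "x \<equiv> t * u"
  shows "(\<lambda>n. 4 * real n * exp (- t * (u * (exp (L * real n) - exp (- L * real n))))) summable_on {1..}"
    and "((\<lambda>m. 4 * of_real x ^ m / fact m * heat_sum L x m) has_sum of_real (heat_trace t)) UNIV"
proof -
  have x: "x > 0" using t u_pos by (simp add: x_def)
  define F where "F n m = real n * exp (- x * exp (L * real n)) * ((x * exp (- L * real n)) ^ m / fact m)" for n m :: nat
  have F0: "F n m \<ge> 0" for n m using x by (simp add: F_def)
  have "(\<lambda>n. complex_of_real (real n * exp (- L * real n * real 0) * exp (- x * exp (L * real n)))) summable_on {1..}"
    by (rule heat_sum_expansion(4)[OF x L_pos])
  from summable_on_Re[OF this] have s0: "(\<lambda>n. real n * exp (- x * exp (L * real n))) summable_on {1..}" by simp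
  have s1: "(\<lambda>m. 1 * (x ^ m / fact m)) summable_on UNIV" using x by (intro summable_on_exp_series) simp
  have prod: "(\<lambda>(n, m). (real n * exp (- x * exp (L * real n))) * (1 * (x ^ m / fact m))) summable_on {1..} \<times> UNIV"
    by (rule abs_summable_on_times[OF s0 s1]) (use x in auto)
  have Fs: "(\<lambda>(n, m). F n m) summable_on {1..} \<times> UNIV"
  proof (rule summable_on_comparison_test[OF prod])
    fix p :: "nat \<times> nat"
    obtain n m where p: "p = (n, m)" by force
    have "x * exp (- L * real n) \<le> x * 1" using x L_pos by (intro mult_left_mono) auto
    then have "(x * exp (- L * real n)) ^ m \<le> x ^ m" using x by (intro power_mono) auto
    then show "(case p of (n, m) \<Rightarrow> F n m) \<le> (case p of (n, m) \<Rightarrow> (real n * exp (- x * exp (L * real n))) * (1 * (x ^ m / fact m)))"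
      unfolding p F_def prod.case by (intro mult_left_mono) (auto intro: divide_right_mono)
    show "0 \<le> (case p of (n, m) \<Rightarrow> F n m)" using F0 by (simp add: p)
  qed
  have row: "(\<Sum>\<^sub>\<infinity>m. F n m) = real n * exp (- t * (u * (exp (L * real n) - exp (- L * real n))))" for n
  proof -
    have "((\<lambda>m. (x * exp (- L * real n)) ^ m /\<^sub>R fact m) has_sum exp (x * exp (- L * real n))) UNIV"
      by (intro norm_summable_imp_has_sum exp_converges summable_norm_exp)
    from has_sum_cmult_right[OF this, of "real n * exp (- x * exp (L * real n))"]
    have "((\<lambda>m. F n m) has_sum (real n * exp (- x * exp (L * real n)) * exp (x * exp (- L * real n)))) UNIV"
      by (simp add: F_def divide_inverse mult_ac)
    moreover have "exp (- x * exp (L * real n)) * exp (x * exp (- L * real n)) = exp (- t * (u * (exp (L * real n) - exp (- L * real n))))"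
      unfolding mult_exp_exp x_def by (simp add: algebra_simps)
    ultimately show ?thesis by (simp add: has_sum_iff mult.assoc)
  qed
  have col: "complex_of_real (\<Sum>\<^sub>\<infinity>n\<in>{1..}. F n m) = of_real x ^ m / fact m * heat_sum L x m" for m
  proof -
    have "((\<lambda>n. complex_of_real (real n * exp (- L * real n * real m) * exp (- x * exp (L * real n)))) has_sum heat_sum L x m) {1..}"
      unfolding heat_sum_def by (rule has_sum_infsum[OF heat_sum_expansion(4)[OF x L_pos]])
    from has_sum_cmult_right[OF this, of "of_real x ^ m / fact m"]
    have "((\<lambda>n. of_real x ^ m / fact m * complex_of_real (real n * exp (- L * real n * real m) * exp (- x * exp (L * real n)))) has_sum (of_real x ^ m / fact m * heat_sum L x m)) {1..}" .
    moreover have "of_real x ^ m / fact m * complex_of_real (real n * exp (- L * real n * real m) * exp (- x * exp (L * real n))) = complex_of_real (F n m)" for n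
    proof -
      have "exp (- L * real n) ^ m = exp (- L * real n * real m)" by (simp add: exp_of_nat_mult[symmetric] mult_ac)
      then show ?thesis by (simp add: F_def power_mult_distrib del: of_real_exp)
    qed
    ultimately have h: "((\<lambda>n. complex_of_real (F n m)) has_sum (of_real x ^ m / fact m * heat_sum L x m)) {1..}" by simp
    have "(\<lambda>n. F n m) summable_on {1..}" using summable_on_Re[OF has_sum_imp_summable[OF h]] by simp
    then have "((\<lambda>n. complex_of_real (F n m)) has_sum complex_of_real (\<Sum>\<^sub>\<infinity>n\<in>{1..}. F n m)) {1..}"
      by (intro has_sum_of_real has_sum_infsum)
    with h show ?thesis by (metis has_sum_unique)
  qed
  have rs: "(\<lambda>n. \<Sum>\<^sub>\<infinity>m. F n m) summable_on {1..}" using summable_on_Sigma_banach[OF Fs] by simp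
  from summable_on_cmult_right[OF this, of 4]
  show "(\<lambda>n. 4 * real n * exp (- t * (u * (exp (L * real n) - exp (- L * real n))))) summable_on {1..}"
    unfolding row by (simp add: mult.assoc)
  have Fs': "(\<lambda>(m, n). F n m) summable_on UNIV \<times> {1..}"
    using Fs by (subst (asm) summable_on_swap) (simp add: case_prod_beta)
  have "((\<lambda>m. \<Sum>\<^sub>\<infinity>n\<in>{1..}. F n m) has_sum (\<Sum>\<^sub>\<infinity>m. \<Sum>\<^sub>\<infinity>n\<in>{1..}. F n m)) UNIV"
    using summable_on_Sigma_banach[OF Fs'] by (intro has_sum_infsum) simp
  also have "(\<Sum>\<^sub>\<infinity>m. \<Sum>\<^sub>\<infinity>n\<in>{1..}. F n m) = (\<Sum>\<^sub>\<infinity>n\<in>{1..}. \<Sum>\<^sub>\<infinity>m. F n m)"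
    by (rule infsum_swap_banach[OF Fs, symmetric])
  finally have "((\<lambda>m. 4 * (\<Sum>\<^sub>\<infinity>n\<in>{1..}. F n m)) has_sum (4 * (\<Sum>\<^sub>\<infinity>n\<in>{1..}. \<Sum>\<^sub>\<infinity>m. F n m))) UNIV"
    by (rule has_sum_cmult_right)
  moreover have "4 * (\<Sum>\<^sub>\<infinity>n\<in>{1..}. \<Sum>\<^sub>\<infinity>m. F n m) = heat_trace t"
    unfolding row heat_trace_def by (simp add: infsum_cmult_right'[symmetric] mult.assoc)
  ultimately have "((\<lambda>m. 4 * (\<Sum>\<^sub>\<infinity>n\<in>{1..}. F n m)) has_sum heat_trace t) UNIV" by simp
  then have "((\<lambda>m. complex_of_real (4 * (\<Sum>\<^sub>\<infinity>n\<in>{1..}. F n m))) has_sum of_real (heat_trace t)) UNIV"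
    by (rule has_sum_of_real)
  then show "((\<lambda>m. 4 * of_real x ^ m / fact m * heat_sum L x m) has_sum of_real (heat_trace t)) UNIV"
    unfolding of_real_mult col by (simp add: mult_ac)
qed

end

section \<open>Matching the residues with the derivatives of the Gamma series and of the geometric
  series\<close>

context podles
begin

text \<open>With s = \<alpha> + m and x = t u one has t^(-\<alpha>) u^(-\<alpha>) = x^m x^(-s). The
  log t of the heat term and the log u of the coefficient add up to log x, as in the derivative of
  the term of frequency - n.\<close>

lemma heat_term_nonreal:
  assumes t: "t > 0" and n: "n \<noteq> 0"
  defines "x \<equiv> t * u"
  shows "heat_term t (Sd_pole q m n) = 4 * of_real x ^ m / fact m * (1 / of_real L ^ 2) * deriv (gam_term L x (- n)) (- of_nat m)"
proof -
  define \<alpha> where "\<alpha> = Sd_pole q m n"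
  define s where "s = \<i> * of_real (2 * pi / L * of_int (- n)) - of_nat m"
  have x: "x > 0" using t u_pos by (simp add: x_def)
  have ln: "ln x = ln t + ln u" using t u_pos by (simp add: x_def ln_mult)
  have s': "- of_nat m + \<i> * of_real (2 * pi / L * of_int (- n)) = s" by (simp add: s_def)
  have "s \<notin> \<int>\<^sub>\<le>\<^sub>0"
    by (rule nonpos_Ints_Im) (use n L_pos in \<open>simp add: s_def\<close>)
  then have dg: "deriv (gam_term L x (- n)) (- of_nat m) = (deriv Gamma s - of_real (ln x) * Gamma s) * exp (- s * of_real (ln x))"
    using deriv_gam_term[of "- of_nat m" L "- n" x] unfolding s' by blast
  have "exp (of_real (ln x) * of_nat m) = complex_of_real x ^ m"
  proof -
    have "exp (complex_of_real (ln x)) = of_real x" using x by (simp add: exp_of_real)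
    then show ?thesis by (simp only: exp_of_nat2_mult)
  qed
  moreover have al: "\<alpha> = s - of_nat m" by (simp add: \<alpha>_def Sd_pole_eq s_def)
  have "exp (- \<alpha> * of_real (ln x)) = exp (of_real (ln x) * of_nat m) * exp (- s * of_real (ln x))"
    unfolding al mult_exp_exp by (intro arg_cong[of _ _ exp]) (simp add: algebra_simps)
  ultimately have xa: "exp (- \<alpha> * of_real (ln x)) = of_real x ^ m * exp (- s * of_real (ln x))" by simp
  have "of_real t powr (- \<alpha>) * of_real u powr (- \<alpha>) = exp (- \<alpha> * of_real (ln x))"
    using t u_pos unfolding ln by (simp add: powr_def Ln_of_real mult_exp_exp algebra_simps)
  then have tu: "of_real t powr (- \<alpha>) * of_real u powr (- \<alpha>) = of_real x ^ m * exp (- s * of_real (ln x))" unfolding xa .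
  define T where "T = complex_of_real t powr (- \<alpha>)"
  define U where "U = complex_of_real u powr (- \<alpha>)"
  define X where "X = exp (- s * of_real (ln x))"
  have TU: "T * U = of_real x ^ m * X" using tu by (simp add: T_def U_def X_def)
  note h = heat_coeff_nonreal_Gamma[OF n, of m, folded s_def \<alpha>_def U_def]
  have "heat_term t \<alpha> = heat_coeff q w \<alpha> 0 * T + heat_coeff q w \<alpha> 1 * (T * of_real (ln t)) + heat_coeff q w \<alpha> 2 * (T * of_real (ln t) ^ 2)"
    by (simp add: heat_term_def T_def numeral_2_eq_2)
  also have "\<dots> = (T * U) * (4 / fact m * (1 / of_real L ^ 2) * (deriv Gamma s - (of_real (ln t) + of_real (ln u)) * Gamma s))"
    unfolding h by (simp add: algebra_simps add_divide_distrib diff_divide_distrib)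
  also have "\<dots> = 4 * of_real x ^ m / fact m * (1 / of_real L ^ 2) * deriv (gam_term L x (- n)) (- of_nat m)"
  proof -
    have "deriv (gam_term L x (- n)) (- of_nat m) = (deriv Gamma s - (of_real (ln t) + of_real (ln u)) * Gamma s) * X"
      unfolding dg X_def ln of_real_add ..
    then show ?thesis unfolding TU by simp
  qed
  finally show ?thesis unfolding \<alpha>_def .
qed

text \<open>The coefficients g, h and c form a quadratic polynomial in log t that depends only on
  log t + log u = log x; up to a factor it is the derivative of the cancelled pole. The coefficient
  d gives the antidiagonal of total degree 2 m of the double kernel series.\<close>

lemma heat_term_real:
  fixes m :: nat
  assumes t: "t > 0"
  defines "x \<equiv> t * u"
  defines "c \<equiv> (- 1) ^ m / fact m * of_real x ^ m * ((of_real (ln x) ^ 2 / 2 - of_real (ln x) * Digamma (of_nat m + 1)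
     + ((Digamma (of_nat m + 1)) ^ 2 - Polygamma 1 (of_nat m + 1)) / 2 + of_real pi ^ 2 / 6) / of_real L - of_real L / 12)"
  shows "heat_term t (Sd_pole q m 0) = 4 * of_real x ^ m / fact m * (1 / of_real L) * c
    + 4 * (\<Sum>j\<in>{0..2 * m} - {m}. complex_of_real x ^ (2 * m - j) / fact (2 * m - j) *
        ((- of_real x) ^ j / fact j * csch_kernel L (of_int (int j - int (2 * m - j)))))"
proof -
  define \<alpha> where "\<alpha> = Sd_pole q m 0"
  have ln: "ln x = ln t + ln u" using t u_pos by (simp add: x_def ln_mult)
  have al: "- \<alpha> = of_nat (2 * m)" by (simp add: \<alpha>_def Sd_pole_def)
  have up: "complex_of_real u powr (- \<alpha>) = of_real u ^ (2 * m)" unfolding al using u_pos by (simp only: powr_nat) simp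
  have tp: "complex_of_real t powr (- \<alpha>) = of_real t ^ (2 * m)" unfolding al using t by (simp only: powr_nat) simp
  have tu: "complex_of_real t ^ (2 * m) * of_real u ^ (2 * m) = of_real x ^ m * of_real x ^ m"
    by (simp add: x_def power_mult_distrib mult_2 power_add)
  have D: "of_real t ^ (2 * m) * coeff_d q u m = 4 * (\<Sum>j\<in>{0..2 * m} - {m}. complex_of_real x ^ (2 * m - j) / fact (2 * m - j) *
        ((- of_real x) ^ j / fact j * csch_kernel L (of_int (int j - int (2 * m - j)))))"
  proof -
    have X: "complex_of_real x ^ (2 * m - j) / fact (2 * m - j) * ((- of_real x) ^ j / fact j * csch_kernel L (of_int (int j - int (2 * m - j))))
       = (of_real t ^ (2 * m) * of_real u ^ (2 * m)) * ((- 1) ^ (2 * m - j) / fact (2 * m - j) / fact j * csch_kernel L (2 * (of_nat j - of_nat m)))"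
      if j: "j \<in> {0..2 * m} - {m}" for j
    proof -
      have a: "of_int (int j - int (2 * m - j)) = (2 * (of_nat j - of_nat m) :: complex)" using j by (simp add: of_nat_diff)
      have sg: "(- 1) ^ (2 * m - j) = ((- 1) ^ j :: complex)"
        using j by (cases "even j") (simp_all add: minus_one_power_iff)
      have "of_real x ^ m * of_real x ^ m = complex_of_real x ^ (2 * m - j) * of_real x ^ j"
        using j by (simp add: mult_2 flip: power_add)
      then show ?thesis unfolding tu a sg power_minus[of "complex_of_real x" j] by (simp add: mult_ac)
    qed
    have "(\<Sum>j\<in>{0..2 * m} - {m}. complex_of_real x ^ (2 * m - j) / fact (2 * m - j) * ((- of_real x) ^ j / fact j * csch_kernel L (of_int (int j - int (2 * m - j)))))
       = (\<Sum>j\<in>{0..2 * m} - {m}. (of_real t ^ (2 * m) * of_real u ^ (2 * m)) * ((- 1) ^ (2 * m - j) / fact (2 * m - j) / fact j * csch_kernel L (2 * (of_nat j - of_nat m))))"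
      by (rule sum.cong[OF refl]) (rule X)
    then show ?thesis
      unfolding sum_distrib_left[symmetric] coeff_d_eq \<alpha>_def[symmetric] up by (simp only: mult_ac)
  qed
  have Lq: "complex_of_real ((ln q)\<^sup>2) = of_real L ^ 2" "(complex_of_real (ln q))\<^sup>2 = of_real L ^ 2" by (simp_all add: L_def)
  have L0: "complex_of_real L \<noteq> 0" using L_pos by simp
  define a where "a = complex_of_real (ln t)"
  define b where "b = complex_of_real (ln u)"
  define \<psi>0 where "\<psi>0 = Digamma (of_nat m + 1 :: complex)"
  define \<psi>1 where "\<psi>1 = Polygamma 1 (of_nat m + 1 :: complex)"
  define T where "T = complex_of_real t ^ (2 * m)"
  define U where "U = complex_of_real u ^ (2 * m)"
  define F where "F = (fact m :: complex)"
  define S where "S = (- 1 :: complex) ^ m"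
  define P where "P = complex_of_real pi ^ 2"
  define K where "K = complex_of_real L"
  have nz: "F \<noteq> 0" "K \<noteq> 0" using L0 by (simp_all add: F_def K_def)
  have g: "coeff_g m = 2 * S / F ^ 2" by (simp add: coeff_g_def S_def F_def)
  have h: "coeff_h q u m 0 = 4 * S / F ^ 2 * (b - \<psi>0)" by (simp add: coeff_h_def S_def F_def b_def \<psi>0_def)
  have cc: "coeff_c q u m 0 = S / (3 * F ^ 2) * (6 * b ^ 2 - K ^ 2 + 2 * P - 12 * b * \<psi>0 + 6 * \<psi>0 ^ 2 - 6 * \<psi>1)"
    by (simp add: coeff_c_def S_def F_def b_def \<psi>0_def \<psi>1_def P_def K_def Lq)
  have "heat_term t \<alpha> = heat_coeff q w \<alpha> 0 * T + heat_coeff q w \<alpha> 1 * (T * a) + heat_coeff q w \<alpha> 2 * (T * a ^ 2)"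
    by (simp add: heat_term_def tp T_def a_def numeral_2_eq_2)
  also have "\<dots> = (T * U) * (1 / K ^ 2 * (coeff_g m * a ^ 2 + coeff_h q u m 0 * a + coeff_c q u m 0)) + T * coeff_d q u m"
    unfolding heat_coeff_real[of m, folded \<alpha>_def] up Lq U_def[symmetric] K_def[symmetric]
    by (simp add: algebra_simps add_divide_distrib)
  \<comment> \<open>Here the three coefficients combine into a polynomial in a + b = log x.\<close>
  also have "1 / K ^ 2 * (coeff_g m * a ^ 2 + coeff_h q u m 0 * a + coeff_c q u m 0) =
     4 * (1 / F) * (1 / K) * (S / F * (((a + b) ^ 2 / 2 - (a + b) * \<psi>0 + (\<psi>0 ^ 2 - \<psi>1) / 2 + P / 6) / K - K / 12))"
    unfolding g h cc using nz by (simp add: field_simps power2_eq_square)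
  also have "(T * U) * (4 * (1 / F) * (1 / K) * (S / F * (((a + b) ^ 2 / 2 - (a + b) * \<psi>0 + (\<psi>0 ^ 2 - \<psi>1) / 2 + P / 6) / K - K / 12)))
     = 4 * of_real x ^ m / F * (1 / K) * (S / F * of_real x ^ m * (((a + b) ^ 2 / 2 - (a + b) * \<psi>0 + (\<psi>0 ^ 2 - \<psi>1) / 2 + P / 6) / K - K / 12))"
    unfolding T_def U_def tu by simp
  also have "S / F * of_real x ^ m * (((a + b) ^ 2 / 2 - (a + b) * \<psi>0 + (\<psi>0 ^ 2 - \<psi>1) / 2 + P / 6) / K - K / 12) = c"
    unfolding c_def ln S_def F_def a_def b_def \<psi>0_def \<psi>1_def P_def K_def of_real_add ..
  finally show ?thesis unfolding \<alpha>_def[symmetric] D[symmetric] T_def F_def K_def .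
qed

text \<open>Summing the expansions of \<open>heat_sum\<close> over m yields the nonreal terms, the
  cancelled poles \<open>c\<close> and the double series \<open>E\<close> by rows. The real heat
  terms consist of the cancelled poles and of \<open>E\<close> by antidiagonals. Both arrangements
  have the total \<open>4 * SE\<close>, which therefore cancels in the comparison.\<close>

theorem heat_trace_expansion:
  assumes t: "t > 0"
  shows "((\<lambda>(m, n). heat_term t (Sd_pole q m n)) has_sum of_real (heat_trace t)) UNIV"
proof -
  define x where "x = t * u"
  have x: "x > 0" using t u_pos by (simp add: x_def)
  have L0: "complex_of_real L \<noteq> 0" using L_pos by simp
  define V where "V m n = heat_term t (Sd_pole q m n)" for m n
  define E where "E m i = complex_of_real x ^ m / fact m * ((- of_real x) ^ i / fact i * csch_kernel L (of_int (int i - int m)))" for m i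
  define c :: "nat \<Rightarrow> complex" where "c m = (- 1) ^ m / fact m * of_real x ^ m * ((of_real (ln x) ^ 2 / 2 - of_real (ln x) * Digamma (of_nat m + 1)
     + ((Digamma (of_nat m + 1)) ^ 2 - Polygamma 1 (of_nat m + 1)) / 2 + of_real pi ^ 2 / 6) / of_real L - of_real L / 12)" for m
  define A where "A m = 4 * complex_of_real x ^ m / fact m" for m
  define D where "D m = 4 * (\<Sum>j\<in>{0..2 * m} - {m}. E (2 * m - j) j)" for m
  note hs = heat_sum_expansion[OF x L_pos]
  obtain C where C: "C > 0" "\<And>m n p. p \<le> 2 \<Longrightarrow> norm (heat_coeff q w (Sd_pole q m n) p) \<le> coeff_bound C m n"
    using norm_heat_coeff_le by blast
  have "(\<lambda>(m, n). norm (V m n)) summable_on UNIV" unfolding V_def by (rule summable_heat_term[OF C(2) t])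
  then have "(\<lambda>p. norm (V (fst p) (snd p))) summable_on UNIV" by (simp add: case_prod_unfold)
  then have "(\<lambda>p. V (fst p) (snd p)) summable_on UNIV" by (rule abs_summable_summable)
  then have Vs: "(\<lambda>p. V (fst p) (snd p)) summable_on B" for B by (rule summable_on_subset_banach) simp
  have Es: "(\<lambda>p. 4 * E (fst p) (snd p)) summable_on {p. fst p \<noteq> snd p}"
    using csch_double_series(1)[OF x L_pos, folded E_def] by (intro summable_on_cmult_right) (rule abs_summable_summable)
  define SW where "SW = (\<Sum>\<^sub>\<infinity>p\<in>Sigma UNIV (\<lambda>_. UNIV - {0}). V (fst p) (snd p))"
  define SV where "SV = (\<Sum>\<^sub>\<infinity>p\<in>Sigma UNIV (\<lambda>_. {0}). V (fst p) (snd p))"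
  define SE where "SE = (\<Sum>\<^sub>\<infinity>p\<in>{p. fst p \<noteq> snd p}. E (fst p) (snd p))"
  have SEh: "((\<lambda>p. 4 * E (fst p) (snd p)) has_sum (4 * SE)) (Sigma UNIV (\<lambda>m. UNIV - {m}))"
  proof -
    have "Sigma UNIV (\<lambda>m. UNIV - {m}) = {p :: nat \<times> nat. fst p \<noteq> snd p}" by auto
    then show ?thesis using Es unfolding SE_def by (simp add: has_sum_iff infsum_cmult_right')
  qed
  have Dh: "(D has_sum (4 * SE)) UNIV"
    unfolding D_def SE_def using csch_double_series(2)[OF x L_pos, folded E_def] by (intro has_sum_cmult_right)
  have W: "((\<lambda>n. V m n) has_sum (A m * (1 / of_real L ^ 2) * (\<Sum>\<^sub>\<infinity>k\<in>UNIV - {0}. deriv (gam_term L x k) (- of_nat m)))) (UNIV - {0})" for m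
  proof -
    have "((\<lambda>k. deriv (gam_term L x k) (- of_nat m)) has_sum (\<Sum>\<^sub>\<infinity>k\<in>UNIV - {0}. deriv (gam_term L x k) (- of_nat m))) (UNIV - {0})"
      by (rule has_sum_infsum[OF hs(2)])
    then have "((\<lambda>n. deriv (gam_term L x (- n)) (- of_nat m)) has_sum (\<Sum>\<^sub>\<infinity>k\<in>UNIV - {0}. deriv (gam_term L x k) (- of_nat m))) (UNIV - {0})"
      by (subst has_sum_reindex_bij_witness[of _ uminus uminus]) auto
    from has_sum_cmult_right[OF this, of "A m * (1 / of_real L ^ 2)"] show ?thesis
    proof (rule has_sum_cong[THEN iffD1, rotated])
      fix n :: int assume "n \<in> UNIV - {0}"
      then show "A m * (1 / of_real L ^ 2) * deriv (gam_term L x (- n)) (- of_nat m) = V m n"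
        unfolding V_def A_def x_def using heat_term_nonreal[OF t, of n m] by simp
    qed
  qed
  have P: "((\<lambda>i. 4 * E m i) has_sum (- (A m * (1 / of_real L) * (\<Sum>\<^sub>\<infinity>i\<in>UNIV - {m}. deriv (pole_term L x i) (- of_nat m))))) (UNIV - {m})" for m
  proof -
    from has_sum_cmult_right[OF has_sum_infsum[OF hs(3)], of "- (A m * (1 / of_real L))" m]
    have "((\<lambda>i. - (A m * (1 / of_real L)) * deriv (pole_term L x i) (- of_nat m)) has_sum
       - (A m * (1 / of_real L)) * (\<Sum>\<^sub>\<infinity>i\<in>UNIV - {m}. deriv (pole_term L x i) (- of_nat m))) (UNIV - {m})" .
    then have "((\<lambda>i. 4 * E m i) has_sum
       - (A m * (1 / of_real L)) * (\<Sum>\<^sub>\<infinity>i\<in>UNIV - {m}. deriv (pole_term L x i) (- of_nat m))) (UNIV - {m})"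
    proof (rule has_sum_cong[THEN iffD1, rotated])
      fix i assume i: "i \<in> UNIV - {m}"
      have "exp (- L * (real i - real m)) \<noteq> 1" using i L_pos by simp
      then have "complex_of_real (exp (- L * (real i - real m))) \<noteq> 1" unfolding of_real_eq_1_iff .
      then have "exp (- of_real L * (- of_nat m + of_nat i)) \<noteq> (1 :: complex)"
        by (simp add: exp_of_real[symmetric])
      from deriv_pole_term[OF this, of x]
      show "- (A m * (1 / of_real L)) * deriv (pole_term L x i) (- of_nat m) = 4 * E m i"
        unfolding A_def E_def csch_kernel_def using L0 by (simp add: algebra_simps)
    qed
    then show ?thesis by simp
  qed
  have main: "A m * heat_sum L x m = A m * (1 / of_real L ^ 2) * (\<Sum>\<^sub>\<infinity>k\<in>UNIV - {0}. deriv (gam_term L x k) (- of_nat m))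
     + - (A m * (1 / of_real L) * (\<Sum>\<^sub>\<infinity>i\<in>UNIV - {m}. deriv (pole_term L x i) (- of_nat m))) + A m * (1 / of_real L) * c m" for m
  proof -
    have "heat_sum L x m = (of_real L * heat_sum L x m) / of_real L" using L0 by simp
    moreover have "a * ((g / l - p + d) / l) = a * (1 / l ^ 2) * g + - (a * (1 / l) * p) + a * (1 / l) * d" for a g l p d :: complex
      by (simp add: add_divide_distrib diff_divide_distrib power2_eq_square algebra_simps)
    ultimately show ?thesis unfolding hs(1) c_def[symmetric] by simp
  qed
  have V0: "V m 0 = A m * (1 / of_real L) * c m + D m" for m
    unfolding V_def A_def c_def D_def E_def x_def by (rule heat_term_real[OF t])
  have "((\<lambda>m. A m * (1 / of_real L ^ 2) * (\<Sum>\<^sub>\<infinity>k\<in>UNIV - {0}. deriv (gam_term L x k) (- of_nat m))) has_sum SW) UNIV"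
    unfolding SW_def by (rule has_sum_SigmaD[OF has_sum_infsum[OF Vs]]) (use W in simp)
  moreover have "((\<lambda>m. - (A m * (1 / of_real L) * (\<Sum>\<^sub>\<infinity>i\<in>UNIV - {m}. deriv (pole_term L x i) (- of_nat m)))) has_sum (4 * SE)) UNIV"
    by (rule has_sum_SigmaD[OF SEh]) (use P in simp)
  \<comment> \<open>Convergence of this series is obtained indirectly, by subtracting the
    antidiagonals from the real heat terms.\<close>
  moreover have "((\<lambda>m. A m * (1 / of_real L) * c m) has_sum (SV - 4 * SE)) UNIV"
  proof -
    have "((\<lambda>m. V m 0) has_sum SV) UNIV"
      unfolding SV_def by (rule has_sum_SigmaD[OF has_sum_infsum[OF Vs]]) (simp add: has_sum_finite_iff)
    from has_sum_add[OF this has_sum_uminusI[OF Dh]] show ?thesis by (simp add: V0)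
  qed
  ultimately have "((\<lambda>m. A m * heat_sum L x m) has_sum (SW + 4 * SE + (SV - 4 * SE))) UNIV"
    unfolding main by (intro has_sum_add)
  then have "((\<lambda>m. A m * heat_sum L x m) has_sum (SW + SV)) UNIV" by simp
  moreover have "((\<lambda>m. A m * heat_sum L x m) has_sum of_real (heat_trace t)) UNIV"
    using heat_trace_heat_sum(2)[OF t] unfolding A_def x_def .
  ultimately have "of_real (heat_trace t) = SW + SV" by (rule has_sum_unique[rotated])
  moreover have "((\<lambda>p. V (fst p) (snd p)) has_sum (SW + SV)) (Sigma UNIV (\<lambda>_. UNIV - {0}) \<union> Sigma UNIV (\<lambda>_. {0}))"
    unfolding SW_def SV_def by (intro has_sum_Un_disjoint has_sum_infsum Vs) auto
  moreover have "Sigma UNIV (\<lambda>_. UNIV - {0}) \<union> Sigma UNIV (\<lambda>_. {0}) = (UNIV :: (nat \<times> int) set)" by auto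
  ultimately show ?thesis by (simp add: V_def case_prod_unfold)
qed

end

section \<open>Integration of the heat trace expansion\<close>

text \<open>For nonnegative terms, monotone convergence makes integrability of the sum equivalent to
  summability of the integrals; the equivalence transfers the trace class property to the heat
  trace.\<close>

lemma integral_sums_nonneg:
  fixes a :: "nat \<Rightarrow> 'a \<Rightarrow> real"
  assumes int: "\<And>n. integrable M (a n)" and nonneg: "\<And>n s. s \<in> space M \<Longrightarrow> a n s \<ge> 0"
    and sums: "\<And>s. s \<in> space M \<Longrightarrow> (\<lambda>n. a n s) sums h s"
  shows "summable (\<lambda>n. integral\<^sup>L M (a n)) \<longleftrightarrow> integrable M h"
    and "summable (\<lambda>n. integral\<^sup>L M (a n)) \<Longrightarrow> (\<lambda>n. integral\<^sup>L M (a n)) sums integral\<^sup>L M h"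
proof -
  have h: "s \<in> space M \<Longrightarrow> h s = (\<Sum>n. a n s)" for s using sums by (simp add: sums_iff)
  have am: "a n \<in> borel_measurable M" for n using int by (rule borel_measurable_integrable)
  have A: "integrable M h \<and> (\<lambda>n. integral\<^sup>L M (a n)) sums integral\<^sup>L M h" if S: "summable (\<lambda>n. integral\<^sup>L M (a n))"
  proof -
    have n: "(\<integral>s. norm (a n s) \<partial>M) = integral\<^sup>L M (a n)" for n
      by (rule Bochner_Integration.integral_cong) (use nonneg in auto)
    have ae: "AE s in M. summable (\<lambda>n. norm (a n s))"
      using nonneg sums by (intro AE_I2) (simp add: sums_iff)
    have sn: "summable (\<lambda>n. \<integral>s. norm (a n s) \<partial>M)" using S by (simp only: n)
    have "integrable M h \<longleftrightarrow> integrable M (\<lambda>s. \<Sum>n. a n s)" by (rule Bochner_Integration.integrable_cong) (use h in auto)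
    moreover have "integral\<^sup>L M h = (\<integral>s. (\<Sum>n. a n s) \<partial>M)" by (rule Bochner_Integration.integral_cong) (use h in auto)
    ultimately show ?thesis using integrable_suminf[OF int ae sn] sums_integral[OF int ae sn] by simp
  qed
  show "summable (\<lambda>n. integral\<^sup>L M (a n)) \<Longrightarrow> (\<lambda>n. integral\<^sup>L M (a n)) sums integral\<^sup>L M h" using A by blast
  have "summable (\<lambda>n. integral\<^sup>L M (a n))" if H: "integrable M h"
  proof (rule summable_suminf_not_top)
    show "0 \<le> integral\<^sup>L M (a n)" for n by (rule integral_nonneg_AE) (use nonneg in auto)
    have "(\<Sum>n. ennreal (integral\<^sup>L M (a n))) = (\<Sum>n. \<integral>\<^sup>+s. ennreal (a n s) \<partial>M)"
      by (intro suminf_cong nn_integral_eq_integral[symmetric] int AE_I2 nonneg)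
    also have "\<dots> = (\<integral>\<^sup>+s. (\<Sum>n. ennreal (a n s)) \<partial>M)"
      using am by (intro nn_integral_suminf[symmetric]) measurable
    also have "\<dots> = (\<integral>\<^sup>+s. ennreal (h s) \<partial>M)"
      by (intro nn_integral_cong suminf_ennreal_eq nonneg sums)
    also have "\<dots> \<le> (\<integral>\<^sup>+s. ennreal (norm (h s)) \<partial>M)"
      by (intro nn_integral_mono ennreal_leI) auto
    also have "\<dots> < \<infinity>" using H by (simp add: integrable_iff_bounded)
    finally show "(\<Sum>n. ennreal (integral\<^sup>L M (a n))) \<noteq> top" by simp
  qed
  then show "summable (\<lambda>n. integral\<^sup>L M (a n)) \<longleftrightarrow> integrable M h" using A by blast
qed

text \<open>Enumerating the index set reduces the claim to an ordinary series; the integral of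
  \<open>B\<close> bounds all partial sums of the integrals of the norms, which also gives
  unconditional convergence of the integrals.\<close>

lemma has_sum_integral_dominated:
  fixes G :: "'i \<Rightarrow> 'a \<Rightarrow> 'b :: {banach, second_countable_topology}"
  assumes I: "countable (UNIV :: 'i set)" "infinite (UNIV :: 'i set)"
    and int: "\<And>i. integrable M (G i)" and B: "integrable M B"
    and summ: "\<And>s. s \<in> space M \<Longrightarrow> (\<lambda>i. norm (G i s)) summable_on UNIV"
    and le: "\<And>s. s \<in> space M \<Longrightarrow> (\<Sum>\<^sub>\<infinity>i. norm (G i s)) \<le> B s"
    and h: "\<And>s. s \<in> space M \<Longrightarrow> ((\<lambda>i. G i s) has_sum h s) UNIV"
  shows "((\<lambda>i. integral\<^sup>L M (G i)) has_sum integral\<^sup>L M h) UNIV"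
proof -
  define e where "e = from_nat_into (UNIV :: 'i set)"
  have e: "bij_betw e UNIV UNIV" unfolding e_def by (rule bij_betw_from_nat_into[OF I])
  have ei: "inj_on e A" for A using e by (auto simp: bij_betw_def intro: inj_on_subset)
  have hs: "(\<lambda>n. norm (G (e n) s)) summable_on UNIV" if "s \<in> space M" for s
    using summable_on_reindex_bij_betw[OF e, of "\<lambda>i. norm (G i s)"] summ[OF that] by simp
  have ae: "AE s in M. summable (\<lambda>n. norm (G (e n) s))"
    using hs by (intro AE_I2 summable_on_imp_summable)
  have ps: "(\<Sum>n<N. norm (G (e n) s)) \<le> B s" if "s \<in> space M" for s N
  proof -
    have "(\<Sum>n<N. norm (G (e n) s)) = (\<Sum>i\<in>e ` {..<N}. norm (G i s))"
      using ei by (simp add: sum.reindex)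
    also have "\<dots> \<le> (\<Sum>\<^sub>\<infinity>i. norm (G i s))"
      by (rule finite_sum_le_infsum[OF summ[OF that]]) auto
    finally show ?thesis using le[OF that] by linarith
  qed
  have sn: "summable (\<lambda>n. \<integral>s. norm (G (e n) s) \<partial>M)"
  proof (rule summableI_nonneg_bounded)
    fix N
    have "(\<Sum>n<N. \<integral>s. norm (G (e n) s) \<partial>M) = (\<integral>s. (\<Sum>n<N. norm (G (e n) s)) \<partial>M)"
      using int by (intro Bochner_Integration.integral_sum[symmetric]) simp
    also have "\<dots> \<le> integral\<^sup>L M B"
      using int B ps by (intro integral_mono) auto
    finally show "(\<Sum>n<N. \<integral>s. norm (G (e n) s) \<partial>M) \<le> integral\<^sup>L M B" .
  qed simp
  have "(\<lambda>n. integral\<^sup>L M (G (e n))) sums (\<integral>s. (\<Sum>n. G (e n) s) \<partial>M)"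
    by (rule sums_integral[OF int ae sn])
  also have "(\<integral>s. (\<Sum>n. G (e n) s) \<partial>M) = integral\<^sup>L M h"
  proof (rule Bochner_Integration.integral_cong[OF refl])
    fix s assume s: "s \<in> space M"
    have "((\<lambda>n. G (e n) s) has_sum h s) UNIV"
      using has_sum_reindex_bij_betw[OF e, of "\<lambda>i. G i s"] h[OF s] by simp
    then show "(\<Sum>n. G (e n) s) = h s" by (intro sums_unique[symmetric] has_sum_imp_sums)
  qed
  finally have su: "(\<lambda>n. integral\<^sup>L M (G (e n))) sums integral\<^sup>L M h" .
  have "summable (\<lambda>n. norm (integral\<^sup>L M (G (e n))))"
    by (rule summable_comparison_test'[OF sn, of 0]) (simp add: integral_norm_bound)
  then have "((\<lambda>n. integral\<^sup>L M (G (e n))) has_sum integral\<^sup>L M h) UNIV"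
    using su by (rule norm_summable_imp_has_sum)
  then show ?thesis using has_sum_reindex_bij_betw[OF e, of "\<lambda>i. integral\<^sup>L M (G i)"] by simp
qed

lemma ln_sq_le_exp:
  fixes s :: real
  assumes "s \<ge> 1"
  shows "(ln s)\<^sup>2 \<le> 2 * exp s"
proof -
  have "ln s \<le> s" using ln_le_minus_one[of s] assms by linarith
  then have "(ln s)\<^sup>2 \<le> s ^ 2" using assms by (intro power_mono) auto
  also have "\<dots> \<le> fact 2 * exp s" by (rule power_le_fact_exp) (use assms in simp)
  finally show ?thesis by simp
qed

section \<open>Measures of class C and their logarithmic moments\<close>

locale class_C =
  fixes \<phi> :: "real measure"
  assumes class_C: "class_C_measure \<phi>"
begin

lemma space_eq: "space \<phi> = {0<..}"
  using class_C sets_eq_imp_space_eq[of \<phi> "restrict_space borel {0<..}"]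
  by (simp add: class_C_measure_def space_restrict_space)

lemma measurable_borel: "g \<in> borel_measurable borel \<Longrightarrow> g \<in> borel_measurable \<phi>"
proof -
  assume "g \<in> borel_measurable borel"
  then have "g \<in> borel_measurable (restrict_space borel {0<..})" by (rule measurable_restrict_space1)
  moreover have "sets \<phi> = sets (restrict_space borel {0<..})" using class_C by (simp add: class_C_measure_def)
  ultimately show ?thesis by (simp cong: measurable_cong_sets)
qed

lemma integrableI_le:
  fixes g :: "real \<Rightarrow> 'b :: {banach, second_countable_topology}" and h :: "real \<Rightarrow> real"
  assumes "integrable \<phi> h" "g \<in> borel_measurable \<phi>" "\<And>s. s > 0 \<Longrightarrow> norm (g s) \<le> h s"
  shows "integrable \<phi> g"
proof (rule Bochner_Integration.integrable_bound[OF assms(1,2)])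
  show "AE s in \<phi>. norm (g s) \<le> norm (h s)"
    by (rule AE_I2) (use assms(3) in \<open>force simp: space_eq\<close>)
qed

lemma integrable_exp: "integrable \<phi> (\<lambda>s. exp (k * s))"
proof -
  have *: "integrable \<phi> (\<lambda>s. exp (k * s))" if "k \<ge> 0" for k
  proof (rule integrableI_nonneg)
    show "(\<integral>\<^sup>+s. ennreal (exp (k * s)) \<partial>\<phi>) < \<infinity>"
      using class_C that by (simp add: class_C_measure_def mult.commute[of k])
  qed (auto intro: measurable_borel)
  show ?thesis
  proof (cases "k \<ge> 0")
    case False
    show ?thesis
    proof (rule integrableI_le[OF *[of 0]])
      show "norm (exp (k * s)) \<le> exp (0 * s)" if "s > 0" for s
        using that False by (simp add: mult_nonpos_nonneg)
    qed (auto intro: measurable_borel)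
  qed (rule *)
qed

text \<open>Split at s = 1: below, the exponential is at most e^k; above, the logarithm is absorbed
  by raising the exponent to k + 1.\<close>

lemma integrable_ln_sq_exp:
  assumes ln: "integrable \<phi> (\<lambda>s. (ln s)\<^sup>2)" and k: "k \<ge> 0"
  shows "integrable \<phi> (\<lambda>s. (1 + (ln s)\<^sup>2) * exp (k * s))"
proof (rule integrableI_le)
  show "integrable \<phi> (\<lambda>s. exp k * (1 + (ln s)\<^sup>2) + 3 * exp ((k + 1) * s))"
    using ln integrable_exp[of 0] integrable_exp[of "k + 1"] by simp
  show "(\<lambda>s. (1 + (ln s)\<^sup>2) * exp (k * s)) \<in> borel_measurable \<phi>" by (rule measurable_borel) simp
  fix s :: real assume s: "s > 0"
  show "norm ((1 + (ln s)\<^sup>2) * exp (k * s)) \<le> exp k * (1 + (ln s)\<^sup>2) + 3 * exp ((k + 1) * s)"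
  proof (cases "s \<le> 1")
    case True
    have "exp (k * s) \<le> exp k" using True k by (simp add: mult_left_le)
    then have "(1 + (ln s)\<^sup>2) * exp (k * s) \<le> (1 + (ln s)\<^sup>2) * exp k" by (intro mult_left_mono) auto
    then show ?thesis by (simp add: mult.commute abs_mult add_increasing2)
  next
    case False
    have "1 + (ln s)\<^sup>2 \<le> 3 * exp s" using ln_sq_le_exp[of s] False one_le_exp_iff[of s] by linarith
    then have "(1 + (ln s)\<^sup>2) * exp (k * s) \<le> (3 * exp s) * exp (k * s)" by (intro mult_right_mono) auto
    also have "\<dots> = 3 * exp ((k + 1) * s)" by (simp add: algebra_simps flip: exp_add)
    finally show ?thesis by (simp add: abs_mult add_increasing)
  qed
qed

lemma measurable_moment_integrand: "moment_integrand \<alpha> k \<in> borel_measurable \<phi>"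
proof -
  have "moment_integrand \<alpha> k \<in> borel_measurable \<phi> \<longleftrightarrow>
     (\<lambda>s. exp (- \<alpha> * complex_of_real (ln s)) * complex_of_real (ln s ^ k)) \<in> borel_measurable \<phi>"
    by (rule measurable_cong) (auto simp: space_eq moment_integrand_def powr_def Ln_of_real)
  also have "\<dots>" by (rule measurable_borel) measurable
  finally show ?thesis .
qed

text \<open>The moment at \<alpha> = 0 with k = 2 is one of those listed. Conversely the imaginary
  part of \<alpha> only contributes a phase, and s^(2 m) \<le> (2 m)! e^s, so every moment is
  dominated by a multiple of (1 + log^2 s) e^s.\<close>

lemma integrable_moments_iff:
  "(\<forall>\<alpha>\<in>Sd1 q. \<forall>k\<le>2. integrable \<phi> (moment_integrand \<alpha> k)) \<longleftrightarrow> integrable \<phi> (\<lambda>s. (ln s)\<^sup>2)"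
proof
  assume "\<forall>\<alpha>\<in>Sd1 q. \<forall>k\<le>2. integrable \<phi> (moment_integrand \<alpha> k)"
  moreover have "0 \<in> Sd1 q" unfolding Sd1_def by (rule CollectI, rule exI[of _ 0], rule exI[of _ 0]) (simp add: Sd_pole_def)
  ultimately have "integrable \<phi> (moment_integrand 0 2)" by blast
  then have "integrable \<phi> (\<lambda>s. norm (moment_integrand 0 2 s))" by (rule integrable_norm)
  then show "integrable \<phi> (\<lambda>s. (ln s)\<^sup>2)"
    by (rule integrableI_le) (auto intro: measurable_borel simp: moment_integrand_def norm_mult norm_power)
next
  assume l: "integrable \<phi> (\<lambda>s. (ln s)\<^sup>2)"
  show "\<forall>\<alpha>\<in>Sd1 q. \<forall>k\<le>2. integrable \<phi> (moment_integrand \<alpha> k)"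
  proof (intro ballI allI impI)
    fix \<alpha> and k :: nat assume "\<alpha> \<in> Sd1 q" and k: "k \<le> 2"
    then obtain m n where \<alpha>: "\<alpha> = Sd_pole q m n" by (auto simp: Sd1_def)
    have "integrable \<phi> (\<lambda>s. fact (2 * m) * ((1 + (ln s)\<^sup>2) * exp (1 * s)))"
      using integrable_ln_sq_exp[OF l, of 1] by simp
    then show "integrable \<phi> (moment_integrand \<alpha> k)"
    proof (rule integrableI_le[OF _ measurable_moment_integrand])
      fix s :: real assume s: "s > 0"
      have "norm (complex_of_real s powr (- \<alpha>)) = s powr (real (2 * m))"
        using s by (subst norm_powr_real_powr) (auto simp: Sd_pole_def \<alpha>)
      then have 1: "norm (complex_of_real s powr (- \<alpha>)) = s ^ (2 * m)" using s by (simp only: powr_realpow)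
      have 2: "\<bar>x\<bar> ^ k \<le> 1 + x\<^sup>2" for x :: real
      proof -
        consider "k = 0" | "k = 1" | "k = 2" using k by linarith
        then show ?thesis
        proof cases
          case 2
          have "0 \<le> (\<bar>x\<bar> - 1)\<^sup>2 + x\<^sup>2 + 1" by simp
          also have "\<dots> = 2 * (1 + x\<^sup>2 - \<bar>x\<bar>)" by (simp add: power2_diff)
          finally show ?thesis using 2 by simp
        qed auto
      qed
      have "norm (moment_integrand \<alpha> k s) = s ^ (2 * m) * \<bar>ln s\<bar> ^ k"
        by (simp add: moment_integrand_def norm_mult norm_power 1)
      also have "\<dots> \<le> (fact (2 * m) * exp s) * (1 + (ln s)\<^sup>2)"
        using s by (intro mult_mono power_le_fact_exp 2) auto
      finally show "norm (moment_integrand \<alpha> k s) \<le> fact (2 * m) * ((1 + (ln s)\<^sup>2) * exp (1 * s))"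
        by (simp add: mult_ac)
    qed
  qed
qed

end

context podles
begin

lemma infsum_norm_heat_term_le:
  assumes C: "C \<ge> 0" "\<And>m n p. p \<le> 2 \<Longrightarrow> norm (heat_coeff q w (Sd_pole q m n) p) \<le> coeff_bound C m n" and t: "t > 0"
  shows "(\<Sum>\<^sub>\<infinity>(m, n)\<in>UNIV. norm (heat_term t (Sd_pole q m n))) \<le> C * (\<Sum>\<^sub>\<infinity>n. int_weight n) * heat_majorant t"
proof -
  define P where "P = 1 + \<bar>ln t\<bar> + (ln t)\<^sup>2"
  have P: "P \<ge> 0" by (simp add: P_def)
  have W: "(\<Sum>\<^sub>\<infinity>n. int_weight n) \<ge> 0" by (rule infsum_nonneg) (simp add: int_weight_def)
  have "(\<Sum>\<^sub>\<infinity>(m, n)\<in>UNIV. norm (heat_term t (Sd_pole q m n))) \<le> (\<Sum>\<^sub>\<infinity>p\<in>UNIV. (case p of (m, n) \<Rightarrow> coeff_bound C m n * t ^ (2 * m)) * P)"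
  proof (rule infsum_mono[OF summable_heat_term[OF C(2) t]])
    show "(\<lambda>p. (case p of (m, n) \<Rightarrow> coeff_bound C m n * t ^ (2 * m)) * P) summable_on UNIV"
      by (rule summable_on_cmult_left[OF summable_coeff_bound(1)[OF t]])
  qed (use norm_heat_term_le[OF C(2) t] in \<open>auto simp: P_def mult.assoc\<close>)
  also have "\<dots> = C * (\<Sum>\<^sub>\<infinity>n. int_weight n) * (\<Sum>\<^sub>\<infinity>m. (4 * u * t) ^ (2 * m) / fact (2 * m)) * P"
    by (simp only: infsum_cmult_left' summable_coeff_bound(2)[OF t])
  also have "\<dots> \<le> C * (\<Sum>\<^sub>\<infinity>n. int_weight n) * exp (4 * u * t) * P"
    using C(1) W P summable_coeff_bound(3)[OF t] by (intro mult_right_mono mult_left_mono) auto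
  also have "\<dots> = C * (\<Sum>\<^sub>\<infinity>n. int_weight n) * heat_majorant t"
    by (simp add: heat_majorant_def P_def)
  finally show ?thesis .
qed

text \<open>As log (s/A) = log s - log A, the inequality (a - b)^2 \<le> 2 a^2 + 2 b^2 separates the
  scale \<open>A\<close> from \<open>s\<close>.\<close>

lemma heat_majorant_le:
  assumes s: "s > 0" and A: "A > 0"
  shows "heat_majorant (s / A) \<le> 4 * (1 + (ln A)\<^sup>2) * ((1 + (ln s)\<^sup>2) * exp (4 * u / A * s))"
proof -
  define a b where "a = ln s" and "b = ln A"
  have 1: "1 + \<bar>x\<bar> + x\<^sup>2 \<le> 2 * (1 + x\<^sup>2)" for x :: real
  proof -
    have "0 \<le> (\<bar>x\<bar> - 1)\<^sup>2 + x\<^sup>2 + 1" by simp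
    also have "\<dots> = 2 * (1 + x\<^sup>2 - \<bar>x\<bar>)" by (simp add: power2_diff)
    finally show ?thesis by simp
  qed
  have 2: "(a - b)\<^sup>2 \<le> 2 * a\<^sup>2 + 2 * b\<^sup>2" using zero_le_power2[of "a + b"] unfolding power2_diff power2_sum by linarith
  have "1 + \<bar>a - b\<bar> + (a - b)\<^sup>2 \<le> 2 * (1 + (a - b)\<^sup>2)" by (rule 1)
  also have "\<dots> \<le> 4 * (1 + b\<^sup>2) * (1 + a\<^sup>2)"
    using mult_left_mono[OF 2, of 2] mult_nonneg_nonneg[OF zero_le_power2[of b] zero_le_power2[of a]]
    unfolding distrib_left distrib_right by linarith
  finally have "(1 + \<bar>a - b\<bar> + (a - b)\<^sup>2) * exp (4 * u * (s / A)) \<le> 4 * (1 + b\<^sup>2) * (1 + a\<^sup>2) * exp (4 * u * (s / A))"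
    by (rule mult_right_mono) simp
  then show ?thesis using s A by (simp add: heat_majorant_def a_def b_def ln_div mult.assoc)
qed

lemma heat_trace_nonneg: "heat_trace t \<ge> 0"
  unfolding heat_trace_def by (rule infsum_nonneg) simp

text \<open>
  For \<open>t \<le> 1\<close> there are about \<open>-ln t / L\<close> levels with \<open>t e\<^bsup>L n\<^esup> \<le> 1\<close>; each of them contributes at least
  \<open>4 n e\<^bsup>-u\<^esup>\<close>.
\<close>

lemma ln_sq_le_heat_trace:
  assumes t: "t > 0"
  shows "(ln t)\<^sup>2 \<le> L\<^sup>2 * (exp u * heat_trace t + 2) + 2 * exp t"
proof (cases "t \<ge> 1")
  case True
  have "0 \<le> L\<^sup>2 * (exp u * heat_trace t + 2)" using heat_trace_nonneg[of t] by simp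
  then show ?thesis using ln_sq_le_exp[OF True] by linarith
next
  case False
  define y where "y = - ln t / L"
  define N where "N = nat \<lfloor>y\<rfloor>"
  have y: "y \<ge> 0" using False t L_pos by (simp add: y_def divide_nonpos_pos)
  have N: "real N \<le> y" "y \<le> real N + 1" using y by (auto simp: N_def)
  have "(\<Sum>n=1..N. 4 * real n * exp (- u)) \<le> (\<Sum>n=1..N. 4 * real n * exp (- t * (u * (exp (L * real n) - exp (- L * real n)))))"
  proof (rule sum_mono)
    fix n assume n: "n \<in> {1..N}"
    have "real n \<le> y" using n N by simp
    then have "L * real n \<le> - ln t" using L_pos by (simp only: y_def pos_le_divide_eq mult.commute)
    then have "exp (L * real n) \<le> exp (- ln t)" by (simp only: exp_le_cancel_iff)
    also have "\<dots> = inverse t" using t by (simp add: exp_minus)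
    finally have "t * exp (L * real n) \<le> 1" using t by (simp add: field_simps)
    then have "t * (exp (L * real n) - exp (- L * real n)) \<le> 1"
      using t by (simp add: algebra_simps add_increasing2 order_trans[OF diff_le_eq[THEN iffD2]])
    then have "u * (t * (exp (L * real n) - exp (- L * real n))) \<le> u * 1" using u_pos by (intro mult_left_mono) auto
    then show "4 * real n * exp (- u) \<le> 4 * real n * exp (- t * (u * (exp (L * real n) - exp (- L * real n))))"
      by (intro mult_left_mono) (auto simp: mult_ac)
  qed
  also have "\<dots> \<le> heat_trace t"
    unfolding heat_trace_def by (rule finite_sum_le_infsum[OF heat_trace_heat_sum(1)[OF t]]) auto
  also have "(\<Sum>n=1..N. 4 * real n * exp (- u)) = 2 * real N * (real N + 1) * exp (- u)"
    by (induction N) (auto simp: algebra_simps)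
  finally have "2 * real N * (real N + 1) * exp (- u) * exp u \<le> heat_trace t * exp u" by (intro mult_right_mono) auto
  moreover have "2 * real N * (real N + 1) * exp (- u) * exp u = 2 * real N * (real N + 1)" by (simp add: exp_minus)
  ultimately have "2 * real N * (real N + 1) \<le> exp u * heat_trace t" by (simp only: mult.commute[of "heat_trace t" "exp u"])
  moreover have "y\<^sup>2 \<le> (real N + 1)\<^sup>2" using y N by (intro power_mono) auto
  \<comment> \<open>The additive constant 2 covers N = 0, where no level contributes.\<close>
  moreover have "(real N + 1)\<^sup>2 \<le> 2 * real N * (real N + 1) + 2" by (simp add: power2_eq_square algebra_simps)
  ultimately have "y\<^sup>2 \<le> exp u * heat_trace t + 2" by linarith
  then have "L\<^sup>2 * y\<^sup>2 \<le> L\<^sup>2 * (exp u * heat_trace t + 2)" by (rule mult_left_mono) simp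
  moreover have "L\<^sup>2 * y\<^sup>2 = (ln t)\<^sup>2" using L_pos by (simp add: y_def power_divide)
  ultimately show ?thesis using exp_gt_zero[of t] by linarith
qed

end

section \<open>Trace class property and trace of f(|D|/\<Lambda>), with \<open>A\<close> in the role
  of \<Lambda>\<close>

locale podles_laplace = podles + class_C +
  fixes f :: "real \<Rightarrow> real" and A :: real
  assumes f_laplace: "\<And>x. x > 0 \<Longrightarrow> f x = laplace \<phi> x" and A_pos: "A > 0"
begin

definition eigval :: "real \<Rightarrow> real" where
  "eigval x = u * (exp (L * x) - exp (- L * x))"

lemma eigval_pos: "x > 0 \<Longrightarrow> eigval x > 0"
  unfolding eigval_def by (rule dirac_eigenvalue_pos)

abbreviation "f_dirac \<equiv> op_fun spinor_labels (\<lambda>x. complex_of_real (f x)) (op_scale (complex_of_real (1 / A)) (abs_dirac q w))"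

lemma f_eigval: "x > 0 \<Longrightarrow> f (eigval x / A) = (\<integral>s. exp (- (s / A) * eigval x) \<partial>\<phi>)"
  using eigval_pos[of x] A_pos by (simp add: f_laplace laplace_def)

lemma f_eigval_bounds:
  assumes "x > 0"
  shows "0 \<le> f (eigval x / A)" and "f (eigval x / A) \<le> (\<integral>s. exp (0 * s) \<partial>\<phi>)"
proof -
  show "0 \<le> f (eigval x / A)" unfolding f_eigval[OF assms] by (rule integral_nonneg_AE) simp
  show "f (eigval x / A) \<le> (\<integral>s. exp (0 * s) \<partial>\<phi>)"
    unfolding f_eigval[OF assms]
  proof (rule integral_mono[OF _ integrable_exp])
    show "integrable \<phi> (\<lambda>s. exp (- (s / A) * eigval x))"
      using integrable_exp[of "- eigval x / A"] by (simp add: mult.commute)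
    show "exp (- (s / A) * eigval x) \<le> exp (0 * s)" if "s \<in> space \<phi>" for s
      using that A_pos eigval_pos[OF assms] by (simp add: space_eq)
  qed
qed

lemma f_dirac_eq: "f_dirac = diag_op spinor_labels (\<lambda>i. complex_of_real (f (eigval (spin_level i) / A)))"
proof -
  have "op_scale (complex_of_real (1 / A)) (abs_dirac q w)
      = diag_op spinor_labels (\<lambda>i. complex_of_real (1 / A) * complex_of_real (cmod w * q_number q (spin_level i)))"
    unfolding abs_dirac_eq[OF w q] using A_pos by (intro op_scale_diag) simp
  also have "(\<lambda>i. complex_of_real (1 / A) * complex_of_real (cmod w * q_number q (spin_level i)))
      = (\<lambda>i. complex_of_real (eigval (spin_level i) / A))"
    by (rule ext) (simp add: dirac_eigenvalue eigval_def flip: of_real_mult)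
  finally show ?thesis by (simp only: op_fun_diag)
qed

lemma f_dirac_trace_class_iff: "op_trace_class spinor_labels f_dirac \<longleftrightarrow> summable (\<lambda>n. 4 * real n * f (eigval (real n) / A))"
proof -
  have "op_trace_class spinor_labels f_dirac \<longleftrightarrow> (\<lambda>i. norm (complex_of_real (f (eigval (spin_level i) / A)))) summable_on spinor_labels"
    unfolding f_dirac_eq
  proof (rule op_trace_class_diag)
    fix i assume "i \<in> spinor_labels"
    then obtain n :: nat where "n \<ge> 1" "spin_level i = real n" by (rule spin_level_cases)
    then show "cmod (complex_of_real (f (eigval (spin_level i) / A))) \<le> (\<integral>s. exp (0 * s) \<partial>\<phi>)"
      using f_eigval_bounds[of "real n"] by simp
  qed
  also have "\<dots> \<longleftrightarrow> (\<lambda>n. 4 * real n * norm (complex_of_real (f (eigval (real n) / A)))) summable_on {1..}"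
    by (rule spinor_labels_sum(1)[symmetric])
  also have "\<dots> \<longleftrightarrow> (\<lambda>n. 4 * real n * f (eigval (real n) / A)) summable_on UNIV"
    by (rule summable_on_cong_neutral) (auto simp: not_le f_eigval_bounds)
  also have "\<dots> \<longleftrightarrow> summable (\<lambda>n. 4 * real n * f (eigval (real n) / A))"
    by (rule summable_on_UNIV_nonneg_real_iff) (metis f_eigval_bounds(1) mult_nonneg_nonneg mult_zero_left mult_zero_right of_nat_0_le_iff of_nat_0_less_iff order_refl zero_le_numeral not_gr_zero of_nat_0)
  finally show ?thesis .
qed

lemma op_trace_f_dirac:
  assumes "op_trace_class spinor_labels f_dirac"
  shows "(\<lambda>n. 4 * real n * f (eigval (real n) / A)) sums Re (op_trace spinor_labels f_dirac)"
    and "op_trace spinor_labels f_dirac \<in> \<real>"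
proof -
  define g where "g x = complex_of_real (f (eigval x / A))" for x
  have S: "summable (\<lambda>n. 4 * real n * f (eigval (real n) / A))" using assms f_dirac_trace_class_iff by simp
  have nn: "4 * real n * f (eigval (real n) / A) \<ge> 0" for n using f_eigval_bounds(1)[of "real n"] by (cases n) auto
  have hs: "((\<lambda>n. 4 * real n * f (eigval (real n) / A)) has_sum (\<Sum>n. 4 * real n * f (eigval (real n) / A))) UNIV"
    by (rule sums_nonneg_imp_has_sum[OF summable_sums[OF S] nn])
  then have "((\<lambda>n. 4 * real n * f (eigval (real n) / A)) has_sum (\<Sum>n. 4 * real n * f (eigval (real n) / A))) {1..}"
    by (rule has_sum_cong_neutral[THEN iffD1, rotated -1]) (auto simp: not_le)
  then have h1: "((\<lambda>n. complex_of_real (4 * real n * f (eigval (real n) / A))) has_sum of_real (\<Sum>n. 4 * real n * f (eigval (real n) / A))) {1..}"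
    by (rule has_sum_of_real)
  have "(\<lambda>n. 4 * real n * norm (g (real n))) summable_on {1..} \<longleftrightarrow> (\<lambda>n. 4 * real n * f (eigval (real n) / A)) summable_on UNIV"
    unfolding g_def by (rule summable_on_cong_neutral) (auto simp: not_le f_eigval_bounds)
  then have "(\<lambda>n. 4 * real n * norm (g (real n))) summable_on {1..}" using hs by (auto simp: has_sum_iff)
  from spinor_labels_sum(2)[OF spinor_labels_sum(1)[THEN iffD1, OF this]]
  have "((\<lambda>n. of_real (4 * real n) * g (real n)) has_sum (\<Sum>\<^sub>\<infinity>i\<in>spinor_labels. g (spin_level i))) {1..}" .
  then have "((\<lambda>n. complex_of_real (4 * real n * f (eigval (real n) / A))) has_sum op_trace spinor_labels f_dirac) {1..}"
    unfolding f_dirac_eq op_trace_diag g_def by simp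
  then have "op_trace spinor_labels f_dirac = of_real (\<Sum>n. 4 * real n * f (eigval (real n) / A))"
    using h1 by (rule has_sum_unique)
  then show "(\<lambda>n. 4 * real n * f (eigval (real n) / A)) sums Re (op_trace spinor_labels f_dirac)"
    and "op_trace spinor_labels f_dirac \<in> \<real>"
    using summable_sums[OF S] by simp_all
qed

lemma heat_trace_sums:
  assumes "s \<in> space \<phi>"
  shows "(\<lambda>n. 4 * real n * exp (- (s / A) * eigval (real n))) sums heat_trace (s / A)"
proof -
  have "s / A > 0" using assms A_pos by (simp add: space_eq)
  from heat_trace_heat_sum(1)[OF this]
  have "((\<lambda>n. 4 * real n * exp (- (s / A) * eigval (real n))) has_sum heat_trace (s / A)) {1..}"
    unfolding eigval_def heat_trace_def by (rule has_sum_infsum)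
  then have "((\<lambda>n. 4 * real n * exp (- (s / A) * eigval (real n))) has_sum heat_trace (s / A)) UNIV"
    by (rule has_sum_cong_neutral[THEN iffD1, rotated -1]) (auto simp: not_le)
  then show ?thesis by (rule has_sum_imp_sums)
qed

text \<open>Each value of \<open>f\<close> at a rescaled eigenvalue is an integral of exponentials,
  so the trace is a sum of integrals of nonnegative functions, and moving the sum inside produces
  the heat trace at s/A.\<close>

lemma heat_trace_integral:
  shows "op_trace_class spinor_labels f_dirac \<longleftrightarrow> integrable \<phi> (\<lambda>s. heat_trace (s / A))"
    and "op_trace_class spinor_labels f_dirac \<Longrightarrow> op_trace spinor_labels f_dirac = of_real (\<integral>s. heat_trace (s / A) \<partial>\<phi>)"
proof -
  define a where "a n s = 4 * real n * exp (- (s / A) * eigval (real n))" for n :: nat and s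
  have int: "integrable \<phi> (a n)" for n
    unfolding a_def[abs_def] using integrable_exp[of "- eigval (real n) / A"] by (simp add: mult.commute)
  have I: "integral\<^sup>L \<phi> (a n) = 4 * real n * f (eigval (real n) / A)" for n
    by (cases "n = 0") (simp_all add: a_def[abs_def] f_eigval)
  have sums: "(\<lambda>n. a n s) sums heat_trace (s / A)" if "s \<in> space \<phi>" for s
    unfolding a_def by (rule heat_trace_sums[OF that])
  have nn: "a n s \<ge> 0" for n s by (simp add: a_def)
  show "op_trace_class spinor_labels f_dirac \<longleftrightarrow> integrable \<phi> (\<lambda>s. heat_trace (s / A))"
    unfolding f_dirac_trace_class_iff I[symmetric] by (intro integral_sums_nonneg(1) int nn sums)
  show "op_trace spinor_labels f_dirac = of_real (\<integral>s. heat_trace (s / A) \<partial>\<phi>)" if tc: "op_trace_class spinor_labels f_dirac"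
  proof -
    have "summable (\<lambda>n. integral\<^sup>L \<phi> (a n))" using tc unfolding f_dirac_trace_class_iff I .
    then have "(\<lambda>n. integral\<^sup>L \<phi> (a n)) sums (\<integral>s. heat_trace (s / A) \<partial>\<phi>)"
      by (intro integral_sums_nonneg(2) int nn sums)
    then have "(\<integral>s. heat_trace (s / A) \<partial>\<phi>) = Re (op_trace spinor_labels f_dirac)"
      unfolding I using op_trace_f_dirac(1)[OF tc] by (rule sums_unique2)
    then show ?thesis using op_trace_f_dirac(2)[OF tc] by simp
  qed
qed

lemma integrable_heat_majorant:
  assumes "integrable \<phi> (\<lambda>s. (ln s)\<^sup>2)"
  shows "integrable \<phi> (\<lambda>s. heat_majorant (s / A))"
proof (rule integrableI_le)
  show "integrable \<phi> (\<lambda>s. 4 * (1 + (ln A)\<^sup>2) * ((1 + (ln s)\<^sup>2) * exp (4 * u / A * s)))"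
    using integrable_ln_sq_exp[OF assms, of "4 * u / A"] u_pos A_pos by simp
  show "(\<lambda>s. heat_majorant (s / A)) \<in> borel_measurable \<phi>"
    unfolding heat_majorant_def by (rule measurable_borel) measurable
  fix s :: real assume s: "s > 0"
  have "heat_majorant t \<ge> 0" for t by (simp add: heat_majorant_def)
  then show "norm (heat_majorant (s / A)) \<le> 4 * (1 + (ln A)\<^sup>2) * ((1 + (ln s)\<^sup>2) * exp (4 * u / A * s))"
    using heat_majorant_le[OF s A_pos] by simp
qed

text \<open>On the space of \<phi> the heat trace is an ordinary series of continuous functions, for
  which measurability is immediate.\<close>

lemma measurable_heat_trace: "(\<lambda>s. heat_trace (s / A)) \<in> borel_measurable \<phi>"
proof -
  have "(\<lambda>s. heat_trace (s / A)) \<in> borel_measurable \<phi> \<longleftrightarrow>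
      (\<lambda>s. \<Sum>n. 4 * real n * exp (- (s / A) * eigval (real n))) \<in> borel_measurable \<phi>"
    by (rule measurable_cong) (rule sums_unique[OF heat_trace_sums])
  also have "\<dots>" by (rule measurable_borel) measurable
  finally show ?thesis .
qed

lemma integrable_heat_trace_iff: "integrable \<phi> (\<lambda>s. heat_trace (s / A)) \<longleftrightarrow> integrable \<phi> (\<lambda>s. (ln s)\<^sup>2)"
proof
  assume H: "integrable \<phi> (\<lambda>s. heat_trace (s / A))"
  show "integrable \<phi> (\<lambda>s. (ln s)\<^sup>2)"
  proof (rule integrableI_le)
    \<comment> \<open>\<open>exp (0 * s)\<close> is the constant 1, integrable because \<phi> is
      finite.\<close>
    show "integrable \<phi> (\<lambda>s. 2 * (L\<^sup>2 * (exp u * heat_trace (s / A) + 2 * exp (0 * s)) + 2 * exp (1 / A * s)) + 2 * (ln A)\<^sup>2 * exp (0 * s))"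
      using H by (intro Bochner_Integration.integrable_add integrable_mult_right integrable_exp)
    fix s :: real assume s: "s > 0"
    have "(ln (s / A))\<^sup>2 \<le> L\<^sup>2 * (exp u * heat_trace (s / A) + 2) + 2 * exp (s / A)"
      using s A_pos by (intro ln_sq_le_heat_trace) simp
    moreover have "(ln s)\<^sup>2 \<le> 2 * (ln (s / A))\<^sup>2 + 2 * (ln A)\<^sup>2"
    proof -
      have "x\<^sup>2 \<le> 2 * (x - y)\<^sup>2 + 2 * y\<^sup>2" for x y :: real
        using zero_le_power2[of "x - 2 * y"] unfolding power2_diff by (simp add: power_mult_distrib)
      from this[of "ln s" "ln A"] show ?thesis using s A_pos by (simp add: ln_div)
    qed
    ultimately show "norm ((ln s)\<^sup>2) \<le> 2 * (L\<^sup>2 * (exp u * heat_trace (s / A) + 2 * exp (0 * s)) + 2 * exp (1 / A * s)) + 2 * (ln A)\<^sup>2 * exp (0 * s)"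
      by simp
  qed (auto intro: measurable_borel)
next
  assume "integrable \<phi> (\<lambda>s. (ln s)\<^sup>2)"
  note M = integrable_heat_majorant[OF this]
  obtain C where C: "C > 0" "\<And>m n p. p \<le> 2 \<Longrightarrow> norm (heat_coeff q w (Sd_pole q m n) p) \<le> coeff_bound C m n"
    using norm_heat_coeff_le by blast
  show "integrable \<phi> (\<lambda>s. heat_trace (s / A))"
  proof (rule integrableI_le[OF integrable_mult_right[OF M] measurable_heat_trace])
    fix s :: real assume "s > 0"
    then have t: "s / A > 0" using A_pos by simp
    have "norm (complex_of_real (heat_trace (s / A))) \<le> (\<Sum>\<^sub>\<infinity>p\<in>UNIV. norm (case p of (m, n) \<Rightarrow> heat_term (s / A) (Sd_pole q m n)))"
      unfolding infsumI[OF heat_trace_expansion[OF t], symmetric]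
      using summable_heat_term[OF C(2) t] by (intro norm_infsum_bound) (simp add: case_prod_unfold)
    also have "\<dots> = (\<Sum>\<^sub>\<infinity>(m, n)\<in>UNIV. norm (heat_term (s / A) (Sd_pole q m n)))"
      by (simp add: case_prod_unfold)
    also have "\<dots> \<le> C * (\<Sum>\<^sub>\<infinity>n. int_weight n) * heat_majorant (s / A)"
      using C(1) by (intro infsum_norm_heat_term_le[OF _ C(2) t]) simp
    finally show "norm (heat_trace (s / A)) \<le> C * (\<Sum>\<^sub>\<infinity>n. int_weight n) * heat_majorant (s / A)" by simp
  qed
qed

definition moment_sum :: "complex \<Rightarrow> complex" where
  "moment_sum \<alpha> = (\<Sum>p=0..2. heat_coeff q w \<alpha> p *
     (\<Sum>k=0..p. (- 1) ^ (p - k) * of_nat (p choose k) * moment \<phi> \<alpha> k *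
        complex_of_real (ln A) ^ (p - k) * complex_of_real A powr \<alpha>))"

text \<open>The signs and binomial coefficients of the final formula come from expanding (log s -
  log A)^p.\<close>

lemma heat_term_scale:
  assumes s: "s > 0"
  shows "heat_term (s / A) \<alpha> = (\<Sum>p=0..2. heat_coeff q w \<alpha> p *
     (\<Sum>k=0..p. (- 1) ^ (p - k) * of_nat (p choose k) * moment_integrand \<alpha> k s *
        complex_of_real (ln A) ^ (p - k) * complex_of_real A powr \<alpha>))"
proof -
  have pw: "complex_of_real (s / A) powr (- \<alpha>) = of_real s powr (- \<alpha>) * of_real A powr \<alpha>"
    using s A_pos by (simp add: powr_def Ln_of_real ln_div algebra_simps del: of_real_divide flip: exp_add)
  have bin: "complex_of_real (ln (s / A)) ^ p = (\<Sum>k=0..p. of_nat (p choose k) * of_real (ln s ^ k) * ((- 1) ^ (p - k) * complex_of_real (ln A) ^ (p - k)))" for p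
  proof -
    have "complex_of_real (ln (s / A)) ^ p = (of_real (ln s) + - of_real (ln A)) ^ p" using s A_pos by (simp add: ln_div)
    then show ?thesis by (simp only: binomial_ring atMost_atLeast0 of_real_power power_minus[of "complex_of_real (ln A)"])
  qed
  show ?thesis
    unfolding heat_term_def pw bin sum_distrib_left moment_integrand_def
    by (intro sum.cong refl) (simp add: mult_ac)
qed

lemma integral_heat_term:
  assumes int: "\<And>k. k \<le> 2 \<Longrightarrow> integrable \<phi> (moment_integrand \<alpha> k)"
  shows "integrable \<phi> (\<lambda>s. heat_term (s / A) \<alpha>)" and "(\<integral>s. heat_term (s / A) \<alpha> \<partial>\<phi>) = moment_sum \<alpha>"
proof -
  define F where "F s = (\<Sum>p=0..2. heat_coeff q w \<alpha> p *
     (\<Sum>k=0..p. (- 1) ^ (p - k) * of_nat (p choose k) * moment_integrand \<alpha> k s *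
        complex_of_real (ln A) ^ (p - k) * complex_of_real A powr \<alpha>))" for s
  have eq: "heat_term (s / A) \<alpha> = F s" if "s \<in> space \<phi>" for s
    unfolding F_def by (rule heat_term_scale) (use that in \<open>simp add: space_eq\<close>)
  have i: "integrable \<phi> (\<lambda>s. (- 1) ^ (p - k) * of_nat (p choose k) * moment_integrand \<alpha> k s *
        complex_of_real (ln A) ^ (p - k) * complex_of_real A powr \<alpha>)" if "p \<in> {0..2}" "k \<in> {0..p}" for p k :: nat
    using that by (intro integrable_mult_left integrable_mult_right int) auto
  have j: "integrable \<phi> (\<lambda>s. heat_coeff q w \<alpha> p * (\<Sum>k=0..p. (- 1) ^ (p - k) * of_nat (p choose k) * moment_integrand \<alpha> k s *
        complex_of_real (ln A) ^ (p - k) * complex_of_real A powr \<alpha>))" if "p \<in> {0..2}" for p :: nat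
    by (intro integrable_mult_right Bochner_Integration.integrable_sum i that)
  have "integrable \<phi> F" unfolding F_def[abs_def] by (intro Bochner_Integration.integrable_sum j)
  then show "integrable \<phi> (\<lambda>s. heat_term (s / A) \<alpha>)"
    by (rule Bochner_Integration.integrable_cong[THEN iffD2, rotated -1]) (use eq in auto)
  have "(\<integral>s. heat_term (s / A) \<alpha> \<partial>\<phi>) = integral\<^sup>L \<phi> F"
    by (rule Bochner_Integration.integral_cong) (use eq in auto)
  also have "\<dots> = moment_sum \<alpha>"
    unfolding F_def[abs_def] moment_sum_def moment_def
    by (subst Bochner_Integration.integral_sum[OF j], assumption, rule sum.cong[OF refl],
        subst integral_mult_right_zero, subst Bochner_Integration.integral_sum[OF i]) simp_all
  finally show "(\<integral>s. heat_term (s / A) \<alpha> \<partial>\<phi>) = moment_sum \<alpha>" .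
qed

lemma trace_class_iff:
  "op_trace_class spinor_labels f_dirac \<longleftrightarrow> (\<forall>\<alpha>\<in>Sd1 q. \<forall>k\<le>2. integrable \<phi> (moment_integrand \<alpha> k))"
  by (simp only: heat_trace_integral(1) integrable_heat_trace_iff integrable_moments_iff)

text \<open>The sum over pairs (m, n) is integrated term by term under the majorant and then carried
  to \<open>Sd1 q\<close> along its parametrisation, which is injective because real and imaginary
  parts determine m and n.\<close>

theorem trace_expansion:
  assumes tc: "op_trace_class spinor_labels f_dirac"
  shows "(moment_sum has_sum op_trace spinor_labels f_dirac) (Sd1 q)"
proof -
  have mom: "integrable \<phi> (moment_integrand (Sd_pole q m n) k)" if "k \<le> 2" for m n k
    using tc[unfolded trace_class_iff] that by (auto simp: Sd1_def)
  have M: "integrable \<phi> (\<lambda>s. heat_majorant (s / A))"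
    using tc[unfolded trace_class_iff integrable_moments_iff] by (rule integrable_heat_majorant)
  obtain C where C: "C > 0" "\<And>m n p. p \<le> 2 \<Longrightarrow> norm (heat_coeff q w (Sd_pole q m n) p) \<le> coeff_bound C m n"
    using norm_heat_coeff_le by blast
  define G where "G i s = heat_term (s / A) (Sd_pole q (fst i) (snd i))" for i :: "nat \<times> int" and s
  have pos: "s / A > 0" if "s \<in> space \<phi>" for s using that A_pos by (simp add: space_eq)
  have "((\<lambda>i. integral\<^sup>L \<phi> (G i)) has_sum (\<integral>s. complex_of_real (heat_trace (s / A)) \<partial>\<phi>)) UNIV"
  proof (rule has_sum_integral_dominated)
    show "infinite (UNIV :: (nat \<times> int) set)" by (simp add: finite_prod)
    show "integrable \<phi> (G i)" for i unfolding G_def by (intro integral_heat_term(1) mom)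
    show "integrable \<phi> (\<lambda>s. C * (\<Sum>\<^sub>\<infinity>n. int_weight n) * heat_majorant (s / A))" by (rule integrable_mult_right[OF M])
    fix s assume "s \<in> space \<phi>"
    note t = pos[OF this]
    show "(\<lambda>i. norm (G i s)) summable_on UNIV"
      using summable_heat_term[OF C(2) t] by (simp add: G_def case_prod_unfold)
    show "(\<Sum>\<^sub>\<infinity>i. norm (G i s)) \<le> C * (\<Sum>\<^sub>\<infinity>n. int_weight n) * heat_majorant (s / A)"
      using infsum_norm_heat_term_le[OF _ C(2) t] C(1) by (simp add: G_def case_prod_unfold)
    show "((\<lambda>i. G i s) has_sum complex_of_real (heat_trace (s / A))) UNIV"
      using heat_trace_expansion[OF t] by (simp add: G_def case_prod_unfold)
  qed simp
  moreover have "(\<lambda>i. integral\<^sup>L \<phi> (G i)) = moment_sum \<circ> (\<lambda>i. Sd_pole q (fst i) (snd i))"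
    unfolding G_def by (rule ext) (simp add: integral_heat_term(2) mom)
  moreover have "(\<integral>s. complex_of_real (heat_trace (s / A)) \<partial>\<phi>) = op_trace spinor_labels f_dirac"
    unfolding heat_trace_integral(2)[OF tc] by simp
  ultimately have "((moment_sum \<circ> (\<lambda>i. Sd_pole q (fst i) (snd i))) has_sum op_trace spinor_labels f_dirac) UNIV" by simp
  moreover have inj: "inj (\<lambda>i. Sd_pole q (fst i) (snd i))"
  proof (rule injI)
    fix i j :: "nat \<times> int"
    assume e: "Sd_pole q (fst i) (snd i) = Sd_pole q (fst j) (snd j)"
    from arg_cong[OF e, of Re] arg_cong[OF e, of Im] show "i = j"
      using q by (simp add: Sd_pole_def prod_eq_iff)
  qed
  moreover have "range (\<lambda>i. Sd_pole q (fst i) (snd i)) = Sd1 q"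
  proof -
    have "Sd_pole q m n \<in> range (\<lambda>i. Sd_pole q (fst i) (snd i))" for m n
      by (rule range_eqI[of _ _ "(m, n)"]) simp
    then show ?thesis unfolding Sd1_def by blast
  qed
  ultimately show ?thesis using has_sum_reindex[OF inj, of moment_sum] by (simp only:)
qed

end

text \<open>\<open>has_sum\<close> over \<open>Sd1 q\<close> asserts unconditional convergence. A
  measure of class C can have so much mass near 0 that log^2 s is not integrable; the equivalence
  with the moments delimits when both sides of the formula make sense.\<close>

theorem theorem5p2:
  fixes q u :: real and w :: complex and \<phi> :: "real measure" and f :: "real \<Rightarrow> real"
  assumes "0 < q" and "q < 1" and "w \<noteq> 0"
    and "u = cmod w * q / (1 - q\<^sup>2)"
    and "class_C_measure \<phi>"
    and "\<And>x. x > 0 \<Longrightarrow> f x = laplace \<phi> x"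
  shows
    "(\<forall>\<Lambda>>0.
        let T = op_fun spinor_labels (\<lambda>x. complex_of_real (f x))
                  (op_scale (complex_of_real (1 / \<Lambda>)) (abs_dirac q w))
        in (op_trace_class spinor_labels T \<longleftrightarrow>
              (\<forall>\<alpha>\<in>Sd1 q. \<forall>k\<le>2. integrable \<phi> (moment_integrand \<alpha> k))) \<and>
           (op_trace_class spinor_labels T \<longrightarrow>
              ((\<lambda>\<alpha>. \<Sum>p=0..2. heat_coeff q w \<alpha> p *
                      (\<Sum>k=0..p. (- 1) ^ (p - k) * of_nat (p choose k) * moment \<phi> \<alpha> k *
                         complex_of_real (ln \<Lambda>) ^ (p - k) * complex_of_real \<Lambda> powr \<alpha>))
                has_sum op_trace spinor_labels T) (Sd1 q))) \<and>
     (\<forall>m. let \<alpha> = Sd_pole q m 0; r = complex_of_real u powr (- \<alpha>) / complex_of_real ((ln q)\<^sup>2)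
          in heat_coeff q w \<alpha> 2 = r * coeff_g m \<and>
             heat_coeff q w \<alpha> 1 = r * coeff_h q u m 0 \<and>
             heat_coeff q w \<alpha> 0 = r * coeff_c q u m 0 + coeff_d q u m) \<and>
     (\<forall>m n. n \<noteq> 0 \<longrightarrow>
        (let \<alpha> = Sd_pole q m n; r = complex_of_real u powr (- \<alpha>) / complex_of_real ((ln q)\<^sup>2)
         in heat_coeff q w \<alpha> 2 = 0 \<and>
            heat_coeff q w \<alpha> 1 = r * coeff_h q u m (- n) \<and>
            heat_coeff q w \<alpha> 0 = r * coeff_c q u m (- n)))"
proof (intro conjI allI impI)
  define L where "L = - ln q"
  interpret podles q u L w using assms by unfold_locales (auto simp: L_def)
  fix \<Lambda> :: real assume A: "\<Lambda> > 0"
  interpret podles_laplace q u L w \<phi> f \<Lambda> using assms A by unfold_locales auto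
  show "let T = op_fun spinor_labels (\<lambda>x. complex_of_real (f x))
                  (op_scale (complex_of_real (1 / \<Lambda>)) (abs_dirac q w))
        in (op_trace_class spinor_labels T \<longleftrightarrow>
              (\<forall>\<alpha>\<in>Sd1 q. \<forall>k\<le>2. integrable \<phi> (moment_integrand \<alpha> k))) \<and>
           (op_trace_class spinor_labels T \<longrightarrow>
              ((\<lambda>\<alpha>. \<Sum>p=0..2. heat_coeff q w \<alpha> p *
                      (\<Sum>k=0..p. (- 1) ^ (p - k) * of_nat (p choose k) * moment \<phi> \<alpha> k *
                         complex_of_real (ln \<Lambda>) ^ (p - k) * complex_of_real \<Lambda> powr \<alpha>))
                has_sum op_trace spinor_labels T) (Sd1 q))"
    unfolding Let_def by (intro conjI impI trace_class_iff trace_expansion[unfolded moment_sum_def[abs_def]])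
next
  define L where "L = - ln q"
  interpret podles q u L w using assms by unfold_locales (auto simp: L_def)
  fix m
  show "let \<alpha> = Sd_pole q m 0; r = complex_of_real u powr (- \<alpha>) / complex_of_real ((ln q)\<^sup>2)
        in heat_coeff q w \<alpha> 2 = r * coeff_g m \<and>
           heat_coeff q w \<alpha> 1 = r * coeff_h q u m 0 \<and>
           heat_coeff q w \<alpha> 0 = r * coeff_c q u m 0 + coeff_d q u m"
    unfolding Let_def by (intro conjI heat_coeff_real)
next
  define L where "L = - ln q"
  interpret podles q u L w using assms by unfold_locales (auto simp: L_def)
  fix m and n :: int assume n: "n \<noteq> 0"
  show "let \<alpha> = Sd_pole q m n; r = complex_of_real u powr (- \<alpha>) / complex_of_real ((ln q)\<^sup>2)
        in heat_coeff q w \<alpha> 2 = 0 \<and>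
           heat_coeff q w \<alpha> 1 = r * coeff_h q u m (- n) \<and>
           heat_coeff q w \<alpha> 0 = r * coeff_c q u m (- n)"
    unfolding Let_def by (intro conjI heat_coeff_nonreal n)
qed

end
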